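(* Let $\mathcal S$ be a compact metric space, $\mu$ a probability measure on $\mathcal S$, and $\kappa:\mathcal S\times\mathcal S\to[0,\infty)$ a symmetric continuous kernel that is irreducible with respect to $\mu$. Let $I$, $I_{\mathrm{Mi}}$, $I_{\mathrm{Ma}}$, $I_{\mathrm{Me}}$, $\mathcal L$, $\mathcal A$ be as in the context. Then for $\lambda\in\mathcal L$ and for $\alpha\in\mathcal A$, respectively, $$\inf_{\alpha'\in\mathcal A}I(\lambda,\alpha')=\begin{cases}I_{\mathrm{Mi}}(\lambda)+I_{\mathrm{Ma}}(\delta_{\mu-c_\lambda})&\text{if }c_\lambda\le\mu,\\\infty&\text{otherwise,}\end{cases}$$ $$\inf_{\lambda'\in\mathcal L}I(\lambda',\alpha)=\begin{cases}I_{\mathrm{Ma}}(\alpha)+J(\mu-c_\alpha)&\text{if }c_\alpha\le\mu,\\\infty&\text{otherwise,}\end{cases}$$ where, for $c\in\mathcal M(\mathcal S)$ with $c\le\mu$, $$J(c)=\begin{cases}I_{\mathrm{Mi}}(\lambda_c)=\big\langle c,\log\frac{\mathrm dc}{\mathrm d\mu}\big\rangle+\frac12\langle c,\kappa(\mu-c)\rangle&\text{if }\Sigma(\kappa,c)\le1,\\ I_{\mathrm{Mi}}(\lambda_{b^*})+I_{\mathrm{Me}}(c-b^* )&\text{if }\Sigma(\kappa,c)>1,\end{cases}$$ and where, in the case $\Sigma(\kappa,c)>1$, $b^*=b^*(c)\in\mathcal M(\mathcal S)$ is the minimal non-trivial (i.e. not equal to $c$) solution $b$ of $$\kappa(c-b)(r)\,b(\mathrm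 dr)=(c-b)(\mathrm dr),\qquad b\le c,$$ and it holds that $\Sigma(\kappa,b^* )=1$.
   Context: Measures: $\mathcal M(\mathcal X)$ is the set of finite Borel measures on $\mathcal X$; $|\nu|$ is total mass; $\langle\nu,f\rangle=\int f\,\mathrm d\nu$; $\nu\le\nu'$ setwise; $\kappa\nu(r)=\int\kappa(r,s)\nu(\mathrm ds)$. $\mathcal M_{\mathbb N_0}(\mathcal S)\subset\mathcal M(\mathcal S)$: $\mathbb N_0$-valued finite measures, i.e. finite sums $k=\sum_{i=1}^{|k|}\delta_{z_i}$ (including $0$). "Minimal" means $b^*\le b$ for every solution $b$. Irreducibility: $\kappa$ is irreducible with respect to $\mu$ if for every measurable $A\subset\mathcal S$, $\kappa=0$ $\mu\otimes\mu$-a.e. on $A\times(\mathcal S\setminus A)$ implies $\mu(A)=0$ or $\mu(\mathcal S\setminus A)=0$. $\Sigma(\kappa,\nu)$ is the operator norm on $L^2(\nu)$ of $T_{\kappa,\nu}f(x)=\int_{\mathcal S}\kappa(x,y)f(y)\,\nu(\mathrm dy)$. Poisson process: $\mathbb Q_\nu$ is the law on $\mathcal M_{\mathbb N_0}(\mathcal S)$ of a Poisson point process on $\mathcal S$ with intensity measure $\nu$. For $k=\sum_{i=1}^{|k|}\delta_{x_i}$: $\tau(k)=\sum_{T\in\mathcal T(k)}\prod_{\{i,j\}\in E(T)}\kappa(x_i,x_j)$, with $\mathcal T(k)$ the set of spanning trees on $\{1,\dots,|k|\}$, and $\tau(0)=0$. For $c\in\mathcal M(\mathcal S)$, $\lambda_c(\mathrm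 dk)=e^{\theta_c(\mathcal S)}\tau(k)\mathbb Q_{\theta_c}(\mathrm dk)$ with $\theta_c(\mathrm dr)=e^{-\kappa c(r)}c(\mathrm dr)$. State spaces: $c_\lambda(R)=\int k(R)\,\lambda(\mathrm dk)$ for $\lambda$ on $\mathcal M_{\mathbb N_0}(\mathcal S)$; $c_\alpha(R)=\int y(R)\,\alpha(\mathrm dy)$ for $\alpha$ on $\mathcal M(\mathcal S)\setminus\{0\}$. Let $(\mu_N)_{N\in\mathbb N}$ be a sequence with $\mu_N=\frac1N\sum_{i=1}^N\delta_{x_i^{(N)}}$, $x_i^{(N)}\in\mathcal S$, converging weakly to $\mu$. $\mathcal L$ is the set of $\lambda\in\mathcal M(\mathcal M_{\mathbb N_0}(\mathcal S))$ with $\lambda(\{0\})=0$ and ($c_\lambda\le\mu$ or $c_\lambda\le\mu_N$ for some $N$). $\mathcal A$ is the set of finite or countably infinite point measures $\alpha=\sum_n\delta_{y_n}$ on $\mathcal M(\mathcal S)\setminus\{0\}$ (repetitions allowed, including $\alpha=0$) with ($c_\alpha\le\mu$ or $c_\alpha\le\mu_N$ for some $N$). If $y=0$, $\delta_y$ is read as the zero element of $\mathcal A$ (so $I_{\mathrm{Ma}}(\delta_0)=0$). Relative entropy: $\mathbb H(\nu|\widetilde\nu)=|\widetilde\nu|-|\nu|+\int\log\frac{\mathrm d\nu}{\mathrm d\widetilde\nu}\mathrm d\nu$ if $\nu\ll\widetilde\nu$, else $+\infty$. Rate function: $I(\lambda,\alpha)=I_{\mathrm{Mi}}(\lambda)+I_{\mathrm{Ma}}(\alpha)+I_{\mathrm{Me}}(\mu-c_\lambda-c_\alpha)$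 if $c_\lambda+c_\alpha\le\mu$, and $+\infty$ otherwise, with $$I_{\mathrm{Mi}}(\lambda)=\mathbb H(\lambda|\mathbb Q_\mu)-1-\langle\lambda,\log\tau\rangle+|c_\lambda|-|\lambda|+\tfrac12\langle c_\lambda,\kappa\mu\rangle,$$ $$I_{\mathrm{Ma}}(\alpha)=\int\alpha(\mathrm dy)\Big[\Big\langle y,\log\frac{\mathrm dy}{(1-e^{-\kappa y})\,\mathrm d\mu}\Big\rangle+\tfrac12\langle y,\kappa(\mu-y)\rangle\Big],\qquad I_{\mathrm{Me}}(\nu)=\Big\langle\nu,\log\frac{\mathrm d\nu}{\kappa\nu\,\mathrm d\mu}\Big\rangle+\tfrac12\langle\nu,\kappa\mu\rangle,$$ with value $+\infty$ where the densities do not exist (for $I_{\mathrm{Ma}}$: if not for $\alpha$-a.e. $y$), $\log0=-\infty$, $0\log0=0$, and $\mathbb H(\lambda|\mathbb Q_\mu)-\langle\lambda,\log\tau\rangle$ read as $1-|\lambda|+\langle\lambda,\log\frac{\mathrm d\lambda}{\tau\,\mathrm d\mathbb Q_\mu}\rangle$ ($+\infty$ if $\lambda\not\ll\tau\mathbb Q_\mu$). *)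

theory Defs
  imports "HOL-Probability.Probability"
begin

section \<open>Finite Borel measures\<close>

text \<open>
  The state space is the whole type \<open>'a\<close>. Between Borel measures, \<open>\<nu> \<le> \<nu>'\<close> is the library order on
  measures, which is the setwise order because both sides have the same \<open>\<sigma>\<close>-algebra.
\<close>

definition fin_borel :: "'a::topological_space measure set" where
  "fin_borel = {\<nu>. sets \<nu> = sets borel \<and> finite_measure \<nu>}"

definition add_measure :: "'a measure \<Rightarrow> 'a measure \<Rightarrow> 'a measure" where
  "add_measure M N = measure_of (space M) (sets M) (\<lambda>A. emeasure M A + emeasure N A)"

definition kap :: "('a \<Rightarrow> 'a \<Rightarrow> real) \<Rightarrow> 'a measure \<Rightarrow> 'a \<Rightarrow> real" where
  "kap \<kappa> \<nu> r = (\<integral>s. \<kappa> r s \<partial>\<nu>)"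

definition irreducible_kernel :: "'a::topological_space measure \<Rightarrow> ('a \<Rightarrow> 'a \<Rightarrow> real) \<Rightarrow> bool" where
  "irreducible_kernel \<mu> \<kappa> \<longleftrightarrow>
     (\<forall>A\<in>sets borel. (AE z in \<mu> \<Otimes>\<^sub>M \<mu>. z \<in> A \<times> (UNIV - A) \<longrightarrow> \<kappa> (fst z) (snd z) = 0) \<longrightarrow>
        emeasure \<mu> A = 0 \<or> emeasure \<mu> (UNIV - A) = 0)"

definition T_op :: "('a \<Rightarrow> 'a \<Rightarrow> real) \<Rightarrow> 'a measure \<Rightarrow> ('a \<Rightarrow> real) \<Rightarrow> 'a \<Rightarrow> real" where
  "T_op \<kappa> \<nu> f r = (\<integral>s. \<kappa> r s * f s \<partial>\<nu>)"

text \<open>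
  The operator norm of \<open>T_op \<kappa> \<nu>\<close> on \<open>L\<^sup>2(\<nu>)\<close>. The set of values is bounded whenever \<open>\<kappa>\<close> is bounded
  and measurable and \<open>\<nu>\<close> is finite, so the real supremum is genuine.
\<close>

definition op_norm_L2 :: "('a::topological_space \<Rightarrow> 'a \<Rightarrow> real) \<Rightarrow> 'a measure \<Rightarrow> real" where
  "op_norm_L2 \<kappa> \<nu> =
     (SUP f\<in>{f \<in> borel_measurable borel. integrable \<nu> (\<lambda>r. (f r)\<^sup>2) \<and> sqrt (\<integral>r. (f r)\<^sup>2 \<partial>\<nu>) \<le> 1}.
        sqrt (\<integral>r. (T_op \<kappa> \<nu> f r)\<^sup>2 \<partial>\<nu>))"

definition empirical :: "(nat \<Rightarrow> nat \<Rightarrow> 'a::topological_space) \<Rightarrow> nat \<Rightarrow> 'a measure" where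
  "empirical x N = scale_measure (1 / of_nat N) (distr (count_space {1..N}) borel (x N))"

definition weakly_converges :: "(nat \<Rightarrow> 'a::topological_space measure) \<Rightarrow> 'a measure \<Rightarrow> bool" where
  "weakly_converges \<nu>s \<nu> \<longleftrightarrow>
     (\<forall>f::'a \<Rightarrow> real. continuous_on UNIV f \<longrightarrow> bounded (range f) \<longrightarrow>
        (\<lambda>n. \<integral>r. f r \<partial>\<nu>s n) \<longlonglongrightarrow> (\<integral>r. f r \<partial>\<nu>))"


section \<open>Extended-real integrals and logarithmic densities\<close>

definition eintegral :: "'a measure \<Rightarrow> ('a \<Rightarrow> ereal) \<Rightarrow> ereal" where
  "eintegral M f =
     enn2ereal (\<integral>\<^sup>+x. e2ennreal (f x) \<partial>M) - enn2ereal (\<integral>\<^sup>+x. e2ennreal (- f x) \<partial>M)"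

definition elog :: "ennreal \<Rightarrow> ereal" where
  "elog a = (if a = 0 then -\<infinity> else if a = \<infinity> then \<infinity> else ereal (ln (enn2real a)))"

text \<open>
  \<open>\<langle>\<nu>, log (d\<nu>/dM)\<rangle>\<close>, with value \<open>\<infinity>\<close> if there is no density. As the integral is against \<open>\<nu>\<close>, the set
  where the density vanishes is null, in accordance with \<open>0 log 0 = 0\<close>.
\<close>

definition log_int :: "'a measure \<Rightarrow> 'a measure \<Rightarrow> ereal" where
  "log_int \<nu> M =
     (if absolutely_continuous M \<nu> then eintegral \<nu> (\<lambda>x. elog (RN_deriv M \<nu> x)) else \<infinity>)"


section \<open>Finite point configurations\<close>

text \<open>
  An \<open>\<nat>\<^sub>0\<close>-valued finite measure \<open>k = \<Sum>\<^sub>i \<delta>\<^bsub>z\<^sub>i\<^esub>\<close> is represented by the finite multiset of its atoms, so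
  that \<open>pts A k\<close> is \<open>k(A)\<close>. The \<open>\<sigma>\<close>-algebra is the one generated by the evaluations \<open>k \<mapsto> k(A)\<close>; over
  a Polish space this is the Borel \<open>\<sigma>\<close>-algebra of the weak topology.
\<close>

definition pts :: "'a set \<Rightarrow> 'a multiset \<Rightarrow> nat" where
  "pts A k = size (filter_mset (\<lambda>z. z \<in> A) k)"

definition config_space :: "'a::topological_space multiset measure" where
  "config_space = sigma UNIV {{k. pts A k = n} |A n. A \<in> sets borel}"

definition poisson_process :: "'a::topological_space measure \<Rightarrow> 'a multiset measure \<Rightarrow> bool" where
  "poisson_process \<nu> Q \<longleftrightarrow>
     prob_space Q \<and> sets Q = sets config_space \<and>
     (\<forall>A\<in>sets borel. \<forall>n.
        measure Q {k. pts A k = n} = measure \<nu> A ^ n / fact n * exp (- measure \<nu> A)) \<and>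
     (\<forall>(A :: nat \<Rightarrow> 'a set) m. (\<forall>i<m. A i \<in> sets borel) \<longrightarrow> disjoint_family_on A {..<m} \<longrightarrow>
        prob_space.indep_vars Q (\<lambda>_. count_space UNIV) (\<lambda>i k. pts (A i) k) {..<m})"

definition poisson_law :: "'a::topological_space measure \<Rightarrow> 'a multiset measure" where
  "poisson_law \<nu> = (THE Q. poisson_process \<nu> Q)"

definition edges_connect :: "nat \<Rightarrow> nat set set \<Rightarrow> bool" where
  "edges_connect n T \<longleftrightarrow> (\<forall>i<n. \<forall>j<n. (i, j) \<in> {(a, b). {a, b} \<in> T}\<^sup>*)"

definition edge_cycle :: "nat set set \<Rightarrow> nat list \<Rightarrow> bool" where
  "edge_cycle T vs \<longleftrightarrow> 3 \<le> length vs \<and> distinct vs \<and>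
     (\<forall>i<length vs. {vs ! i, vs ! (Suc i mod length vs)} \<in> T)"

definition spanning_trees :: "nat \<Rightarrow> nat set set set" where
  "spanning_trees n =
     {T. T \<subseteq> {e. e \<subseteq> {0..<n} \<and> card e = 2} \<and> edges_connect n T \<and> (\<nexists>vs. edge_cycle T vs)}"

text \<open>
  The enumeration \<open>xs\<close> of \<open>k\<close> is arbitrary, as the sum is invariant under relabelling of the vertices.
  Orienting an edge \<open>e\<close> from \<open>Min e\<close> to \<open>Max e\<close> is immaterial for symmetric \<open>\<kappa>\<close>.
\<close>

definition tau :: "('a \<Rightarrow> 'a \<Rightarrow> real) \<Rightarrow> 'a multiset \<Rightarrow> real" where
  "tau \<kappa> k =
     (if k = {#} then 0
      else let xs = (SOME xs. mset xs = k)
           in \<Sum>T\<in>spanning_trees (length xs). \<Prod>e\<in>T. \<kappa> (xs ! Min e) (xs ! Max e))"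

definition theta :: "('a \<Rightarrow> 'a \<Rightarrow> real) \<Rightarrow> 'a measure \<Rightarrow> 'a measure" where
  "theta \<kappa> c = density c (\<lambda>r. ennreal (exp (- kap \<kappa> c r)))"

definition lambda_c ::
  "('a::topological_space \<Rightarrow> 'a \<Rightarrow> real) \<Rightarrow> 'a measure \<Rightarrow> 'a multiset measure" where
  "lambda_c \<kappa> c =
     density (poisson_law (theta \<kappa> c))
       (\<lambda>k. ennreal (exp (measure (theta \<kappa> c) UNIV) * tau \<kappa> k))"


section \<open>State spaces\<close>

definition c_micro :: "'a::topological_space multiset measure \<Rightarrow> 'a measure" where
  "c_micro l = measure_of UNIV (sets borel) (\<lambda>R. \<integral>\<^sup>+k. of_nat (pts R k) \<partial>l)"

definition c_macro :: "'a::topological_space measure measure \<Rightarrow> 'a measure" where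
  "c_macro \<alpha> = measure_of UNIV (sets borel) (\<lambda>R. \<integral>\<^sup>+y. emeasure y R \<partial>\<alpha>)"

definition micro_states ::
  "'a::topological_space measure \<Rightarrow> (nat \<Rightarrow> nat \<Rightarrow> 'a) \<Rightarrow> 'a multiset measure set" where
  "micro_states \<mu> x =
     {l. sets l = sets config_space \<and> finite_measure l \<and> emeasure l {{#}} = 0 \<and>
         (c_micro l \<le> \<mu> \<or> (\<exists>N\<ge>1. c_micro l \<le> empirical x N))}"

text \<open>
  The point measure \<open>\<Sum>\<^bsub>n \<in> ind\<^esub> \<delta>\<^bsub>y n\<^esub>\<close> is the image of the counting measure on \<open>ind\<close> under \<open>y\<close>. Point
  measures are defined on all subsets, so the nonzero finite measures carry the discrete \<open>\<sigma>\<close>-algebra here.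
\<close>

definition nonzero_measures :: "'a::topological_space measure set" where
  "nonzero_measures = fin_borel - {null_measure borel}"

definition point_measures :: "'a::topological_space measure measure set" where
  "point_measures =
     {distr (count_space ind) (count_space nonzero_measures) y |(ind :: nat set) y.
        y \<in> ind \<rightarrow> nonzero_measures}"

definition macro_states ::
  "'a::topological_space measure \<Rightarrow> (nat \<Rightarrow> nat \<Rightarrow> 'a) \<Rightarrow> 'a measure measure set" where
  "macro_states \<mu> x =
     {\<alpha> \<in> point_measures. c_macro \<alpha> \<le> \<mu> \<or> (\<exists>N\<ge>1. c_macro \<alpha> \<le> empirical x N)}"

definition macro_delta :: "'a::topological_space measure \<Rightarrow> 'a measure measure" where
  "macro_delta y =
     (if y = null_measure borel then null_measure (count_space nonzero_measures)
      else return (count_space nonzero_measures) y)"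


section \<open>Rate functions\<close>

text \<open>
  The combination \<open>H(\<lambda>|Q\<^sub>\<mu>) - \<langle>\<lambda>, log \<tau>\<rangle>\<close> is read as \<open>1 - |\<lambda>| + \<langle>\<lambda>, log (d\<lambda>/(\<tau> dQ\<^sub>\<mu>))\<rangle>\<close>.
\<close>

definition I_Mi ::
  "('a::topological_space \<Rightarrow> 'a \<Rightarrow> real) \<Rightarrow> 'a measure \<Rightarrow> 'a multiset measure \<Rightarrow> ereal" where
  "I_Mi \<kappa> \<mu> l =
     (ereal (1 - measure l UNIV)
       + log_int l (density (poisson_law \<mu>) (\<lambda>k. ennreal (tau \<kappa> k))))
     - 1 + ereal (measure (c_micro l) UNIV) - ereal (measure l UNIV)
     + ereal (1/2 * (\<integral>r. kap \<kappa> \<mu> r \<partial>c_micro l))"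

text \<open>Here \<open>\<mu> - y\<close> may be a signed measure, and \<open>\<kappa>(\<mu> - y)\<close> means \<open>\<kappa>\<mu> - \<kappa>y\<close>.\<close>

definition I_Ma ::
  "('a::topological_space \<Rightarrow> 'a \<Rightarrow> real) \<Rightarrow> 'a measure \<Rightarrow> 'a measure measure \<Rightarrow> ereal" where
  "I_Ma \<kappa> \<mu> \<alpha> =
     (let ref = (\<lambda>y. density \<mu> (\<lambda>r. ennreal (1 - exp (- kap \<kappa> y r))))
      in if AE y in \<alpha>. absolutely_continuous (ref y) y
         then eintegral \<alpha> (\<lambda>y. log_int y (ref y)
                 + ereal (1/2 * (\<integral>r. kap \<kappa> \<mu> r - kap \<kappa> y r \<partial>y)))
         else \<infinity>)"

definition I_Me :: "('a \<Rightarrow> 'a \<Rightarrow> real) \<Rightarrow> 'a measure \<Rightarrow> 'a measure \<Rightarrow> ereal" where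
  "I_Me \<kappa> \<mu> \<nu> =
     log_int \<nu> (density \<mu> (\<lambda>r. ennreal (kap \<kappa> \<nu> r))) + ereal (1/2 * (\<integral>r. kap \<kappa> \<mu> r \<partial>\<nu>))"

definition rate_I ::
  "('a::topological_space \<Rightarrow> 'a \<Rightarrow> real) \<Rightarrow> 'a measure \<Rightarrow>
     'a multiset measure \<Rightarrow> 'a measure measure \<Rightarrow> ereal" where
  "rate_I \<kappa> \<mu> l \<alpha> =
     (if add_measure (c_micro l) (c_macro \<alpha>) \<le> \<mu>
      then I_Mi \<kappa> \<mu> l + I_Ma \<kappa> \<mu> \<alpha>
        + I_Me \<kappa> \<mu> (diff_measure (diff_measure \<mu> (c_micro l)) (c_macro \<alpha>))
      else \<infinity>)"

definition balance_solution ::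
  "('a::topological_space \<Rightarrow> 'a \<Rightarrow> real) \<Rightarrow> 'a measure \<Rightarrow> 'a measure \<Rightarrow> bool" where
  "balance_solution \<kappa> c b \<longleftrightarrow> b \<in> fin_borel \<and> b \<le> c \<and>
     density b (\<lambda>r. ennreal (kap \<kappa> (diff_measure c b) r)) = diff_measure c b"

definition minimal_solution ::
  "('a::topological_space \<Rightarrow> 'a \<Rightarrow> real) \<Rightarrow> 'a measure \<Rightarrow> 'a measure \<Rightarrow> bool" where
  "minimal_solution \<kappa> c b \<longleftrightarrow>
     balance_solution \<kappa> c b \<and> b \<noteq> c \<and> (\<forall>b'. balance_solution \<kappa> c b' \<longrightarrow> b \<le> b')"

definition b_star :: "('a::topological_space \<Rightarrow> 'a \<Rightarrow> real) \<Rightarrow> 'a measure \<Rightarrow> 'a measure" where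
  "b_star \<kappa> c = (THE b. minimal_solution \<kappa> c b)"

definition J_fun ::
  "('a::topological_space \<Rightarrow> 'a \<Rightarrow> real) \<Rightarrow> 'a measure \<Rightarrow> 'a measure \<Rightarrow> ereal" where
  "J_fun \<kappa> \<mu> c =
     (if op_norm_L2 \<kappa> c \<le> 1 then I_Mi \<kappa> \<mu> (lambda_c \<kappa> c)
      else I_Mi \<kappa> \<mu> (lambda_c \<kappa> (b_star \<kappa> c)) + I_Me \<kappa> \<mu> (diff_measure c (b_star \<kappa> c)))"

end

theory Submission
  imports Defs
begin

text \<open>
  Both infima and the formula for \<open>J\<close> come from one device, Gibbs' inequality (\<open>gibbs\<close>): for
  finite measures, \<open>\<langle>y, log (dy/dR)\<rangle> \<ge> |y| - \<integral> w dR + \<integral> ln w dy\<close> for every comparison density \<open>w\<close>, with equality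
  if \<open>w = dy/dR\<close>. So it suffices to guess \<open>w\<close>. Write \<open>f\<close> for the density of the mass in question with respect to \<open>\<mu>\<close>, and \<open>\<langle>a, \<kappa>b\<rangle>\<close>
  for the symmetric form \<open>\<integral> kap \<kappa> b da\<close>.

  \<^bold>\<open>Macroscopic states.\<close> Let \<open>\<nu> = \<mu> - c_micro l\<close> be shared by the macroscopic components \<open>y\<close> and the mesoscopic
  rest \<open>m\<close>. Taking \<open>w = f exp (- \<kappa>(\<nu> - y) / 2) / (1 - exp (- \<kappa>\<nu>))\<close> for \<open>y\<close>, and the same without the \<open>y\<close> in the
  exponent for \<open>m\<close>, makes every bound linear: by convexity of the hyperbolic sine, the nonlinear term
  \<open>(1 - exp (- \<kappa>y)) exp (- \<kappa>(\<nu> - y) / 2)\<close> is at most \<open>\<kappa>y (1 - exp (- \<kappa>\<nu>)) / \<kappa>\<nu>\<close>. So a component costs at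
  least \<open>\<integral> G dy\<close> with a function \<open>G\<close> that depends on \<open>\<nu>\<close> alone (\<open>component_cost_ge\<close>). The sum over all components is
  \<open>\<integral> G d\<nu>\<close>, which is the cost of putting everything into one component. The factor \<open>1 - exp (- \<kappa>\<nu>)\<close> may
  vanish and has to be truncated; \<open>I_Ma_macro_delta_le\<close> removes the truncation.

  \<^bold>\<open>Microscopic states.\<close> Let \<open>c = \<mu> - c_macro \<alpha>\<close>, and let \<open>b \<le> c\<close> solve the balance equation with operator
  norm at most one; \<open>b = c\<close> or \<open>b = b_star \<kappa> c\<close> will do. With \<open>d = c - b\<close>, the balance equation says that
  \<open>\<phi> = f / (1 + \<kappa>d)\<close> is the density of \<open>b\<close> with respect to \<open>\<mu>\<close> and also that of \<open>d\<close> with respect to \<open>(\<kappa>d) \<mu>\<close>. The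
  comparison densities are those of \<open>lambda_c \<kappa> b\<close> and of \<open>d\<close>. For any other state with intensity \<open>a\<close> and rest
  \<open>m = c - a\<close> the two bounds contain the mixed terms \<open>\<langle>a, \<kappa>b\<rangle>\<close> and \<open>\<langle>b, \<kappa>m\<rangle> = \<langle>m, \<kappa>b\<rangle>\<close>, whose sum
  \<open>\<langle>c, \<kappa>b\<rangle>\<close> does not depend on \<open>a\<close>; hence they add up to the cost of \<open>lambda_c \<kappa> b\<close> and \<open>d\<close>
  (\<open>I_Mi_plus_I_Me_ge\<close>).

  This needs the intensity and the mass of \<open>lambda_c \<kappa> b\<close>, namely \<open>b\<close> and \<open>|b| - \<langle>b, \<kappa>b\<rangle> / 2\<close>. Under the
  unnormalized Poisson measure, cutting a tree at an edge turns into a product of integrals. Cutting the edges at the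
  root shows that the weight of the trees rooted at \<open>r\<close> is the exponential of the weight \<open>T r\<close> of a single branch,
  so that \<open>1 - exp (T - \<kappa>b)\<close> solves the survival equation of a branching process; it is zero if the norm is at most
  one (\<open>c_micro_lambda_c\<close>). Cutting an arbitrary edge counts the edges, of which a tree on \<open>n\<close> points has
  \<open>n - 1\<close>, and gives the mass (\<open>measure_lambda_c\<close>). These integrals need the Poisson law as an explicit sum over
  the number of points (\<open>poisson_law_eq\<close>), hence existence and uniqueness of the Poisson process, and
  measurability of the tree sum.

  \<^bold>\<open>The balance equation.\<close> For the density \<open>\<eta>\<close> of \<open>c - b\<close> with respect to \<open>c\<close> it is the fixed point equation
  \<open>\<eta> = T \<eta> / (1 + T \<eta>)\<close> of a monotone map. Iterating from \<open>1\<close> yields the largest solution and so the minimal \<open>b\<close>.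
  If \<open>b\<close> is not \<open>c\<close>, then \<open>T \<eta>\<close> is an eigenfunction of the operator of \<open>b\<close> for the eigenvalue \<open>1\<close>, so the norm is at
  least one. It is at most one by Schur's test, with a test function made from the differences between the
  iterates and their limit (\<open>op_norm_minimal_b_le_1\<close>); in particular \<open>b\<close> is not \<open>c\<close> if the norm for \<open>c\<close> exceeds one.
\<close>


section \<open>Cutting a tree at an edge of its root\<close>

definition edges_on :: "nat set \<Rightarrow> nat set set" where
  "edges_on V = {e. e \<subseteq> V \<and> card e = 2}"

definition reach :: "nat set set \<Rightarrow> (nat \<times> nat) set" where
  "reach T = {(a, b). {a, b} \<in> T}\<^sup>*"

text \<open>
  Trees on an arbitrary vertex set, with acyclicity expressed by saying that every edge is a bridge.
  This form survives restriction, union and relabelling without any mention of closed walks.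
\<close>

definition trees_on :: "nat set \<Rightarrow> nat set set set" where
  "trees_on V = {T. T \<subseteq> edges_on V \<and> (\<forall>u\<in>V. \<forall>v\<in>V. (u, v) \<in> reach T) \<and>
     (\<forall>u v. {u, v} \<in> T \<longrightarrow> (u, v) \<notin> reach (T - {{u, v}}))}"

definition deg :: "nat set set \<Rightarrow> nat \<Rightarrow> nat" where
  "deg T r = card {v. {r, v} \<in> T}"

lemma reach_refl [simp, intro!]: "(u, u) \<in> reach T"
  by (simp add: reach_def)

lemma reach_step: "(u, w) \<in> reach T \<Longrightarrow> {w, z} \<in> T \<Longrightarrow> (u, z) \<in> reach T"
  unfolding reach_def by (rule rtrancl_into_rtrancl) auto

lemma reach_trans: "(u, v) \<in> reach T \<Longrightarrow> (v, w) \<in> reach T \<Longrightarrow> (u, w) \<in> reach T"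
  unfolding reach_def by (rule rtrancl_trans)

lemma reach_induct [consumes 1, case_names base step]:
  assumes "(u, v) \<in> reach T" "P u"
    and "\<And>w z. (u, w) \<in> reach T \<Longrightarrow> {w, z} \<in> T \<Longrightarrow> P w \<Longrightarrow> P z"
  shows "P v"
  using assms(1) unfolding reach_def
  by (induction rule: rtrancl_induct) (use assms(2,3) in \<open>auto simp: reach_def\<close>)

lemma reach_mono: "T \<subseteq> T' \<Longrightarrow> (u, v) \<in> reach T \<Longrightarrow> (u, v) \<in> reach T'"
  unfolding reach_def by (rule subsetD[OF rtrancl_mono]) auto

lemma reach_sym: "(u, v) \<in> reach T \<Longrightarrow> (v, u) \<in> reach T"
proof -
  have "sym {(a, b). {a, b} \<in> T}"
    by (auto simp: sym_def insert_commute)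
  then show "(u, v) \<in> reach T \<Longrightarrow> (v, u) \<in> reach T"
    unfolding reach_def using sym_rtrancl by (auto dest: symD)
qed

lemma edges_on_pair: "{u, v} \<in> edges_on V \<longleftrightarrow> u \<in> V \<and> v \<in> V \<and> u \<noteq> v"
  by (auto simp: edges_on_def card_insert_if)

lemma edges_onE:
  assumes "e \<in> edges_on V"
  obtains u v where "e = {u, v}" "u \<in> V" "v \<in> V" "u \<noteq> v"
proof -
  have "card e = 2" "e \<subseteq> V" using assms by (simp_all add: edges_on_def)
  then obtain u v where "e = {u, v}" "u \<noteq> v" unfolding card_2_iff by blast
  then show ?thesis using that \<open>e \<subseteq> V\<close> by simp
qed

lemma finite_edges_on: "finite V \<Longrightarrow> finite (edges_on V)"
  unfolding edges_on_def by (rule finite_subset[of _ "Pow V"]) auto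

lemma finite_trees: "finite V \<Longrightarrow> finite (trees_on V)"
  by (rule finite_subset[of _ "Pow (edges_on V)"]) (auto simp: trees_on_def finite_edges_on)

lemma trees_subset: "T \<in> trees_on V \<Longrightarrow> T \<subseteq> edges_on V"
  by (simp add: trees_on_def)

lemma edge_nonempty: "T \<in> trees_on V \<Longrightarrow> e \<in> T \<Longrightarrow> e \<noteq> {}"
  using trees_subset[of T V] by (auto simp: edges_on_def)

lemma finite_tree: "T \<in> trees_on V \<Longrightarrow> finite V \<Longrightarrow> finite T"
  by (rule finite_subset[OF trees_subset finite_edges_on])

lemma finite_nbrs:
  assumes "T \<in> trees_on V" "finite V"
  shows "finite {v. {r, v} \<in> T}"
proof (rule finite_subset[OF _ assms(2)])
  show "{v. {r, v} \<in> T} \<subseteq> V"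
  proof
    fix v assume "v \<in> {v. {r, v} \<in> T}"
    then have "{r, v} \<in> edges_on V" using trees_subset[OF assms(1)] by blast
    then show "v \<in> V" by (simp add: edges_on_pair)
  qed
qed

lemma simple_path:
  assumes "(u, v) \<in> R\<^sup>*"
  shows "\<exists>p. p \<noteq> [] \<and> distinct p \<and> hd p = u \<and> last p = v \<and> successively (\<lambda>a b. (a, b) \<in> R) p"
  using assms
proof (induction rule: converse_rtrancl_induct)
  case base
  show ?case by (rule exI[of _ "[v]"]) simp
next
  case (step u y)
  then obtain p where p: "p \<noteq> []" "distinct p" "hd p = y" "last p = v"
    "successively (\<lambda>a b. (a, b) \<in> R) p" by blast
  show ?case
  proof (cases "u \<in> set p")
    case True
    then obtain as bs where ab: "p = as @ u # bs" by (meson split_list)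
    show ?thesis
      by (rule exI[of _ "u # bs"]) (use p ab in \<open>auto simp: successively_append_iff\<close>)
  next
    case False
    show ?thesis
      by (rule exI[of _ "u # p"]) (use p False step(1) in \<open>auto simp: successively_Cons\<close>)
  qed
qed

text \<open>
  A simple path around an edge closes up to a cycle, and conversely a cycle minus one of its edges is
  a path around that edge.
\<close>

lemma spanning_trees_eq_trees: "spanning_trees n = trees_on {0..<n}"
proof -
  have "(\<nexists>vs. edge_cycle T vs) \<longleftrightarrow> (\<forall>u v. {u, v} \<in> T \<longrightarrow> (u, v) \<notin> reach (T - {{u, v}}))"
    if T: "T \<subseteq> edges_on {0..<n}" for T
  proof
    assume nc: "\<nexists>vs. edge_cycle T vs"
    show "\<forall>u v. {u, v} \<in> T \<longrightarrow> (u, v) \<notin> reach (T - {{u, v}})"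
    proof (intro allI impI notI)
      fix u v assume uv: "{u, v} \<in> T" and r: "(u, v) \<in> reach (T - {{u, v}})"
      obtain p where p: "p \<noteq> []" "distinct p" "hd p = u" "last p = v"
        "successively (\<lambda>a b. {a, b} \<in> T - {{u, v}}) p"
        using simple_path[OF r[unfolded reach_def]] by auto
      have "u \<noteq> v" using uv T edges_on_pair by blast
      have nth: "{p ! i, p ! Suc i} \<in> T - {{u, v}}" if "Suc i < length p" for i
        using p(5) that by (auto simp: successively_conv_nth)
      have l3: "3 \<le> length p"
      proof (rule ccontr)
        assume "\<not> 3 \<le> length p"
        moreover have "length p \<noteq> 1"
          using p(1,3,4) \<open>u \<noteq> v\<close> by (auto simp: length_Suc_conv)
        moreover have "length p \<noteq> 0" using p(1) by simp
        ultimately have "length p = 2" by linarith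
        with nth[of 0] p(1,3,4) show False
          by (auto simp: hd_conv_nth last_conv_nth)
      qed
      have "edge_cycle T p"
        unfolding edge_cycle_def
      proof (intro conjI allI impI)
        fix i assume i: "i < length p"
        show "{p ! i, p ! (Suc i mod length p)} \<in> T"
        proof (cases "Suc i < length p")
          case True
          then show ?thesis using nth by auto
        next
          case False
          then have "i = length p - 1" using i by linarith
          moreover have "p ! (length p - 1) = v" "p ! 0 = u"
            using p by (auto simp: hd_conv_nth last_conv_nth)
          moreover have "Suc i mod length p = 0" using False i by (metis Suc_lessI mod_self)
          ultimately show ?thesis using uv by (simp add: insert_commute)
        qed
      qed (use l3 p(2) in auto)
      with nc show False by blast
    qed
  next
    assume br: "\<forall>u v. {u, v} \<in> T \<longrightarrow> (u, v) \<notin> reach (T - {{u, v}})"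
    show "\<nexists>vs. edge_cycle T vs"
    proof (intro notI, elim exE)
      fix p assume "edge_cycle T p"
      then have l3: "3 \<le> length p" and d: "distinct p"
        and e: "\<And>i. i < length p \<Longrightarrow> {p ! i, p ! (Suc i mod length p)} \<in> T"
        by (auto simp: edge_cycle_def)
      define m where "m = length p - 1"
      have "{p ! m, p ! 0} \<in> T"
        using e[of m] l3 by (cases p) (auto simp: m_def)
      then have uv: "{p ! 0, p ! m} \<in> T" by (simp add: insert_commute)
      have "i \<le> m \<Longrightarrow> (p ! 0, p ! i) \<in> reach (T - {{p ! 0, p ! m}})" for i
      proof (induction i)
        case (Suc i)
        have "{p ! i, p ! Suc i} \<in> T" using e[of i] Suc.prems by (auto simp: m_def)
        moreover have "{p ! i, p ! Suc i} \<noteq> {p ! 0, p ! m}"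
        proof
          assume "{p ! i, p ! Suc i} = {p ! 0, p ! m}"
          then have "(!) p ` {i, Suc i} = (!) p ` {0, m}" by simp
          moreover have "inj_on ((!) p) {..m}"
            using d l3 by (intro inj_on_nth) (auto simp: m_def)
          ultimately have "{i, Suc i} = {0, m}"
            using Suc.prems by (subst (asm) inj_on_image_eq_iff) auto
          then show False using l3 by (auto simp: doubleton_eq_iff m_def)
        qed
        ultimately show ?case using Suc by (auto intro: reach_step)
      qed simp
      with br uv show False by blast
    qed
  qed
  then show ?thesis
    unfolding spanning_trees_def trees_on_def edges_connect_def reach_def[symmetric]
    by (auto simp: edges_on_def)
qed

text \<open>
  Adding the edge \<open>{r, v}\<close> between trees on disjoint vertex sets: a walk that avoids an edge of the
  first tree can leave \<open>A\<close> only through \<open>r\<close>, so it creates no way around that edge.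
\<close>

lemma join_bridge:
  assumes TA: "TA \<in> trees_on A" and TB: "TB \<in> trees_on B" and AB: "A \<inter> B = {}"
    and r: "r \<in> A" and v: "v \<in> B" and e: "{x, y} \<in> TA"
  shows "(x, y) \<notin> reach (insert {r, v} (TA \<union> TB) - {{x, y}})"
proof
  let ?T = "insert {r, v} (TA \<union> TB) - {{x, y}}"
  have xy: "x \<in> A" "y \<in> A" "x \<noteq> y" using e trees_subset[OF TA] edges_on_pair by auto
  have sA: "\<And>a b. {a, b} \<in> TA \<Longrightarrow> a \<in> A \<and> b \<in> A" and sB: "\<And>a b. {a, b} \<in> TB \<Longrightarrow> a \<in> B \<and> b \<in> B"
    using trees_subset[OF TA] trees_subset[OF TB] edges_on_pair by auto
  assume xy_T: "(x, y) \<in> reach ?T"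
  have "(z \<in> A \<and> (x, z) \<in> reach (TA - {{x, y}})) \<or> (z \<in> B \<and> (x, r) \<in> reach (TA - {{x, y}}))"
    if "(x, z) \<in> reach ?T" for z
    using that
  proof (induction rule: reach_induct)
    case base
    then show ?case using xy by simp
  next
    case (step w z)
    from step(2) consider "{w, z} \<in> TA - {{x, y}}" | "{w, z} \<in> TB" | "{w, z} = {r, v}" by auto
    then show ?case
    proof cases
      case 1
      then have "w \<in> A" "z \<in> A" using sA[of w z] by auto
      then have "w \<notin> B" using AB by auto
      with step(3) have "(x, w) \<in> reach (TA - {{x, y}})" by argo
      then have "(x, z) \<in> reach (TA - {{x, y}})"
        by (rule reach_step) (use 1 in simp)
      then show ?thesis using \<open>z \<in> A\<close> by blast
    next
      case 2
      then have "w \<in> B" "z \<in> B" using sB[of w z] by auto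
      with step(3) AB show ?thesis by auto
    next
      case 3
      then have "w = r \<and> z = v \<or> w = v \<and> z = r" by (auto simp: doubleton_eq_iff)
      with step(3) AB r v show ?thesis by auto
    qed
  qed
  from this[OF xy_T] xy AB have "(x, y) \<in> reach (TA - {{x, y}})" by auto
  with TA e show False by (auto simp: trees_on_def)
qed

lemma join_trees:
  assumes TA: "TA \<in> trees_on A" and TB: "TB \<in> trees_on B" and AB: "A \<inter> B = {}"
    and r: "r \<in> A" and v: "v \<in> B"
  shows "insert {r, v} (TA \<union> TB) \<in> trees_on (A \<union> B)"
    and "{r, v} \<notin> TA \<union> TB"
    and "{z \<in> A \<union> B. (v, z) \<in> reach (insert {r, v} (TA \<union> TB) - {{r, v}})} = B"
proof -
  let ?T = "insert {r, v} (TA \<union> TB)"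
  have rv: "r \<noteq> v" using AB r v by auto
  have sA: "\<And>a b. {a, b} \<in> TA \<Longrightarrow> a \<in> A \<and> b \<in> A" and sB: "\<And>a b. {a, b} \<in> TB \<Longrightarrow> a \<in> B \<and> b \<in> B"
    using trees_subset[OF TA] trees_subset[OF TB] edges_on_pair by auto
  show new: "{r, v} \<notin> TA \<union> TB"
    using sA[of r v] sB[of r v] AB r v by auto
  then have T': "?T - {{r, v}} = TA \<union> TB" by auto
  have stay: "z \<in> B" if "(v, z) \<in> reach (TA \<union> TB)" for z
    using that
  proof (induction rule: reach_induct)
    case (step w z)
    then show ?case using sA[of w z] sB[of w z] AB by auto
  qed (use v in simp)
  show comp: "{z \<in> A \<union> B. (v, z) \<in> reach (?T - {{r, v}})} = B"
    unfolding T' using stay TB v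
    by (auto simp: trees_on_def intro: reach_mono[of TB "TA \<union> TB"])
  have cA: "(a, r) \<in> reach ?T" if "a \<in> A" for a
    using TA r that by (auto simp: trees_on_def intro: reach_mono[of TA ?T])
  have cB: "(b, r) \<in> reach ?T" if "b \<in> B" for b
  proof -
    have "(b, v) \<in> reach ?T"
      using TB v that by (auto simp: trees_on_def intro: reach_mono[of TB ?T])
    then show ?thesis
      by (rule reach_step) (auto simp: insert_commute)
  qed
  have c: "(a, b) \<in> reach ?T" if "a \<in> A \<union> B" "b \<in> A \<union> B" for a b
    using cA cB that reach_sym reach_trans by (metis Un_iff)
  have b: "(x, y) \<notin> reach (?T - {{x, y}})" if e: "{x, y} \<in> ?T" for x y
  proof -
    from e consider "{x, y} \<in> TA" | "{x, y} \<in> TB" | "{x, y} = {r, v}" by auto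
    then show ?thesis
    proof cases
      case 1
      then show ?thesis by (rule join_bridge[OF TA TB AB r v])
    next
      case 2
      have "(x, y) \<notin> reach (insert {v, r} (TB \<union> TA) - {{x, y}})"
        by (rule join_bridge[OF TB TA _ v r 2]) (use AB in auto)
      then show ?thesis by (simp add: insert_commute Un_commute)
    next
      case 3
      have "(v, r) \<notin> reach (TA \<union> TB)" using stay[of r] AB r by auto
      then have "(v, r) \<notin> reach (?T - {{x, y}})" using T' 3 by simp
      moreover have "x = r \<and> y = v \<or> x = v \<and> y = r" using 3 by (auto simp: doubleton_eq_iff)
      ultimately show ?thesis using reach_sym by blast
    qed
  qed
  have "?T \<subseteq> edges_on (A \<union> B)"
    using trees_subset[OF TA] trees_subset[OF TB] r v rv
    by (auto simp: edges_on_pair) (auto simp: edges_on_def)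
  then show "?T \<in> trees_on (A \<union> B)"
    using c b by (auto simp: trees_on_def)
qed

text \<open>
  As every edge is a bridge, removing \<open>{r, v}\<close> leaves two components. The set \<open>B\<close> is the component of \<open>v\<close>, and
  no other edge joins it to the rest, because such an edge would extend the component.
\<close>

lemma cut_tree:
  assumes T: "T \<in> trees_on V" and e: "{r, v} \<in> T"
  defines "B \<equiv> {z \<in> V. (v, z) \<in> reach (T - {{r, v}})}"
  shows "B \<subseteq> V - {r}" and "v \<in> B"
    and "{e \<in> T. e \<subseteq> V - B} \<in> trees_on (V - B)" and "{e \<in> T. e \<subseteq> B} \<in> trees_on B"
    and "T = insert {r, v} ({e \<in> T. e \<subseteq> V - B} \<union> {e \<in> T. e \<subseteq> B})"
proof -
  let ?T = "T - {{r, v}}"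
  let ?TA = "{e \<in> T. e \<subseteq> V - B}" and ?TB = "{e \<in> T. e \<subseteq> B}"
  have sT: "\<And>a b. {a, b} \<in> T \<Longrightarrow> a \<in> V \<and> b \<in> V \<and> a \<noteq> b"
    using trees_subset[OF T] edges_on_pair by auto
  have rv: "r \<in> V" "v \<in> V" "r \<noteq> v" using sT[OF e] by auto
  have bridge: "\<And>x y. {x, y} \<in> T \<Longrightarrow> (x, y) \<notin> reach (T - {{x, y}})"
    and conn: "\<And>x y. x \<in> V \<Longrightarrow> y \<in> V \<Longrightarrow> (x, y) \<in> reach T"
    using T by (auto simp: trees_on_def)
  have "r \<notin> B" using bridge[OF e] reach_sym by (auto simp: B_def)
  then show BV: "B \<subseteq> V - {r}" by (auto simp: B_def)
  show vB: "v \<in> B" using rv by (simp add: B_def)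
  have side: "z \<in> B" if "w \<in> B" "{w, z} \<in> ?T" for w z
    using that sT[of w z] by (auto simp: B_def intro: reach_step)
  show eq: "T = insert {r, v} (?TA \<union> ?TB)"
  proof (intro equalityI subsetI)
    fix e' assume e': "e' \<in> T"
    then obtain x y where xy: "e' = {x, y}" "x \<in> V" "y \<in> V"
      using trees_subset[OF T] by (meson edges_onE subsetD)
    show "e' \<in> insert {r, v} (?TA \<union> ?TB)"
    proof (cases "e' = {r, v}")
      case False
      then have "{x, y} \<in> ?T" "{y, x} \<in> ?T" using e' xy by (auto simp: insert_commute)
      then have "x \<in> B \<longleftrightarrow> y \<in> B" using side by blast
      then show ?thesis using e' xy by auto
    qed simp
  qed (use e in auto)
  have notA: "{r, v} \<notin> ?TA" and notB: "{r, v} \<notin> ?TB" using vB \<open>r \<notin> B\<close> by auto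
  have br: "(x, y) \<notin> reach (T' - {{x, y}})" if "T' \<subseteq> T" "{x, y} \<in> T'" for T' x y
    using bridge[of x y] reach_mono[of "T' - {{x, y}}" "T - {{x, y}}" x y] that by blast
  have cB: "(v, z) \<in> reach ?TB" if "z \<in> B" for z
  proof -
    have "(v, z) \<in> reach ?T" using that by (simp add: B_def)
    then have "z \<in> B \<and> (v, z) \<in> reach ?TB"
    proof (induction rule: reach_induct)
      case (step w z)
      then have "w \<in> B" "z \<in> B" using side[of w z] by auto
      moreover have "(v, z) \<in> reach ?TB"
        by (rule reach_step[of _ w]) (use step calculation in auto)
      ultimately show ?case by simp
    qed (use vB in simp)
    then show ?thesis ..
  qed
  have cA: "(r, z) \<in> reach ?TA" if "z \<in> V - B" for z
  proof -
    have "(r, z) \<in> reach T" using conn rv that by auto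
    then have "z \<in> B \<or> (r, z) \<in> reach ?TA"
    proof (induction rule: reach_induct)
      case (step w z)
      show ?case
      proof (cases "z \<in> B")
        case False
        show ?thesis
        proof (cases "{w, z} = {r, v}")
          case True
          then have "z = r" using False vB by (auto simp: doubleton_eq_iff)
          then show ?thesis by simp
        next
          case neq: False
          then have "w \<notin> B" using side[of w z] step(2) False by auto
          then have "(r, w) \<in> reach ?TA" using step(3) by simp
          moreover have "{w, z} \<in> ?TA" using step(2) sT[of w z] \<open>w \<notin> B\<close> False by auto
          ultimately show ?thesis by (auto intro: reach_step)
        qed
      qed simp
    qed simp
    with that show ?thesis by simp
  qed
  have "?TA \<subseteq> edges_on (V - B)" "?TB \<subseteq> edges_on B"
    using trees_subset[OF T] by (auto simp: edges_on_def)
  moreover have "(x, y) \<in> reach ?TA" if "x \<in> V - B" "y \<in> V - B" for x y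
    by (rule reach_trans[OF reach_sym[OF cA] cA]) (use that in auto)
  moreover have "(x, y) \<in> reach ?TB" if "x \<in> B" "y \<in> B" for x y
    by (rule reach_trans[OF reach_sym[OF cB] cB]) (use that in auto)
  moreover have "(x, y) \<notin> reach (?TA - {{x, y}})" if "{x, y} \<in> ?TA" for x y
    using br[of ?TA x y] that by blast
  moreover have "(x, y) \<notin> reach (?TB - {{x, y}})" if "{x, y} \<in> ?TB" for x y
    using br[of ?TB x y] that by blast
  ultimately show "?TA \<in> trees_on (V - B)" "?TB \<in> trees_on B"
    unfolding trees_on_def by blast+
qed

lemma join_restrict:
  assumes TA: "TA \<in> trees_on A" and TB: "TB \<in> trees_on B" and AB: "A \<inter> B = {}"
    and r: "r \<in> A" and v: "v \<in> B"
  shows "{e \<in> insert {r, v} (TA \<union> TB). e \<subseteq> A} = TA"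
    and "{e \<in> insert {r, v} (TA \<union> TB). e \<subseteq> B} = TB"
proof -
  have "\<And>e. e \<in> TA \<Longrightarrow> e \<subseteq> A \<and> e \<noteq> {}" "\<And>e. e \<in> TB \<Longrightarrow> e \<subseteq> B \<and> e \<noteq> {}"
    using trees_subset[OF TA] trees_subset[OF TB] by (force simp: edges_on_def)+
  then show "{e \<in> insert {r, v} (TA \<union> TB). e \<subseteq> A} = TA"
    and "{e \<in> insert {r, v} (TA \<union> TB). e \<subseteq> B} = TB"
    using AB r v by blast+
qed

lemma deg_join:
  assumes TA: "TA \<in> trees_on A" and TB: "TB \<in> trees_on B" and AB: "A \<inter> B = {}"
    and r: "r \<in> A" and v: "v \<in> B" and fin: "finite A"
  shows "deg (insert {r, v} (TA \<union> TB)) r = Suc (deg TA r)"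
proof -
  have rB: "{r, z} \<notin> TB" for z
    using trees_subset[OF TB] AB r by (auto simp: edges_on_def)
  have "{z. {r, z} \<in> insert {r, v} (TA \<union> TB)} = insert v {z. {r, z} \<in> TA}"
    using rB AB r v by (auto simp: doubleton_eq_iff)
  moreover have "v \<notin> {z. {r, z} \<in> TA}"
    using join_trees(2)[OF TA TB AB r v] by simp
  ultimately show ?thesis
    unfolding deg_def using finite_nbrs[OF TA fin] by simp
qed

text \<open>
  Marking one of the edges at the root amounts to choosing the subtree that hangs off that edge and
  its vertex adjacent to the root. No division is needed in this form, so it holds for weights in any
  commutative semiring.
\<close>

lemma root_edge_recursion:
  fixes w :: "nat set \<Rightarrow> 'b::comm_semiring_1"
  assumes fin: "finite V" and r: "r \<in> V"
  shows "of_nat (Suc j) * (\<Sum>T\<in>{T\<in>trees_on V. deg T r = Suc j}. \<Prod>e\<in>T. w e) =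
    (\<Sum>B\<in>Pow (V - {r}). (\<Sum>T\<in>{T\<in>trees_on (V - B). deg T r = j}. \<Prod>e\<in>T. w e) *
       (\<Sum>T\<in>trees_on B. \<Prod>e\<in>T. w e) * (\<Sum>v\<in>B. w {r, v}))"
proof -
  let ?L = "SIGMA T:{T\<in>trees_on V. deg T r = Suc j}. {v. {r, v} \<in> T}"
  let ?R = "SIGMA B:Pow (V - {r}). ({T\<in>trees_on (V - B). deg T r = j} \<times> trees_on B) \<times> B"
  define comp where "comp T v = {z\<in>V. (v, z) \<in> reach (T - {{r, v}})}" for T v
  define join where "join = (\<lambda>(B :: nat set, (TA, TB), v). (insert {r, v} (TA \<union> TB), v))"
  define cut where "cut = (\<lambda>(T, v). (comp T v, ({e\<in>T. e \<subseteq> V - comp T v}, {e\<in>T. e \<subseteq> comp T v}), v))"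
  define h where "h = (\<lambda>(B :: nat set, (TA, TB), v). (\<Prod>e\<in>TA. w e) * (\<Prod>e\<in>TB. w e) * w {r, v})"
  have finB: "finite B" "finite {T\<in>trees_on (V - B). deg T r = j}" "finite (trees_on B)"
    if "B \<in> Pow (V - {r})" for B
  proof -
    show "finite B" using that fin finite_subset[of B V] by auto
    then show "finite (trees_on B)" by (rule finite_trees)
    have "finite (trees_on (V - B))" using fin by (intro finite_trees) simp
    then show "finite {T\<in>trees_on (V - B). deg T r = j}" by simp
  qed
  have "of_nat (Suc j) * (\<Sum>T\<in>{T\<in>trees_on V. deg T r = Suc j}. \<Prod>e\<in>T. w e) =
    (\<Sum>T\<in>{T\<in>trees_on V. deg T r = Suc j}. \<Sum>v\<in>{v. {r, v} \<in> T}. \<Prod>e\<in>T. w e)"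
    unfolding sum_distrib_left by (rule sum.cong) (auto simp: deg_def)
  also have "\<dots> = (\<Sum>(T, v)\<in>?L. \<Prod>e\<in>T. w e)"
    by (rule sum.Sigma) (use fin finite_trees finite_nbrs in auto)
  also have "\<dots> = (\<Sum>q\<in>?R. h q)"
  proof (rule sum.reindex_bij_witness
      [where i = join and j = cut])
    fix p assume p: "p \<in> ?L"
    then obtain T v where Tv: "p = (T, v)" "T \<in> trees_on V" "{r, v} \<in> T" "deg T r = Suc j" by auto
    note ct = cut_tree[OF Tv(2,3), folded comp_def]
    let ?A = "{e\<in>T. e \<subseteq> V - comp T v}" and ?B = "{e\<in>T. e \<subseteq> comp T v}"
    have f: "finite T" using finite_tree[OF Tv(2) fin] .
    show "join (cut p) = p"
      unfolding join_def cut_def using ct(5) Tv(1) by simp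
    have "deg T r = Suc (deg ?A r)"
      by (subst ct(5), rule deg_join[OF ct(3,4)]) (use ct(1,2) r fin in auto)
    then show "cut p \<in> ?R"
      unfolding cut_def using ct(1-4) Tv by simp
    have "prod w (insert {r, v} (?A \<union> ?B)) = w {r, v} * prod w (?A \<union> ?B)"
      by (rule prod.insert) (use f ct(1,2) in auto)
    also have "prod w (?A \<union> ?B) = prod w ?A * prod w ?B"
      by (rule prod.union_disjoint) (use f edge_nonempty[OF Tv(2)] in auto)
    finally have "prod w ?A * prod w ?B * w {r, v} = prod w T"
      using ct(5) by (simp add: mult_ac)
    then show "h (cut p) = (case p of (T, v) \<Rightarrow> prod w T)"
      unfolding h_def cut_def using Tv(1) by simp
  next
    fix q assume q: "q \<in> ?R"
    then obtain B TA TB v where *: "q = (B, (TA, TB), v)" "B \<subseteq> V - {r}" "TA \<in> trees_on (V - B)"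
      "deg TA r = j" "TB \<in> trees_on B" "v \<in> B" by auto
    have AB: "(V - B) \<inter> B = {}" "r \<in> V - B" "(V - B) \<union> B = V" using * r by auto
    note jn = join_trees[OF *(3,5) AB(1,2) *(6), unfolded AB(3)]
    note jr = join_restrict[OF *(3,5) AB(1,2) *(6)]
    have c: "comp (insert {r, v} (TA \<union> TB)) v = B" using jn(3) unfolding comp_def .
    show "cut (join q) = q"
      unfolding *(1) cut_def join_def prod.case c jr ..
    have "deg (insert {r, v} (TA \<union> TB)) r = Suc j"
      using deg_join[OF *(3,5) AB(1,2) *(6)] fin *(4) by simp
    then show "join q \<in> ?L"
      unfolding join_def using jn(1) *(1) by simp
  qed
  also have "\<dots> = (\<Sum>B\<in>Pow (V - {r}).
      \<Sum>q\<in>({T\<in>trees_on (V - B). deg T r = j} \<times> trees_on B) \<times> B. h (B, q))"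
    by (subst sum.Sigma) (use fin finB in \<open>auto intro!: finite_cartesian_product\<close>)
  also have "\<dots> = (\<Sum>B\<in>Pow (V - {r}). (\<Sum>T\<in>{T\<in>trees_on (V - B). deg T r = j}. \<Prod>e\<in>T. w e) *
       (\<Sum>T\<in>trees_on B. \<Prod>e\<in>T. w e) * (\<Sum>v\<in>B. w {r, v}))"
    unfolding sum.cartesian_product' h_def prod.case
    by (simp only: sum_distrib_left[symmetric] sum_distrib_right[symmetric])
  finally show ?thesis .
qed

lemma tree_has_root_edge:
  assumes "T \<in> trees_on V" "r \<in> V" "V \<noteq> {r}"
  obtains v where "{r, v} \<in> T"
proof -
  obtain z where z: "z \<in> V" "z \<noteq> r" using assms by auto
  then have "(r, z) \<in> reach T" using assms by (simp add: trees_on_def)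
  then show ?thesis unfolding reach_def
    by (cases rule: converse_rtranclE) (use z that in auto)
qed

lemma card_tree: "T \<in> trees_on V \<Longrightarrow> finite V \<Longrightarrow> V \<noteq> {} \<Longrightarrow> Suc (card T) = card V"
proof (induction "card V" arbitrary: V T rule: less_induct)
  case less
  obtain r where r: "r \<in> V" using less by auto
  show ?case
  proof (cases "V = {r}")
    case True
    then have "T = {}" using trees_subset[OF less(2)] by (auto elim!: edges_onE)
    then show ?thesis using True by simp
  next
    case False
    then obtain v where e: "{r, v} \<in> T" using tree_has_root_edge[OF less(2) r] by blast
    define B where "B = {z\<in>V. (v, z) \<in> reach (T - {{r, v}})}"
    note cut = cut_tree[OF less(2) e, folded B_def]
    let ?A = "{e\<in>T. e \<subseteq> V - B}" and ?B = "{e\<in>T. e \<subseteq> B}"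
    have fB: "finite B" using cut(1) less(3) by (auto intro: finite_subset)
    have cB: "card B < card V" by (rule psubset_card_mono) (use cut(1) r less(3) in auto)
    have cA: "card (V - B) < card V" by (rule psubset_card_mono) (use cut(1,2) less(3) in auto)
    have IA: "Suc (card ?A) = card (V - B)" by (rule less(1)[OF cA cut(3)]) (use less(3) cut(1) r in auto)
    have IB: "Suc (card ?B) = card B" by (rule less(1)[OF cB cut(4) fB]) (use cut(2) in auto)
    have f: "finite T" using finite_tree[OF less(2,3)] .
    have "card T = Suc (card (?A \<union> ?B))"
      by (subst cut(5), rule card_insert_disjoint) (use f cut(1,2) in auto)
    also have "card (?A \<union> ?B) = card ?A + card ?B"
    proof (rule card_Un_disjoint)
      show "?A \<inter> ?B = {}" using edge_nonempty[OF less(2)] by blast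
    qed (use f in auto)
    finally have "card T = Suc (card ?A + card ?B)" .
    moreover have "card V = card (V - B) + card B"
    proof -
      have "B \<subseteq> V" using cut(1) by auto
      then show ?thesis using card_Diff_subset[OF fB] card_mono[OF less(3)] by force
    qed
    ultimately show ?thesis using IA IB by simp
  qed
qed

lemma edge_at:
  assumes "T \<in> trees_on V" "e \<in> T" "r \<in> e"
  shows "\<exists>v. e = {r, v}"
proof -
  have "e \<in> edges_on V" using assms trees_subset by blast
  then obtain x y where "e = {x, y}" by (rule edges_onE)
  then show ?thesis using assms(3) by (auto simp: insert_commute)
qed

lemma deg_eq_card_edges:
  assumes T: "T \<in> trees_on V"
  shows "deg T r = card {e \<in> T. r \<in> e}"
proof -
  have "{e \<in> T. r \<in> e} = (\<lambda>v. {r, v}) ` {v. {r, v} \<in> T}"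
  proof (intro equalityI subsetI)
    fix e assume e: "e \<in> {e \<in> T. r \<in> e}"
    then obtain v where "e = {r, v}" using edge_at[OF T, of e r] by blast
    then show "e \<in> (\<lambda>v. {r, v}) ` {v. {r, v} \<in> T}" using e by blast
  qed auto
  moreover have "inj_on (\<lambda>v. {r, v}) {v. {r, v} \<in> T}"
    by (auto simp: inj_on_def doubleton_eq_iff)
  ultimately show ?thesis by (simp add: deg_def card_image)
qed

lemma handshake:
  assumes T: "T \<in> trees_on V" and fin: "finite V"
  shows "(\<Sum>r\<in>V. deg T r) = 2 * card T"
proof -
  have fT: "finite T" using finite_tree[OF T fin] .
  have "(\<Sum>r\<in>V. deg T r) = (\<Sum>r\<in>V. \<Sum>e\<in>T. if r \<in> e then 1 else 0)"
    unfolding deg_eq_card_edges[OF T] using fT by (simp add: sum.If_cases Int_def)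
  also have "\<dots> = (\<Sum>e\<in>T. \<Sum>r\<in>V. if r \<in> e then 1 else 0)"
    by (rule sum.swap)
  also have "\<dots> = (\<Sum>e\<in>T. 2)"
  proof (rule sum.cong)
    fix e assume "e \<in> T"
    then have "e \<subseteq> V" "card e = 2" using trees_subset[OF T] by (auto simp: edges_on_def)
    then show "(\<Sum>r\<in>V. if r \<in> e then 1 else 0) = (2::nat)"
      using fin by (simp add: sum.If_cases Int_absorb1)
  qed simp
  finally show ?thesis by simp
qed

section \<open>Mixtures, dominated measures and entropy bounds\<close>

text \<open>
  The intensity measures \<open>c_micro\<close> and \<open>c_macro\<close>, as well as \<open>poisson_weight\<close> below, are mixtures of this form.
\<close>

lemma
  fixes K :: "'k \<Rightarrow> 'b measure"
  assumes sets_K: "\<And>k. sets (K k) = sets B"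
    and meas: "\<And>R. R \<in> sets B \<Longrightarrow> (\<lambda>k. emeasure (K k) R) \<in> borel_measurable l"
  defines "M \<equiv> measure_of (space B) (sets B) (\<lambda>R. \<integral>\<^sup>+k. emeasure (K k) R \<partial>l)"
  shows sets_mixture: "sets M = sets B"
    and emeasure_mixture: "R \<in> sets B \<Longrightarrow> emeasure M R = (\<integral>\<^sup>+k. emeasure (K k) R \<partial>l)"
    and measurable_mixture: "f \<in> borel_measurable B \<Longrightarrow> (\<lambda>k. \<integral>\<^sup>+x. f x \<partial>K k) \<in> borel_measurable l"
    and nn_integral_mixture:
      "f \<in> borel_measurable B \<Longrightarrow> (\<integral>\<^sup>+x. f x \<partial>M) = (\<integral>\<^sup>+k. \<integral>\<^sup>+x. f x \<partial>K k \<partial>l)"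
proof -
  show s: "sets M = sets B"
    unfolding M_def by (simp add: sets.space_closed sets.sigma_sets_eq)
  have sp: "space (K k) = space B" for k by (rule sets_eq_imp_space_eq[OF sets_K])
  have spM: "space M = space B" by (rule sets_eq_imp_space_eq[OF s])
  have mK: "f \<in> borel_measurable B \<longleftrightarrow> f \<in> borel_measurable (K k)" for f :: "'b \<Rightarrow> ennreal" and k
    by (simp add: measurable_cong_sets[OF sets_K refl])
  have mM: "f \<in> borel_measurable B \<longleftrightarrow> f \<in> borel_measurable M" for f :: "'b \<Rightarrow> ennreal"
    by (simp add: measurable_cong_sets[OF s refl])
  show e: "emeasure M R = (\<integral>\<^sup>+k. emeasure (K k) R \<partial>l)" if "R \<in> sets B" for R
    unfolding M_def
  proof (rule emeasure_measure_of_sigma)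
    show "sigma_algebra (space B) (sets B)" by (rule sets.sigma_algebra_axioms)
    show "positive (sets B) (\<lambda>R. \<integral>\<^sup>+k. emeasure (K k) R \<partial>l)" by (simp add: positive_def)
    show "countably_additive (sets B) (\<lambda>R. \<integral>\<^sup>+k. emeasure (K k) R \<partial>l)"
    proof (rule countably_additiveI)
      fix A :: "nat \<Rightarrow> 'b set" assume A: "range A \<subseteq> sets B" "disjoint_family A"
      have "(\<Sum>i. \<integral>\<^sup>+k. emeasure (K k) (A i) \<partial>l) = (\<integral>\<^sup>+k. (\<Sum>i. emeasure (K k) (A i)) \<partial>l)"
        using A meas by (intro nn_integral_suminf[symmetric]) auto
      also have "\<dots> = (\<integral>\<^sup>+k. emeasure (K k) (\<Union>i. A i) \<partial>l)"
        using A sets_K by (intro nn_integral_cong suminf_emeasure) auto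
      finally show "(\<Sum>i. \<integral>\<^sup>+k. emeasure (K k) (A i) \<partial>l) = (\<integral>\<^sup>+k. emeasure (K k) (\<Union>i. A i) \<partial>l)" .
    qed
  qed fact
  have *: "(\<lambda>k. \<integral>\<^sup>+x. f x \<partial>K k) \<in> borel_measurable l \<and>
      (\<integral>\<^sup>+x. f x \<partial>M) = (\<integral>\<^sup>+k. \<integral>\<^sup>+x. f x \<partial>K k \<partial>l)" if "f \<in> borel_measurable B" for f
    using that
  proof (induction rule: borel_measurable_induct)
    case (cong f g)
    have "(\<integral>\<^sup>+x. f x \<partial>K k) = (\<integral>\<^sup>+x. g x \<partial>K k)" for k
      by (rule nn_integral_cong) (simp add: sp cong(3))
    moreover have "(\<integral>\<^sup>+x. f x \<partial>M) = (\<integral>\<^sup>+x. g x \<partial>M)"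
      by (rule nn_integral_cong) (simp add: spM cong(3))
    ultimately show ?case using cong(4) by simp
  next
    case (set A)
    then show ?case using e meas sets_K s by simp
  next
    case (mult f c)
    then have f: "f \<in> borel_measurable M" "f \<in> borel_measurable (K k)" for k using mK mM by blast+
    have [measurable]: "(\<lambda>k. \<integral>\<^sup>+x. f x \<partial>K k) \<in> borel_measurable l" using mult by blast
    have "(\<lambda>k. c * (\<integral>\<^sup>+x. f x \<partial>K k)) \<in> borel_measurable l" by measurable
    then show ?case using mult f by (simp add: nn_integral_cmult)
  next
    case (add f g)
    then have f: "f \<in> borel_measurable M" "f \<in> borel_measurable (K k)"
      "g \<in> borel_measurable M" "g \<in> borel_measurable (K k)" for k using mK mM by blast+
    have [measurable]: "(\<lambda>k. \<integral>\<^sup>+x. f x \<partial>K k) \<in> borel_measurable l"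
      "(\<lambda>k. \<integral>\<^sup>+x. g x \<partial>K k) \<in> borel_measurable l" using add by blast+
    have "(\<lambda>k. (\<integral>\<^sup>+x. f x \<partial>K k) + (\<integral>\<^sup>+x. g x \<partial>K k)) \<in> borel_measurable l" by measurable
    then show ?case using add f by (simp add: nn_integral_add)
  next
    case (seq U)
    then have U: "\<And>i. U i \<in> borel_measurable M" "\<And>i k. U i \<in> borel_measurable (K k)" "incseq U"
      using mM mK by auto
    have "(\<integral>\<^sup>+x. (SUP i. U i) x \<partial>K k) = (SUP i. \<integral>\<^sup>+x. U i x \<partial>K k)" for k
      using U by (simp add: nn_integral_monotone_convergence_SUP[symmetric] image_comp)
    moreover have "(\<integral>\<^sup>+x. (SUP i. U i) x \<partial>M) = (SUP i. \<integral>\<^sup>+x. U i x \<partial>M)"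
      using U by (simp add: nn_integral_monotone_convergence_SUP[symmetric] image_comp)
    moreover have "(\<integral>\<^sup>+k. (SUP i. \<integral>\<^sup>+x. U i x \<partial>K k) \<partial>l) = (SUP i. \<integral>\<^sup>+k. \<integral>\<^sup>+x. U i x \<partial>K k \<partial>l)"
      using seq U(3) by (intro nn_integral_monotone_convergence_SUP)
        (auto simp: incseq_def le_fun_def intro!: nn_integral_mono)
    moreover have "(\<lambda>k. SUP i. \<integral>\<^sup>+x. U i x \<partial>K k) \<in> borel_measurable l"
      using seq by (intro borel_measurable_SUP) auto
    ultimately show ?case using seq by simp
  qed
  show "f \<in> borel_measurable B \<Longrightarrow> (\<lambda>k. \<integral>\<^sup>+x. f x \<partial>K k) \<in> borel_measurable l"
    "f \<in> borel_measurable B \<Longrightarrow> (\<integral>\<^sup>+x. f x \<partial>M) = (\<integral>\<^sup>+k. \<integral>\<^sup>+x. f x \<partial>K k \<partial>l)"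
    using * by blast+
qed

lemma ereal_integral_eq:
  fixes l :: "'b \<Rightarrow> real"
  assumes "integrable M l"
  shows "ereal (\<integral>x. l x \<partial>M) = enn2ereal (\<integral>\<^sup>+x. ennreal (l x) \<partial>M) - enn2ereal (\<integral>\<^sup>+x. ennreal (- l x) \<partial>M)"
proof -
  have "(\<integral>\<^sup>+x. ennreal (l x) \<partial>M) \<noteq> \<infinity>" "(\<integral>\<^sup>+x. ennreal (- l x) \<partial>M) \<noteq> \<infinity>"
    using assms by (auto simp: real_integrable_def)
  moreover have "\<exists>r\<ge>0. e = ennreal r" if "e \<noteq> \<infinity>" for e
    using that by (cases e) auto
  ultimately obtain a b where "(\<integral>\<^sup>+x. ennreal (l x) \<partial>M) = ennreal a" "0 \<le> a"
     "(\<integral>\<^sup>+x. ennreal (- l x) \<partial>M) = ennreal b" "0 \<le> b"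
    by blast
  then show ?thesis unfolding real_lebesgue_integral_def[OF assms] by (simp add: enn2ereal_ennreal)
qed

lemma eintegral_eq_integral:
  assumes "integrable M l" "AE x in M. F x = ereal (l x)"
  shows "eintegral M F = ereal (\<integral>x. l x \<partial>M)"
proof -
  have "(\<integral>\<^sup>+x. e2ennreal (F x) \<partial>M) = (\<integral>\<^sup>+x. ennreal (l x) \<partial>M)"
    using assms(2) by (intro nn_integral_cong_AE) (auto simp: e2ennreal_ereal)
  moreover have "(\<integral>\<^sup>+x. e2ennreal (- F x) \<partial>M) = (\<integral>\<^sup>+x. ennreal (- l x) \<partial>M)"
    using assms(2) by (intro nn_integral_cong_AE) (auto simp: e2ennreal_ereal)
  ultimately show ?thesis unfolding eintegral_def ereal_integral_eq[OF assms(1)] by simp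
qed

lemma eintegral_ge_integral:
  assumes "integrable M l" "AE x in M. ereal (l x) \<le> F x"
  shows "ereal (\<integral>x. l x \<partial>M) \<le> eintegral M F"
proof -
  have "ennreal (l x) \<le> e2ennreal (F x)" "e2ennreal (- F x) \<le> ennreal (- l x)"
    if "ereal (l x) \<le> F x" for x
  proof -
    show "ennreal (l x) \<le> e2ennreal (F x)" using e2ennreal_mono[OF that] by simp
    have "- F x \<le> ereal (- l x)" using that by (metis ereal_minus_le_minus uminus_ereal.simps(1))
    from e2ennreal_mono[OF this] show "e2ennreal (- F x) \<le> ennreal (- l x)" by simp
  qed
  then have "(\<integral>\<^sup>+x. ennreal (l x) \<partial>M) \<le> (\<integral>\<^sup>+x. e2ennreal (F x) \<partial>M)"
    "(\<integral>\<^sup>+x. e2ennreal (- F x) \<partial>M) \<le> (\<integral>\<^sup>+x. ennreal (- l x) \<partial>M)"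
    using assms(2) by (auto intro!: nn_integral_mono_AE elim!: eventually_mono)
  then show ?thesis
    unfolding eintegral_def ereal_integral_eq[OF assms(1)]
    by (intro ereal_minus_mono) (auto simp: less_eq_ennreal.rep_eq)
qed

text \<open>
  A quasi-integrable function is controlled by its truncations from above, by monotone convergence.
\<close>

lemma eintegral_le_truncations:
  assumes l: "integrable M l" and p[measurable]: "p \<in> borel_measurable M" and p0: "\<And>x. 0 \<le> p x"
    and F: "AE x in M. F x = ereal (l x + p x)"
    and tr: "\<And>k::nat. integrable M (\<lambda>x. min (p x) k)"
    and X: "\<And>k::nat. ereal (\<integral>x. l x + min (p x) k \<partial>M) \<le> X"
  shows "eintegral M F \<le> X"
proof (cases "X = \<infinity>")
  case False
  have "X \<noteq> -\<infinity>" using X[of 0] by auto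
  with False obtain z where z: "X = ereal z" by (cases X) auto
  have b: "(\<integral>x. min (p x) k \<partial>M) \<le> z - (\<integral>x. l x \<partial>M)" for k :: nat
    using X[of k] z l tr[of k] by simp
  have "(\<integral>\<^sup>+x. ennreal (p x) \<partial>M) = (\<integral>\<^sup>+x. (SUP k::nat. ennreal (min (p x) k)) \<partial>M)"
  proof (intro nn_integral_cong antisym)
    fix x
    obtain k :: nat where "p x \<le> k" using real_arch_simple by blast
    then show "ennreal (p x) \<le> (SUP k::nat. ennreal (min (p x) k))"
      by (intro SUP_upper2[of k]) auto
    show "(SUP k::nat. ennreal (min (p x) k)) \<le> ennreal (p x)"
      by (intro SUP_least ennreal_leI) simp
  qed
  also have "\<dots> = (SUP k::nat. \<integral>\<^sup>+x. ennreal (min (p x) k) \<partial>M)"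
    by (intro nn_integral_monotone_convergence_SUP)
      (auto simp: incseq_def le_fun_def intro!: ennreal_leI)
  also have "\<dots> \<le> ennreal (z - (\<integral>x. l x \<partial>M))"
  proof (rule SUP_least)
    fix k :: nat
    have "(\<integral>\<^sup>+x. ennreal (min (p x) k) \<partial>M) = ennreal (\<integral>x. min (p x) k \<partial>M)"
      using tr p0 by (intro nn_integral_eq_integral) auto
    then show "(\<integral>\<^sup>+x. ennreal (min (p x) k) \<partial>M) \<le> ennreal (z - (\<integral>x. l x \<partial>M))"
      using b[of k] by (simp add: ennreal_leI)
  qed
  finally have le: "(\<integral>\<^sup>+x. ennreal (p x) \<partial>M) \<le> ennreal (z - (\<integral>x. l x \<partial>M))" .
  then have ip: "integrable M p"
    using p0 by (intro integrableI_nonneg) (auto simp: le_less_trans)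
  have z0: "0 \<le> z - (\<integral>x. l x \<partial>M)" using b[of 0] p0 by simp
  have "ennreal (\<integral>x. p x \<partial>M) \<le> ennreal (z - (\<integral>x. l x \<partial>M))"
    using le ip p0 by (simp add: nn_integral_eq_integral)
  then have "(\<integral>x. p x \<partial>M) \<le> z - (\<integral>x. l x \<partial>M)" using z0 by simp
  moreover have "eintegral M F = ereal (\<integral>x. l x + p x \<partial>M)"
    by (rule eintegral_eq_integral) (use l ip F in auto)
  ultimately show ?thesis using l ip z by simp
qed simp

lemma log_int_density:
  assumes R: "sigma_finite_measure R" and g[measurable]: "g \<in> borel_measurable R"
    and g0: "\<And>x. 0 \<le> g x" and y: "y = density R (\<lambda>x. ennreal (g x))"
  shows "log_int y R = eintegral y (\<lambda>x. ereal (ln (g x)))"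
    and "AE x in y. 0 < g x"
proof -
  interpret sigma_finite_measure R by fact
  show pos: "AE x in y. 0 < g x"
    unfolding y by (subst AE_density) (auto simp: g0 less_le)
  have ac: "absolutely_continuous R y"
    unfolding y by (rule absolutely_continuousI_density) simp
  have "AE x in R. ennreal (g x) = RN_deriv R y x"
    by (rule RN_deriv_unique) (simp_all add: y)
  then have "AE x in y. ennreal (g x) = RN_deriv R y x"
    unfolding y by (subst AE_density) auto
  with pos have ae: "AE x in y. elog (RN_deriv R y x) = ereal (ln (g x))"
  proof eventually_elim
    case (elim x)
    then have "RN_deriv R y x = ennreal (g x)" by simp
    then show ?case using elim(1) by (simp add: elog_def)
  qed
  have "(\<integral>\<^sup>+x. e2ennreal (elog (RN_deriv R y x)) \<partial>y) = (\<integral>\<^sup>+x. e2ennreal (ereal (ln (g x))) \<partial>y)"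
    "(\<integral>\<^sup>+x. e2ennreal (- elog (RN_deriv R y x)) \<partial>y) = (\<integral>\<^sup>+x. e2ennreal (- ereal (ln (g x))) \<partial>y)"
    using ae by (auto intro!: nn_integral_cong_AE)
  then show "log_int y R = eintegral y (\<lambda>x. ereal (ln (g x)))"
    using ac by (simp add: log_int_def eintegral_def)
qed

lemma log_int_density_integrable:
  assumes "sigma_finite_measure R" "g \<in> borel_measurable R"
    and "\<And>x. 0 \<le> g x" and "y = density R (\<lambda>x. ennreal (g x))"
    and "integrable y (\<lambda>x. ln (g x))"
  shows "log_int y R = ereal (\<integral>x. ln (g x) \<partial>y)"
  using log_int_density(1)[OF assms(1-4)] assms(5) by (simp add: eintegral_eq_integral)

text \<open>
  The variational bound of Gibbs and of Donsker and Varadhan, for measures that need not be normalized: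
  every comparison density \<open>w\<close> bounds the relative entropy from below, because
  \<open>ln d \<ge> 1 - w / d + ln w\<close> at the true density \<open>d\<close>. All lower bounds below are instances, and each
  of them comes down to guessing \<open>w\<close>.
\<close>

lemma gibbs:
  assumes R: "sigma_finite_measure R" and y: "finite_measure y" and s: "sets y = sets R"
    and w0: "\<And>x. 0 \<le> w x" and wpos: "AE x in y. 0 < w x"
    and w: "integrable R w" and lw: "integrable y (\<lambda>x. ln (w x))"
  shows "ereal (measure y (space y) - (\<integral>x. w x \<partial>R) + (\<integral>x. ln (w x) \<partial>y)) \<le> log_int y R"
proof (cases "absolutely_continuous R y")
  case True
  interpret sigma_finite_measure R by fact
  interpret y: finite_measure y by fact
  note [measurable] = borel_measurable_integrable[OF w]
  define D where "D = RN_deriv R y"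
  have Dm[measurable]: "D \<in> borel_measurable R" by (simp add: D_def)
  have dens: "y = density R D" using density_RN_deriv[OF True s] by (simp add: D_def)
  have "AE x in R. D x \<noteq> \<infinity>"
    unfolding D_def by (rule RN_deriv_finite[OF _ True s]) (rule y.sigma_finite_measure_axioms)
  then have "AE x in y. D x \<noteq> 0 \<and> D x \<noteq> \<infinity>"
    by (subst dens, subst AE_density) auto
  then have Dpos: "AE x in y. 0 < enn2real (D x) \<and> D x = ennreal (enn2real (D x))"
    by eventually_elim (auto simp: enn2real_positive_iff less_top zero_less_iff_neq_zero)
  have my: "f \<in> borel_measurable y \<longleftrightarrow> f \<in> borel_measurable R" for f :: "'a \<Rightarrow> real"
    by (simp add: measurable_cong_sets[OF s refl])
  have "(\<integral>\<^sup>+x. ennreal (w x / enn2real (D x)) \<partial>y) = (\<integral>\<^sup>+x. D x * ennreal (w x / enn2real (D x)) \<partial>R)"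
    by (subst dens, subst nn_integral_density) auto
  also have "\<dots> \<le> (\<integral>\<^sup>+x. ennreal (w x) \<partial>R)"
  proof (rule nn_integral_mono_AE)
    show "AE x in R. D x * ennreal (w x / enn2real (D x)) \<le> ennreal (w x)"
      using \<open>AE x in R. D x \<noteq> \<infinity>\<close>
    proof eventually_elim
      case (elim x)
      then obtain d where d: "D x = ennreal d" "0 \<le> d" by (cases "D x") auto
      then show ?case
        using w0[of x] by (cases "d = 0") (auto simp: ennreal_mult[symmetric])
    qed
  qed
  finally have le: "(\<integral>\<^sup>+x. ennreal (w x / enn2real (D x)) \<partial>y) \<le> (\<integral>\<^sup>+x. ennreal (w x) \<partial>R)" .
  have fin: "(\<integral>\<^sup>+x. ennreal (w x) \<partial>R) = ennreal (\<integral>x. w x \<partial>R)"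
    using w w0 by (intro nn_integral_eq_integral) auto
  have iq: "integrable y (\<lambda>x. w x / enn2real (D x))"
    using le w0 by (intro integrableI_nonneg) (auto simp: my fin le_less_trans)
  have "ennreal (\<integral>x. w x / enn2real (D x) \<partial>y) \<le> ennreal (\<integral>x. w x \<partial>R)"
    using le iq w0 unfolding fin by (subst nn_integral_eq_integral[symmetric]) auto
  then have q: "(\<integral>x. w x / enn2real (D x) \<partial>y) \<le> (\<integral>x. w x \<partial>R)"
    using w0 by (subst (asm) ennreal_le_iff) (auto intro: integral_nonneg)
  let ?l = "\<lambda>x. 1 - w x / enn2real (D x) + ln (w x)"
  have il: "integrable y ?l" using iq lw by simp
  have "ereal (\<integral>x. ?l x \<partial>y) \<le> eintegral y (\<lambda>x. elog (D x))"
  proof (rule eintegral_ge_integral[OF il])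
    show "AE x in y. ereal (?l x) \<le> elog (D x)"
      using Dpos wpos
    proof eventually_elim
      case (elim x)
      have "ln (w x / enn2real (D x)) \<le> w x / enn2real (D x) - 1"
        by (rule ln_le_minus_one) (use elim in simp)
      then have "?l x \<le> ln (enn2real (D x))" using elim by (simp add: ln_div)
      moreover have "elog (D x) = ereal (ln (enn2real (D x)))"
        using elim by (metis elog_def ennreal_neq_top enn2real_0 infinity_ennreal_def less_irrefl)
      ultimately show ?case by simp
    qed
  qed
  moreover have "(\<integral>x. ?l x \<partial>y) = measure y (space y) - (\<integral>x. w x / enn2real (D x) \<partial>y) + (\<integral>x. ln (w x) \<partial>y)"
    using iq lw by simp
  ultimately show ?thesis
    using q True by (simp add: log_int_def D_def[symmetric] order_trans[rotated])
qed (simp add: log_int_def)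

text \<open>
  The densities of \<open>b\<close> and of \<open>c - b\<close> with respect to \<open>c\<close> add up to \<open>1\<close> almost everywhere, hence neither exceeds \<open>1\<close>. The
  minimum with \<open>1\<close> turns this into a bound at every point.
\<close>

lemma dominated_density:
  assumes c: "finite_measure c" and s: "sets b = sets c" and le: "b \<le> c"
  obtains \<beta> where "\<beta> \<in> borel_measurable c" "\<And>x. 0 \<le> \<beta> x" "\<And>x. \<beta> x \<le> (1::real)"
    "b = density c (\<lambda>x. ennreal (\<beta> x))"
proof -
  interpret c: finite_measure c by fact
  have le': "emeasure b A \<le> emeasure c A" for A
    using le s by (cases "A \<in> sets c") (auto simp: le_measure emeasure_notin_sets)
  have b: "finite_measure b"
    by (rule finite_measureI) (use le'[of "space c"] c.emeasure_finite[of "space c"] sets_eq_imp_space_eq[OF s]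
      in \<open>auto simp: top_unique\<close>)
  have ac: "absolutely_continuous c b"
    using le' s by (auto simp: absolutely_continuous_def null_sets_def le_zero_eq) (metis le_zero_eq)
  define d where "d = diff_measure c b"
  have ed: "emeasure d A = emeasure c A - emeasure b A" if "A \<in> sets c" for A
    unfolding d_def by (rule emeasure_diff_measure) (use c b s le' that in auto)
  have sd: "sets d = sets c" by (simp add: d_def)
  have ac': "absolutely_continuous c d"
    using ed sd by (auto simp: absolutely_continuous_def null_sets_def)
  let ?f = "RN_deriv c b" and ?g = "RN_deriv c d"
  have fb: "density c ?f = b" by (rule c.density_RN_deriv[OF ac s])
  have gd: "density c ?g = d" by (rule c.density_RN_deriv[OF ac' sd])
  have "density c (\<lambda>x. ?f x + ?g x) = density c (\<lambda>x. 1)"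
  proof (rule measure_eqI)
    fix A assume A: "A \<in> sets (density c (\<lambda>x. ?f x + ?g x))"
    then have Ac: "A \<in> sets c" by simp
    have "emeasure (density c (\<lambda>x. ?f x + ?g x)) A = emeasure (density c ?f) A + emeasure (density c ?g) A"
      using Ac by (simp add: emeasure_density nn_integral_add distrib_right)
    also have "\<dots> = emeasure c A"
      unfolding fb gd using ed[OF Ac] le'[of A] by (simp add: add_diff_inverse_ennreal)
    finally show "emeasure (density c (\<lambda>x. ?f x + ?g x)) A = emeasure (density c (\<lambda>x. 1)) A"
      by (simp add: density_1)
  qed simp
  then have "AE x in c. ?f x + ?g x = 1"
    by (subst (asm) c.density_unique_iff) auto
  then have ae: "AE x in c. ?f x \<le> 1"
    by eventually_elim (metis le_iff_add)
  let ?b = "\<lambda>x. min 1 (enn2real (?f x))"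
  show ?thesis
  proof (rule that)
    have "density c (\<lambda>x. ennreal (?b x)) = density c ?f"
    proof (rule density_cong)
      show "AE x in c. ennreal (?b x) = ?f x"
        using ae
      proof eventually_elim
        case (elim x)
        then obtain t where "?f x = ennreal t" "0 \<le> t" by (cases "?f x") (auto simp: top_unique)
        with elim show ?case by (simp add: min_def)
      qed
    qed auto
    then show "b = density c (\<lambda>x. ennreal (?b x))" using fb by simp
  qed auto
qed

lemma diff_measure_density:
  assumes c: "finite_measure c" and [measurable]: "\<beta> \<in> borel_measurable c"
    and b: "\<And>x. 0 \<le> \<beta> x" "\<And>x. \<beta> x \<le> (1::real)"
  shows "diff_measure c (density c (\<lambda>x. ennreal (\<beta> x))) = density c (\<lambda>x. ennreal (1 - \<beta> x))"
proof -
  interpret c: finite_measure c by fact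
  let ?b = "density c (\<lambda>x. ennreal (\<beta> x))"
  have sum: "emeasure ?b A + emeasure (density c (\<lambda>x. ennreal (1 - \<beta> x))) A = emeasure c A"
    if "A \<in> sets c" for A
  proof -
    have "emeasure ?b A + emeasure (density c (\<lambda>x. ennreal (1 - \<beta> x))) A =
      (\<integral>\<^sup>+x. (ennreal (\<beta> x) + ennreal (1 - \<beta> x)) * indicator A x \<partial>c)"
      using that by (simp add: emeasure_density nn_integral_add distrib_right)
    also have "\<dots> = emeasure c A"
      using b that by (simp add: ennreal_plus[symmetric] del: ennreal_plus)
    finally show ?thesis .
  qed
  have le: "emeasure ?b A \<le> emeasure c A" if "A \<in> sets c" for A
    using sum[OF that] by (metis le_iff_add)
  have fb: "finite_measure ?b"
  proof (rule finite_measureI)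
    have "emeasure ?b (space c) \<le> emeasure c (space c)"
      using sum[of "space c"] by (metis le_iff_add sets.top)
    then show "emeasure ?b (space ?b) \<noteq> \<infinity>"
      using c.emeasure_finite[of "space c"] by (auto simp: top_unique)
  qed
  show ?thesis
  proof (rule measure_eqI)
    fix A assume "A \<in> sets (diff_measure c ?b)"
    then have A: "A \<in> sets c" by simp
    have "emeasure (diff_measure c ?b) A = emeasure c A - emeasure ?b A"
      by (rule emeasure_diff_measure) (use c fb A le in auto)
    also have "\<dots> = emeasure (density c (\<lambda>x. ennreal (1 - \<beta> x))) A"
      using sum[OF A] finite_measure.emeasure_finite[OF fb, of A]
      by (metis ennreal_add_diff_cancel_left infinity_ennreal_def)
    finally show "emeasure (diff_measure c ?b) A = emeasure (density c (\<lambda>x. ennreal (1 - \<beta> x))) A" .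
  qed simp
qed

section \<open>Measurability on the space of configurations\<close>

lemma pts_empty [simp]: "pts A {#} = 0"
  by (simp add: pts_def)

lemma pts_add_mset [simp]: "pts A (add_mset x k) = (if x \<in> A then Suc (pts A k) else pts A k)"
  by (simp add: pts_def)

lemma pts_plus [simp]: "pts A (k + k') = pts A k + pts A k'"
  by (simp add: pts_def)

lemma pts_UNIV [simp]: "pts UNIV k = size k"
  by (simp add: pts_def)

lemma pts_eq_0_iff: "pts A k = 0 \<longleftrightarrow> (\<forall>x\<in>#k. x \<notin> A)"
  by (induction k) auto

lemma pts_vimage: "pts (\<pi> -` A) k = pts A (image_mset \<pi> k)"
  by (induction k) auto

lemma pts_singleton: "pts {x} k = count k x"
  by (induction k) auto

lemma space_config_space [simp]: "space (config_space :: 'a::topological_space multiset measure) = UNIV"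
  by (simp add: config_space_def)

lemma measurable_pts [measurable]:
  assumes "A \<in> sets borel"
  shows "pts A \<in> config_space \<rightarrow>\<^sub>M count_space UNIV"
proof -
  have "{k. pts A k = n} \<in> sets config_space" for n
    unfolding config_space_def using assms by (auto intro!: in_measure_of)
  then show ?thesis
    by (subst measurable_count_space_eq_countable) (auto simp: vimage_def)
qed

lemma measurable_into_config:
  fixes f :: "'b \<Rightarrow> 'a::topological_space multiset"
  assumes "\<And>A. A \<in> sets borel \<Longrightarrow> (\<lambda>x. pts A (f x)) \<in> N \<rightarrow>\<^sub>M count_space UNIV"
  shows "f \<in> N \<rightarrow>\<^sub>M config_space"
  unfolding config_space_def
proof (rule measurable_measure_of)
  fix Y :: "'a multiset set" assume "Y \<in> {{k. pts A k = n} |A n. A \<in> sets borel}"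
  then obtain A n where Y: "Y = {k. pts A k = n}" and A: "A \<in> sets borel" by auto
  have "(\<lambda>x. pts A (f x)) -` {n} \<inter> space N \<in> sets N"
    using assms[OF A] by (rule measurable_sets) simp
  then show "f -` Y \<inter> space N \<in> sets N" by (simp add: Y vimage_def)
qed auto

lemma measurable_add_mset [measurable]:
  "(\<lambda>(x :: 'a::topological_space, k). add_mset x k) \<in> borel \<Otimes>\<^sub>M config_space \<rightarrow>\<^sub>M config_space"
proof (rule measurable_into_config)
  fix A :: "'a set" assume [measurable]: "A \<in> sets borel"
  have "(\<lambda>z. if fst z \<in> A then Suc (pts A (snd z)) else pts A (snd z))
      \<in> borel \<Otimes>\<^sub>M config_space \<rightarrow>\<^sub>M count_space UNIV"
    by measurable
  then show "(\<lambda>z. pts A (case z of (x, k) \<Rightarrow> add_mset x k)) \<in> borel \<Otimes>\<^sub>M config_space \<rightarrow>\<^sub>M count_space UNIV"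
    by (simp add: split_beta')
qed

lemma measurable_plus_mset [measurable (raw)]:
  fixes f :: "'b \<Rightarrow> 'a::topological_space multiset"
  assumes [measurable]: "f \<in> N \<rightarrow>\<^sub>M config_space" "g \<in> N \<rightarrow>\<^sub>M config_space"
  shows "(\<lambda>x. f x + g x) \<in> N \<rightarrow>\<^sub>M config_space"
proof (rule measurable_into_config)
  fix A :: "'a set" assume [measurable]: "A \<in> sets borel"
  show "(\<lambda>x. pts A (f x + g x)) \<in> N \<rightarrow>\<^sub>M count_space UNIV"
    unfolding pts_plus by measurable
qed

text \<open>
  Classifying the points by a measurable map into \<open>\<nat>\<close> turns a configuration into one of countably many
  multisets. This is the main source of measurable functions and of generating sets: any function
  whatsoever of the classified configuration is measurable.
\<close>

lemma countable_nat_mset: "countable (UNIV :: nat multiset set)"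
proof -
  have "(UNIV :: nat multiset set) = mset ` UNIV" 
    using ex_mset by (auto simp: image_iff eq_commute)
  then show ?thesis by (metis countable_image countableI_type)
qed

lemma measurable_image_mset [measurable]:
  assumes [measurable]: "\<pi> \<in> borel \<rightarrow>\<^sub>M count_space (UNIV :: nat set)"
  shows "image_mset \<pi> \<in> config_space \<rightarrow>\<^sub>M count_space UNIV"
proof (subst measurable_count_space_eq_countable[OF countable_nat_mset], safe)
  fix k' :: "nat multiset"
  have "image_mset \<pi> -` {k'} = {k \<in> space config_space. \<forall>i. pts (\<pi> -` {i}) k = count k' i}"
    by (auto simp: pts_vimage pts_singleton multiset_eq_iff)
  also have "\<dots> \<in> sets config_space"
  proof -
    have [measurable]: "\<pi> -` {i} \<in> sets borel" for i
      using measurable_sets[OF assms, of "{i}"] by simp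
    show ?thesis by measurable
  qed
  finally show "image_mset \<pi> -` {k'} \<inter> space config_space \<in> sets config_space" by simp
qed auto

definition cylinders :: "'a::topological_space multiset set set" where
  "cylinders = {image_mset \<pi> -` C |\<pi> (C :: nat multiset set). \<pi> \<in> borel \<rightarrow>\<^sub>M count_space UNIV \<and> finite (range \<pi>)}"

lemma cylindersI:
  "\<pi> \<in> borel \<rightarrow>\<^sub>M count_space UNIV \<Longrightarrow> finite (range \<pi>) \<Longrightarrow> image_mset (\<pi> :: _ \<Rightarrow> nat) -` C \<in> cylinders"
  unfolding cylinders_def by (rule CollectI, rule exI[of _ \<pi>], rule exI[of _ C]) simp

lemma cylindersE:
  assumes "X \<in> cylinders"
  obtains \<pi> :: "'a::topological_space \<Rightarrow> nat" and C where "X = image_mset \<pi> -` C"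
    "\<pi> \<in> borel \<rightarrow>\<^sub>M count_space UNIV" "finite (range \<pi>)"
  using assms unfolding cylinders_def mem_Collect_eq by (elim exE conjE) (rule that)

text \<open>Two classifications can be merged into one by pairing the labels.\<close>

lemma common_classification:
  fixes \<pi> \<rho> :: "'a::topological_space \<Rightarrow> nat"
  assumes p: "\<pi> \<in> borel \<rightarrow>\<^sub>M count_space UNIV" "finite (range \<pi>)"
    and r: "\<rho> \<in> borel \<rightarrow>\<^sub>M count_space UNIV" "finite (range \<rho>)"
  obtains \<sigma> :: "'a \<Rightarrow> nat" where "\<sigma> \<in> borel \<rightarrow>\<^sub>M count_space UNIV" "finite (range \<sigma>)"
    "\<And>C. image_mset \<pi> -` C = image_mset \<sigma> -` {k. image_mset (fst \<circ> prod_decode) k \<in> C}"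
    "\<And>C. image_mset \<rho> -` C = image_mset \<sigma> -` {k. image_mset (snd \<circ> prod_decode) k \<in> C}"
proof
  note [measurable] = p(1) r(1)
  let ?s = "\<lambda>x. prod_encode (\<pi> x, \<rho> x)"
  show "?s \<in> borel \<rightarrow>\<^sub>M count_space UNIV" by measurable
  have "range ?s \<subseteq> prod_encode ` (range \<pi> \<times> range \<rho>)" by auto
  then show "finite (range ?s)" using p(2) r(2) finite_subset by blast
  show "image_mset \<pi> -` C = image_mset ?s -` {k. image_mset (fst \<circ> prod_decode) k \<in> C}" for C
    by (auto simp: image_mset.compositionality comp_def)
  show "image_mset \<rho> -` C = image_mset ?s -` {k. image_mset (snd \<circ> prod_decode) k \<in> C}" for C
    by (auto simp: image_mset.compositionality comp_def)
qed

lemma Int_stable_cylinders: "Int_stable (cylinders :: 'a::topological_space multiset set set)"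
  unfolding Int_stable_def
proof (intro ballI)
  fix X Y :: "'a multiset set" assume XY: "X \<in> cylinders" "Y \<in> cylinders"
  obtain \<pi> :: "'a \<Rightarrow> nat" and C where 1: "X = image_mset \<pi> -` C"
    "\<pi> \<in> borel \<rightarrow>\<^sub>M count_space UNIV" "finite (range \<pi>)" by (rule cylindersE[OF XY(1)])
  obtain \<rho> :: "'a \<Rightarrow> nat" and D where 2: "Y = image_mset \<rho> -` D"
    "\<rho> \<in> borel \<rightarrow>\<^sub>M count_space UNIV" "finite (range \<rho>)" by (rule cylindersE[OF XY(2)])
  from common_classification[OF 1(2,3) 2(2,3)] obtain \<sigma> :: "'a \<Rightarrow> nat" where
    s: "\<sigma> \<in> borel \<rightarrow>\<^sub>M count_space UNIV" "finite (range \<sigma>)"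
    "X = image_mset \<sigma> -` {k. image_mset (fst \<circ> prod_decode) k \<in> C}"
    "Y = image_mset \<sigma> -` {k. image_mset (snd \<circ> prod_decode) k \<in> D}" using 1(1) 2(1) by metis
  then have "X \<inter> Y = image_mset \<sigma> -` ({k. image_mset (fst \<circ> prod_decode) k \<in> C} \<inter> {k. image_mset (snd \<circ> prod_decode) k \<in> D})"
    by auto
  then show "X \<inter> Y \<in> cylinders" by (simp only: cylindersI[OF s(1,2)])
qed

lemma UNIV_cylinder: "UNIV \<in> cylinders"
  using cylindersI[of "\<lambda>_. 0" UNIV] by simp

lemma cylinders_measurable:
  assumes "X \<in> cylinders"
  shows "X \<in> sets config_space"
proof -
  obtain \<pi> :: "'a \<Rightarrow> nat" and C where X: "X = image_mset \<pi> -` C"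
    "\<pi> \<in> borel \<rightarrow>\<^sub>M count_space UNIV" by (rule cylindersE[OF assms])
  show ?thesis using measurable_sets[OF measurable_image_mset[OF X(2)], of C] X(1) by simp
qed

lemma sets_config_space_cylinders: "sets config_space = sigma_sets UNIV cylinders"
proof
  show "sigma_sets UNIV cylinders \<subseteq> sets (config_space :: 'a multiset measure)"
    using sets.sigma_sets_subset[of cylinders "config_space :: 'a multiset measure"] cylinders_measurable by auto
  have "{k. pts A k = n} \<in> cylinders" if [measurable]: "A \<in> sets borel" for A :: "'a set" and n
  proof -
    let ?p = "\<lambda>x. if x \<in> A then 1 else (0::nat)"
    have "?p \<in> borel \<rightarrow>\<^sub>M count_space UNIV" by measurable
    moreover have "finite (range ?p)" by (rule finite_subset[of _ "{0, 1}"]) auto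
    moreover have "pts A k = count (image_mset ?p k) 1" for k by (induction k) auto
    then have "{k. pts A k = n} = image_mset ?p -` {k. count k 1 = n}" by auto
    ultimately show ?thesis by (simp only: cylindersI)
  qed
  then have "{{k. pts A k = n} |(A :: 'a set) n. A \<in> sets borel} \<subseteq> sigma_sets UNIV cylinders"
    by (auto intro: sigma_sets.Basic)
  from sigma_sets_mono[OF this]
  show "sets (config_space :: 'a multiset measure) \<subseteq> sigma_sets UNIV cylinders"
    unfolding config_space_def by simp
qed

subsection \<open>Sums and products over the points\<close>

text \<open>
  A configuration as a measure; any enumeration of the points gives the same one.
\<close>

definition point_count :: "'a::topological_space multiset \<Rightarrow> 'a measure" where
  "point_count k = (let xs = (SOME xs. mset xs = k) in distr (count_space {..<length xs}) borel (nth xs))"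

lemma point_count_mset:
  obtains xs where "mset xs = k" "point_count k = distr (count_space {..<length xs}) borel (nth xs)"
  using someI_ex[OF ex_mset, of k] that unfolding point_count_def Let_def by blast

lemma sets_point_count [simp]: "sets (point_count k) = sets borel"
  using point_count_mset[of k] by (metis sets_distr)

lemma nn_integral_point_count:
  assumes [measurable]: "f \<in> borel_measurable borel"
  shows "(\<integral>\<^sup>+x. f x \<partial>point_count k) = (\<Sum>x\<in>#k. f x)"
proof -
  obtain xs where xs: "mset xs = k" "point_count k = distr (count_space {..<length xs}) borel (nth xs)"
    by (rule point_count_mset)
  have "(\<integral>\<^sup>+x. f x \<partial>point_count k) = (\<Sum>i<length xs. f (xs ! i))"
    unfolding xs(2) by (simp add: nn_integral_distr nn_integral_count_space_finite)
  also have "\<dots> = sum_list (map f xs)"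
    by (simp add: sum_list_sum_nth atLeast0LessThan)
  also have "\<dots> = (\<Sum>x\<in>#k. f x)"
    unfolding xs(1)[symmetric] by (simp add: sum_mset_sum_list[symmetric] del: sum_mset_sum_list)
  finally show ?thesis .
qed

lemma emeasure_point_count:
  assumes "R \<in> sets borel"
  shows "emeasure (point_count k) R = of_nat (pts R k)"
proof -
  have "emeasure (point_count k) R = (\<Sum>x\<in>#k. indicator R x)"
    using assms nn_integral_point_count[of "indicator R" k] by simp
  also have "\<dots> = of_nat (pts R k)"
    by (induction k) (auto simp: indicator_def)
  finally show ?thesis .
qed

lemma measurable_emeasure_point_count:
  "R \<in> sets borel \<Longrightarrow> sets l = sets config_space \<Longrightarrow> (\<lambda>k. emeasure (point_count k) R) \<in> borel_measurable l"
  by (subst measurable_cong_sets[of l config_space]) (auto simp: emeasure_point_count cong: measurable_cong)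

lemma measurable_sum_points [measurable]:
  fixes f :: "'a::topological_space \<Rightarrow> ennreal"
  assumes "f \<in> borel_measurable borel"
  shows "(\<lambda>k. \<Sum>x\<in>#k. f x) \<in> borel_measurable config_space"
  using measurable_mixture[of point_count borel config_space f] assms
  by (simp add: nn_integral_point_count measurable_emeasure_point_count)

lemma
  assumes l: "sets l = sets config_space"
  shows sets_c_micro [simp]: "sets (c_micro l) = sets borel"
    and emeasure_c_micro: "R \<in> sets borel \<Longrightarrow> emeasure (c_micro l) R = (\<integral>\<^sup>+k. of_nat (pts R k) \<partial>l)"
    and nn_integral_c_micro:
      "f \<in> borel_measurable borel \<Longrightarrow> (\<integral>\<^sup>+x. f x \<partial>c_micro l) = (\<integral>\<^sup>+k. (\<Sum>x\<in>#k. f x) \<partial>l)"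
proof -
  have eq: "c_micro l = measure_of (space borel) (sets borel) (\<lambda>R. \<integral>\<^sup>+k. emeasure (point_count k) R \<partial>l)"
    unfolding c_micro_def space_borel
    by (rule measure_of_eq) (auto simp: sets.sigma_sets_eq[of borel, unfolded space_borel] emeasure_point_count)
  note mm = measurable_emeasure_point_count[OF _ l]
  show "sets (c_micro l) = sets borel"
    unfolding eq using sets_mixture[of point_count borel l] mm by simp
  show "R \<in> sets borel \<Longrightarrow> emeasure (c_micro l) R = (\<integral>\<^sup>+k. of_nat (pts R k) \<partial>l)"
    unfolding eq using emeasure_mixture[of point_count borel l] mm by (simp add: emeasure_point_count)
  show "f \<in> borel_measurable borel \<Longrightarrow> (\<integral>\<^sup>+x. f x \<partial>c_micro l) = (\<integral>\<^sup>+k. (\<Sum>x\<in>#k. f x) \<partial>l)"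
    unfolding eq using nn_integral_mixture[of point_count borel l] mm by (simp add: nn_integral_point_count)
qed

lemma sum_mset_ennreal:
  "(\<And>x. 0 \<le> f x) \<Longrightarrow> (\<Sum>x\<in>#k. ennreal (f x)) = ennreal (\<Sum>x\<in>#k. f x)"
proof (induction k)
  case (add x k)
  have "0 \<le> (\<Sum>x\<in>#k. f x)" using add(2) by (induction k) auto
  with add show ?case by (simp add: ennreal_plus)
qed simp

lemma measurable_sum_points_real [measurable]:
  fixes f :: "'a::topological_space \<Rightarrow> real"
  assumes [measurable]: "f \<in> borel_measurable borel"
  shows "(\<lambda>k. \<Sum>x\<in>#k. f x) \<in> borel_measurable config_space"
proof -
  have pos: "0 \<le> (\<Sum>x\<in>#k. max 0 (f x))" "0 \<le> (\<Sum>x\<in>#k. max 0 (- f x))" for k by (induction k) auto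
  have "(\<Sum>x\<in>#k. f x) = (\<Sum>x\<in>#k. max 0 (f x)) - (\<Sum>x\<in>#k. max 0 (- f x))" for k
    by (induction k) auto
  also have "(\<Sum>x\<in>#k. max 0 (f x)) - (\<Sum>x\<in>#k. max 0 (- f x)) =
    enn2real (\<Sum>x\<in>#k. ennreal (max 0 (f x))) - enn2real (\<Sum>x\<in>#k. ennreal (max 0 (- f x)))" for k
    using pos by (simp add: sum_mset_ennreal del: ennreal_max_0 ennreal_max_0')
  finally show ?thesis by simp
qed

lemma prod_points_eq_exp:
  fixes f :: "'a \<Rightarrow> real"
  assumes "\<And>x. 0 \<le> f x"
  shows "(\<Prod>x\<in>#k. f x) = (if pts {x. f x = 0} k = 0 then exp (\<Sum>x\<in>#k. ln (f x)) else 0)"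
proof (induction k)
  case (add x k)
  show ?case
  proof (cases "f x = 0")
    case False
    then have "0 < f x" using assms[of x] by simp
    with add show ?thesis by (simp add: exp_add)
  qed simp
qed simp

lemma measurable_prod_points [measurable]:
  fixes f :: "'a::topological_space \<Rightarrow> real"
  assumes [measurable]: "f \<in> borel_measurable borel" and "\<And>x. 0 \<le> f x"
  shows "(\<lambda>k. \<Prod>x\<in>#k. f x) \<in> borel_measurable config_space"
  unfolding prod_points_eq_exp[of f, OF assms(2)] by measurable

subsection \<open>Sums over the splittings of a configuration\<close>

text \<open>
  All ways to distribute the points of a configuration over an ordered pair of configurations, where
  coinciding points still count as different individuals.
\<close>

definition splits :: "'a multiset \<Rightarrow> ('a multiset \<times> 'a multiset) multiset" where
  "splits = fold_mset (\<lambda>x S. image_mset (\<lambda>(A, B). (add_mset x A, B)) S +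
     image_mset (\<lambda>(A, B). (A, add_mset x B)) S) {#({#}, {#})#}"

lemma splits_empty [simp]: "splits {#} = {#({#}, {#})#}"
  by (simp add: splits_def)

lemma splits_add_mset [simp]:
  "splits (add_mset x k) = image_mset (\<lambda>(A, B). (add_mset x A, B)) (splits k) +
     image_mset (\<lambda>(A, B). (A, add_mset x B)) (splits k)"
proof -
  interpret comp_fun_commute "\<lambda>x S. image_mset (\<lambda>(A, B). (add_mset x A, B)) S +
     image_mset (\<lambda>(A, B). (A, add_mset x B)) S"
    by standard (auto simp: fun_eq_iff image_mset.compositionality comp_def split_beta
        add_mset_commute add_ac intro!: arg_cong2[where f = "(+)"] image_mset_cong)
  show ?thesis unfolding splits_def by (rule fold_mset_add_mset)
qed

lemma sum_splits_add:
  fixes F :: "'a multiset \<times> 'a multiset \<Rightarrow> 'b::comm_monoid_add"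
  shows "(\<Sum>p\<in>#splits (add_mset x k). F p) =
    (\<Sum>p\<in>#splits k. F (add_mset x (fst p), snd p)) + (\<Sum>p\<in>#splits k. F (fst p, add_mset x (snd p)))"
  by (simp add: image_mset.compositionality comp_def split_beta)

lemma splits_sum: "p \<in># splits k \<Longrightarrow> fst p + snd p = k"
  by (induction k arbitrary: p) auto

lemma splits_image: "splits (image_mset \<pi> k) = image_mset (map_prod (image_mset \<pi>) (image_mset \<pi>)) (splits k)"
  by (induction k) (auto simp: image_mset.compositionality comp_def split_beta map_prod_def intro!: image_mset_cong)

text \<open>
  On a product of two cylinders the sum depends on the configuration only through a common classification of the
  points. Since products of cylinders are stable under intersections and generate the product \<open>\<sigma>\<close>-algebra, a
  monotone class argument covers all measurable sets.
\<close>

lemma measurable_sum_splits [measurable]: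
  fixes F :: "'a::topological_space multiset \<times> 'a multiset \<Rightarrow> ennreal"
  assumes "F \<in> borel_measurable (config_space \<Otimes>\<^sub>M config_space)"
  shows "(\<lambda>k. \<Sum>p\<in>#splits k. F p) \<in> borel_measurable config_space"
  using assms
proof (induction rule: borel_measurable_induct)
  case (cong f g)
  then show ?case by (simp add: space_pair_measure)
next
  case (mult f c)
  then show ?case by (simp add: sum_mset_distrib_left[symmetric])
next
  case (add f g)
  then show ?case by (simp add: sum_mset.distrib)
next
  case (seq U)
  have "(\<Sum>p\<in>#S. (SUP i. U i) p) = (SUP i. \<Sum>p\<in>#S. U i p)" for S
  proof (induction S)
    case (add p S)
    have "incseq (\<lambda>i. U i p)" "incseq (\<lambda>i. \<Sum>p\<in>#S. U i p)"
      using seq(3) by (auto simp: incseq_def le_fun_def simp del: split_paired_All intro!: sum_mset_mono)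
    with add show ?case by (simp add: ennreal_SUP_add image_comp)
  qed simp
  moreover have "(\<lambda>k. SUP i. \<Sum>p\<in>#splits k. U i p) \<in> borel_measurable config_space"
    using seq by (intro borel_measurable_SUP) auto
  ultimately show ?case using seq(4) by simp
next
  case (set E)
  let ?S = "\<lambda>E k. \<Sum>p\<in>#splits k. indicator E p :: ennreal"
  let ?G = "{a \<times> b |a b. a \<in> (cylinders :: 'a multiset set set) \<and> b \<in> (cylinders :: 'a multiset set set)}"
  have "sets (config_space \<Otimes>\<^sub>M config_space) = sets (sigma (space config_space \<times> space config_space) ?G)"
    by (rule sets_pair_eq[of _ _ "{UNIV}" _ _ "{UNIV}"])
      (auto simp: sets_config_space_cylinders UNIV_cylinder)
  then have sets_G: "sets (config_space \<Otimes>\<^sub>M config_space) = sigma_sets (UNIV \<times> UNIV) ?G"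
    by simp
  have "Int_stable ?G"
    unfolding Int_stable_def
  proof (intro ballI)
    fix X Y :: "('a multiset \<times> 'a multiset) set" assume "X \<in> ?G" "Y \<in> ?G"
    then obtain a b c d where *: "X = a \<times> b" "Y = c \<times> d" "a \<in> cylinders" "b \<in> cylinders"
      "c \<in> cylinders" "d \<in> cylinders" by auto
    have "X \<inter> Y = (a \<inter> c) \<times> (b \<inter> d)" using *(1,2) by auto
    moreover have "a \<inter> c \<in> cylinders" "b \<inter> d \<in> cylinders"
      using *(3-6) Int_stable_cylinders by (auto simp: Int_stable_def)
    ultimately show "X \<inter> Y \<in> ?G" by blast
  qed
  moreover have "?G \<subseteq> Pow (UNIV \<times> UNIV)" by auto
  moreover have "E \<in> sigma_sets (UNIV \<times> UNIV) ?G" using set sets_G by simp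
  ultimately show ?case
  proof (induction rule: sigma_sets_induct_disjoint)
    case (basic E)
    then obtain a b where ab: "E = a \<times> b" "a \<in> cylinders" "b \<in> cylinders" by auto
    obtain \<pi> :: "'a \<Rightarrow> nat" and C where 1: "a = image_mset \<pi> -` C"
      "\<pi> \<in> borel \<rightarrow>\<^sub>M count_space UNIV" "finite (range \<pi>)" by (rule cylindersE[OF ab(2)])
    obtain \<rho> :: "'a \<Rightarrow> nat" and D where 2: "b = image_mset \<rho> -` D"
      "\<rho> \<in> borel \<rightarrow>\<^sub>M count_space UNIV" "finite (range \<rho>)" by (rule cylindersE[OF ab(3)])
    from common_classification[OF 1(2,3) 2(2,3)] obtain \<sigma> :: "'a \<Rightarrow> nat" where
      s: "\<sigma> \<in> borel \<rightarrow>\<^sub>M count_space UNIV"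
      "image_mset \<pi> -` C = image_mset \<sigma> -` {k. image_mset (fst \<circ> prod_decode) k \<in> C}"
      "image_mset \<rho> -` D = image_mset \<sigma> -` {k. image_mset (snd \<circ> prod_decode) k \<in> D}"
      by metis
    let ?E = "{k. image_mset (fst \<circ> prod_decode) k \<in> C} \<times> {k. image_mset (snd \<circ> prod_decode) k \<in> D}"
    have "indicator E p = (indicator ?E (map_prod (image_mset \<sigma>) (image_mset \<sigma>) p) :: ennreal)" for p
      unfolding ab(1) 1(1) 2(1) s(2,3) by (cases p) (auto simp: indicator_def)
    then have "?S E k = ?S ?E (image_mset \<sigma> k)" for k
      by (simp add: splits_image image_mset.compositionality comp_def)
    moreover have "(\<lambda>k. ?S ?E (image_mset \<sigma> k)) \<in> borel_measurable config_space"
      by (rule measurable_compose[OF measurable_image_mset[OF s(1)]]) simp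
    ultimately show ?case by simp
  next
    case empty
    then show ?case by simp
  next
    case (compl E)
    have "?S (UNIV \<times> UNIV - E) k = of_nat (size (splits k)) - ?S E k" for k
    proof -
      have "?S (UNIV \<times> UNIV - E) k + ?S E k = (\<Sum>p\<in>#splits k. 1)"
        unfolding sum_mset.distrib[symmetric] by (rule arg_cong[where f = sum_mset], rule image_mset_cong) (auto simp: indicator_def)
      also have "\<dots> = of_nat (size (splits k))" by simp
      finally have eq: "?S (UNIV \<times> UNIV - E) k + ?S E k = of_nat (size (splits k))" .
      then have "?S E k \<noteq> \<top>" by (auto simp: top_add)
      with eq show ?thesis by (metis add.commute ennreal_add_diff_cancel_left infinity_ennreal_def)
    qed
    moreover have "size (splits k) = 2 ^ size k" for k :: "'a multiset"
      by (induction k) auto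
    moreover have "(\<lambda>k. of_nat (2 ^ size k) - ?S E k) \<in> borel_measurable config_space"
    proof -
      have [measurable]: "size \<in> config_space \<rightarrow>\<^sub>M count_space UNIV"
        using measurable_pts[of UNIV] by (simp add: pts_UNIV[abs_def])
      note [measurable] = compl(2)
      show ?thesis by measurable
    qed
    ultimately show ?case by simp
  next
    case (union E)
    have "?S (\<Union>i. E i) k = (\<Sum>i. ?S (E i) k)" for k
    proof -
      have "(\<Sum>p\<in>#S. \<Sum>i. indicator (E i) p) = (\<Sum>i. \<Sum>p\<in>#S. indicator (E i) p :: ennreal)" for S
        by (induction S) (simp_all add: suminf_add)
      then show ?thesis by (simp add: suminf_indicator[OF union(1), symmetric])
    qed
    then show ?case using union(3) by simp
  qed
qed

section \<open>Poisson point processes\<close>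

subsection \<open>Unnormalized Poisson measures\<close>

text \<open>
  \<open>n_point \<nu> n\<close> is \<open>\<nu>\<^sup>\<otimes>\<^sup>n / n!\<close>, pushed forward to configurations, and \<open>poisson_weight \<nu>\<close> is the sum over
  \<open>n\<close>, that is, \<open>e\<^bsup>|\<nu>|\<^esup>\<close> times the Poisson law. The recursion adds one point at a time, so that
  every identity below becomes an induction on the number of points.
\<close>

primrec n_point :: "'a::topological_space measure \<Rightarrow> nat \<Rightarrow> 'a multiset measure" where
  "n_point \<nu> 0 = return config_space {#}"
| "n_point \<nu> (Suc n) = scale_measure (ennreal (1 / real (Suc n)))
     (distr (\<nu> \<Otimes>\<^sub>M n_point \<nu> n) config_space (\<lambda>(x, k). add_mset x k))"

declare n_point.simps [simp del]

definition poisson_weight :: "'a::topological_space measure \<Rightarrow> 'a multiset measure" where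
  "poisson_weight \<nu> = measure_of UNIV (sets config_space)
     (\<lambda>A. \<integral>\<^sup>+n. emeasure (n_point \<nu> n) A \<partial>count_space UNIV)"

lemma sets_n_point [simp, measurable_cong]: "sets (n_point \<nu> n) = sets config_space"
  by (cases n) (simp_all add: n_point.simps)

lemma space_n_point [simp]: "space (n_point \<nu> n) = UNIV"
  using sets_eq_imp_space_eq[OF sets_n_point] by simp

lemma ennreal_Suc_cancel: "of_nat (Suc n) * a = of_nat (Suc n) * b \<Longrightarrow> a = (b :: ennreal)"
  by (subst (asm) ennreal_mult_cancel_left) (auto simp del: of_nat_Suc)

lemma of_nat_Suc_times_inverse: "of_nat (Suc n) * (ennreal (1 / real (Suc n)) * a) = a"
proof -
  have "of_nat (Suc n) * ennreal (1 / real (Suc n)) = ennreal (real (Suc n) * (1 / real (Suc n)))"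
    by (subst ennreal_mult) (auto simp del: of_nat_Suc simp: ennreal_of_nat_eq_real_of_nat)
  then show ?thesis by (simp add: mult.assoc[symmetric] del: of_nat_Suc)
qed

lemma sum_times_index:
  fixes a :: "nat \<Rightarrow> 'b::comm_semiring_1"
  shows "(\<Sum>i\<le>Suc n. of_nat i * a i) = (\<Sum>i\<le>n. of_nat (Suc i) * a (Suc i))"
  by (subst sum.atMost_Suc_shift) simp

lemma suminf_diagonal:
  fixes a :: "nat \<Rightarrow> nat \<Rightarrow> ennreal"
  shows "(\<Sum>n. \<Sum>i\<le>n. a i (n - i)) = (\<Sum>i. \<Sum>j. a i j)"
proof -
  have "(\<Sum>i\<le>n. a i (n - i)) = (\<Sum>i. if i \<le> n then a i (n - i) else 0)" for n
    by (subst suminf_finite[of "{..n}"]) auto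
  then have "(\<Sum>n. \<Sum>i\<le>n. a i (n - i)) = (\<integral>\<^sup>+n. (\<Sum>i. if i \<le> n then a i (n - i) else 0) \<partial>count_space UNIV)"
    by (simp add: nn_integral_count_space_nat)
  also have "\<dots> = (\<Sum>i. \<integral>\<^sup>+n. (if i \<le> n then a i (n - i) else 0) \<partial>count_space UNIV)"
    by (rule nn_integral_suminf) simp
  also have "\<dots> = (\<Sum>i. \<Sum>j. a i j)"
  proof (rule suminf_cong)
    fix i
    have "(\<integral>\<^sup>+n. (if i \<le> n then a i (n - i) else 0) \<partial>count_space UNIV) = (\<Sum>n. if i \<le> n then a i (n - i) else 0)"
      by (simp add: nn_integral_count_space_nat)
    also have "\<dots> = (\<Sum>j. if i \<le> j + i then a i (j + i - i) else 0)"
      by (subst suminf_offset[of _ i]) (auto simp: summableI)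
    finally show "(\<integral>\<^sup>+n. (if i \<le> n then a i (n - i) else 0) \<partial>count_space UNIV) = (\<Sum>j. a i j)" by simp
  qed
  finally show ?thesis .
qed

locale finite_borel =
  fixes \<nu> :: "'a::second_countable_topology measure"
  assumes finite_nu: "finite_measure \<nu>" and sets_nu [simp, measurable_cong]: "sets \<nu> = sets borel"
begin

sublocale finite_measure \<nu> by (rule finite_nu)

lemma space_nu [simp]: "space \<nu> = UNIV"
  using sets_eq_imp_space_eq[OF sets_nu] by simp

lemma measurable_nu: "f \<in> borel_measurable borel \<Longrightarrow> f \<in> borel_measurable \<nu>"
  by (simp add: measurable_cong_sets[OF sets_nu refl])

lemma finite_n_point: "finite_measure (n_point \<nu> n)"
proof (induction n)
  case 0
  interpret prob_space "return config_space {#}" by (rule prob_space_return) simp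
  show ?case by (simp add: n_point.simps) unfold_locales
next
  case (Suc n)
  interpret n: finite_measure "n_point \<nu> n" by fact
  interpret pair_sigma_finite \<nu> "n_point \<nu> n" ..
  have fp: "finite_measure (\<nu> \<Otimes>\<^sub>M n_point \<nu> n)"
    by (rule finite_measure_pair_measure) unfold_locales
  have "finite_measure (distr (\<nu> \<Otimes>\<^sub>M n_point \<nu> n) config_space (\<lambda>(x, k). add_mset x k))"
    by (rule finite_measure.finite_measure_distr[OF fp]) measurable
  from finite_measure.emeasure_finite[OF this] show ?case
    by (intro finite_measureI) (simp add: n_point.simps ennreal_mult_eq_top_iff)
qed

lemma sigma_finite_n_point: "sigma_finite_measure (n_point \<nu> n)"
  using finite_n_point by (rule finite_measure.axioms)

lemma nn_integral_n_point_Suc: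
  assumes [measurable]: "F \<in> borel_measurable config_space"
  shows "of_nat (Suc n) * (\<integral>\<^sup>+k. F k \<partial>n_point \<nu> (Suc n)) = (\<integral>\<^sup>+x. \<integral>\<^sup>+k. F (add_mset x k) \<partial>n_point \<nu> n \<partial>\<nu>)"
proof -
  interpret n: sigma_finite_measure "n_point \<nu> n" by (rule sigma_finite_n_point)
  have "(\<integral>\<^sup>+k. F k \<partial>n_point \<nu> (Suc n)) =
     ennreal (1 / real (Suc n)) * (\<integral>\<^sup>+z. F (case z of (x, k) \<Rightarrow> add_mset x k) \<partial>(\<nu> \<Otimes>\<^sub>M n_point \<nu> n))"
    by (simp add: n_point.simps nn_integral_scale_measure nn_integral_distr del: of_nat_Suc)
  also have "(\<integral>\<^sup>+z. F (case z of (x, k) \<Rightarrow> add_mset x k) \<partial>(\<nu> \<Otimes>\<^sub>M n_point \<nu> n)) =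
     (\<integral>\<^sup>+x. \<integral>\<^sup>+k. F (add_mset x k) \<partial>n_point \<nu> n \<partial>\<nu>)"
    by (subst n.nn_integral_fst[symmetric]) (simp_all add: split_beta')
  finally show ?thesis by (simp only: of_nat_Suc_times_inverse)
qed

lemma nn_integral_n_point_0 [simp]:
  "F \<in> borel_measurable config_space \<Longrightarrow> (\<integral>\<^sup>+k. F k \<partial>n_point \<nu> 0) = F {#}"
  by (simp add: n_point.simps nn_integral_return)

lemma measurable_n_point_integral [measurable (raw)]:
  assumes [measurable]: "(\<lambda>z. F (fst z) (snd z)) \<in> borel_measurable (N \<Otimes>\<^sub>M config_space)"
  shows "(\<lambda>x. \<integral>\<^sup>+k. F x k \<partial>n_point \<nu> n) \<in> borel_measurable N"
proof -
  interpret n: sigma_finite_measure "n_point \<nu> n" by (rule sigma_finite_n_point)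
  show ?thesis
    by (rule n.borel_measurable_nn_integral) (simp add: split_beta')
qed

lemma
  shows sets_poisson_weight [simp, measurable_cong]: "sets (poisson_weight \<nu>) = sets config_space"
    and nn_integral_poisson_weight: "F \<in> borel_measurable config_space \<Longrightarrow>
      (\<integral>\<^sup>+k. F k \<partial>poisson_weight \<nu>) = (\<Sum>n. \<integral>\<^sup>+k. F k \<partial>n_point \<nu> n)"
proof -
  have W: "poisson_weight \<nu> = measure_of (space config_space) (sets config_space)
     (\<lambda>A. \<integral>\<^sup>+n. emeasure (n_point \<nu> n) A \<partial>count_space UNIV)"
    by (simp add: poisson_weight_def)
  show "sets (poisson_weight \<nu>) = sets config_space"
    unfolding W by (rule sets_mixture) simp_all
  show "(\<integral>\<^sup>+k. F k \<partial>poisson_weight \<nu>) = (\<Sum>n. \<integral>\<^sup>+k. F k \<partial>n_point \<nu> n)"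
    if "F \<in> borel_measurable config_space"
    unfolding W by (subst nn_integral_mixture) (use that in \<open>simp_all add: nn_integral_count_space_nat\<close>)
qed

lemma space_poisson_weight [simp]: "space (poisson_weight \<nu>) = UNIV"
  using sets_eq_imp_space_eq[OF sets_poisson_weight] by simp

lemma emeasure_n_point_UNIV: "emeasure (n_point \<nu> n) UNIV = ennreal (measure \<nu> UNIV ^ n / fact n)"
proof (induction n)
  case (Suc n)
  have "of_nat (Suc n) * emeasure (n_point \<nu> (Suc n)) UNIV = emeasure (n_point \<nu> n) UNIV * emeasure \<nu> UNIV"
    using nn_integral_n_point_Suc[of "\<lambda>_. 1" n] by (simp del: of_nat_Suc)
  also have "\<dots> = ennreal (measure \<nu> UNIV ^ n / fact n * measure \<nu> UNIV)"
    unfolding Suc emeasure_eq_measure by (rule ennreal_mult[symmetric]) simp_all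
  also have "measure \<nu> UNIV ^ n / fact n * measure \<nu> UNIV = real (Suc n) * (measure \<nu> UNIV ^ Suc n / fact (Suc n))"
    by (simp add: field_simps del: of_nat_Suc)
  also have "ennreal \<dots> = of_nat (Suc n) * ennreal (measure \<nu> UNIV ^ Suc n / fact (Suc n))"
    by (subst ennreal_mult) (auto simp: ennreal_of_nat_eq_real_of_nat simp del: of_nat_Suc)
  finally show ?case by (rule ennreal_Suc_cancel)
next
  case 0
  show ?case using nn_integral_n_point_0[of "\<lambda>_. 1"] by simp
qed

lemma emeasure_poisson_weight_UNIV: "emeasure (poisson_weight \<nu>) UNIV = ennreal (exp (measure \<nu> UNIV))"
proof -
  have "emeasure (poisson_weight \<nu>) UNIV = (\<Sum>n. emeasure (n_point \<nu> n) UNIV)"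
    using nn_integral_poisson_weight[of "\<lambda>_. 1"] by simp
  also have "\<dots> = (\<Sum>n. ennreal (measure \<nu> UNIV ^ n / fact n))"
    by (simp add: emeasure_n_point_UNIV)
  also have "\<dots> = ennreal (exp (measure \<nu> UNIV))"
    using exp_converges[of "measure \<nu> UNIV"]
    by (intro suminf_ennreal_eq) (simp_all add: divide_inverse_commute)
  finally show ?thesis .
qed

lemma finite_poisson_weight: "finite_measure (poisson_weight \<nu>)"
  by (rule finite_measureI) (simp add: emeasure_poisson_weight_UNIV)

lemma measurable_poisson_weight_integral [measurable (raw)]:
  assumes [measurable]: "(\<lambda>z. F (fst z) (snd z)) \<in> borel_measurable (N \<Otimes>\<^sub>M config_space)"
  shows "(\<lambda>x. \<integral>\<^sup>+k. F x k \<partial>poisson_weight \<nu>) \<in> borel_measurable N"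
proof -
  interpret n: sigma_finite_measure "poisson_weight \<nu>"
    using finite_poisson_weight by (rule finite_measure.axioms)
  show ?thesis
    by (rule n.borel_measurable_nn_integral) (simp add: split_beta')
qed

lemma size_n_point: "AE k in n_point \<nu> n. size k = n"
proof (induction n)
  case 0
  have "{k \<in> space config_space. size k = 0} \<in> sets config_space"
    using measurable_pts[of UNIV] by (subst pts_UNIV[symmetric]) measurable
  then have "Measurable.pred config_space (\<lambda>k :: 'a multiset. size k = 0)" by (simp add: pred_def)
  then show ?case unfolding n_point.simps by (subst AE_return) simp_all
next
  case (Suc n)
  have [measurable]: "size \<in> config_space \<rightarrow>\<^sub>M count_space UNIV"
    using measurable_pts[of UNIV] by (simp add: pts_UNIV[abs_def])
  have "of_nat (Suc n) * (\<integral>\<^sup>+k. indicator {k. size k \<noteq> Suc n} k \<partial>n_point \<nu> (Suc n)) =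
     (\<integral>\<^sup>+x. \<integral>\<^sup>+k. indicator {k. size k \<noteq> Suc n} (add_mset x k) \<partial>n_point \<nu> n \<partial>\<nu>)"
    by (rule nn_integral_n_point_Suc) (simp add: pred_def[symmetric])
  also have "\<dots> = (\<integral>\<^sup>+x. 0 \<partial>\<nu>)"
    using Suc by (intro nn_integral_cong nn_integral_0_iff_AE[THEN iffD2])
      (auto elim!: eventually_mono simp: indicator_def)
  finally have "(\<integral>\<^sup>+k. indicator {k. size k \<noteq> Suc n} k \<partial>n_point \<nu> (Suc n)) = 0" by simp
  then show ?case
    by (subst (asm) nn_integral_0_iff_AE) (auto elim!: eventually_mono simp: indicator_def)
qed

subsection \<open>Splitting, marking and change of density\<close>

text \<open>
  Multiplied by \<open>n + 1\<close>, both sides can be resolved at one added point, which lies either in the first or in the second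
  part. This yields the weights \<open>i\<close> and \<open>n + 1 - i\<close>, which sum up to \<open>n + 1\<close>.
\<close>

lemma nn_integral_splits_n_point:
  assumes "F \<in> borel_measurable (config_space \<Otimes>\<^sub>M config_space)"
  shows "(\<integral>\<^sup>+k. (\<Sum>p\<in>#splits k. F p) \<partial>n_point \<nu> n) =
    (\<Sum>i\<le>n. \<integral>\<^sup>+A. \<integral>\<^sup>+B. F (A, B) \<partial>n_point \<nu> (n - i) \<partial>n_point \<nu> i)"
  using assms
proof (induction n arbitrary: F)
  case 0
  note [measurable] = this
  show ?case by simp
next
  case (Suc n)
  note [measurable] = Suc.prems
  define a where "a i j = (\<integral>\<^sup>+A. \<integral>\<^sup>+B. F (A, B) \<partial>n_point \<nu> j \<partial>n_point \<nu> i)" for i j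
  have add1: "of_nat (Suc i) * a (Suc i) j =
      (\<integral>\<^sup>+x. \<integral>\<^sup>+A. \<integral>\<^sup>+B. F (add_mset x A, B) \<partial>n_point \<nu> j \<partial>n_point \<nu> i \<partial>\<nu>)" for i j
    unfolding a_def by (subst nn_integral_n_point_Suc) measurable
  have add2: "of_nat (Suc j) * a i (Suc j) =
      (\<integral>\<^sup>+x. \<integral>\<^sup>+A. \<integral>\<^sup>+B. F (A, add_mset x B) \<partial>n_point \<nu> j \<partial>n_point \<nu> i \<partial>\<nu>)" for i j
  proof -
    interpret i: sigma_finite_measure "n_point \<nu> i" by (rule sigma_finite_n_point)
    interpret pair_sigma_finite "n_point \<nu> i" \<nu> ..
    have "of_nat (Suc j) * a i (Suc j) =
       (\<integral>\<^sup>+A. of_nat (Suc j) * (\<integral>\<^sup>+B. F (A, B) \<partial>n_point \<nu> (Suc j)) \<partial>n_point \<nu> i)"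
      unfolding a_def by (rule nn_integral_cmult[symmetric]) measurable
    also have "\<dots> = (\<integral>\<^sup>+A. \<integral>\<^sup>+x. \<integral>\<^sup>+B. F (A, add_mset x B) \<partial>n_point \<nu> j \<partial>\<nu> \<partial>n_point \<nu> i)"
      by (intro nn_integral_cong nn_integral_n_point_Suc) measurable
    also have "\<dots> = (\<integral>\<^sup>+x. \<integral>\<^sup>+A. \<integral>\<^sup>+B. F (A, add_mset x B) \<partial>n_point \<nu> j \<partial>n_point \<nu> i \<partial>\<nu>)"
      by (rule Fubini'[symmetric]) measurable
    finally show ?thesis .
  qed
  have "of_nat (Suc n) * (\<integral>\<^sup>+k. (\<Sum>p\<in>#splits k. F p) \<partial>n_point \<nu> (Suc n)) =
     (\<integral>\<^sup>+x. \<integral>\<^sup>+k. (\<Sum>p\<in>#splits (add_mset x k). F p) \<partial>n_point \<nu> n \<partial>\<nu>)"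
    by (rule nn_integral_n_point_Suc) measurable
  also have "\<dots> = (\<integral>\<^sup>+x. (\<Sum>i\<le>n. \<integral>\<^sup>+A. \<integral>\<^sup>+B. F (add_mset x A, B) \<partial>n_point \<nu> (n - i) \<partial>n_point \<nu> i) +
      (\<Sum>i\<le>n. \<integral>\<^sup>+A. \<integral>\<^sup>+B. F (A, add_mset x B) \<partial>n_point \<nu> (n - i) \<partial>n_point \<nu> i) \<partial>\<nu>)"
  proof (rule nn_integral_cong)
    fix x
    have 1: "(\<integral>\<^sup>+k. (\<Sum>p\<in>#splits k. F (add_mset x (fst p), snd p)) \<partial>n_point \<nu> n) =
      (\<Sum>i\<le>n. \<integral>\<^sup>+A. \<integral>\<^sup>+B. F (add_mset x A, B) \<partial>n_point \<nu> (n - i) \<partial>n_point \<nu> i)"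
      by (subst Suc.IH) simp_all
    have 2: "(\<integral>\<^sup>+k. (\<Sum>p\<in>#splits k. F (fst p, add_mset x (snd p))) \<partial>n_point \<nu> n) =
      (\<Sum>i\<le>n. \<integral>\<^sup>+A. \<integral>\<^sup>+B. F (A, add_mset x B) \<partial>n_point \<nu> (n - i) \<partial>n_point \<nu> i)"
      by (subst Suc.IH) simp_all
    show "(\<integral>\<^sup>+k. (\<Sum>p\<in>#splits (add_mset x k). F p) \<partial>n_point \<nu> n) =
      (\<Sum>i\<le>n. \<integral>\<^sup>+A. \<integral>\<^sup>+B. F (add_mset x A, B) \<partial>n_point \<nu> (n - i) \<partial>n_point \<nu> i) +
      (\<Sum>i\<le>n. \<integral>\<^sup>+A. \<integral>\<^sup>+B. F (A, add_mset x B) \<partial>n_point \<nu> (n - i) \<partial>n_point \<nu> i)"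
      unfolding sum_splits_add 1[symmetric] 2[symmetric]
      by (rule nn_integral_add) measurable
  qed
  also have "\<dots> = (\<Sum>i\<le>n. of_nat (Suc i) * a (Suc i) (n - i)) + (\<Sum>i\<le>n. of_nat (Suc (n - i)) * a i (Suc (n - i)))"
    unfolding add1 add2
    by (simp add: nn_integral_add nn_integral_sum)
  also have "(\<Sum>i\<le>n. of_nat (Suc i) * a (Suc i) (n - i)) = (\<Sum>i\<le>Suc n. of_nat i * a i (Suc n - i))"
    by (subst sum_times_index) simp
  also have "(\<Sum>i\<le>n. of_nat (Suc (n - i)) * a i (Suc (n - i))) = (\<Sum>i\<le>Suc n. of_nat (Suc n - i) * a i (Suc n - i))"
    by (simp add: Suc_diff_le del: of_nat_Suc)
  also have "(\<Sum>i\<le>Suc n. of_nat i * a i (Suc n - i)) + (\<Sum>i\<le>Suc n. of_nat (Suc n - i) * a i (Suc n - i)) =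
     of_nat (Suc n) * (\<Sum>i\<le>Suc n. a i (Suc n - i))"
    unfolding sum.distrib[symmetric] sum_distrib_left
    by (intro sum.cong refl) (simp add: distrib_right[symmetric] of_nat_add[symmetric] del: of_nat_Suc of_nat_add)
  finally show ?case unfolding a_def by (rule ennreal_Suc_cancel)
qed

text \<open>
  Distributing the points of a Poisson configuration in all possible ways yields two independent
  Poisson configurations; for the unnormalized measures there is no constant.
\<close>

lemma nn_integral_splits:
  assumes [measurable]: "F \<in> borel_measurable (config_space \<Otimes>\<^sub>M config_space)"
  shows "(\<integral>\<^sup>+k. (\<Sum>p\<in>#splits k. F p) \<partial>poisson_weight \<nu>) =
    (\<integral>\<^sup>+A. \<integral>\<^sup>+B. F (A, B) \<partial>poisson_weight \<nu> \<partial>poisson_weight \<nu>)"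
proof -
  have "(\<integral>\<^sup>+k. (\<Sum>p\<in>#splits k. F p) \<partial>poisson_weight \<nu>) =
    (\<Sum>n. \<Sum>i\<le>n. \<integral>\<^sup>+A. \<integral>\<^sup>+B. F (A, B) \<partial>n_point \<nu> (n - i) \<partial>n_point \<nu> i)"
    by (subst nn_integral_poisson_weight) (simp_all add: nn_integral_splits_n_point)
  also have "\<dots> = (\<Sum>i. \<Sum>j. \<integral>\<^sup>+A. \<integral>\<^sup>+B. F (A, B) \<partial>n_point \<nu> j \<partial>n_point \<nu> i)"
    by (rule suminf_diagonal)
  also have "\<dots> = (\<Sum>i. \<integral>\<^sup>+A. (\<Sum>j. \<integral>\<^sup>+B. F (A, B) \<partial>n_point \<nu> j) \<partial>n_point \<nu> i)"
    by (intro suminf_cong nn_integral_suminf[symmetric]) measurable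
  also have "\<dots> = (\<Sum>i. \<integral>\<^sup>+A. \<integral>\<^sup>+B. F (A, B) \<partial>poisson_weight \<nu> \<partial>n_point \<nu> i)"
    by (intro suminf_cong nn_integral_cong, subst nn_integral_poisson_weight) simp_all
  also have "\<dots> = (\<integral>\<^sup>+A. \<integral>\<^sup>+B. F (A, B) \<partial>poisson_weight \<nu> \<partial>poisson_weight \<nu>)"
    by (subst nn_integral_poisson_weight) simp_all
  finally show ?thesis .
qed

lemma mecke_n_point:
  assumes "H \<in> borel_measurable config_space" and [measurable]: "\<phi> \<in> borel_measurable borel"
  shows "(\<integral>\<^sup>+k. (\<Sum>x\<in>#k. \<phi> x) * H k \<partial>n_point \<nu> (Suc n)) = (\<integral>\<^sup>+x. \<phi> x * (\<integral>\<^sup>+k. H (add_mset x k) \<partial>n_point \<nu> n) \<partial>\<nu>)"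
  using assms(1)
proof (induction n arbitrary: H)
  case 0
  note [measurable] = this
  have "of_nat (Suc 0) * (\<integral>\<^sup>+k. (\<Sum>x\<in>#k. \<phi> x) * H k \<partial>n_point \<nu> (Suc 0)) = (\<integral>\<^sup>+x. \<phi> x * (\<integral>\<^sup>+k. H (add_mset x k) \<partial>n_point \<nu> 0) \<partial>\<nu>)"
    by (subst nn_integral_n_point_Suc) simp_all
  then show ?case by simp
next
  case (Suc n)
  note [measurable] = Suc.prems
  interpret pair_sigma_finite \<nu> \<nu> ..
  have "of_nat (Suc (Suc n)) * (\<integral>\<^sup>+k. (\<Sum>x\<in>#k. \<phi> x) * H k \<partial>n_point \<nu> (Suc (Suc n))) =
    (\<integral>\<^sup>+y. \<integral>\<^sup>+k. \<phi> y * H (add_mset y k) + (\<Sum>x\<in>#k. \<phi> x) * H (add_mset y k) \<partial>n_point \<nu> (Suc n) \<partial>\<nu>)"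
    by (subst nn_integral_n_point_Suc) (simp_all add: distrib_right of_nat_Suc)
  also have "\<dots> = (\<integral>\<^sup>+y. \<phi> y * (\<integral>\<^sup>+k. H (add_mset y k) \<partial>n_point \<nu> (Suc n)) +
      (\<integral>\<^sup>+x. \<phi> x * (\<integral>\<^sup>+k. H (add_mset y (add_mset x k)) \<partial>n_point \<nu> n) \<partial>\<nu>) \<partial>\<nu>)"
    using Suc.IH by (intro nn_integral_cong)
      (subst nn_integral_add, measurable, subst nn_integral_cmult, measurable)
  also have "\<dots> = (\<integral>\<^sup>+y. \<phi> y * (\<integral>\<^sup>+k. H (add_mset y k) \<partial>n_point \<nu> (Suc n)) \<partial>\<nu>) +
      (\<integral>\<^sup>+y. \<integral>\<^sup>+x. \<phi> x * (\<integral>\<^sup>+k. H (add_mset y (add_mset x k)) \<partial>n_point \<nu> n) \<partial>\<nu> \<partial>\<nu>)"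
    by (rule nn_integral_add) measurable
  also have "(\<integral>\<^sup>+y. \<integral>\<^sup>+x. \<phi> x * (\<integral>\<^sup>+k. H (add_mset y (add_mset x k)) \<partial>n_point \<nu> n) \<partial>\<nu> \<partial>\<nu>) =
      (\<integral>\<^sup>+x. \<integral>\<^sup>+y. \<phi> x * (\<integral>\<^sup>+k. H (add_mset y (add_mset x k)) \<partial>n_point \<nu> n) \<partial>\<nu> \<partial>\<nu>)"
    by (rule Fubini') measurable
  also have "\<dots> = (\<integral>\<^sup>+x. \<phi> x * (of_nat (Suc n) * (\<integral>\<^sup>+k. H (add_mset x k) \<partial>n_point \<nu> (Suc n))) \<partial>\<nu>)"
    by (intro nn_integral_cong)
      (subst nn_integral_n_point_Suc, measurable, subst nn_integral_cmult, measurable, simp add: add_mset_commute)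
  also have "\<dots> = of_nat (Suc n) * (\<integral>\<^sup>+x. \<phi> x * (\<integral>\<^sup>+k. H (add_mset x k) \<partial>n_point \<nu> (Suc n)) \<partial>\<nu>)"
    by (subst nn_integral_cmult[symmetric], measurable) (simp add: mult_ac of_nat_Suc)
  finally have "of_nat (Suc (Suc n)) * (\<integral>\<^sup>+k. (\<Sum>x\<in>#k. \<phi> x) * H k \<partial>n_point \<nu> (Suc (Suc n))) =
     of_nat (Suc (Suc n)) * (\<integral>\<^sup>+x. \<phi> x * (\<integral>\<^sup>+k. H (add_mset x k) \<partial>n_point \<nu> (Suc n)) \<partial>\<nu>)"
    by (simp only: of_nat_Suc[of "Suc n"] distrib_right mult_1)
  then show ?case by (rule ennreal_Suc_cancel)
qed

text \<open>
  Mecke's formula: choosing a point of a Poisson configuration is the same as adding a point. Without the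
  normalization it holds in the same form as with it.
\<close>

lemma mecke:
  assumes [measurable]: "H \<in> borel_measurable config_space" "\<phi> \<in> borel_measurable borel"
  shows "(\<integral>\<^sup>+k. (\<Sum>x\<in>#k. \<phi> x) * H k \<partial>poisson_weight \<nu>) =
    (\<integral>\<^sup>+x. \<phi> x * (\<integral>\<^sup>+k. H (add_mset x k) \<partial>poisson_weight \<nu>) \<partial>\<nu>)"
proof -
  have "(\<integral>\<^sup>+k. (\<Sum>x\<in>#k. \<phi> x) * H k \<partial>poisson_weight \<nu>) = (\<Sum>n. \<integral>\<^sup>+k. (\<Sum>x\<in>#k. \<phi> x) * H k \<partial>n_point \<nu> n)"
    by (rule nn_integral_poisson_weight) measurable
  also have "\<dots> = (\<Sum>n. \<integral>\<^sup>+k. (\<Sum>x\<in>#k. \<phi> x) * H k \<partial>n_point \<nu> (Suc n))"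
  proof -
    have "(\<integral>\<^sup>+k. (\<Sum>x\<in>#k. \<phi> x) * H k \<partial>n_point \<nu> 0) = 0"
      by (subst nn_integral_n_point_0) simp_all
    then show ?thesis
      by (subst suminf_offset[of _ 1]) (simp_all add: summableI)
  qed
  also have "\<dots> = (\<Sum>n. \<integral>\<^sup>+x. \<phi> x * (\<integral>\<^sup>+k. H (add_mset x k) \<partial>n_point \<nu> n) \<partial>\<nu>)"
    by (intro suminf_cong mecke_n_point) measurable
  also have "\<dots> = (\<integral>\<^sup>+x. (\<Sum>n. \<phi> x * (\<integral>\<^sup>+k. H (add_mset x k) \<partial>n_point \<nu> n)) \<partial>\<nu>)"
    by (rule nn_integral_suminf[symmetric]) measurable
  also have "\<dots> = (\<integral>\<^sup>+x. \<phi> x * (\<integral>\<^sup>+k. H (add_mset x k) \<partial>poisson_weight \<nu>) \<partial>\<nu>)"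
  proof (rule nn_integral_cong)
    fix x
    show "(\<Sum>n. \<phi> x * (\<integral>\<^sup>+k. H (add_mset x k) \<partial>n_point \<nu> n)) = \<phi> x * (\<integral>\<^sup>+k. H (add_mset x k) \<partial>poisson_weight \<nu>)"
      by (subst nn_integral_poisson_weight) simp_all
  qed
  finally show ?thesis .
qed

lemma finite_borel_density:
  assumes [measurable]: "f \<in> borel_measurable borel" and "\<And>x. f x \<le> C"
  shows "finite_borel (density \<nu> (\<lambda>x. ennreal (f x)))"
proof (intro finite_borel.intro finite_measureI)
  have "emeasure (density \<nu> (\<lambda>x. ennreal (f x))) (space \<nu>) = (\<integral>\<^sup>+x. ennreal (f x) \<partial>\<nu>)"
    by (subst emeasure_density) auto
  also have "\<dots> \<le> (\<integral>\<^sup>+x. ennreal C \<partial>\<nu>)"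
    by (intro nn_integral_mono ennreal_leI assms(2))
  also have "\<dots> < \<infinity>" by (simp add: less_top[symmetric] ennreal_mult_eq_top_iff)
  finally show "emeasure (density \<nu> (\<lambda>x. ennreal (f x))) (space (density \<nu> (\<lambda>x. ennreal (f x)))) \<noteq> \<infinity>"
    by simp
qed simp

end

context finite_borel
begin

text \<open>
  Changing the intensity by a density multiplies the unnormalized measure by the product of the density over all
  points. Restrictions of the intensity to a set are the special case of an indicator function.
\<close>

lemma nn_integral_poisson_weight_density:
  fixes f :: "'a \<Rightarrow> real"
  assumes "F \<in> borel_measurable config_space" and f[measurable]: "f \<in> borel_measurable borel"
    and f0: "\<And>x. 0 \<le> f x" and fC: "\<And>x. f x \<le> C"
  shows "(\<integral>\<^sup>+k. F k \<partial>poisson_weight (density \<nu> (\<lambda>x. ennreal (f x)))) =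
    (\<integral>\<^sup>+k. F k * ennreal (\<Prod>x\<in>#k. f x) \<partial>poisson_weight \<nu>)"
proof -
  let ?\<nu> = "density \<nu> (\<lambda>x. ennreal (f x))"
  interpret d: finite_borel ?\<nu> by (rule finite_borel_density[OF f fC])
  have [measurable]: "(\<lambda>k. \<Prod>x\<in>#k. f x) \<in> borel_measurable config_space"
    by (rule measurable_prod_points[OF f f0])
  have p0: "0 \<le> (\<Prod>x\<in>#k. f x)" for k using f0 by (induction k) auto
  have "(\<integral>\<^sup>+k. F k \<partial>n_point ?\<nu> n) = (\<integral>\<^sup>+k. F k * ennreal (\<Prod>x\<in>#k. f x) \<partial>n_point \<nu> n)" for n
    using assms(1)
  proof (induction n arbitrary: F)
    case 0
    note [measurable] = this
    have "(\<lambda>k. F k * ennreal (\<Prod>x\<in>#k. f x)) \<in> borel_measurable config_space" by measurable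
    then show ?case using 0 by simp
  next
    case (Suc n)
    note [measurable] = Suc.prems
    have "of_nat (Suc n) * (\<integral>\<^sup>+k. F k \<partial>n_point ?\<nu> (Suc n)) = (\<integral>\<^sup>+x. \<integral>\<^sup>+k. F (add_mset x k) \<partial>n_point ?\<nu> n \<partial>?\<nu>)"
      by (rule d.nn_integral_n_point_Suc) measurable
    also have "\<dots> = (\<integral>\<^sup>+x. ennreal (f x) * (\<integral>\<^sup>+k. F (add_mset x k) \<partial>n_point ?\<nu> n) \<partial>\<nu>)"
      by (rule nn_integral_density) measurable
    also have "\<dots> = (\<integral>\<^sup>+x. \<integral>\<^sup>+k. F (add_mset x k) * ennreal (\<Prod>x\<in>#add_mset x k. f x) \<partial>n_point \<nu> n \<partial>\<nu>)"
    proof (rule nn_integral_cong)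
      fix x
      have "(\<integral>\<^sup>+k. F (add_mset x k) \<partial>n_point ?\<nu> n) = (\<integral>\<^sup>+k. F (add_mset x k) * ennreal (\<Prod>x\<in>#k. f x) \<partial>n_point \<nu> n)"
        by (rule Suc.IH) measurable
      then show "ennreal (f x) * (\<integral>\<^sup>+k. F (add_mset x k) \<partial>n_point ?\<nu> n) =
         (\<integral>\<^sup>+k. F (add_mset x k) * ennreal (\<Prod>x\<in>#add_mset x k. f x) \<partial>n_point \<nu> n)"
        using f0 p0 by (simp add: nn_integral_cmult[symmetric] ennreal_mult mult_ac)
    qed
    also have "\<dots> = of_nat (Suc n) * (\<integral>\<^sup>+k. F k * ennreal (\<Prod>x\<in>#k. f x) \<partial>n_point \<nu> (Suc n))"
      by (rule nn_integral_n_point_Suc[symmetric]) measurable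
    finally show ?case by (rule ennreal_Suc_cancel)
  qed
  then show ?thesis
    using assms(1) by (simp add: nn_integral_poisson_weight d.nn_integral_poisson_weight)
qed

end

subsection \<open>The Poisson law\<close>

context finite_borel
begin

lemma emeasure_poisson_weight_size:
  "emeasure (poisson_weight \<nu>) {k. size k = n} = ennreal (measure \<nu> UNIV ^ n / fact n)"
proof -
  have [measurable]: "size \<in> config_space \<rightarrow>\<^sub>M count_space UNIV"
    using measurable_pts[of UNIV] by (simp add: pts_UNIV[abs_def])
  have S: "{k. size k = n} \<in> sets config_space" for n
  proof -
    have "{k \<in> space config_space. size k = n} \<in> sets config_space" by measurable
    then show ?thesis by simp
  qed
  have "emeasure (poisson_weight \<nu>) {k. size k = n} = (\<integral>\<^sup>+k. indicator {k. size k = n} k \<partial>poisson_weight \<nu>)"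
    by (rule nn_integral_indicator[symmetric]) (simp add: S)
  also have "\<dots> = (\<Sum>m. \<integral>\<^sup>+k. indicator {k. size k = n} k \<partial>n_point \<nu> m)"
    using S by (intro nn_integral_poisson_weight) simp
  also have "\<dots> = (\<Sum>m. if m = n then ennreal (measure \<nu> UNIV ^ n / fact n) else 0)"
  proof (rule suminf_cong)
    fix m
    have "(\<integral>\<^sup>+k. indicator {k. size k = n} k \<partial>n_point \<nu> m) = (\<integral>\<^sup>+k. (if m = n then 1 else 0) \<partial>n_point \<nu> m)"
      using size_n_point[of m] by (intro nn_integral_cong_AE) (auto elim!: eventually_mono)
    then show "(\<integral>\<^sup>+k. indicator {k. size k = n} k \<partial>n_point \<nu> m) =
        (if m = n then ennreal (measure \<nu> UNIV ^ n / fact n) else 0)"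
      by (simp add: emeasure_n_point_UNIV)
  qed
  also have "\<dots> = ennreal (measure \<nu> UNIV ^ n / fact n)"
    by (subst suminf_finite[of "{n}"]) auto
  finally show ?thesis .
qed

text \<open>
  A Poisson configuration splits into its parts inside and outside of \<open>C\<close>, and of all its splittings
  exactly one separates the points in this way.
\<close>

lemma nn_integral_poisson_weight_separate:
  assumes [measurable]: "F \<in> borel_measurable config_space" "C \<in> sets borel"
  shows "(\<integral>\<^sup>+k. F k \<partial>poisson_weight \<nu>) =
    (\<integral>\<^sup>+A. \<integral>\<^sup>+B. F (A + B) * (indicator {A. pts (- C) A = 0} A * indicator {B. pts C B = 0} B)
      \<partial>poisson_weight \<nu> \<partial>poisson_weight \<nu>)"
proof -
  let ?i = "\<lambda>p. indicator {A. pts (- C) A = 0} (fst p) * indicator {B. pts C B = 0} (snd p) :: ennreal"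
  have one: "(\<Sum>p\<in>#splits k. ?i p) = 1" for k
  proof (induction k)
    case (add x k)
    show ?case
    proof (cases "x \<in> C")
      case True
      have "(\<Sum>p\<in>#splits k. ?i (add_mset x (fst p), snd p)) = (\<Sum>p\<in>#splits k. ?i p)"
        "(\<Sum>p\<in>#splits k. ?i (fst p, add_mset x (snd p))) = 0"
        using True by (auto simp: indicator_def intro!: arg_cong[where f = sum_mset] image_mset_cong)
      then show ?thesis using add unfolding sum_splits_add by simp
    next
      case False
      have "(\<Sum>p\<in>#splits k. ?i (fst p, add_mset x (snd p))) = (\<Sum>p\<in>#splits k. ?i p)"
        "(\<Sum>p\<in>#splits k. ?i (add_mset x (fst p), snd p)) = 0"
        using False by (auto simp: indicator_def intro!: arg_cong[where f = sum_mset] image_mset_cong)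
      then show ?thesis using add unfolding sum_splits_add by simp
    qed
  qed (simp add: indicator_def)
  have F_splits: "F k = (\<Sum>p\<in>#splits k. F (fst p + snd p) * ?i p)" for k
  proof -
    have "(\<Sum>p\<in>#splits k. F (fst p + snd p) * ?i p) = (\<Sum>p\<in>#splits k. F k * ?i p)"
      by (intro arg_cong[where f = sum_mset] image_mset_cong) (simp add: splits_sum)
    then show ?thesis by (simp add: sum_mset_distrib_left[symmetric] one)
  qed
  have "(\<integral>\<^sup>+k. F k \<partial>poisson_weight \<nu>) = (\<integral>\<^sup>+k. (\<Sum>p\<in>#splits k. F (fst p + snd p) * ?i p) \<partial>poisson_weight \<nu>)"
    by (rule nn_integral_cong) (rule F_splits)
  also have "\<dots> = (\<integral>\<^sup>+A. \<integral>\<^sup>+B. F (A + B) * ?i (A, B) \<partial>poisson_weight \<nu> \<partial>poisson_weight \<nu>)"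
    by (subst nn_integral_splits) simp_all
  finally show ?thesis by simp
qed

end

lemma prod_points_indicator: "(\<Prod>x\<in>#k. indicator C x :: real) = indicator {k. pts (- C) k = 0} k"
  by (induction k) (auto simp: indicator_def)

lemma measurable_counts [measurable]:
  fixes A :: "'i \<Rightarrow> 'a::topological_space set"
  assumes "finite J" "\<And>i. i \<in> J \<Longrightarrow> A i \<in> sets borel"
  shows "{k. \<forall>i\<in>J. pts (A i) k = n i} \<in> sets config_space"
proof -
  have "{k \<in> space config_space. pts (A i) k = n i} \<in> sets config_space" if "i \<in> J" for i
    using assms(2)[OF that] by measurable
  then have "(\<Inter>i\<in>J. {k \<in> space config_space. pts (A i) k = n i}) \<in> sets config_space" if "J \<noteq> {}"
    using assms(1) that by (intro sets.finite_INT) auto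
  moreover have "{k. \<forall>i\<in>J. pts (A i) k = n i} = (\<Inter>i\<in>J. {k \<in> space config_space. pts (A i) k = n i})"
    by auto
  moreover have "UNIV \<in> sets (config_space :: 'a multiset measure)"
    using sets.top[of "config_space :: 'a multiset measure"] by (simp del: sets.top)
  ultimately show ?thesis by (cases "J = {}") simp_all
qed

text \<open>
  Induction on the number of cells: the points inside and outside of a cell are independent, and the configuration
  outside is again Poisson, with the intensity restricted to the complement.
\<close>

lemma emeasure_poisson_weight_counts:
  fixes \<nu> :: "'a::second_countable_topology measure"
  assumes "finite J" "finite_borel \<nu>" "\<And>i. i \<in> J \<Longrightarrow> A i \<in> sets borel" "disjoint_family_on A J"
  shows "emeasure (poisson_weight \<nu>) {k. \<forall>i\<in>J. pts (A i) k = n i} =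
    ennreal (exp (measure \<nu> (UNIV - (\<Union>i\<in>J. A i))) * (\<Prod>i\<in>J. measure \<nu> (A i) ^ n i / fact (n i)))"
  using assms
proof (induction J arbitrary: \<nu> rule: finite_induct)
  case empty
  then interpret finite_borel \<nu> by simp
  show ?case by (simp add: emeasure_poisson_weight_UNIV)
next
  case (insert m J)
  interpret finite_borel \<nu> by fact
  note Am[measurable] = insert.prems(2)
  let ?C = "A m"
  have C[measurable]: "?C \<in> sets borel" by (rule Am) simp
  define \<nu>1 where "\<nu>1 = density \<nu> (\<lambda>x. ennreal (indicator ?C x))"
  define \<nu>2 where "\<nu>2 = density \<nu> (\<lambda>x. ennreal (indicator (- ?C) x))"
  interpret n1: finite_borel \<nu>1
    unfolding \<nu>1_def by (rule finite_borel_density[where C = 1]) (auto simp: indicator_def)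
  have n2: "finite_borel \<nu>2"
    unfolding \<nu>2_def by (rule finite_borel_density[where C = 1]) (auto simp: indicator_def)
  have m1: "measure \<nu>1 X = measure \<nu> (X \<inter> ?C)" if "X \<in> sets borel" for X
    using that unfolding \<nu>1_def measure_def
    by (simp add: ennreal_indicator emeasure_density indicator_inter_arith[symmetric] Int_commute)
  have m2: "measure \<nu>2 X = measure \<nu> (X - ?C)" if "X \<in> sets borel" for X
    using that unfolding \<nu>2_def measure_def
    by (simp add: ennreal_indicator emeasure_density indicator_inter_arith[symmetric] Int_commute Diff_eq)
  have dj: "A i \<inter> ?C = {}" if "i \<in> J" for i
    using insert.prems(3) insert.hyps(2) that by (auto simp: disjoint_family_on_def)
  have dJ: "disjoint_family_on A J"
    using insert.prems(3) by (auto simp: disjoint_family_on_def)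
  let ?S = "{k. \<forall>i\<in>insert m J. pts (A i) k = n i}" and ?S2 = "{k. \<forall>i\<in>J. pts (A i) k = n i}"
  let ?S1 = "{k :: 'a multiset. size k = n m}"
  have S[measurable]: "?S \<in> sets config_space" and S2[measurable]: "?S2 \<in> sets config_space"
    by (rule measurable_counts, use insert in auto)+
  have S1[measurable]: "?S1 \<in> sets config_space"
    using measurable_counts[of "{()}" "\<lambda>_. UNIV" "\<lambda>_. n m"] by simp
  have sep: "indicator ?S (a + b) * (indicator {a. pts (- ?C) a = 0} a * indicator {b. pts ?C b = 0} b) =
    (indicator ?S1 a * indicator {a. pts (- ?C) a = 0} a) *
    (indicator ?S2 b * indicator {b. pts ?C b = 0} b :: ennreal)" for a b
  proof (cases "pts (- ?C) a = 0 \<and> pts ?C b = 0")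
    case True
    then have "size a = pts ?C a"
      unfolding pts_UNIV[symmetric] by (induction a) auto
    moreover have "pts (A i) a = 0" if "i \<in> J" for i
      using True dj[OF that] by (auto simp: pts_eq_0_iff)
    ultimately have "a + b \<in> ?S \<longleftrightarrow> a \<in> ?S1 \<and> b \<in> ?S2" using True by auto
    then show ?thesis by (auto simp: indicator_def)
  qed (auto simp: indicator_def)
  have "emeasure (poisson_weight \<nu>) ?S = (\<integral>\<^sup>+k. indicator ?S k \<partial>poisson_weight \<nu>)"
    by (rule nn_integral_indicator[symmetric]) measurable
  also have "\<dots> = (\<integral>\<^sup>+a. \<integral>\<^sup>+b. (indicator ?S1 a * indicator {a. pts (- ?C) a = 0} a) *
    (indicator ?S2 b * indicator {b. pts ?C b = 0} b) \<partial>poisson_weight \<nu> \<partial>poisson_weight \<nu>)"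
  proof -
    have "indicator ?S \<in> borel_measurable config_space" by measurable
    from nn_integral_poisson_weight_separate[OF this C] show ?thesis by (simp only: sep)
  qed
  also have "\<dots> = (\<integral>\<^sup>+a. indicator ?S1 a * indicator {a. pts (- ?C) a = 0} a \<partial>poisson_weight \<nu>) *
     (\<integral>\<^sup>+b. indicator ?S2 b * indicator {b. pts ?C b = 0} b \<partial>poisson_weight \<nu>)"
    by (subst nn_integral_cmult, measurable, subst nn_integral_multc, measurable)
  also have "(\<integral>\<^sup>+a. indicator ?S1 a * indicator {a. pts (- ?C) a = 0} a \<partial>poisson_weight \<nu>) =
     emeasure (poisson_weight \<nu>1) ?S1"
  proof -
    have "emeasure (poisson_weight \<nu>1) ?S1 = (\<integral>\<^sup>+k. indicator ?S1 k \<partial>poisson_weight \<nu>1)" by simp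
    also have "\<dots> = (\<integral>\<^sup>+a. indicator ?S1 a * ennreal (\<Prod>x\<in>#a. indicator ?C x) \<partial>poisson_weight \<nu>)"
      unfolding \<nu>1_def
      by (rule nn_integral_poisson_weight_density[where C = 1, OF borel_measurable_indicator[OF S1]])
        (auto simp: indicator_def)
    finally show ?thesis unfolding prod_points_indicator by (simp add: ennreal_indicator)
  qed
  also have "(\<integral>\<^sup>+b. indicator ?S2 b * indicator {b. pts ?C b = 0} b \<partial>poisson_weight \<nu>) =
     emeasure (poisson_weight \<nu>2) ?S2"
  proof -
    interpret n2: finite_borel \<nu>2 by (rule n2)
    have "emeasure (poisson_weight \<nu>2) ?S2 = (\<integral>\<^sup>+k. indicator ?S2 k \<partial>poisson_weight \<nu>2)" by simp
    also have "\<dots> = (\<integral>\<^sup>+a. indicator ?S2 a * ennreal (\<Prod>x\<in>#a. indicator (- ?C) x) \<partial>poisson_weight \<nu>)"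
      unfolding \<nu>2_def
      by (rule nn_integral_poisson_weight_density[where C = 1, OF borel_measurable_indicator[OF S2]])
        (auto simp: indicator_def)
    finally show ?thesis unfolding prod_points_indicator by (simp add: ennreal_indicator)
  qed
  also have "emeasure (poisson_weight \<nu>1) ?S1 = ennreal (measure \<nu> ?C ^ n m / fact (n m))"
    using m1[of UNIV] by (simp add: n1.emeasure_poisson_weight_size)
  also have "emeasure (poisson_weight \<nu>2) ?S2 =
     ennreal (exp (measure \<nu>2 (UNIV - (\<Union>i\<in>J. A i))) * (\<Prod>i\<in>J. measure \<nu>2 (A i) ^ n i / fact (n i)))"
    by (rule insert.IH[OF n2 _ dJ]) (use Am in auto)
  also have "measure \<nu>2 (UNIV - (\<Union>i\<in>J. A i)) = measure \<nu> (UNIV - (\<Union>i\<in>insert m J. A i))"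
  proof -
    have "(\<Union>i\<in>J. A i) \<in> sets borel" using insert.hyps(1) Am by (intro sets.finite_UN) auto
    then have "measure \<nu>2 (UNIV - (\<Union>i\<in>J. A i)) = measure \<nu> (UNIV - (\<Union>i\<in>J. A i) - ?C)" by (intro m2) auto
    then show ?thesis by (simp add: Diff_eq Int_ac)
  qed
  also have "(\<Prod>i\<in>J. measure \<nu>2 (A i) ^ n i / fact (n i)) = (\<Prod>i\<in>J. measure \<nu> (A i) ^ n i / fact (n i))"
  proof (rule prod.cong)
    fix i assume i: "i \<in> J"
    have "A i - ?C = A i" using dj[OF i] by auto
    then show "measure \<nu>2 (A i) ^ n i / fact (n i) = measure \<nu> (A i) ^ n i / fact (n i)"
      using m2[of "A i"] Am i by simp
  qed simp
  finally show ?case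
    using insert.hyps by (subst (asm) ennreal_mult[symmetric]) (auto intro!: prod_nonneg mult_nonneg_nonneg simp: mult_ac)
qed

context finite_borel
begin

definition poisson_normalized :: "'a multiset measure" where
  "poisson_normalized = scale_measure (ennreal (exp (- measure \<nu> UNIV))) (poisson_weight \<nu>)"

lemma sets_poisson_normalized [simp]: "sets poisson_normalized = sets config_space"
  by (simp add: poisson_normalized_def)

lemma space_poisson_normalized [simp]: "space poisson_normalized = UNIV"
  using sets_eq_imp_space_eq[OF sets_poisson_normalized] by simp

lemma prob_space_poisson_normalized: "prob_space poisson_normalized"
  by (rule prob_spaceI)
    (simp add: poisson_normalized_def emeasure_poisson_weight_UNIV ennreal_mult[symmetric] exp_minus space_scale_measure)

lemma measure_poisson_normalized_counts:
  assumes J: "finite J" and A: "\<And>i. i \<in> J \<Longrightarrow> A i \<in> sets borel" and d: "disjoint_family_on A J"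
  shows "measure poisson_normalized {k. \<forall>i\<in>J. pts (A i) k = n i} =
    (\<Prod>i\<in>J. measure \<nu> (A i) ^ n i / fact (n i) * exp (- measure \<nu> (A i)))"
proof -
  let ?U = "\<Union>i\<in>J. A i"
  have U: "?U \<in> sets borel" using J A by (intro sets.finite_UN) auto
  have "measure \<nu> UNIV = measure \<nu> (UNIV - ?U) + measure \<nu> ?U"
    using finite_measure_Diff[of UNIV ?U] U by simp
  also have "measure \<nu> ?U = (\<Sum>i\<in>J. measure \<nu> (A i))"
    using J A d by (intro finite_measure_finite_Union) auto
  finally have tot: "- measure \<nu> UNIV + measure \<nu> (UNIV - ?U) = (\<Sum>i\<in>J. - measure \<nu> (A i))"
    by (simp add: sum_negf)
  have p: "0 \<le> (\<Prod>i\<in>J. measure \<nu> (A i) ^ n i / fact (n i))" by (intro prod_nonneg) auto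
  have "measure poisson_normalized {k. \<forall>i\<in>J. pts (A i) k = n i} =
    exp (- measure \<nu> UNIV) * (exp (measure \<nu> (UNIV - ?U)) * (\<Prod>i\<in>J. measure \<nu> (A i) ^ n i / fact (n i)))"
    using emeasure_poisson_weight_counts[OF J finite_borel_axioms A d] p
    by (intro measure_eq_emeasure_eq_ennreal) (simp_all add: poisson_normalized_def ennreal_mult[symmetric])
  also have "\<dots> = exp (\<Sum>i\<in>J. - measure \<nu> (A i)) * (\<Prod>i\<in>J. measure \<nu> (A i) ^ n i / fact (n i))"
    unfolding tot[symmetric] exp_add by (simp add: mult.assoc)
  also have "\<dots> = (\<Prod>i\<in>J. measure \<nu> (A i) ^ n i / fact (n i) * exp (- measure \<nu> (A i)))"
    unfolding exp_sum[OF J] prod.distrib[symmetric] by (simp add: mult_ac)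
  finally show ?thesis .
qed

lemma poisson_process_normalized: "poisson_process \<nu> poisson_normalized"
proof -
  interpret Q: prob_space poisson_normalized by (rule prob_space_poisson_normalized)
  have one: "measure poisson_normalized {k. pts A k = n} = measure \<nu> A ^ n / fact n * exp (- measure \<nu> A)"
    if "A \<in> sets borel" for A n
    using measure_poisson_normalized_counts[of "{()}" "\<lambda>_. A" "\<lambda>_. n"] that
    by (simp add: disjoint_family_on_def)
  have "Q.indep_vars (\<lambda>_. count_space UNIV) (\<lambda>i k. pts (A i) k) {..<m}"
    if A: "\<forall>i<m. A i \<in> sets borel" and d: "disjoint_family_on A {..<m}" for A :: "nat \<Rightarrow> 'a set" and m
  proof -
    let ?F = "\<lambda>i. insert {} (range (\<lambda>n. {k. pts (A i) k = n}))"
    have ev: "{k. pts (A i) k = n} \<in> Q.events" if "i < m" for i n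
      using measurable_counts[of "{()}" "\<lambda>_. A i" "\<lambda>_. n"] A that by simp
    have "Q.indep_sets ?F {..<m}"
    proof (rule Q.indep_setsI)
      show "?F i \<subseteq> Q.events" if "i \<in> {..<m}" for i using ev that by auto
      fix B J assume J: "J \<noteq> {}" "J \<subseteq> {..<m}" "finite J" and B: "\<forall>j\<in>J. B j \<in> ?F j"
      show "Q.prob (\<Inter>j\<in>J. B j) = (\<Prod>j\<in>J. Q.prob (B j))"
      proof (cases "\<exists>j\<in>J. B j = {}")
        case True
        then obtain j where j: "j \<in> J" "B j = {}" by blast
        then have "(\<Inter>j\<in>J. B j) = {}" by auto
        moreover have "(\<Prod>j\<in>J. Q.prob (B j)) = 0" using j J(3) by (intro prod_zero bexI[of _ j]) auto
        ultimately show ?thesis by simp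
      next
        case False
        have "\<exists>n. B j = {k. pts (A j) k = n}" if "j \<in> J" for j
        proof -
          have "B j \<in> ?F j" "B j \<noteq> {}" using B False that by simp_all
          then show ?thesis by (simp add: image_iff)
        qed
        then obtain n where n: "\<And>j. j \<in> J \<Longrightarrow> B j = {k. pts (A j) k = n j}" by metis
        have AJ: "A j \<in> sets borel" if "j \<in> J" for j using A J(2) that by auto
        have dJ: "disjoint_family_on A J" using d J(2) by (rule disjoint_family_on_mono[rotated])
        have "(\<Inter>j\<in>J. B j) = {k. \<forall>j\<in>J. pts (A j) k = n j}" using n by auto
        then have "Q.prob (\<Inter>j\<in>J. B j) =
            (\<Prod>i\<in>J. measure \<nu> (A i) ^ n i / fact (n i) * exp (- measure \<nu> (A i)))"
          using measure_poisson_normalized_counts[OF J(3) AJ dJ] by simp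
        also have "\<dots> = (\<Prod>j\<in>J. Q.prob (B j))"
          using n one AJ by (intro prod.cong) auto
        finally show ?thesis .
      qed
    qed
    then have "Q.indep_sets (\<lambda>i. sigma_sets (space poisson_normalized) (?F i)) {..<m}"
      by (rule Q.indep_sets_sigma) (auto simp: Int_stable_def)
    then have "Q.indep_sets (\<lambda>i. {(\<lambda>k. pts (A i) k) -` X \<inter> space poisson_normalized |X. X \<in> sets (count_space UNIV)}) {..<m}"
    proof (rule Q.indep_sets_mono_sets)
      fix i assume "i \<in> {..<m}"
      show "{(\<lambda>k. pts (A i) k) -` X \<inter> space poisson_normalized |X. X \<in> sets (count_space UNIV)}
        \<subseteq> sigma_sets (space poisson_normalized) (?F i)"
      proof
        fix Y assume "Y \<in> {(\<lambda>k. pts (A i) k) -` X \<inter> space poisson_normalized |X. X \<in> sets (count_space UNIV)}"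
        then obtain X where Y: "Y = (\<Union>n. if n \<in> X then {k. pts (A i) k = n} else {})" by auto
        show "Y \<in> sigma_sets (space poisson_normalized) (?F i)"
          unfolding Y by (rule sigma_sets.Union) (auto intro: sigma_sets.Basic)
      qed
    qed
    moreover have "Q.random_variable (count_space UNIV) (\<lambda>k. pts (A i) k)" if "i < m" for i
      using A that measurable_pts[of "A i"] by (simp add: measurable_cong_sets[OF sets_poisson_normalized refl])
    ultimately show ?thesis unfolding Q.indep_vars_def2 by simp
  qed
  then show ?thesis
    using one Q.prob_space_axioms unfolding poisson_process_def by auto
qed

end

lemma poisson_process_cylinder:
  fixes \<pi> :: "'a::topological_space \<Rightarrow> nat"
  assumes P: "poisson_process \<nu> Q" and \<pi>: "\<pi> \<in> borel \<rightarrow>\<^sub>M count_space UNIV" and m: "range \<pi> \<subseteq> {..<m}" and "0 < m"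
  shows "emeasure Q (image_mset \<pi> -` {k'}) = (if set_mset k' \<subseteq> {..<m}
    then ennreal (\<Prod>i<m. measure \<nu> (\<pi> -` {i}) ^ count k' i / fact (count k' i) * exp (- measure \<nu> (\<pi> -` {i}))) else 0)"
proof (cases "set_mset k' \<subseteq> {..<m}")
  case False
  moreover have "set_mset (image_mset \<pi> k) \<subseteq> {..<m}" for k using m by auto
  ultimately have "image_mset \<pi> -` {k'} = {}" by blast
  then show ?thesis using False by simp
next
  case True
  interpret prob_space Q using P by (simp add: poisson_process_def)
  have sQ: "sets Q = sets config_space" using P by (simp add: poisson_process_def)
  have spQ: "space Q = UNIV" using sets_eq_imp_space_eq[OF sQ] by simp
  have A: "\<pi> -` {i} \<in> sets borel" for i using measurable_sets[OF \<pi>, of "{i}"] by simp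
  have d: "disjoint_family_on (\<lambda>i. \<pi> -` {i}) {..<m}" by (auto simp: disjoint_family_on_def)
  have ind: "indep_vars (\<lambda>_. count_space UNIV) (\<lambda>i k. pts (\<pi> -` {i}) k) {..<m}"
  proof -
    have "\<forall>(A :: nat \<Rightarrow> 'a set) m. (\<forall>i<m. A i \<in> sets borel) \<longrightarrow> disjoint_family_on A {..<m} \<longrightarrow>
        indep_vars (\<lambda>_. count_space UNIV) (\<lambda>i k. pts (A i) k) {..<m}"
      using P unfolding poisson_process_def by (elim conjE) assumption
    from this[THEN spec[of _ "\<lambda>i. \<pi> -` {i}"], THEN spec[of _ m]] A d show ?thesis by simp
  qed
  have "image_mset \<pi> -` {k'} = (\<Inter>i\<in>{..<m}. (\<lambda>k. pts (\<pi> -` {i}) k) -` {count k' i} \<inter> space Q)"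
    (is "_ = ?R")
  proof -
    have "image_mset \<pi> k = k' \<longleftrightarrow> (\<forall>i<m. count (image_mset \<pi> k) i = count k' i)" for k
    proof -
      have "count (image_mset \<pi> k) i = count k' i" if "\<not> i < m" for i
      proof -
        have "i \<notin># k'" "i \<notin># image_mset \<pi> k" using that True m by auto
        then show ?thesis unfolding not_in_iff by simp
      qed
      then show ?thesis unfolding multiset_eq_iff by blast
    qed
    moreover have "k \<in> ?R \<longleftrightarrow> (\<forall>i<m. count (image_mset \<pi> k) i = count k' i)" for k
      using \<open>0 < m\<close> by (auto simp: pts_vimage pts_singleton spQ)
    ultimately show ?thesis by (intro set_eqI) (simp only: vimage_singleton_eq)
  qed
  also have "prob \<dots> = (\<Prod>i\<in>{..<m}. prob ((\<lambda>k. pts (\<pi> -` {i}) k) -` {count k' i} \<inter> space Q))"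
    by (rule indep_varsD_finite[OF ind]) (use \<open>0 < m\<close> in auto)
  also have "\<dots> = (\<Prod>i<m. measure \<nu> (\<pi> -` {i}) ^ count k' i / fact (count k' i) * exp (- measure \<nu> (\<pi> -` {i})))"
    using P A by (intro prod.cong) (auto simp: poisson_process_def spQ vimage_def)
  finally show ?thesis using True by (simp add: emeasure_eq_measure)
qed

text \<open>
  The counts in the cells of a finite classification determine the classified configuration, so their joint law
  determines the measure on all cylinders.
\<close>

lemma poisson_process_unique:
  fixes \<nu> :: "'a::topological_space measure"
  assumes P: "poisson_process \<nu> Q" and P': "poisson_process \<nu> Q'"
  shows "Q = Q'"
proof (rule measure_eqI_generator_eq[OF Int_stable_cylinders, where \<Omega> = UNIV and A = "\<lambda>_. UNIV"])
  interpret prob_space Q using P by (simp add: poisson_process_def)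
  have s: "sets Q = sets config_space" "sets Q' = sets config_space"
    using P P' by (auto simp: poisson_process_def)
  then show "sets Q = sigma_sets UNIV cylinders" "sets Q' = sigma_sets UNIV cylinders"
    by (simp_all add: sets_config_space_cylinders)
  fix X :: "'a multiset set" assume "X \<in> cylinders"
  then obtain \<pi> :: "'a \<Rightarrow> nat" and C where X: "X = image_mset \<pi> -` C"
    and \<pi>: "\<pi> \<in> borel \<rightarrow>\<^sub>M count_space UNIV" and fin: "finite (range \<pi>)" by (rule cylindersE)
  define m where "m = Suc (Max (range \<pi>))"
  have m: "range \<pi> \<subseteq> {..<m}" "0 < m" using fin by (auto simp: m_def less_Suc_eq_le)
  have ms: "image_mset \<pi> -` {k'} \<in> sets config_space" for k'
    using measurable_sets[OF measurable_image_mset[OF \<pi>], of "{k'}"] by simp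
  have XU: "X = (\<Union>k'\<in>C. image_mset \<pi> -` {k'})" using X by auto
  have sum: "emeasure R X = (\<integral>\<^sup>+k'. emeasure R (image_mset \<pi> -` {k'}) \<partial>count_space C)"
    if "sets R = sets config_space" for R
    unfolding XU
    by (rule emeasure_UN_countable)
      (use that ms countable_subset[OF subset_UNIV countable_nat_mset] in \<open>auto simp: disjoint_family_on_def\<close>)
  show "emeasure Q X = emeasure Q' X"
    unfolding sum[OF s(1)] sum[OF s(2)] poisson_process_cylinder[OF P \<pi> m] poisson_process_cylinder[OF P' \<pi> m] ..
next
  interpret prob_space Q using P by (simp add: poisson_process_def)
  show "emeasure Q UNIV \<noteq> \<infinity>" by simp
qed (use UNIV_cylinder in auto)

context finite_borel
begin

lemma poisson_law_eq: "poisson_law \<nu> = scale_measure (ennreal (exp (- measure \<nu> UNIV))) (poisson_weight \<nu>)"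
  unfolding poisson_law_def poisson_normalized_def[symmetric]
  by (rule the_equality) (auto intro: poisson_process_normalized poisson_process_unique)

end

section \<open>Tree sums of a configuration\<close>

subsection \<open>Relabelling\<close>

lemma reach_image: "(u, v) \<in> reach T \<Longrightarrow> (\<sigma> u, \<sigma> v) \<in> reach ((`) \<sigma> ` T)"
proof (induction rule: reach_induct)
  case (step w z)
  have "{\<sigma> w, \<sigma> z} = \<sigma> ` {w, z}" by simp
  then have "{\<sigma> w, \<sigma> z} \<in> (`) \<sigma> ` T" using step(2) by blast
  with step(3) show ?case by (rule reach_step)
qed simp

lemma trees_on_image:
  assumes T: "T \<in> trees_on V" and inj: "inj_on \<sigma> V"
  shows "(`) \<sigma> ` T \<in> trees_on (\<sigma> ` V)"
proof -
  let ?T = "(`) \<sigma> ` T" and ?\<rho> = "inv_into V \<sigma>"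
  have sub: "e \<subseteq> V" if "e \<in> T" for e using that trees_subset[OF T] by (auto simp: edges_on_def)
  have "?T \<subseteq> edges_on (\<sigma> ` V)"
  proof
    fix e' assume "e' \<in> ?T"
    then obtain e where e: "e \<in> T" "e' = \<sigma> ` e" by auto
    then have "card e' = card e" using sub inj by (metis card_image inj_on_subset)
    then show "e' \<in> edges_on (\<sigma> ` V)"
      using e sub trees_subset[OF T] by (auto simp: edges_on_def)
  qed
  moreover have "(a, b) \<in> reach ?T" if "a \<in> \<sigma> ` V" "b \<in> \<sigma> ` V" for a b
    using that T by (auto simp: trees_on_def intro!: reach_image)
  moreover have "(a, b) \<notin> reach (?T - {{a, b}})" if ab: "{a, b} \<in> ?T" for a b
  proof
    assume r: "(a, b) \<in> reach (?T - {{a, b}})"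
    obtain e where e: "e \<in> T" "{a, b} = \<sigma> ` e" using ab by auto
    let ?u = "?\<rho> a" and ?v = "?\<rho> b"
    have inv: "?\<rho> ` \<sigma> ` f = f" if "f \<in> T" for f
      using sub[OF that] inj by (rule inv_into_image_cancel[rotated])
    have euv: "e = {?u, ?v}" using inv[OF e(1)] unfolding e(2)[symmetric] by simp
    have "(?u, ?v) \<in> reach ((`) ?\<rho> ` (?T - {{a, b}}))" using r by (rule reach_image)
    moreover have "(`) ?\<rho> ` (?T - {{a, b}}) \<subseteq> T - {{?u, ?v}}"
    proof
      fix f' assume "f' \<in> (`) ?\<rho> ` (?T - {{a, b}})"
      then obtain f where f: "f \<in> T" "\<sigma> ` f \<noteq> {a, b}" "f' = ?\<rho> ` \<sigma> ` f" by auto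
      then have "f' = f" using inv by simp
      moreover have "f \<noteq> e" using f(2) e(2) by auto
      ultimately show "f' \<in> T - {{?u, ?v}}" using f(1) euv by simp
    qed
    ultimately have "(?u, ?v) \<in> reach (T - {{?u, ?v}})" by (rule reach_mono[rotated])
    moreover have "\<forall>u v. {u, v} \<in> T \<longrightarrow> (u, v) \<notin> reach (T - {{u, v}})"
      using T by (simp add: trees_on_def)
    moreover have "{?u, ?v} \<in> T" using e(1) euv by simp
    ultimately show False by blast
  qed
  ultimately show ?thesis unfolding trees_on_def by blast
qed

lemma deg_image:
  assumes T: "T \<in> trees_on V" and inj: "inj_on \<sigma> V" and r: "r \<in> V"
  shows "deg ((`) \<sigma> ` T) (\<sigma> r) = deg T r"
proof -
  have sub: "e \<subseteq> V" if "e \<in> T" for e using that trees_subset[OF T] by (auto simp: edges_on_def)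
  have "\<sigma> r \<in> \<sigma> ` e \<longleftrightarrow> r \<in> e" if "e \<in> T" for e
    using inj_on_image_mem_iff[OF inj r sub[OF that]] .
  then have "{e \<in> (`) \<sigma> ` T. \<sigma> r \<in> e} = (`) \<sigma> ` {e \<in> T. r \<in> e}" by auto
  moreover have "inj_on ((`) \<sigma>) {e \<in> T. r \<in> e}"
    using inj_on_image_Pow[OF inj] by (rule inj_on_subset) (use sub in auto)
  ultimately show ?thesis
    by (simp add: deg_eq_card_edges[OF T] deg_eq_card_edges[OF trees_on_image[OF T inj]] card_image)
qed

text \<open>
  The tree sum does not depend on the names of the vertices. This allows passing from the enumeration chosen in
  \<open>tau\<close> to an arbitrary vertex set, on which removing a branch is possible without renumbering.
\<close>

lemma sum_trees_relabel:
  fixes w w' :: "nat set \<Rightarrow> 'b::comm_semiring_1"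
  assumes bij: "bij_betw \<sigma> V V'"
    and w: "\<And>u v. u \<in> V \<Longrightarrow> v \<in> V \<Longrightarrow> w' {\<sigma> u, \<sigma> v} = w {u, v}"
    and Q: "\<And>T. T \<in> trees_on V \<Longrightarrow> Q' ((`) \<sigma> ` T) \<longleftrightarrow> Q T"
  shows "(\<Sum>T\<in>{T\<in>trees_on V. Q T}. \<Prod>e\<in>T. w e) = (\<Sum>T\<in>{T\<in>trees_on V'. Q' T}. \<Prod>e\<in>T. w' e)"
proof -
  let ?\<rho> = "inv_into V \<sigma>"
  have inj: "inj_on \<sigma> V" and im: "\<sigma> ` V = V'" using bij by (auto simp: bij_betw_def)
  have inj': "inj_on ?\<rho> V'" and im': "?\<rho> ` V' = V"
    using bij_betw_inv_into[OF bij] by (auto simp: bij_betw_def)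
  have sub: "e \<subseteq> U" if "T \<in> trees_on U" "e \<in> T" for e T U
    using that trees_subset[OF that(1)] by (auto simp: edges_on_def)
  have 1: "(`) ?\<rho> ` (`) \<sigma> ` T = T" if "T \<in> trees_on V" for T
  proof -
    have "?\<rho> ` \<sigma> ` e = e" if "e \<in> T" for e
      using sub[OF \<open>T \<in> trees_on V\<close> that] inj by (rule inv_into_image_cancel[rotated])
    then show ?thesis by (simp add: image_image)
  qed
  have 2: "(`) \<sigma> ` (`) ?\<rho> ` T = T" if "T \<in> trees_on V'" for T
  proof -
    have "\<sigma> ` ?\<rho> ` e = e" if "e \<in> T" for e
      using sub[OF \<open>T \<in> trees_on V'\<close> that] im by (rule image_inv_into_cancel[rotated])
    then show ?thesis by (simp add: image_image)
  qed
  show ?thesis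
  proof (rule sum.reindex_bij_witness[where i = "(`) ((`) ?\<rho>)" and j = "(`) ((`) \<sigma>)"])
    fix T assume T: "T \<in> {T \<in> trees_on V. Q T}"
    show "(`) ?\<rho> ` (`) \<sigma> ` T = T" using 1 T by simp
    show "(`) \<sigma> ` T \<in> {T \<in> trees_on V'. Q' T}" using trees_on_image[of T V \<sigma>] inj im Q T by auto
    have "inj_on ((`) \<sigma>) T"
      using inj_on_image_Pow[OF inj] by (rule inj_on_subset) (use sub T in auto)
    then have "prod w' ((`) \<sigma> ` T) = (\<Prod>e\<in>T. w' (\<sigma> ` e))" by (simp add: prod.reindex)
    also have "\<dots> = prod w T"
    proof (rule prod.cong)
      fix e assume "e \<in> T"
      then have "e \<in> edges_on V" using T trees_subset by blast
      then obtain u v where "e = {u, v}" "u \<in> V" "v \<in> V" by (rule edges_onE)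
      then show "w' (\<sigma> ` e) = w e" using w by simp
    qed simp
    finally show "prod w' ((`) \<sigma> ` T) = prod w T" .
  next
    fix T assume T: "T \<in> {T \<in> trees_on V'. Q' T}"
    show "(`) \<sigma> ` (`) ?\<rho> ` T = T" using 2 T by simp
    have "(`) ?\<rho> ` T \<in> trees_on V" using trees_on_image[of T V' ?\<rho>] inj' im' T by simp
    then show "(`) ?\<rho> ` T \<in> {T \<in> trees_on V. Q T}" using Q 2 T by force
  qed
qed

lemma bij_betw_case_nat:
  assumes "bij_betw \<sigma> {0..<n} U" "u \<notin> U"
  shows "bij_betw (case_nat u \<sigma>) {0..<Suc n} (insert u U)"
proof -
  have im: "\<sigma> ` {0..<n} = U" and inj: "inj_on \<sigma> {0..<n}" using assms by (auto simp: bij_betw_def)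
  have "{0..<Suc n} = insert 0 (Suc ` {0..<n})" by (auto simp: image_iff)
  moreover have "case_nat u \<sigma> ` Suc ` {0..<n} = U"
    using im by (simp add: image_image del: image_Suc_atLeastLessThan)
  moreover have "inj_on (case_nat u \<sigma>) (insert 0 (Suc ` {0..<n}))"
    using inj assms(2) im by (auto simp: inj_on_def simp del: image_Suc_atLeastLessThan)
  ultimately show ?thesis by (simp add: bij_betw_def)
qed

lemma ex_labelling:
  assumes "mset xs = image_mset x (mset_set U)" "finite U"
  shows "\<exists>\<sigma>. bij_betw \<sigma> {0..<length xs} U \<and> (\<forall>i<length xs. x (\<sigma> i) = xs ! i)"
  using assms
proof (induction xs arbitrary: U)
  case Nil
  then have "U = {}" by (simp add: mset_set_empty_iff)
  then show ?case by (auto simp: bij_betw_def)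
next
  case (Cons a xs)
  have "a \<in># image_mset x (mset_set U)" using Cons.prems(1) by (metis list.set_intros(1) set_mset_mset)
  then obtain u where u: "u \<in> U" "a = x u" using Cons.prems(2) by auto
  have "mset_set U = add_mset u (mset_set (U - {u}))"
    using u Cons.prems(2) by (metis mset_set.remove)
  then have "mset xs = image_mset x (mset_set (U - {u}))" using Cons.prems(1) u by simp
  from Cons.IH[OF this] Cons.prems(2) obtain \<sigma> where
    s: "bij_betw \<sigma> {0..<length xs} (U - {u})" "\<forall>i<length xs. x (\<sigma> i) = xs ! i" by auto
  have "bij_betw (case_nat u \<sigma>) {0..<length (a # xs)} U"
    using bij_betw_case_nat[OF s(1), of u] u by (simp add: insert_absorb)
  moreover have "x (case_nat u \<sigma> i) = (a # xs) ! i" if "i < length (a # xs)" for i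
    using that s(2) u by (cases i) auto
  ultimately show ?case by blast
qed

definition labelled :: "(nat \<Rightarrow> 'a) \<Rightarrow> nat set \<Rightarrow> 'a multiset" where
  "labelled x V = image_mset x (mset_set V)"

lemma labelled_insert: "finite V \<Longrightarrow> v \<notin> V \<Longrightarrow> labelled x (insert v V) = add_mset (x v) (labelled x V)"
  by (simp add: labelled_def)

lemma labelled_empty [simp]: "labelled x {} = {#}"
  by (simp add: labelled_def)

lemma size_labelled: "size (labelled x V) = card V"
  by (simp add: labelled_def)

lemma sum_labelled: "(\<Sum>s\<in>#labelled x V. f s) = (\<Sum>v\<in>V. f (x v))"
  by (simp add: labelled_def image_mset.compositionality comp_def sum_unfold_sum_mset)

lemma image_labelled: "image_mset f (labelled x V) = labelled (\<lambda>v. f (x v)) V"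
  by (simp add: labelled_def image_mset.compositionality comp_def)

lemma labelled_nth: "labelled ((!) xs) {0..<length xs} = mset xs"
proof -
  have "mset_set {0..<length xs} = mset [0..<length xs]" by simp
  then have "labelled ((!) xs) {0..<length xs} = mset (map ((!) xs) [0..<length xs])"
    by (simp add: labelled_def)
  then show ?thesis by (simp only: map_nth)
qed

lemma ex_rooted_labelling:
  obtains V x r0 where "finite V" "r0 \<in> V" "x r0 = r" "labelled x (V - {r0}) = k"
proof -
  obtain xs where xs: "mset xs = k" using ex_mset by blast
  let ?V = "insert 0 (Suc ` {0..<length xs})"
  have "labelled ((!) (r # xs)) (?V - {0}) = labelled ((!) xs) {0..<length xs}"
  proof -
    have "?V - {0} = Suc ` {0..<length xs}" by auto
    moreover have "mset_set (Suc ` {0..<length xs}) = image_mset Suc (mset_set {0..<length xs})"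
      by (simp add: image_mset_mset_set del: image_Suc_atLeastLessThan)
    ultimately show ?thesis
      by (simp add: labelled_def image_mset.compositionality comp_def del: image_Suc_atLeastLessThan)
  qed
  then show ?thesis using that[of ?V 0 "(!) (r # xs)"] xs by (simp add: labelled_nth)
qed

text \<open>
  Sums over subsets of the vertices become sums over splittings of the configuration; this is why \<open>splits\<close> counts
  coinciding points as different individuals.
\<close>

lemma sum_subsets_eq_sum_splits:
  fixes F :: "'a multiset \<times> 'a multiset \<Rightarrow> 'b::comm_monoid_add"
  assumes "finite U"
  shows "(\<Sum>B\<in>Pow U. F (labelled x (U - B), labelled x B)) = (\<Sum>p\<in>#splits (labelled x U). F p)"
  using assms
proof (induction U arbitrary: F rule: finite_induct)
  case (insert a U)
  have fin: "finite B" if "B \<in> Pow U" for B using that insert.hyps(1) finite_subset by auto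
  have "(\<Sum>B\<in>Pow (insert a U). F (labelled x (insert a U - B), labelled x B)) =
    (\<Sum>B\<in>Pow U. F (labelled x (insert a U - B), labelled x B)) +
    (\<Sum>B\<in>insert a ` Pow U. F (labelled x (insert a U - B), labelled x B))"
    unfolding Pow_insert by (rule sum.union_disjoint) (use insert.hyps in auto)
  also have "(\<Sum>B\<in>Pow U. F (labelled x (insert a U - B), labelled x B)) =
    (\<Sum>B\<in>Pow U. F (add_mset (x a) (labelled x (U - B)), labelled x B))"
  proof (rule sum.cong)
    fix B assume B: "B \<in> Pow U"
    then have "insert a U - B = insert a (U - B)" using insert.hyps by auto
    then show "F (labelled x (insert a U - B), labelled x B) = F (add_mset (x a) (labelled x (U - B)), labelled x B)"
      using insert.hyps by (simp add: labelled_insert)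
  qed simp
  also have "(\<Sum>B\<in>insert a ` Pow U. F (labelled x (insert a U - B), labelled x B)) =
    (\<Sum>B\<in>Pow U. F (labelled x (insert a U - insert a B), labelled x (insert a B)))"
  proof (subst sum.reindex)
    show "inj_on (insert a) (Pow U)" using insert.hyps by (auto simp: inj_on_def)
  qed simp
  also have "\<dots> = (\<Sum>B\<in>Pow U. F (labelled x (U - B), add_mset (x a) (labelled x B)))"
  proof (rule sum.cong)
    fix B assume B: "B \<in> Pow U"
    then have "insert a U - insert a B = U - B" "a \<notin> B" using insert.hyps by auto
    then show "F (labelled x (insert a U - insert a B), labelled x (insert a B)) =
      F (labelled x (U - B), add_mset (x a) (labelled x B))"
      using fin[OF B] by (simp add: labelled_insert)
  qed simp
  finally show ?case
    using insert.IH[of "\<lambda>p. F (add_mset (x a) (fst p), snd p)"] insert.IH[of "\<lambda>p. F (fst p, add_mset (x a) (snd p))"]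
    unfolding labelled_insert[OF insert.hyps] sum_splits_add by simp
qed simp

text \<open>Summing the recursion at the root over all roots gives the recursion for an arbitrary edge.\<close>

lemma edge_recursion:
  fixes w :: "nat set \<Rightarrow> 'b::comm_semiring_1"
  assumes fin: "finite V"
  shows "(\<Sum>T\<in>trees_on V. of_nat (2 * card T) * (\<Prod>e\<in>T. w e)) =
    (\<Sum>B\<in>Pow V. (\<Sum>T\<in>trees_on (V - B). \<Prod>e\<in>T. w e) * (\<Sum>T\<in>trees_on B. \<Prod>e\<in>T. w e) *
       (\<Sum>r\<in>V - B. \<Sum>v\<in>B. w {r, v}))"
proof -
  let ?t = "\<lambda>V. \<Sum>T\<in>trees_on V. \<Prod>e\<in>T. w e"
  have deg_le: "deg T r < Suc (card V)" if "T \<in> trees_on U" "U \<subseteq> V" for T r U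
  proof -
    have "{v. {r, v} \<in> T} \<subseteq> V" using that trees_subset[OF that(1)] by (auto simp: edges_on_def)
    then show ?thesis using fin by (simp add: deg_def card_mono less_Suc_eq_le)
  qed
  have group: "(\<Sum>j<Suc (card V). \<Sum>T\<in>{T\<in>trees_on U. deg T r = j}. g T) = (\<Sum>T\<in>trees_on U. g T)"
    if "U \<subseteq> V" for U r and g :: "nat set set \<Rightarrow> 'b"
    by (rule sum.group) (use deg_le that finite_trees[OF finite_subset[OF that fin]] in auto)
  have root: "(\<Sum>T\<in>trees_on V. of_nat (deg T r) * (\<Prod>e\<in>T. w e)) =
      (\<Sum>B\<in>Pow (V - {r}). ?t (V - B) * ?t B * (\<Sum>v\<in>B. w {r, v}))" if r: "r \<in> V" for r
  proof -
    have "(\<Sum>T\<in>trees_on V. of_nat (deg T r) * (\<Prod>e\<in>T. w e)) =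
      (\<Sum>j<Suc (Suc (card V)). \<Sum>T\<in>{T\<in>trees_on V. deg T r = j}. of_nat (deg T r) * (\<Prod>e\<in>T. w e))"
      by (rule sum.group[symmetric]) (use deg_le[of _ V] finite_trees fin in \<open>auto intro: less_SucI\<close>)
    also have "\<dots> = (\<Sum>j<Suc (Suc (card V)). of_nat j * (\<Sum>T\<in>{T\<in>trees_on V. deg T r = j}. \<Prod>e\<in>T. w e))"
      unfolding sum_distrib_left by (intro sum.cong) auto
    also have "\<dots> = (\<Sum>j<Suc (card V). of_nat (Suc j) * (\<Sum>T\<in>{T\<in>trees_on V. deg T r = Suc j}. \<Prod>e\<in>T. w e))"
      by (subst sum.lessThan_Suc_shift) simp
    also have "\<dots> = (\<Sum>B\<in>Pow (V - {r}). \<Sum>j<Suc (card V).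
        (\<Sum>T\<in>{T\<in>trees_on (V - B). deg T r = j}. \<Prod>e\<in>T. w e) * (?t B * (\<Sum>v\<in>B. w {r, v})))"
      unfolding root_edge_recursion[OF fin r] by (subst sum.swap) (simp only: mult.assoc)
    also have "\<dots> = (\<Sum>B\<in>Pow (V - {r}). ?t (V - B) * (?t B * (\<Sum>v\<in>B. w {r, v})))"
      unfolding sum_distrib_right[symmetric] by (intro sum.cong refl, subst group) auto
    finally show ?thesis by (simp only: mult.assoc)
  qed
  have "(\<Sum>T\<in>trees_on V. of_nat (2 * card T) * (\<Prod>e\<in>T. w e)) =
    (\<Sum>T\<in>trees_on V. \<Sum>r\<in>V. of_nat (deg T r) * (\<Prod>e\<in>T. w e))"
    using handshake[OF _ fin] by (intro sum.cong refl) (simp only: sum_distrib_right[symmetric] of_nat_sum[symmetric])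
  also have "\<dots> = (\<Sum>r\<in>V. \<Sum>B\<in>Pow (V - {r}). ?t (V - B) * ?t B * (\<Sum>v\<in>B. w {r, v}))"
    by (subst sum.swap) (intro sum.cong refl root)
  also have "\<dots> = (\<Sum>(r, B)\<in>(SIGMA r:V. Pow (V - {r})). ?t (V - B) * ?t B * (\<Sum>v\<in>B. w {r, v}))"
    by (rule sum.Sigma) (use fin in auto)
  also have "\<dots> = (\<Sum>(B, r)\<in>(SIGMA B:Pow V. V - B). ?t (V - B) * ?t B * (\<Sum>v\<in>B. w {r, v}))"
    by (rule sum.reindex_bij_witness[where i = prod.swap and j = prod.swap]) auto
  also have "\<dots> = (\<Sum>B\<in>Pow V. \<Sum>r\<in>V - B. ?t (V - B) * ?t B * (\<Sum>v\<in>B. w {r, v}))"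
    by (rule sum.Sigma[symmetric]) (use fin in auto)
  finally show ?thesis by (simp only: sum_distrib_left)
qed

subsection \<open>Recursions for the tree sum\<close>

locale kernel =
  fixes \<kappa> :: "'a::polish_space \<Rightarrow> 'a \<Rightarrow> real" and K :: real
  assumes kappa_nonneg: "0 \<le> \<kappa> r s" and kappa_sym: "\<kappa> r s = \<kappa> s r"
    and kappa_cont: "continuous_on UNIV (\<lambda>z. \<kappa> (fst z) (snd z))"
    and kappa_le: "\<kappa> r s \<le> K"
begin

abbreviation edge_weight :: "(nat \<Rightarrow> 'a) \<Rightarrow> nat set \<Rightarrow> real" where
  "edge_weight x e \<equiv> \<kappa> (x (Min e)) (x (Max e))"

lemma edge_weight_pair: "edge_weight x {u, v} = \<kappa> (x u) (x v)"
  using kappa_sym by (cases u v rule: linorder_cases) (auto simp: min_def max_def)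

text \<open>The part of the tree sum of \<open>add_mset r k\<close> in which the distinguished point \<open>r\<close> has \<open>j\<close> neighbours.\<close>

definition rooted_tau :: "nat \<Rightarrow> 'a \<Rightarrow> 'a multiset \<Rightarrow> real" where
  "rooted_tau j r k = (let xs = (SOME xs. mset xs = k) in
     \<Sum>T\<in>{T\<in>trees_on {0..<Suc (length xs)}. deg T 0 = j}. \<Prod>e\<in>T. edge_weight ((!) (r # xs)) e)"

lemma tau_labelled:
  assumes "finite V" "V \<noteq> {}"
  shows "tau \<kappa> (labelled x V) = (\<Sum>T\<in>trees_on V. \<Prod>e\<in>T. edge_weight x e)"
proof -
  define xs where "xs = (SOME xs. mset xs = labelled x V)"
  have xs: "mset xs = labelled x V" unfolding xs_def by (rule someI_ex[OF ex_mset])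
  obtain \<sigma> where s: "bij_betw \<sigma> {0..<length xs} V" "\<forall>i<length xs. x (\<sigma> i) = xs ! i"
    using ex_labelling[OF xs[unfolded labelled_def] assms(1)] by blast
  have "labelled x V \<noteq> {#}" using assms by (simp add: labelled_def mset_set_empty_iff)
  then have "tau \<kappa> (labelled x V) = (\<Sum>T\<in>{T\<in>trees_on {0..<length xs}. True}. \<Prod>e\<in>T. edge_weight ((!) xs) e)"
    unfolding tau_def Let_def xs_def[symmetric] by (simp add: spanning_trees_eq_trees)
  also have "\<dots> = (\<Sum>T\<in>{T\<in>trees_on V. True}. \<Prod>e\<in>T. edge_weight x e)"
    by (rule sum_trees_relabel[OF s(1)]) (use s(2) in \<open>simp_all only: edge_weight_pair atLeastLessThan_iff\<close>)
  finally show ?thesis by simp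
qed

lemma rooted_tau_labelled:
  assumes V: "finite V" and r0: "r0 \<in> V"
  shows "rooted_tau j (x r0) (labelled x (V - {r0})) =
    (\<Sum>T\<in>{T\<in>trees_on V. deg T r0 = j}. \<Prod>e\<in>T. edge_weight x e)"
proof -
  define xs where "xs = (SOME xs. mset xs = labelled x (V - {r0}))"
  have xs: "mset xs = labelled x (V - {r0})" unfolding xs_def by (rule someI_ex[OF ex_mset])
  have "finite (V - {r0})" using V by simp
  then obtain \<sigma> where s: "bij_betw \<sigma> {0..<length xs} (V - {r0})" "\<forall>i<length xs. x (\<sigma> i) = xs ! i"
    using ex_labelling[OF xs[unfolded labelled_def]] by blast
  let ?s = "case_nat r0 \<sigma>"
  have b: "bij_betw ?s {0..<Suc (length xs)} V"
    using bij_betw_case_nat[OF s(1), of r0] r0 by (simp add: insert_absorb)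
  have x: "x (?s i) = (x r0 # xs) ! i" if "i < Suc (length xs)" for i
    using that s(2) by (cases i) auto
  have "inj_on ?s {0..<Suc (length xs)}" using b by (simp add: bij_betw_def)
  then have d: "deg ((`) ?s ` T) r0 = deg T 0" if "T \<in> trees_on {0..<Suc (length xs)}" for T
    using deg_image[OF that, of ?s 0] by simp
  show ?thesis
    unfolding rooted_tau_def Let_def xs_def[symmetric]
    by (rule sum_trees_relabel[OF b]) (use x d in \<open>simp_all only: edge_weight_pair atLeastLessThan_iff\<close>)
qed

lemma labelled_root:
  assumes "finite V" "r0 \<in> V"
  shows "labelled x V = add_mset (x r0) (labelled x (V - {r0}))"
  using labelled_insert[of "V - {r0}" r0 x] assms by (simp add: insert_absorb)

lemma tau_nonneg: "0 \<le> tau \<kappa> k"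
  unfolding tau_def Let_def by (auto intro!: sum_nonneg prod_nonneg kappa_nonneg)

lemma tau_empty [simp]: "tau \<kappa> {#} = 0"
  by (simp add: tau_def)

lemma rooted_tau_nonneg: "0 \<le> rooted_tau j r k"
  unfolding rooted_tau_def Let_def by (auto intro!: sum_nonneg prod_nonneg kappa_nonneg)

lemma tau_eq_sum_rooted_tau: "tau \<kappa> (add_mset r k) = (\<Sum>j\<le>size k. rooted_tau j r k)"
proof -
  obtain V x r0 where V: "finite V" "r0 \<in> V" "x r0 = r" "labelled x (V - {r0}) = k"
    by (rule ex_rooted_labelling)
  have "deg T r0 \<le> size k" if T: "T \<in> trees_on V" for T
  proof -
    have "{v. {r0, v} \<in> T} \<subseteq> V - {r0}" using trees_subset[OF T] by (auto simp: edges_on_def)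
    then have "deg T r0 \<le> card (V - {r0})" unfolding deg_def using V(1) by (intro card_mono) auto
    then show ?thesis using V(4) by (metis size_labelled)
  qed
  then have "(\<Sum>j\<le>size k. \<Sum>T\<in>{T\<in>trees_on V. deg T r0 = j}. \<Prod>e\<in>T. edge_weight x e) =
      (\<Sum>T\<in>trees_on V. \<Prod>e\<in>T. edge_weight x e)"
    by (intro sum.group) (use finite_trees V(1) in auto)
  also have "\<dots> = tau \<kappa> (add_mset r k)"
  proof -
    have "V \<noteq> {}" using V(2) by auto
    from tau_labelled[OF V(1) this, of x] show ?thesis
      using labelled_root[OF V(1,2), of x] V(3,4) by simp
  qed
  finally show ?thesis using rooted_tau_labelled[OF V(1,2), where x = x] V(3,4) by simp
qed

lemma rooted_tau_0: "rooted_tau 0 r k = (if k = {#} then 1 else 0)"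
proof -
  obtain V x r0 where V: "finite V" "r0 \<in> V" "x r0 = r" "labelled x (V - {r0}) = k"
    by (rule ex_rooted_labelling)
  have k: "k = {#} \<longleftrightarrow> V = {r0}"
    using V by (auto simp: labelled_def mset_set_empty_iff)
  have "{T\<in>trees_on V. deg T r0 = 0} = (if V = {r0} then {{}} else {})"
  proof (cases "V = {r0}")
    case True
    have "T = {}" if "T \<in> trees_on {r0}" for T
      using trees_subset[OF that] by (auto elim!: edges_onE)
    moreover have "{} \<in> trees_on {r0}" by (simp add: trees_on_def)
    ultimately show ?thesis using True by (auto simp: deg_def)
  next
    case False
    have "deg T r0 \<noteq> 0" if T: "T \<in> trees_on V" for T
    proof -
      obtain v where "{r0, v} \<in> T" using tree_has_root_edge[OF T V(2) False] .
      then show ?thesis using finite_nbrs[OF T V(1)] by (auto simp: deg_def)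
    qed
    then show ?thesis using False by auto
  qed
  then show ?thesis using rooted_tau_labelled[OF V(1,2), of 0 x] V(3,4) k by simp
qed

lemma rooted_tau_Suc:
  "real (Suc j) * rooted_tau (Suc j) r k =
    (\<Sum>p\<in>#splits k. rooted_tau j r (fst p) * tau \<kappa> (snd p) * (\<Sum>s\<in>#snd p. \<kappa> r s))"
proof -
  obtain V x r0 where V: "finite V" "r0 \<in> V" "x r0 = r" "labelled x (V - {r0}) = k"
    by (rule ex_rooted_labelling)
  let ?U = "V - {r0}"
  have "real (Suc j) * rooted_tau (Suc j) r k =
    (\<Sum>B\<in>Pow ?U. (\<Sum>T\<in>{T\<in>trees_on (V - B). deg T r0 = j}. \<Prod>e\<in>T. edge_weight x e) *
       (\<Sum>T\<in>trees_on B. \<Prod>e\<in>T. edge_weight x e) * (\<Sum>v\<in>B. edge_weight x {r0, v}))"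
    using rooted_tau_labelled[OF V(1,2), of "Suc j" x] V(3,4) root_edge_recursion[OF V(1,2), of j "edge_weight x"]
    by simp
  also have "\<dots> = (\<Sum>B\<in>Pow ?U. (\<lambda>p. rooted_tau j r (fst p) * tau \<kappa> (snd p) * (\<Sum>s\<in>#snd p. \<kappa> r s))
      (labelled x (?U - B), labelled x B))"
  proof (rule sum.cong)
    fix B assume B: "B \<in> Pow ?U"
    have "?U - B = (V - B) - {r0}" by auto
    then have "rooted_tau j r (labelled x (?U - B)) =
        (\<Sum>T\<in>{T\<in>trees_on (V - B). deg T r0 = j}. \<Prod>e\<in>T. edge_weight x e)"
      using rooted_tau_labelled[of "V - B" r0 j x] V B by auto
    moreover have "(\<Sum>s\<in>#labelled x B. \<kappa> r s) = (\<Sum>v\<in>B. edge_weight x {r0, v})"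
      using V(3) by (simp only: sum_labelled edge_weight_pair)
    moreover have "tau \<kappa> (labelled x B) = (\<Sum>T\<in>trees_on B. \<Prod>e\<in>T. edge_weight x e)" if "B \<noteq> {}"
      by (rule tau_labelled) (use B V(1) that finite_subset in auto)
    ultimately show "(\<Sum>T\<in>{T\<in>trees_on (V - B). deg T r0 = j}. \<Prod>e\<in>T. edge_weight x e) *
       (\<Sum>T\<in>trees_on B. \<Prod>e\<in>T. edge_weight x e) * (\<Sum>v\<in>B. edge_weight x {r0, v}) =
       (\<lambda>p. rooted_tau j r (fst p) * tau \<kappa> (snd p) * (\<Sum>s\<in>#snd p. \<kappa> r s)) (labelled x (?U - B), labelled x B)"
      by (cases "B = {}") (simp_all only: fst_conv snd_conv sum.empty mult_zero_right simp_thms)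
  qed simp
  also have "\<dots> = (\<Sum>p\<in>#splits (labelled x ?U). rooted_tau j r (fst p) * tau \<kappa> (snd p) * (\<Sum>s\<in>#snd p. \<kappa> r s))"
    by (rule sum_subsets_eq_sum_splits) (use V(1) in simp)
  finally show ?thesis using V(4) by simp
qed

lemma tau_edge_recursion:
  "2 * (real (size k) - 1) * tau \<kappa> k =
    (\<Sum>p\<in>#splits k. tau \<kappa> (fst p) * tau \<kappa> (snd p) * (\<Sum>r\<in>#fst p. \<Sum>s\<in>#snd p. \<kappa> r s))"
proof (cases "k = {#}")
  case False
  obtain xs where xs: "mset xs = k" using ex_mset by blast
  define V where "V = {0..<length xs}"
  define x where "x = (!) xs"
  have k: "labelled x V = k" using xs by (simp add: V_def x_def labelled_nth)
  have V: "finite V" "V \<noteq> {}" "card V = size k" using xs False by (auto simp: V_def)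
  have "2 * (real (size k) - 1) * tau \<kappa> k = (\<Sum>T\<in>trees_on V. real (2 * card T) * (\<Prod>e\<in>T. edge_weight x e))"
  proof -
    have "real (2 * card T) = 2 * (real (size k) - 1)" if "T \<in> trees_on V" for T
      using card_tree[OF that V(1,2)] V(3) by (simp add: algebra_simps)
    then show ?thesis
      unfolding k[symmetric] tau_labelled[OF V(1,2)] sum_distrib_left by (intro sum.cong) (auto simp: k)
  qed
  also have "\<dots> = (\<Sum>B\<in>Pow V. (\<lambda>p. tau \<kappa> (fst p) * tau \<kappa> (snd p) * (\<Sum>r\<in>#fst p. \<Sum>s\<in>#snd p. \<kappa> r s))
      (labelled x (V - B), labelled x B))"
    unfolding edge_recursion[OF V(1)]
  proof (rule sum.cong)
    fix B assume B: "B \<in> Pow V"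
    have fB: "finite B" using B V(1) finite_subset by auto
    have "(\<Sum>r\<in>#labelled x (V - B). \<Sum>s\<in>#labelled x B. \<kappa> r s) = (\<Sum>r\<in>V - B. \<Sum>v\<in>B. edge_weight x {r, v})"
      by (simp only: sum_labelled edge_weight_pair)
    moreover have "tau \<kappa> (labelled x B) = (\<Sum>T\<in>trees_on B. \<Prod>e\<in>T. edge_weight x e)" if "B \<noteq> {}"
      by (rule tau_labelled) (use fB that in auto)
    moreover have "tau \<kappa> (labelled x (V - B)) = (\<Sum>T\<in>trees_on (V - B). \<Prod>e\<in>T. edge_weight x e)" if "V - B \<noteq> {}"
      by (rule tau_labelled) (use V(1) that in auto)
    ultimately show "(\<Sum>T\<in>trees_on (V - B). \<Prod>e\<in>T. edge_weight x e) * (\<Sum>T\<in>trees_on B. \<Prod>e\<in>T. edge_weight x e) *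
       (\<Sum>r\<in>V - B. \<Sum>v\<in>B. edge_weight x {r, v}) =
      (\<lambda>p. tau \<kappa> (fst p) * tau \<kappa> (snd p) * (\<Sum>r\<in>#fst p. \<Sum>s\<in>#snd p. \<kappa> r s)) (labelled x (V - B), labelled x B)"
      by (cases "B = {}"; cases "V - B = {}")
        (simp_all only: fst_conv snd_conv sum.empty mult_zero_right sum.neutral_const simp_thms)
  qed simp
  also have "\<dots> = (\<Sum>p\<in>#splits (labelled x V). tau \<kappa> (fst p) * tau \<kappa> (snd p) * (\<Sum>r\<in>#fst p. \<Sum>s\<in>#snd p. \<kappa> r s))"
    by (rule sum_subsets_eq_sum_splits) (rule V(1))
  finally show ?thesis using k by simp
qed simp

subsection \<open>Measurability of the tree sum\<close>

text \<open>
  Moving every point to a nearby element of a countable dense set makes the tree sum a function of a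
  classified configuration, hence measurable, and by continuity of \<open>\<kappa>\<close> little is changed.
\<close>

definition dense_seq :: "nat \<Rightarrow> 'a" where
  "dense_seq = from_nat_into (SOME D. countable D \<and> (\<forall>X. open X \<longrightarrow> X \<noteq> {} \<longrightarrow> (\<exists>d\<in>D. d \<in> X)))"

definition nearby :: "nat \<Rightarrow> 'a \<Rightarrow> nat" where
  "nearby m x = (LEAST n. dist x (dense_seq n) < inverse (Suc m))"

lemma nearby: "dist x (dense_seq (nearby m x)) < inverse (Suc m)"
proof -
  define D :: "'a set" where "D = (SOME D. countable D \<and> (\<forall>X. open X \<longrightarrow> X \<noteq> {} \<longrightarrow> (\<exists>d\<in>D. d \<in> X)))"
  have "\<exists>D :: 'a set. countable D \<and> (\<forall>X. open X \<longrightarrow> X \<noteq> {} \<longrightarrow> (\<exists>d\<in>D. d \<in> X))"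
    by (rule countable_dense_setE) blast
  from someI_ex[OF this, folded D_def]
  have D: "countable D" "\<And>X. open X \<Longrightarrow> X \<noteq> {} \<Longrightarrow> \<exists>d\<in>D. d \<in> X" by simp_all
  have "ball x (inverse (Suc m)) \<noteq> {}" by simp
  then obtain d where d: "d \<in> D" "dist x d < inverse (Suc m)"
    using D(2)[of "ball x (inverse (Suc m))"] by auto
  then obtain n where "dense_seq n = d"
    using from_nat_into_surj[OF D(1) d(1)] unfolding dense_seq_def D_def[symmetric] by auto
  then have "dist x (dense_seq n) < inverse (Suc m)" using d(2) by simp
  then show ?thesis unfolding nearby_def
    by (rule LeastI[where P = "\<lambda>n. dist x (dense_seq n) < inverse (Suc m)"])
qed

lemma measurable_nearby [measurable]: "nearby m \<in> borel \<rightarrow>\<^sub>M count_space UNIV"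
  unfolding nearby_def[abs_def]
proof (rule measurable_Least)
  fix n
  have "open {x. dist x (dense_seq n) < inverse (real (Suc m))}"
    by (intro open_Collect_less continuous_intros)
  then show "Measurable.pred borel (\<lambda>x. dist x (dense_seq n) < inverse (real (Suc m)))"
    by (simp only: pred_def space_borel mem_Collect_eq simp_thms borel_open Collect_conj_eq Collect_mem_eq UNIV_I)
qed

lemma nearby_tendsto: "(\<lambda>m. dense_seq (nearby m x)) \<longlonglongrightarrow> x"
proof (rule metric_LIMSEQ_I)
  fix e :: real assume "0 < e"
  then obtain M where M: "inverse (real (Suc M)) < e" using reals_Archimedean by blast
  have "dist (dense_seq (nearby m x)) x < e" if "M \<le> m" for m
  proof -
    have "dist x (dense_seq (nearby m x)) < inverse (real (Suc m))" by (rule nearby)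
    also have "\<dots> \<le> inverse (real (Suc M))" using that by (simp add: le_imp_inverse_le)
    also note M
    finally show ?thesis by (simp only: dist_commute)
  qed
  then show "\<exists>M. \<forall>m\<ge>M. dist (dense_seq (nearby m x)) x < e" by blast
qed

lemma kappa_tendsto:
  assumes "f \<longlonglongrightarrow> r" "g \<longlonglongrightarrow> s"
  shows "(\<lambda>m. \<kappa> (f m) (g m)) \<longlonglongrightarrow> \<kappa> r s"
proof -
  have "isCont (\<lambda>z. \<kappa> (fst z) (snd z)) (r, s)"
    using kappa_cont by (simp add: continuous_on_eq_continuous_at)
  from isCont_tendsto_compose[OF this tendsto_Pair[OF assms]] show ?thesis by simp
qed

lemma measurable_config_limit:
  assumes "\<And>k. (\<lambda>m. F (image_mset (\<lambda>x. dense_seq (nearby m x)) k)) \<longlonglongrightarrow> (F k :: real)"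
  shows "F \<in> borel_measurable config_space"
proof (rule borel_measurable_LIMSEQ_real[OF assms])
  fix m
  have "(\<lambda>k. F (image_mset dense_seq (image_mset (nearby m) k))) \<in> borel_measurable config_space"
    by (rule measurable_compose[OF measurable_image_mset[OF measurable_nearby]]) simp
  then show "(\<lambda>k. F (image_mset (\<lambda>x. dense_seq (nearby m x)) k)) \<in> borel_measurable config_space"
    by (simp add: image_mset.compositionality comp_def)
qed

lemma measurable_tau [measurable]: "tau \<kappa> \<in> borel_measurable config_space"
proof (rule measurable_config_limit)
  fix k :: "'a multiset"
  show "(\<lambda>m. tau \<kappa> (image_mset (\<lambda>x. dense_seq (nearby m x)) k)) \<longlonglongrightarrow> tau \<kappa> k"
  proof (cases "k = {#}")
    case False
    obtain xs where xs: "mset xs = k" using ex_mset by blast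
    let ?V = "{0..<length xs}"
    have k: "k = labelled ((!) xs) ?V" using xs by (simp add: labelled_nth)
    have V: "finite ?V" "?V \<noteq> {}" using xs False by auto
    show ?thesis
      unfolding k image_labelled tau_labelled[OF V]
      by (intro tendsto_sum tendsto_prod kappa_tendsto nearby_tendsto)
  qed simp
qed

lemma measurable_rooted_tau [measurable]: "rooted_tau j r \<in> borel_measurable config_space"
proof (rule measurable_config_limit)
  fix k :: "'a multiset"
  obtain V x r0 where V: "finite V" "r0 \<in> V" "x r0 = r" "labelled x (V - {r0}) = k"
    by (rule ex_rooted_labelling)
  define y where "y m v = (if v = r0 then r else dense_seq (nearby m (x v)))" for m v
  have "labelled (\<lambda>v. dense_seq (nearby m (x v))) (V - {r0}) = labelled (y m) (V - {r0})" for m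
    unfolding labelled_def by (rule image_mset_cong) (use V(1) in \<open>simp add: y_def\<close>)
  then have "rooted_tau j r (image_mset (\<lambda>x. dense_seq (nearby m x)) k) =
      (\<Sum>T\<in>{T\<in>trees_on V. deg T r0 = j}. \<Prod>e\<in>T. edge_weight (y m) e)" for m
    using rooted_tau_labelled[OF V(1,2), of j "y m"] V(4)[symmetric] by (simp add: image_labelled y_def)
  moreover have "rooted_tau j r k = (\<Sum>T\<in>{T\<in>trees_on V. deg T r0 = j}. \<Prod>e\<in>T. edge_weight x e)"
    using rooted_tau_labelled[OF V(1,2), of j x] V(3,4) by simp
  moreover have "(\<lambda>m. y m v) \<longlonglongrightarrow> x v" for v
    using nearby_tendsto[of "x v"] V(3) by (cases "v = r0") (simp_all add: y_def)
  then have "(\<lambda>m. \<Sum>T\<in>{T\<in>trees_on V. deg T r0 = j}. \<Prod>e\<in>T. edge_weight (y m) e) \<longlonglongrightarrow>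
      (\<Sum>T\<in>{T\<in>trees_on V. deg T r0 = j}. \<Prod>e\<in>T. edge_weight x e)"
    by (intro tendsto_sum tendsto_prod kappa_tendsto)
  ultimately show "(\<lambda>m. rooted_tau j r (image_mset (\<lambda>x. dense_seq (nearby m x)) k)) \<longlonglongrightarrow> rooted_tau j r k"
    by simp
qed

end

section \<open>The operator norm and the minimal solution of the balance equation\<close>

subsection \<open>Bounds for the operator norm\<close>

locale kernel_measure = kernel \<kappa> K + finite_borel \<nu>
  for \<kappa> :: "'a::polish_space \<Rightarrow> 'a \<Rightarrow> real" and K :: real and \<nu> :: "'a measure"

context kernel
begin

lemma K_nonneg: "0 \<le> K"
  using kappa_nonneg kappa_le order_trans by blast

lemma measurable_kappa [measurable]: "(\<lambda>z. \<kappa> (fst z) (snd z)) \<in> borel_measurable (borel \<Otimes>\<^sub>M borel)"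
  unfolding borel_prod using kappa_cont by (rule borel_measurable_continuous_onI)

lemma measurable_kappa' [measurable (raw)]:
  assumes [measurable]: "f \<in> N \<rightarrow>\<^sub>M borel" "g \<in> N \<rightarrow>\<^sub>M borel"
  shows "(\<lambda>x. \<kappa> (f x) (g x)) \<in> borel_measurable N"
  using measurable_compose[OF measurable_Pair[OF assms] measurable_kappa] by simp

end

context kernel_measure
begin

lemma integrable_bounded:
  assumes "f \<in> borel_measurable borel" "\<And>x. \<bar>f x\<bar> \<le> (C :: real)"
  shows "integrable \<nu> f"
  by (rule integrable_const_bound[where B = C]) (use assms in \<open>auto intro: measurable_nu\<close>)

lemma kappa_times_bound:
  assumes "\<bar>f s\<bar> \<le> C"
  shows "\<bar>\<kappa> r s * f s\<bar> \<le> K * C"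
  unfolding abs_mult using kappa_nonneg[of r s] kappa_le[of r s] assms
  by (intro mult_mono) auto

lemma integrable_kappa_times:
  assumes [measurable]: "f \<in> borel_measurable borel" and "\<And>x. \<bar>f x\<bar> \<le> C"
  shows "integrable \<nu> (\<lambda>s. \<kappa> r s * f s)"
  by (rule integrable_bounded[where C = "K * C"]) (use assms kappa_times_bound in auto)

lemma integrable_kappa: "integrable \<nu> (\<kappa> r)"
  using integrable_kappa_times[of "\<lambda>_. 1" 1 r] by simp

lemma measurable_T_op [measurable]:
  assumes [measurable]: "f \<in> borel_measurable borel"
  shows "T_op \<kappa> \<nu> f \<in> borel_measurable borel"
  unfolding T_op_def[abs_def] by (rule borel_measurable_lebesgue_integral) measurable

lemma kap_eq_T_op: "kap \<kappa> \<nu> = T_op \<kappa> \<nu> (\<lambda>_. 1)"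
  by (simp add: kap_def T_op_def fun_eq_iff)

lemma measurable_kap [measurable]: "kap \<kappa> \<nu> \<in> borel_measurable borel"
  unfolding kap_eq_T_op by measurable

lemma T_op_nonneg: "(\<And>x. 0 \<le> f x) \<Longrightarrow> 0 \<le> T_op \<kappa> \<nu> f r"
  unfolding T_op_def by (intro Bochner_Integration.integral_nonneg mult_nonneg_nonneg kappa_nonneg)

lemma T_op_mono:
  assumes "f \<in> borel_measurable borel" "g \<in> borel_measurable borel" "\<And>x. \<bar>f x\<bar> \<le> C" "\<And>x. \<bar>g x\<bar> \<le> D"
    and "AE x in \<nu>. f x \<le> g x"
  shows "T_op \<kappa> \<nu> f r \<le> T_op \<kappa> \<nu> g r"
  unfolding T_op_def
  by (rule integral_mono_AE)
    (use assms integrable_kappa_times[OF assms(1,3)] integrable_kappa_times[OF assms(2,4)] in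
      \<open>auto intro!: mult_left_mono kappa_nonneg elim!: eventually_mono\<close>)

lemma T_op_abs_le:
  assumes "integrable \<nu> f"
  shows "\<bar>T_op \<kappa> \<nu> f r\<bar> \<le> K * (\<integral>x. \<bar>f x\<bar> \<partial>\<nu>)"
proof -
  have "\<bar>T_op \<kappa> \<nu> f r\<bar> \<le> (\<integral>s. \<bar>\<kappa> r s * f s\<bar> \<partial>\<nu>)"
    unfolding T_op_def by (rule integral_abs_bound)
  also have "\<dots> \<le> (\<integral>s. K * \<bar>f s\<bar> \<partial>\<nu>)"
    by (rule integral_mono') (use assms kappa_nonneg kappa_le K_nonneg in \<open>auto simp: abs_mult intro!: mult_right_mono\<close>)
  finally show ?thesis by simp
qed

lemma T_op_bounded:
  assumes "f \<in> borel_measurable borel" "\<And>x. \<bar>f x\<bar> \<le> C"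
  shows "\<bar>T_op \<kappa> \<nu> f r\<bar> \<le> K * (C * measure \<nu> UNIV)"
proof -
  have "\<bar>T_op \<kappa> \<nu> f r\<bar> \<le> K * (\<integral>x. \<bar>f x\<bar> \<partial>\<nu>)"
    by (rule T_op_abs_le) (rule integrable_bounded[OF assms])
  also have "\<dots> \<le> K * (\<integral>x. C \<partial>\<nu>)"
    using assms integrable_bounded[OF assms] K_nonneg by (intro mult_left_mono integral_mono) auto
  finally show ?thesis by (simp add: mult_ac)
qed

lemma kap_nonneg: "0 \<le> kap \<kappa> \<nu> r"
  unfolding kap_eq_T_op by (rule T_op_nonneg) simp

lemma kap_le: "kap \<kappa> \<nu> r \<le> K * measure \<nu> UNIV"
  using T_op_bounded[of "\<lambda>_. 1" 1 r] by (simp add: kap_eq_T_op)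

abbreviation unit_ball :: "('a \<Rightarrow> real) set" where
  "unit_ball \<equiv> {f \<in> borel_measurable borel. integrable \<nu> (\<lambda>r. (f r)\<^sup>2) \<and> sqrt (\<integral>r. (f r)\<^sup>2 \<partial>\<nu>) \<le> 1}"

lemma unit_ball_integrable:
  assumes "f \<in> unit_ball"
  shows "integrable \<nu> f" and "(\<integral>x. \<bar>f x\<bar> \<partial>\<nu>) \<le> (measure \<nu> UNIV + 1) / 2"
proof -
  have [measurable]: "f \<in> borel_measurable borel" and i: "integrable \<nu> (\<lambda>r. (f r)\<^sup>2)"
    and le: "(\<integral>r. (f r)\<^sup>2 \<partial>\<nu>) \<le> 1" using assms by auto
  have b: "\<bar>f x\<bar> \<le> (1 + (f x)\<^sup>2) / 2" for x
    using zero_le_power2[of "\<bar>f x\<bar> - 1"] by (simp add: power2_eq_square algebra_simps)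
  have i2: "integrable \<nu> (\<lambda>x. (1 + (f x)\<^sup>2) / 2)" using i by simp
  show f: "integrable \<nu> f"
    by (rule Bochner_Integration.integrable_bound[OF i2]) (use b in \<open>auto intro: measurable_nu\<close>)
  have "(\<integral>x. \<bar>f x\<bar> \<partial>\<nu>) \<le> (\<integral>x. (1 + (f x)\<^sup>2) / 2 \<partial>\<nu>)"
    by (rule integral_mono) (use f i2 b in auto)
  also have "\<dots> = (measure \<nu> UNIV + (\<integral>r. (f r)\<^sup>2 \<partial>\<nu>)) / 2" using i by simp
  finally show "(\<integral>x. \<bar>f x\<bar> \<partial>\<nu>) \<le> (measure \<nu> UNIV + 1) / 2" using le by simp
qed

lemma bdd_above_op_norm: "bdd_above ((\<lambda>f. sqrt (\<integral>r. (T_op \<kappa> \<nu> f r)\<^sup>2 \<partial>\<nu>)) ` unit_ball)"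
proof (rule bdd_aboveI2)
  fix f assume f: "f \<in> unit_ball"
  then have [measurable]: "f \<in> borel_measurable borel" by simp
  let ?C = "K * ((measure \<nu> UNIV + 1) / 2)"
  have "\<bar>T_op \<kappa> \<nu> f r\<bar> \<le> ?C" for r
    using T_op_abs_le[OF unit_ball_integrable(1)[OF f], of r] unit_ball_integrable(2)[OF f] K_nonneg
    by (meson mult_left_mono order_trans)
  then have le: "(T_op \<kappa> \<nu> f r)\<^sup>2 \<le> ?C\<^sup>2" for r by (metis abs_ge_zero power2_abs power_mono)
  have "(\<integral>r. (T_op \<kappa> \<nu> f r)\<^sup>2 \<partial>\<nu>) \<le> (\<integral>r. ?C\<^sup>2 \<partial>\<nu>)"
    by (rule integral_mono) (use le in \<open>auto intro!: integrable_bounded[where C = "?C\<^sup>2"]\<close>)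
  then show "sqrt (\<integral>r. (T_op \<kappa> \<nu> f r)\<^sup>2 \<partial>\<nu>) \<le> sqrt (?C\<^sup>2 * measure \<nu> UNIV)"
    by (simp add: mult.commute)
qed

lemma op_norm_bound:
  assumes f[measurable]: "f \<in> borel_measurable borel" and C: "\<And>x. \<bar>f x\<bar> \<le> C"
  shows "(\<integral>r. (T_op \<kappa> \<nu> f r)\<^sup>2 \<partial>\<nu>) \<le> (op_norm_L2 \<kappa> \<nu>)\<^sup>2 * (\<integral>r. (f r)\<^sup>2 \<partial>\<nu>)"
proof -
  define s where "s = (\<integral>r. (f r)\<^sup>2 \<partial>\<nu>)"
  have i: "integrable \<nu> (\<lambda>r. (f r)\<^sup>2)"
    by (rule integrable_bounded[where C = "C\<^sup>2"]) (use C in \<open>auto simp: abs_le_square_iff[symmetric] intro: order_trans[OF _ abs_ge_self]\<close>)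
  have s0: "0 \<le> s" unfolding s_def by simp
  show ?thesis
  proof (cases "s = 0")
    case True
    then have "AE r in \<nu>. (f r)\<^sup>2 = 0"
      unfolding s_def using i by (subst (asm) integral_nonneg_eq_0_iff_AE) auto
    then have "T_op \<kappa> \<nu> f r = 0" for r
      unfolding T_op_def by (intro integral_eq_zero_AE) (auto elim!: eventually_mono)
    then show ?thesis using True unfolding s_def by simp
  next
    case False
    with s0 have sp: "0 < s" by simp
    define g where "g x = f x / sqrt s" for x
    have g2: "(g x)\<^sup>2 = (f x)\<^sup>2 / s" for x using sp by (simp add: g_def power_divide)
    have "integrable \<nu> (\<lambda>x. (g x)\<^sup>2)" "(\<integral>x. (g x)\<^sup>2 \<partial>\<nu>) = 1"
      unfolding g2 using i sp by (simp_all add: s_def)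
    moreover have "g \<in> borel_measurable borel" unfolding g_def[abs_def] by measurable
    ultimately have g: "g \<in> unit_ball" by simp
    have Tg: "T_op \<kappa> \<nu> g r = T_op \<kappa> \<nu> f r / sqrt s" for r
      unfolding T_op_def g_def by simp
    have "sqrt (\<integral>r. (T_op \<kappa> \<nu> g r)\<^sup>2 \<partial>\<nu>) \<le> op_norm_L2 \<kappa> \<nu>"
      unfolding op_norm_L2_def by (rule cSUP_upper[OF g bdd_above_op_norm])
    then have "(sqrt (\<integral>r. (T_op \<kappa> \<nu> g r)\<^sup>2 \<partial>\<nu>))\<^sup>2 \<le> (op_norm_L2 \<kappa> \<nu>)\<^sup>2"
      by (intro power_mono) auto
    then have "(\<integral>r. (T_op \<kappa> \<nu> g r)\<^sup>2 \<partial>\<nu>) \<le> (op_norm_L2 \<kappa> \<nu>)\<^sup>2" by simp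
    then show ?thesis
      using sp unfolding Tg s_def[symmetric] by (simp add: power_divide divide_le_eq)
  qed
qed

lemma op_norm_nonneg: "0 \<le> op_norm_L2 \<kappa> \<nu>"
proof -
  have "sqrt (\<integral>r. (T_op \<kappa> \<nu> (\<lambda>_. 0) r)\<^sup>2 \<partial>\<nu>) \<le> op_norm_L2 \<kappa> \<nu>"
    unfolding op_norm_L2_def by (rule cSUP_upper[OF _ bdd_above_op_norm]) simp
  then show ?thesis by (simp add: T_op_def)
qed

text \<open>
  Schur's test. The weight \<open>h\<close> is split off by the Cauchy-Schwarz inequality, and symmetry of the
  kernel allows using the same bound for both variables.
\<close>

lemma op_norm_le_schur:
  assumes h[measurable]: "h \<in> borel_measurable borel" and h0: "\<And>x. 0 < h x" and hC: "\<And>x. h x \<le> C"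
    and \<rho>: "0 \<le> \<rho>" and Th: "\<And>r. T_op \<kappa> \<nu> h r \<le> \<rho> * h r"
  shows "op_norm_L2 \<kappa> \<nu> \<le> \<rho>"
  unfolding op_norm_L2_def
proof (rule cSUP_least)
  show "unit_ball \<noteq> {}" by (auto intro!: exI[of _ "\<lambda>_. 0"])
next
  fix f assume f: "f \<in> unit_ball"
  then have [measurable]: "f \<in> borel_measurable borel" and i: "integrable \<nu> (\<lambda>r. (f r)\<^sup>2)"
    and le: "(\<integral>r. (f r)\<^sup>2 \<partial>\<nu>) \<le> 1" by auto
  interpret pair_sigma_finite \<nu> \<nu> ..
  have ih: "(\<integral>\<^sup>+s. ennreal (\<kappa> r s * h s) \<partial>\<nu>) \<le> ennreal (\<rho> * h r)" for r
  proof -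
    have "integrable \<nu> (\<lambda>s. \<kappa> r s * h s)"
      by (rule integrable_kappa_times[where C = C]) (use h0 hC in \<open>auto simp: abs_of_pos\<close>)
    then have "(\<integral>\<^sup>+s. ennreal (\<kappa> r s * h s) \<partial>\<nu>) = ennreal (T_op \<kappa> \<nu> h r)"
      unfolding T_op_def using h0 kappa_nonneg by (intro nn_integral_eq_integral) (auto simp: less_imp_le)
    then show ?thesis using Th by (simp add: ennreal_leI)
  qed
  have pw: "ennreal ((T_op \<kappa> \<nu> f r)\<^sup>2) \<le> ennreal (\<rho> * h r) * (\<integral>\<^sup>+s. ennreal (\<kappa> r s * (f s)\<^sup>2 / h s) \<partial>\<nu>)" for r
  proof -
    have "ennreal \<bar>T_op \<kappa> \<nu> f r\<bar> \<le> (\<integral>\<^sup>+s. ennreal \<bar>\<kappa> r s * f s\<bar> \<partial>\<nu>)"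
    proof (cases "integrable \<nu> (\<lambda>s. \<kappa> r s * f s)")
      case True
      then show ?thesis unfolding T_op_def using integral_norm_bound_ennreal[OF True] by simp
    qed (simp add: T_op_def not_integrable_integral_eq)
    then have "(ennreal \<bar>T_op \<kappa> \<nu> f r\<bar>)\<^sup>2 \<le> (\<integral>\<^sup>+s. ennreal \<bar>\<kappa> r s * f s\<bar> \<partial>\<nu>)\<^sup>2"
      by (intro power_mono) auto
    also have "(\<integral>\<^sup>+s. ennreal \<bar>\<kappa> r s * f s\<bar> \<partial>\<nu>) =
      (\<integral>\<^sup>+s. ennreal (sqrt (\<kappa> r s * h s)) * ennreal (sqrt (\<kappa> r s / h s) * \<bar>f s\<bar>) \<partial>\<nu>)"
    proof (rule nn_integral_cong)
      fix s
      have "sqrt (\<kappa> r s * h s) * sqrt (\<kappa> r s / h s) = \<kappa> r s"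
        using h0[of s] kappa_nonneg[of r s] by (simp add: real_sqrt_mult[symmetric])
      then have "\<bar>\<kappa> r s * f s\<bar> = sqrt (\<kappa> r s * h s) * (sqrt (\<kappa> r s / h s) * \<bar>f s\<bar>)"
        using kappa_nonneg[of r s] by (simp add: abs_mult mult.assoc[symmetric])
      then show "ennreal \<bar>\<kappa> r s * f s\<bar> =
        ennreal (sqrt (\<kappa> r s * h s)) * ennreal (sqrt (\<kappa> r s / h s) * \<bar>f s\<bar>)"
        using h0[of s] kappa_nonneg[of r s] by (simp add: ennreal_mult less_imp_le)
    qed
    also have "\<dots>\<^sup>2 \<le> (\<integral>\<^sup>+s. (ennreal (sqrt (\<kappa> r s * h s)))\<^sup>2 \<partial>\<nu>) *
      (\<integral>\<^sup>+s. (ennreal (sqrt (\<kappa> r s / h s) * \<bar>f s\<bar>))\<^sup>2 \<partial>\<nu>)"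
      by (rule Cauchy_Schwarz_nn_integral) measurable
    also have "(\<integral>\<^sup>+s. (ennreal (sqrt (\<kappa> r s * h s)))\<^sup>2 \<partial>\<nu>) = (\<integral>\<^sup>+s. ennreal (\<kappa> r s * h s) \<partial>\<nu>)"
      using h0 kappa_nonneg by (intro nn_integral_cong) (simp add: ennreal_power less_imp_le)
    also have "(\<integral>\<^sup>+s. (ennreal (sqrt (\<kappa> r s / h s) * \<bar>f s\<bar>))\<^sup>2 \<partial>\<nu>) = (\<integral>\<^sup>+s. ennreal (\<kappa> r s * (f s)\<^sup>2 / h s) \<partial>\<nu>)"
      using h0 kappa_nonneg by (intro nn_integral_cong) (simp add: ennreal_power power_mult_distrib less_imp_le)
    also have "(\<integral>\<^sup>+s. ennreal (\<kappa> r s * h s) \<partial>\<nu>) * (\<integral>\<^sup>+s. ennreal (\<kappa> r s * (f s)\<^sup>2 / h s) \<partial>\<nu>) \<le>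
      ennreal (\<rho> * h r) * (\<integral>\<^sup>+s. ennreal (\<kappa> r s * (f s)\<^sup>2 / h s) \<partial>\<nu>)"
      by (intro mult_right_mono ih) simp
    finally show ?thesis by (simp add: ennreal_power)
  qed
  have "(\<integral>\<^sup>+r. ennreal ((T_op \<kappa> \<nu> f r)\<^sup>2) \<partial>\<nu>) \<le>
    (\<integral>\<^sup>+r. \<integral>\<^sup>+s. ennreal (\<rho> * h r) * ennreal (\<kappa> r s * (f s)\<^sup>2 / h s) \<partial>\<nu> \<partial>\<nu>)"
    by (rule nn_integral_mono) (use pw in \<open>simp add: nn_integral_cmult\<close>)
  also have "\<dots> = (\<integral>\<^sup>+s. \<integral>\<^sup>+r. ennreal (\<rho> * h r) * ennreal (\<kappa> r s * (f s)\<^sup>2 / h s) \<partial>\<nu> \<partial>\<nu>)"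
    by (rule Fubini') measurable
  also have "\<dots> = (\<integral>\<^sup>+s. ennreal (\<rho> * (f s)\<^sup>2 / h s) * (\<integral>\<^sup>+r. ennreal (\<kappa> s r * h r) \<partial>\<nu>) \<partial>\<nu>)"
  proof (rule nn_integral_cong)
    fix s
    have "ennreal (\<rho> * h r) * ennreal (\<kappa> r s * (f s)\<^sup>2 / h s) = ennreal (\<rho> * (f s)\<^sup>2 / h s) * ennreal (\<kappa> s r * h r)" for r
      using \<rho> h0[of r] h0[of s] kappa_nonneg[of r s] kappa_sym[of r s]
      by (simp add: ennreal_mult[symmetric] mult_ac less_imp_le)
    then show "(\<integral>\<^sup>+r. ennreal (\<rho> * h r) * ennreal (\<kappa> r s * (f s)\<^sup>2 / h s) \<partial>\<nu>) =
      ennreal (\<rho> * (f s)\<^sup>2 / h s) * (\<integral>\<^sup>+r. ennreal (\<kappa> s r * h r) \<partial>\<nu>)"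
      by (simp add: nn_integral_cmult)
  qed
  also have "\<dots> \<le> (\<integral>\<^sup>+s. ennreal (\<rho> * (f s)\<^sup>2 / h s) * ennreal (\<rho> * h s) \<partial>\<nu>)"
    by (intro nn_integral_mono mult_left_mono ih) simp
  also have "\<dots> = (\<integral>\<^sup>+s. ennreal (\<rho>\<^sup>2 * (f s)\<^sup>2) \<partial>\<nu>)"
  proof (rule nn_integral_cong)
    fix s
    have "(\<rho> * (f s)\<^sup>2 / h s) * (\<rho> * h s) = \<rho>\<^sup>2 * (f s)\<^sup>2"
      using h0[of s] by (simp add: power2_eq_square field_simps)
    then show "ennreal (\<rho> * (f s)\<^sup>2 / h s) * ennreal (\<rho> * h s) = ennreal (\<rho>\<^sup>2 * (f s)\<^sup>2)"
      using \<rho> h0[of s] by (simp add: ennreal_mult[symmetric] less_imp_le)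
  qed
  also have "\<dots> = ennreal (\<rho>\<^sup>2 * (\<integral>s. (f s)\<^sup>2 \<partial>\<nu>))"
    using i by (subst nn_integral_eq_integral) auto
  also have "\<dots> \<le> ennreal (\<rho>\<^sup>2)"
    using le by (intro ennreal_leI) (simp add: mult_left_le)
  finally have nn: "(\<integral>\<^sup>+r. ennreal ((T_op \<kappa> \<nu> f r)\<^sup>2) \<partial>\<nu>) \<le> ennreal (\<rho>\<^sup>2)" .
  have "(\<integral>r. (T_op \<kappa> \<nu> f r)\<^sup>2 \<partial>\<nu>) = enn2real (\<integral>\<^sup>+r. ennreal ((T_op \<kappa> \<nu> f r)\<^sup>2) \<partial>\<nu>)"
    by (rule integral_eq_nn_integral) (auto intro: measurable_nu)
  also have "\<dots> \<le> \<rho>\<^sup>2"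
    using enn2real_mono[OF nn] by simp
  finally show "sqrt (\<integral>r. (T_op \<kappa> \<nu> f r)\<^sup>2 \<partial>\<nu>) \<le> \<rho>"
    using \<rho> by (rule real_le_lsqrt[rotated])
qed

lemma kernel_measure_density:
  assumes "\<beta> \<in> borel_measurable borel" "\<And>x. \<beta> x \<le> C"
  shows "kernel_measure \<kappa> K (density \<nu> (\<lambda>x. ennreal (\<beta> x)))"
  using finite_borel_density[OF assms] by (intro kernel_measure.intro) (rule kernel_axioms)

lemma T_op_density:
  assumes "\<beta> \<in> borel_measurable borel" "\<And>x. 0 \<le> \<beta> x" "f \<in> borel_measurable borel"
  shows "T_op \<kappa> (density \<nu> (\<lambda>x. ennreal (\<beta> x))) f r = T_op \<kappa> \<nu> (\<lambda>s. \<beta> s * f s) r"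
  unfolding T_op_def using assms by (subst integral_density) (auto simp: mult_ac intro!: measurable_nu)

lemma kap_density:
  assumes "\<beta> \<in> borel_measurable borel" "\<And>x. 0 \<le> \<beta> x"
  shows "kap \<kappa> (density \<nu> (\<lambda>x. ennreal (\<beta> x))) r = T_op \<kappa> \<nu> \<beta> r"
  using T_op_density[OF assms, of "\<lambda>_. 1" r] by (simp add: kap_def T_op_def)

subsection \<open>The minimal solution\<close>

text \<open>
  In terms of the density \<open>\<eta>\<close> of \<open>c - b\<close> with respect to \<open>c\<close>, the balance equation reads
  \<open>\<eta> = T \<eta> / (1 + T \<eta>)\<close>. The right-hand side is monotone in \<open>\<eta>\<close>, so iterating it from \<open>\<eta> = 1\<close>
  decreases to the largest solution, which gives the smallest \<open>b\<close>.
\<close>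

primrec balance_iter :: "nat \<Rightarrow> 'a \<Rightarrow> real" where
  "balance_iter 0 = (\<lambda>_. 1)"
| "balance_iter (Suc n) = (\<lambda>r. T_op \<kappa> \<nu> (balance_iter n) r / (1 + T_op \<kappa> \<nu> (balance_iter n) r))"

definition balance_lim :: "'a \<Rightarrow> real" where
  "balance_lim r = (INF n. balance_iter n r)"

lemma ratio_mono: "0 \<le> a \<Longrightarrow> a \<le> b \<Longrightarrow> a / (1 + a) \<le> b / (1 + (b :: real))"
  by (simp add: field_simps)

lemma balance_iter_range [measurable]: "balance_iter n \<in> borel_measurable borel"
  and balance_iter_nonneg: "0 \<le> balance_iter n r"
  and balance_iter_le_1: "balance_iter n r \<le> 1"
proof -
  have "balance_iter n \<in> borel_measurable borel \<and> (\<forall>r. 0 \<le> balance_iter n r \<and> balance_iter n r \<le> 1)"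
  proof (induction n)
    case (Suc n)
    then have [measurable]: "balance_iter n \<in> borel_measurable borel" by simp
    have "0 \<le> T_op \<kappa> \<nu> (balance_iter n) r" for r by (rule T_op_nonneg) (use Suc in simp)
    then show ?case by (auto simp: field_simps add_pos_nonneg)
  qed simp
  then show "balance_iter n \<in> borel_measurable borel" "0 \<le> balance_iter n r" "balance_iter n r \<le> 1" by auto
qed

lemma balance_iter_abs: "\<bar>balance_iter n r\<bar> \<le> 1"
  using balance_iter_nonneg balance_iter_le_1 by simp

lemma balance_iter_Suc_le: "balance_iter (Suc n) r \<le> balance_iter n r"
proof (induction n arbitrary: r)
  case 0
  show ?case using balance_iter_le_1[of "Suc 0"] by simp
next
  case (Suc n)
  have "T_op \<kappa> \<nu> (balance_iter (Suc n)) r \<le> T_op \<kappa> \<nu> (balance_iter n) r" for r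
    by (rule T_op_mono[OF balance_iter_range balance_iter_range balance_iter_abs balance_iter_abs])
      (intro AE_I2 Suc.IH)
  moreover have "0 \<le> T_op \<kappa> \<nu> (balance_iter (Suc n)) r" for r
    by (rule T_op_nonneg) (rule balance_iter_nonneg)
  ultimately show ?case unfolding balance_iter.simps(2)[of "Suc n"] balance_iter.simps(2)[of n]
    by (metis balance_iter.simps(2) ratio_mono)
qed

lemma balance_iter_tendsto: "(\<lambda>n. balance_iter n r) \<longlonglongrightarrow> balance_lim r"
  unfolding balance_lim_def
proof (rule LIMSEQ_decseq_INF)
  show "bdd_below (range (\<lambda>n. balance_iter n r))"
    by (rule bdd_belowI2[of _ 0]) (rule balance_iter_nonneg)
  show "decseq (\<lambda>n. balance_iter n r)"
    using balance_iter_Suc_le by (rule decseq_SucI)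
qed

lemma balance_lim_le_iter: "balance_lim r \<le> balance_iter n r"
  unfolding balance_lim_def
  by (rule cINF_lower) (auto intro!: bdd_belowI2[of _ 0] balance_iter_nonneg)

lemma balance_lim_nonneg: "0 \<le> balance_lim r"
  by (rule LIMSEQ_le_const[OF balance_iter_tendsto]) (use balance_iter_nonneg in auto)

lemma balance_lim_le_1: "balance_lim r \<le> 1"
  using balance_lim_le_iter[of r 0] by simp

lemma measurable_balance_lim [measurable]: "balance_lim \<in> borel_measurable borel"
  by (rule borel_measurable_LIMSEQ_real[OF balance_iter_tendsto]) measurable

lemma T_balance_iter_tendsto: "(\<lambda>n. T_op \<kappa> \<nu> (balance_iter n) r) \<longlonglongrightarrow> T_op \<kappa> \<nu> balance_lim r"
  unfolding T_op_def
proof (rule integral_dominated_convergence[where w = "\<lambda>_. K"])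
  show "AE s in \<nu>. (\<lambda>n. \<kappa> r s * balance_iter n s) \<longlonglongrightarrow> \<kappa> r s * balance_lim s"
    by (intro AE_I2 tendsto_mult tendsto_const balance_iter_tendsto)
  show "AE s in \<nu>. norm (\<kappa> r s * balance_iter n s) \<le> K" for n
  proof (rule AE_I2)
    fix s
    show "norm (\<kappa> r s * balance_iter n s) \<le> K"
      using kappa_times_bound[of "balance_iter n" s 1 r, OF balance_iter_abs] by simp
  qed
qed (auto intro: measurable_nu)

abbreviation T_lim :: "'a \<Rightarrow> real" where "T_lim \<equiv> T_op \<kappa> \<nu> balance_lim"

lemma T_lim_nonneg: "0 \<le> T_lim r"
  by (rule T_op_nonneg) (rule balance_lim_nonneg)

lemma balance_lim_fixpoint: "balance_lim r = T_lim r / (1 + T_lim r)"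
proof (rule LIMSEQ_unique)
  show "(\<lambda>n. balance_iter (Suc n) r) \<longlonglongrightarrow> balance_lim r"
    using balance_iter_tendsto by (rule LIMSEQ_Suc)
  show "(\<lambda>n. balance_iter (Suc n) r) \<longlonglongrightarrow> T_lim r / (1 + T_lim r)"
    unfolding balance_iter.simps
    by (intro tendsto_divide tendsto_add tendsto_const T_balance_iter_tendsto)
      (use T_lim_nonneg[of r] in simp)
qed

lemma one_minus_balance_lim: "1 - balance_lim r = 1 / (1 + T_lim r)"
  unfolding balance_lim_fixpoint[of r] using T_lim_nonneg[of r] by (simp add: field_simps)

lemma balance_lim_less_1: "balance_lim r < 1"
proof -
  have "0 < 1 / (1 + T_lim r)" using T_lim_nonneg[of r] by simp
  then show ?thesis unfolding one_minus_balance_lim[symmetric] by simp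
qed

definition minimal_b :: "'a measure" where
  "minimal_b = density \<nu> (\<lambda>r. ennreal (1 - balance_lim r))"

lemma density_le:
  assumes "\<beta> \<in> borel_measurable borel" "\<gamma> \<in> borel_measurable borel" "AE x in \<nu>. \<beta> x \<le> (\<gamma> x :: real)"
  shows "density \<nu> (\<lambda>x. ennreal (\<beta> x)) \<le> density \<nu> (\<lambda>x. ennreal (\<gamma> x))"
  using assms by (subst le_measure)
    (auto simp: emeasure_density measurable_nu intro!: nn_integral_mono_AE elim!: eventually_mono
      intro: mult_right_mono ennreal_leI split: split_indicator)

lemma balance_solution_density:
  assumes [measurable]: "\<eta> \<in> borel_measurable borel" and e: "\<And>x. 0 \<le> \<eta> x" "\<And>x. \<eta> x \<le> (1::real)"
  shows "balance_solution \<kappa> \<nu> (density \<nu> (\<lambda>x. ennreal (1 - \<eta> x))) \<longleftrightarrow>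
    (AE r in \<nu>. \<eta> r = T_op \<kappa> \<nu> \<eta> r / (1 + T_op \<kappa> \<nu> \<eta> r))"
proof -
  let ?b = "density \<nu> (\<lambda>x. ennreal (1 - \<eta> x))"
  have d: "diff_measure \<nu> ?b = density \<nu> (\<lambda>x. ennreal (\<eta> x))"
    using diff_measure_density[OF finite_nu, of "\<lambda>r. 1 - \<eta> r"] e by (auto intro: measurable_nu)
  have T: "kap \<kappa> (diff_measure \<nu> ?b) r = T_op \<kappa> \<nu> \<eta> r" for r
    unfolding d by (rule kap_density) (use e in auto)
  have T0: "0 \<le> T_op \<kappa> \<nu> \<eta> r" for r by (rule T_op_nonneg) (rule e)
  have b: "?b \<in> fin_borel"
    using finite_borel_density[of "\<lambda>r. 1 - \<eta> r" 1] e by (auto simp: fin_borel_def finite_borel_def)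
  have "?b \<le> density \<nu> (\<lambda>x. ennreal 1)"
    by (rule density_le) (use e in auto)
  then have le: "?b \<le> \<nu>" by (simp add: density_1)
  have "density ?b (\<lambda>r. ennreal (T_op \<kappa> \<nu> \<eta> r)) = density \<nu> (\<lambda>r. ennreal (1 - \<eta> r) * ennreal (T_op \<kappa> \<nu> \<eta> r))"
    by (rule density_density_eq) (auto intro!: measurable_nu)
  then have "balance_solution \<kappa> \<nu> ?b \<longleftrightarrow>
    density \<nu> (\<lambda>r. ennreal (1 - \<eta> r) * ennreal (T_op \<kappa> \<nu> \<eta> r)) = density \<nu> (\<lambda>x. ennreal (\<eta> x))"
    unfolding balance_solution_def T using b le by (simp add: d)
  also have "\<dots> \<longleftrightarrow> (AE r in \<nu>. ennreal (1 - \<eta> r) * ennreal (T_op \<kappa> \<nu> \<eta> r) = ennreal (\<eta> r))"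
    by (rule density_unique_iff) (auto intro!: measurable_nu)
  also have "\<dots> \<longleftrightarrow> (AE r in \<nu>. \<eta> r = T_op \<kappa> \<nu> \<eta> r / (1 + T_op \<kappa> \<nu> \<eta> r))"
  proof (rule AE_cong)
    fix r
    have "ennreal (1 - \<eta> r) * ennreal (T_op \<kappa> \<nu> \<eta> r) = ennreal (\<eta> r) \<longleftrightarrow> (1 - \<eta> r) * T_op \<kappa> \<nu> \<eta> r = \<eta> r"
      using e[of r] T0[of r] by (simp add: ennreal_mult[symmetric])
    also have "\<dots> \<longleftrightarrow> \<eta> r = T_op \<kappa> \<nu> \<eta> r / (1 + T_op \<kappa> \<nu> \<eta> r)"
      using T0[of r] by (auto simp: eq_divide_eq algebra_simps)
    finally show "ennreal (1 - \<eta> r) * ennreal (T_op \<kappa> \<nu> \<eta> r) = ennreal (\<eta> r) \<longleftrightarrow>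
      \<eta> r = T_op \<kappa> \<nu> \<eta> r / (1 + T_op \<kappa> \<nu> \<eta> r)" .
  qed
  finally show ?thesis .
qed

lemma balance_solution_minimal_b: "balance_solution \<kappa> \<nu> minimal_b"
  unfolding minimal_b_def using balance_solution_density[of balance_lim] balance_lim_nonneg balance_lim_le_1
  by (simp add: balance_lim_fixpoint[symmetric])

lemma minimal_b_le:
  assumes "balance_solution \<kappa> \<nu> b"
  shows "minimal_b \<le> b"
proof -
  have b: "sets b = sets borel" "b \<le> \<nu>" using assms by (auto simp: balance_solution_def fin_borel_def)
  obtain \<beta> where \<beta>: "\<beta> \<in> borel_measurable \<nu>" "\<And>x. 0 \<le> \<beta> x" "\<And>x. \<beta> x \<le> (1::real)"
    "b = density \<nu> (\<lambda>x. ennreal (\<beta> x))"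
    by (rule dominated_density[OF finite_nu _ b(2)]) (use b(1) in auto)
  have bm[measurable]: "\<beta> \<in> borel_measurable borel" using \<beta>(1) by (simp add: measurable_cong_sets[OF sets_nu refl])
  define \<eta> where "\<eta> x = 1 - \<beta> x" for x
  have [measurable]: "\<eta> \<in> borel_measurable borel" unfolding \<eta>_def[abs_def] by measurable
  have e: "0 \<le> \<eta> x" "\<eta> x \<le> 1" "\<bar>\<eta> x\<bar> \<le> 1" for x using \<beta>(2,3)[of x] by (auto simp: \<eta>_def)
  have fp: "AE r in \<nu>. \<eta> r = T_op \<kappa> \<nu> \<eta> r / (1 + T_op \<kappa> \<nu> \<eta> r)"
    using balance_solution_density[of \<eta>] e assms \<beta>(4) by (simp add: \<eta>_def)
  have "AE r in \<nu>. \<eta> r \<le> balance_iter n r" for n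
  proof (induction n)
    case (Suc n)
    have "T_op \<kappa> \<nu> \<eta> r \<le> T_op \<kappa> \<nu> (balance_iter n) r" for r
      by (rule T_op_mono[OF _ balance_iter_range e(3) balance_iter_abs Suc]) measurable
    moreover have "0 \<le> T_op \<kappa> \<nu> \<eta> r" for r by (rule T_op_nonneg) (rule e)
    ultimately have "T_op \<kappa> \<nu> \<eta> r / (1 + T_op \<kappa> \<nu> \<eta> r) \<le> balance_iter (Suc n) r" for r
      by (simp add: ratio_mono)
    then show ?case using fp by (auto elim!: eventually_mono)
  qed (use e in simp)
  then have "AE r in \<nu>. \<forall>n. \<eta> r \<le> balance_iter n r" by (simp add: AE_all_countable)
  then have "AE r in \<nu>. \<eta> r \<le> balance_lim r"
    by eventually_elim (rule LIMSEQ_le_const[OF balance_iter_tendsto], auto)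
  then have "AE r in \<nu>. 1 - balance_lim r \<le> \<beta> r"
    by eventually_elim (simp add: \<eta>_def)
  then show ?thesis
    unfolding minimal_b_def \<beta>(4) by (intro density_le) measurable
qed

text \<open>
  At the minimal solution the operator norm is at most one: with \<open>e\<^sub>n\<close> the distance of the iterates to
  their limit and \<open>\<beta>\<close> the density of \<open>b\<close>, the recursion gives \<open>T e\<^sub>n \<le> (1 + o(1)) e\<^bsub>n + 1\<^esub> / \<beta>\<^sup>2\<close>. Hence a
  suitably weighted sum of the \<open>e\<^sub>n / \<beta>\<close> is an approximate supersolution of the linearized equation,
  up to a factor \<open>1 / \<beta> = 1 + T \<eta>\<close>, which is absorbed by adding a large multiple of the exact
  solution \<open>T \<eta>\<close>. Schur's test applies to the result.
\<close>

lemma op_norm_minimal_b_le_1: "op_norm_L2 \<kappa> minimal_b \<le> 1"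
proof (rule field_le_epsilon)
  fix \<epsilon> :: real assume "0 < \<epsilon>"
  define \<rho> where "\<rho> = sqrt (1 + \<epsilon>)"
  have \<rho>: "1 < \<rho>" "\<rho>\<^sup>2 = 1 + \<epsilon>" using \<open>0 < \<epsilon>\<close> by (auto simp: \<rho>_def)
  define \<beta> where "\<beta> r = 1 - balance_lim r" for r
  define e where "e n r = balance_iter n r - balance_lim r" for n r
  define \<delta> where "\<delta> n = K * (\<integral>r. e n r \<partial>\<nu>)" for n
  \<comment> \<open>passing from \<open>n\<close> to \<open>n + 1\<close> absorbs the error \<open>1 + \<delta> n\<close> up to the factor \<open>\<rho>\<close>; the weights
     decay geometrically because \<open>\<delta>\<close> tends to zero\<close>
  define w where "w n = (\<Prod>i<n. (1 + \<delta> i) / \<rho>)" for n :: nat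
  have [measurable]: "\<beta> \<in> borel_measurable borel" "e n \<in> borel_measurable borel" for n
    unfolding \<beta>_def[abs_def] e_def[abs_def] by measurable
  have \<beta>: "0 < \<beta> r" "\<beta> r \<le> 1" for r using balance_lim_less_1 balance_lim_nonneg by (auto simp: \<beta>_def)
  have \<beta>T: "\<beta> r = 1 / (1 + T_lim r)" for r by (simp add: \<beta>_def one_minus_balance_lim)
  have e0: "0 \<le> e n r" for n r using balance_lim_le_iter by (simp add: e_def)
  have e\<beta>: "e n r \<le> \<beta> r" for n r using balance_iter_le_1 by (simp add: e_def \<beta>_def)
  have e1: "\<bar>e n r\<bar> \<le> 1" for n r using e0[of n r] e\<beta>[of n r] \<beta>(2)[of r] by simp
  have \<delta>0: "0 \<le> \<delta> n" for n unfolding \<delta>_def using K_nonneg e0 by (intro mult_nonneg_nonneg integral_nonneg) auto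
  have w0: "0 < w n" for n unfolding w_def using \<delta>0 \<rho>(1) by (intro prod_pos) (auto simp: add_pos_nonneg)
  have wS: "w (Suc n) * \<rho> = w n * (1 + \<delta> n)" for n using \<rho>(1) by (simp add: w_def)
  have "(\<lambda>n. \<integral>r. e n r \<partial>\<nu>) \<longlonglongrightarrow> (\<integral>r. 0 \<partial>\<nu>)"
  proof (rule integral_dominated_convergence[where w = "\<lambda>_. 1"])
    have "(\<lambda>n. e n r) \<longlonglongrightarrow> 0" for r
      unfolding e_def using tendsto_diff[OF balance_iter_tendsto[of r] tendsto_const[of "balance_lim r"]] by simp
    then show "AE r in \<nu>. (\<lambda>n. e n r) \<longlonglongrightarrow> 0" by simp
  qed (use e1 in \<open>auto intro: measurable_nu\<close>)
  then have \<delta>lim: "\<delta> \<longlonglongrightarrow> 0"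
    unfolding \<delta>_def using tendsto_mult_right_zero by auto
  have "w \<longlonglongrightarrow> 0"
  proof (rule summable_LIMSEQ_zero)
    have "1 / \<rho> < 1" using \<rho>(1) by simp
    then obtain q where q: "1 / \<rho> < q" "q < 1" using dense by blast
    have "(\<lambda>n. (1 + \<delta> n) / \<rho>) \<longlonglongrightarrow> (1 + 0) / \<rho>"
      by (intro tendsto_intros \<delta>lim) (use \<rho>(1) in simp)
    then have "\<forall>\<^sub>F n in sequentially. (1 + \<delta> n) / \<rho> < q"
      by (rule order_tendstoD(2)) (use q(1) in simp)
    then obtain N0 where N0: "\<And>n. N0 \<le> n \<Longrightarrow> (1 + \<delta> n) / \<rho> < q"
      by (auto simp: eventually_sequentially)
    show "summable w"
    proof (rule summable_ratio_test[OF q(2)])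
      fix n assume "N0 \<le> n"
      then have "w n * ((1 + \<delta> n) / \<rho>) \<le> w n * q"
        using N0[of n] w0[of n] by (intro mult_left_mono) auto
      moreover have "w (Suc n) = w n * ((1 + \<delta> n) / \<rho>)" by (simp add: w_def)
      ultimately show "norm (w (Suc n)) \<le> q * norm (w n)"
        using w0[of n] w0[of "Suc n"] by (simp add: mult.commute)
    qed
  qed
  then have "(\<lambda>n. w (Suc n)) \<longlonglongrightarrow> 0" by (rule LIMSEQ_Suc)
  then have "\<forall>\<^sub>F n in sequentially. w (Suc n) < \<rho> - 1"
    by (rule order_tendstoD(2)) (use \<rho>(1) in simp)
  then obtain N where N: "w (Suc N) < \<rho> - 1" by (auto simp: eventually_sequentially)
  define h1 where "h1 = T_lim"
  define h2 where "h2 r = (\<Sum>n\<le>N. w n * e n r) / \<beta> r" for r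
  define M where "M = (\<Sum>n\<le>N. w n)"
  have [measurable]: "h1 \<in> borel_measurable borel" "h2 \<in> borel_measurable borel"
    unfolding h1_def h2_def[abs_def] by measurable
  have h1: "0 \<le> h1 r" for r unfolding h1_def by (rule T_lim_nonneg)
  have h2_ge: "1 \<le> h2 r" for r
  proof -
    have "w 0 * e 0 r \<le> (\<Sum>n\<le>N. w n * e n r)"
      by (rule member_le_sum) (use w0 e0 in \<open>auto simp: less_imp_le\<close>)
    then show ?thesis using \<beta>(1)[of r] by (simp add: h2_def w_def e_def \<beta>_def)
  qed
  have h2_le: "h2 r \<le> M" for r
  proof -
    have "(\<Sum>n\<le>N. w n * e n r) \<le> (\<Sum>n\<le>N. w n * \<beta> r)"
      using w0 e\<beta> by (intro sum_mono mult_left_mono) (auto simp: less_imp_le)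
    then show ?thesis using \<beta>(1)[of r] by (simp add: h2_def M_def sum_distrib_right[symmetric] divide_le_eq)
  qed
  have M: "1 \<le> M" using h2_ge h2_le order_trans by blast
  \<comment> \<open>the exact identity \<open>e (n + 1) = t / ((1 + a + t) (1 + a))\<close> for \<open>t = T (e n)\<close>, solved for \<open>t\<close>\<close>
  have Te: "T_op \<kappa> \<nu> (e n) r \<le> (1 + \<delta> n) * (e (Suc n) r / (\<beta> r)\<^sup>2)" for n r
  proof -
    define a where "a = T_lim r"
    define t where "t = T_op \<kappa> \<nu> (e n) r"
    have a0: "0 \<le> a" unfolding a_def by (rule T_lim_nonneg)
    have t0: "0 \<le> t" unfolding t_def by (rule T_op_nonneg) (rule e0)
    have at: "T_op \<kappa> \<nu> (balance_iter n) r = a + t"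
    proof -
      have "T_op \<kappa> \<nu> (e n) r = T_op \<kappa> \<nu> (balance_iter n) r - T_lim r"
        unfolding T_op_def e_def right_diff_distrib
        by (rule Bochner_Integration.integral_diff)
          (auto intro!: integrable_kappa_times[where C = 1] balance_iter_abs simp: balance_lim_nonneg balance_lim_le_1)
      then show ?thesis by (simp add: a_def t_def)
    qed
    have t\<delta>: "t \<le> \<delta> n"
    proof -
      have "t \<le> \<bar>t\<bar>" by simp
      also have "\<dots> \<le> K * (\<integral>x. \<bar>e n x\<bar> \<partial>\<nu>)"
        unfolding t_def by (rule T_op_abs_le) (rule integrable_bounded[OF _ e1], measurable)
      finally show ?thesis using e0 by (simp add: \<delta>_def)
    qed
    have "e (Suc n) r = (a + t) / (1 + (a + t)) - a / (1 + a)"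
      unfolding e_def balance_iter.simps at balance_lim_fixpoint[of r] a_def[symmetric] ..
    also have "\<dots> = t / ((1 + a + t) * (1 + a))"
      using a0 t0 by (simp add: field_simps)
    finally have "e (Suc n) r = t / ((1 + a + t) * (1 + a))" .
    moreover have "(1 + a + t) * (1 + a) \<noteq> 0" using a0 t0 by simp
    ultimately have "t = e (Suc n) r * ((1 + a + t) * (1 + a))" by (simp only: times_divide_eq_left nonzero_mult_div_cancel_right not_False_eq_True)
    also have "\<dots> \<le> e (Suc n) r * ((1 + \<delta> n) * (1 + a) * (1 + a))"
    proof (intro mult_left_mono mult_right_mono)
      have "1 + a + t \<le> (1 + a) * (1 + t)" using a0 t0 by (simp add: algebra_simps)
      also have "\<dots> \<le> (1 + a) * (1 + \<delta> n)" using t\<delta> a0 by (intro mult_left_mono) auto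
      finally show "1 + a + t \<le> (1 + \<delta> n) * (1 + a)" by (simp add: mult.commute)
    qed (use a0 e0 in auto)
    also have "\<dots> = (1 + \<delta> n) * (e (Suc n) r / (\<beta> r)\<^sup>2)"
      using a0 by (simp add: \<beta>T a_def[symmetric] power2_eq_square)
    finally show ?thesis by (simp add: t_def)
  qed
  have Th2: "T_op \<kappa> \<nu> (\<lambda>s. \<beta> s * h2 s) r \<le> \<rho>\<^sup>2 * ((1 + h1 r) * h2 r)" for r
  proof -
    have "T_op \<kappa> \<nu> (\<lambda>s. \<beta> s * h2 s) r = (\<Sum>n\<le>N. w n * T_op \<kappa> \<nu> (e n) r)"
    proof -
      have "\<kappa> r s * (\<beta> s * h2 s) = (\<Sum>n\<le>N. w n * (\<kappa> r s * e n s))" for s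
      proof -
        have "\<beta> s * h2 s = (\<Sum>n\<le>N. w n * e n s)" using \<beta>(1)[of s] by (simp add: h2_def)
        then show ?thesis by (simp add: sum_distrib_left mult_ac)
      qed
      then show ?thesis
        unfolding T_op_def by (simp add: integrable_kappa_times[OF _ e1])
    qed
    also have "\<dots> \<le> (\<Sum>n\<le>N. w n * ((1 + \<delta> n) * (e (Suc n) r / (\<beta> r)\<^sup>2)))"
      by (intro sum_mono mult_left_mono Te) (use w0 in \<open>auto simp: less_imp_le\<close>)
    also have "\<dots> = (\<Sum>n\<le>N. \<rho> * (w (Suc n) * e (Suc n) r)) / (\<beta> r)\<^sup>2"
      unfolding sum_divide_distrib
    proof (rule sum.cong)
      fix n
      have "w n * ((1 + \<delta> n) * (e (Suc n) r / (\<beta> r)\<^sup>2)) = w n * (1 + \<delta> n) * e (Suc n) r / (\<beta> r)\<^sup>2" by simp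
      then show "w n * ((1 + \<delta> n) * (e (Suc n) r / (\<beta> r)\<^sup>2)) = \<rho> * (w (Suc n) * e (Suc n) r) / (\<beta> r)\<^sup>2"
        by (simp add: wS[symmetric] mult_ac)
    qed simp
    also have "\<dots> \<le> \<rho> * ((\<Sum>n\<le>N. w n * e n r) + w (Suc N) * \<beta> r) / (\<beta> r)\<^sup>2"
    proof -
      have "(\<Sum>n\<le>N. w (Suc n) * e (Suc n) r) \<le> (\<Sum>n\<le>Suc N. w n * e n r)"
        by (subst sum.atMost_Suc_shift) (use w0[of 0] e0 in \<open>simp add: less_imp_le\<close>)
      also have "\<dots> \<le> (\<Sum>n\<le>N. w n * e n r) + w (Suc N) * \<beta> r"
        using w0[of "Suc N"] e\<beta>[of "Suc N" r] by (simp add: mult_left_mono less_imp_le)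
      finally show ?thesis
        unfolding sum_distrib_left[symmetric] using \<rho>(1) by (intro divide_right_mono mult_left_mono) auto
    qed
    also have "\<dots> = \<rho> * (h2 r + w (Suc N)) / \<beta> r"
      using \<beta>(1)[of r] by (simp add: h2_def field_simps power2_eq_square)
    also have "\<dots> \<le> \<rho> * (\<rho> * h2 r) / \<beta> r"
    proof (intro divide_right_mono mult_left_mono)
      have "(\<rho> - 1) * 1 \<le> (\<rho> - 1) * h2 r" using h2_ge \<rho>(1) by (intro mult_left_mono) auto
      then show "h2 r + w (Suc N) \<le> \<rho> * h2 r" using N by (simp add: algebra_simps)
    qed (use \<rho>(1) \<beta>(1)[of r] in auto)
    also have "\<dots> = \<rho>\<^sup>2 * ((1 + h1 r) * h2 r)"
      unfolding \<beta>T h1_def by (simp add: power2_eq_square mult_ac)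
    finally show ?thesis .
  qed
  \<comment> \<open>small enough that the excess factor \<open>1 + h1\<close> of \<open>h2\<close> is paid for by the exact solution \<open>h1\<close>\<close>
  define \<zeta> where "\<zeta> = (\<rho>\<^sup>2 - 1) / (\<rho>\<^sup>2 * M)"
  have \<zeta>: "0 < \<zeta>" "\<zeta> * \<rho>\<^sup>2 * M = \<rho>\<^sup>2 - 1" using \<rho> M \<open>0 < \<epsilon>\<close> by (auto simp: \<zeta>_def)
  define h where "h r = h1 r + \<zeta> * h2 r" for r
  have [measurable]: "h \<in> borel_measurable borel" unfolding h_def[abs_def] by measurable
  interpret b: kernel_measure \<kappa> K minimal_b
    unfolding minimal_b_def by (rule kernel_measure_density[where C = 1]) (use balance_lim_nonneg in auto)
  have h1b: "\<bar>h1 r\<bar> \<le> K * (1 * measure \<nu> UNIV)" for r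
    unfolding h1_def by (rule T_op_bounded) (use balance_lim_nonneg balance_lim_le_1 in auto)
  have h2b: "\<bar>h2 r\<bar> \<le> M" for r using h2_ge[of r] h2_le[of r] by simp
  have "op_norm_L2 \<kappa> minimal_b \<le> \<rho>\<^sup>2"
  proof (rule b.op_norm_le_schur)
    show "h \<in> borel_measurable borel" by measurable
    show "0 < h r" for r using h1[of r] h2_ge[of r] \<zeta>(1) by (simp add: h_def add_nonneg_pos)
    show "h r \<le> K * (1 * measure \<nu> UNIV) + \<zeta> * M" for r
      unfolding h_def using h1b[of r] h2_le[of r] \<zeta>(1) by (intro add_mono mult_left_mono) auto
    show "T_op \<kappa> minimal_b h r \<le> \<rho>\<^sup>2 * h r" for r
    proof -
      have \<beta>b: "\<bar>\<beta> s * f s\<bar> \<le> C" if "\<bar>f s\<bar> \<le> C" for f :: "'a \<Rightarrow> real" and s C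
      proof -
        have "\<bar>\<beta> s\<bar> * \<bar>f s\<bar> \<le> 1 * C" by (rule mult_mono) (use \<beta>[of s] that in auto)
        then show ?thesis by (simp add: abs_mult)
      qed
      have "T_op \<kappa> minimal_b h r = T_op \<kappa> \<nu> (\<lambda>s. \<beta> s * h s) r"
        unfolding minimal_b_def \<beta>_def by (rule T_op_density) (use balance_lim_le_1 in auto)
      also have "\<dots> = T_op \<kappa> \<nu> (\<lambda>s. \<beta> s * h1 s) r + \<zeta> * T_op \<kappa> \<nu> (\<lambda>s. \<beta> s * h2 s) r"
      proof -
        have "\<kappa> r s * (\<beta> s * h s) = \<kappa> r s * (\<beta> s * h1 s) + \<zeta> * (\<kappa> r s * (\<beta> s * h2 s))" for s
          by (simp add: h_def algebra_simps)
        moreover have "integrable \<nu> (\<lambda>s. \<kappa> r s * (\<beta> s * h1 s))"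
          by (rule integrable_kappa_times[where C = "K * (1 * measure \<nu> UNIV)"]) (measurable, rule \<beta>b, rule h1b)
        moreover have "integrable \<nu> (\<lambda>s. \<kappa> r s * (\<beta> s * h2 s))"
          by (rule integrable_kappa_times[where C = M]) (measurable, rule \<beta>b, rule h2b)
        ultimately show ?thesis unfolding T_op_def by simp
      qed
      also have "(\<lambda>s. \<beta> s * h1 s) = balance_lim"
        unfolding h1_def \<beta>T using balance_lim_fixpoint by (auto simp: fun_eq_iff)
      also have "T_op \<kappa> \<nu> balance_lim r = h1 r" by (simp add: h1_def)
      also have "h1 r + \<zeta> * T_op \<kappa> \<nu> (\<lambda>s. \<beta> s * h2 s) r \<le> h1 r + \<zeta> * (\<rho>\<^sup>2 * ((1 + h1 r) * h2 r))"
        using Th2 \<zeta>(1) by (intro add_left_mono mult_left_mono) auto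
      also have "\<dots> = h1 r * (1 + \<zeta> * \<rho>\<^sup>2 * h2 r) + \<rho>\<^sup>2 * (\<zeta> * h2 r)" by (simp add: algebra_simps)
      also have "\<dots> \<le> h1 r * (1 + \<zeta> * \<rho>\<^sup>2 * M) + \<rho>\<^sup>2 * (\<zeta> * h2 r)"
        using h1 h2_le \<zeta>(1) by (intro add_right_mono mult_left_mono add_left_mono) auto
      also have "\<dots> = \<rho>\<^sup>2 * h r" unfolding \<zeta>(2) by (simp add: h_def algebra_simps)
      finally show ?thesis .
    qed
  qed simp
  then show "op_norm_L2 \<kappa> minimal_b \<le> 1 + \<epsilon>" using \<rho>(2) by simp
qed

text \<open>
  Boundedness makes \<open>f\<close> square integrable, so that the bound by the operator norm applies to it.
\<close>

lemma op_norm_ge_1_eigenfunction: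
  assumes f[measurable]: "f \<in> borel_measurable borel" and C: "\<And>x. \<bar>f x\<bar> \<le> C"
    and T: "\<And>r. T_op \<kappa> \<nu> f r = f r" and nz: "\<not> (AE x in \<nu>. f x = 0)"
  shows "1 \<le> op_norm_L2 \<kappa> \<nu>"
proof -
  have i: "integrable \<nu> (\<lambda>r. (f r)\<^sup>2)"
    by (rule integrable_bounded[where C = "C\<^sup>2"]) (use C in \<open>auto simp: abs_le_square_iff[symmetric] intro: order_trans[OF _ abs_ge_self]\<close>)
  have "(\<integral>r. (f r)\<^sup>2 \<partial>\<nu>) \<noteq> 0"
    using nz i by (subst integral_nonneg_eq_0_iff_AE) auto
  moreover have "0 \<le> (\<integral>r. (f r)\<^sup>2 \<partial>\<nu>)" by simp
  ultimately have "0 < (\<integral>r. (f r)\<^sup>2 \<partial>\<nu>)" by linarith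
  with op_norm_bound[OF f C] have "1 \<le> (op_norm_L2 \<kappa> \<nu>)\<^sup>2" by (simp add: T)
  then have "1\<^sup>2 \<le> (op_norm_L2 \<kappa> \<nu>)\<^sup>2" by simp
  then show ?thesis using op_norm_nonneg by (rule power2_le_imp_le)
qed

text \<open>
  Since the norm is at most one at the minimal solution, the latter is not \<open>c\<close>. Then \<open>T \<eta>\<close> does not vanish
  identically, and \<open>b = (1 - \<eta>) c\<close> together with \<open>(1 - \<eta>) T \<eta> = \<eta>\<close> makes it an eigenfunction for the eigenvalue \<open>1\<close>.
\<close>

proposition minimal_solution_b_star:
  assumes "1 < op_norm_L2 \<kappa> \<nu>"
  shows "minimal_solution \<kappa> \<nu> minimal_b" and "\<exists>!b. minimal_solution \<kappa> \<nu> b"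
    and "b_star \<kappa> \<nu> = minimal_b" and "op_norm_L2 \<kappa> minimal_b = 1"
proof -
  have ne: "minimal_b \<noteq> \<nu>" using op_norm_minimal_b_le_1 assms by auto
  show ms: "minimal_solution \<kappa> \<nu> minimal_b"
    unfolding minimal_solution_def using balance_solution_minimal_b minimal_b_le ne by simp
  have uq: "b = minimal_b" if "minimal_solution \<kappa> \<nu> b" for b
  proof (rule antisym)
    show "b \<le> minimal_b" using that ms by (simp add: minimal_solution_def)
    show "minimal_b \<le> b" using that ms by (simp add: minimal_solution_def)
  qed
  show "\<exists>!b. minimal_solution \<kappa> \<nu> b" using ms uq by (rule ex1I)
  show "b_star \<kappa> \<nu> = minimal_b" unfolding b_star_def using ms uq by (rule the_equality)
  interpret b: kernel_measure \<kappa> K minimal_b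
    unfolding minimal_b_def by (rule kernel_measure_density[where C = 1]) (use balance_lim_nonneg in auto)
  have "1 \<le> op_norm_L2 \<kappa> minimal_b"
  proof (rule b.op_norm_ge_1_eigenfunction)
    show "\<bar>T_lim r\<bar> \<le> K * (1 * measure \<nu> UNIV)" for r
      by (rule T_op_bounded) (use balance_lim_nonneg balance_lim_le_1 in auto)
    have "(\<lambda>s. (1 - balance_lim s) * T_lim s) = balance_lim"
      unfolding one_minus_balance_lim using balance_lim_fixpoint by (auto simp: fun_eq_iff)
    then show "T_op \<kappa> minimal_b T_lim r = T_lim r" for r
      unfolding minimal_b_def by (subst T_op_density) (use balance_lim_le_1 in auto)
    show "\<not> (AE x in minimal_b. T_lim x = 0)"
    proof
      assume "AE x in minimal_b. T_lim x = 0"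
      then have "AE x in \<nu>. T_lim x = 0"
        unfolding minimal_b_def using balance_lim_less_1
        by (subst (asm) AE_density) (auto simp: measurable_nu)
      then have "AE x in \<nu>. ennreal (1 - balance_lim x) = 1"
        using balance_lim_fixpoint by (auto elim!: eventually_mono)
      then have "minimal_b = density \<nu> (\<lambda>_. 1)"
        unfolding minimal_b_def by (intro density_cong) (auto intro!: measurable_nu)
      with ne show False by (simp add: density_1)
    qed
  qed measurable
  with op_norm_minimal_b_le_1 show "op_norm_L2 \<kappa> minimal_b = 1" by simp
qed

end

section \<open>The generating function of trees\<close>

lemma sum_mset_nonneg_real:
  fixes f :: "'b \<Rightarrow> real"
  shows "(\<And>x. 0 \<le> f x) \<Longrightarrow> 0 \<le> (\<Sum>x\<in>#k. f x)"
  by (induction k) auto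

context kernel
begin

lemma rooted_tau_eq_0: "size k < j \<Longrightarrow> rooted_tau j r k = 0"
proof (induction j arbitrary: k)
  case (Suc j)
  have "rooted_tau j r (fst p) * tau \<kappa> (snd p) * (\<Sum>s\<in>#snd p. \<kappa> r s) = 0" if p: "p \<in># splits k" for p
  proof (cases "snd p = {#}")
    case False
    then have "size (snd p) \<noteq> 0" by simp
    moreover have "size (fst p) + size (snd p) = size k" using splits_sum[OF p] by (metis size_union)
    ultimately have "size (fst p) < j" using Suc.prems by linarith
    then show ?thesis using Suc.IH by simp
  qed simp
  then have "(\<Sum>p\<in>#splits k. rooted_tau j r (fst p) * tau \<kappa> (snd p) * (\<Sum>s\<in>#snd p. \<kappa> r s)) = (\<Sum>p\<in>#splits k. 0)"
    by (intro arg_cong[where f = sum_mset] image_mset_cong) auto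
  then have "real (Suc j) * rooted_tau (Suc j) r k = 0" unfolding rooted_tau_Suc by simp
  then show ?case by (simp del: of_nat_Suc)
qed simp

lemma sum_kappa_nonneg: "0 \<le> (\<Sum>s\<in>#k. \<kappa> r s)"
  by (intro sum_mset_nonneg_real kappa_nonneg)

definition link :: "'a \<Rightarrow> 'a multiset \<Rightarrow> ennreal" where
  "link r k = (\<Sum>s\<in>#k. ennreal (\<kappa> r s))"

lemma link_eq: "link r k = ennreal (\<Sum>s\<in>#k. \<kappa> r s)"
  unfolding link_def by (rule sum_mset_ennreal) (rule kappa_nonneg)

lemma measurable_link [measurable]: "link r \<in> borel_measurable config_space"
  unfolding link_def[abs_def] by (rule measurable_sum_points) measurable

lemma ennreal_rooted_tau_Suc:
  "of_nat (Suc j) * ennreal (rooted_tau (Suc j) r k) =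
    (\<Sum>p\<in>#splits k. ennreal (rooted_tau j r (fst p)) * (ennreal (tau \<kappa> (snd p)) * link r (snd p)))"
proof -
  have "of_nat (Suc j) * ennreal (rooted_tau (Suc j) r k) = ennreal (real (Suc j) * rooted_tau (Suc j) r k)"
    using rooted_tau_nonneg by (simp add: ennreal_mult ennreal_of_nat_eq_real_of_nat del: of_nat_Suc)
  also have "\<dots> = (\<Sum>p\<in>#splits k. ennreal (rooted_tau j r (fst p) * tau \<kappa> (snd p) * (\<Sum>s\<in>#snd p. \<kappa> r s)))"
    unfolding rooted_tau_Suc
    by (rule sum_mset_ennreal[symmetric]) (intro mult_nonneg_nonneg rooted_tau_nonneg tau_nonneg sum_kappa_nonneg)
  also have "\<dots> = (\<Sum>p\<in>#splits k. ennreal (rooted_tau j r (fst p)) * (ennreal (tau \<kappa> (snd p)) * link r (snd p)))"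
    using rooted_tau_nonneg tau_nonneg sum_kappa_nonneg by (simp add: link_eq ennreal_mult mult.assoc)
  finally show ?thesis .
qed

lemma ennreal_tau_eq_suminf: "ennreal (tau \<kappa> (add_mset r k)) = (\<Sum>j. ennreal (rooted_tau j r k))"
proof -
  have "ennreal (tau \<kappa> (add_mset r k)) = (\<Sum>j\<in>{..size k}. ennreal (rooted_tau j r k))"
    unfolding tau_eq_sum_rooted_tau using rooted_tau_nonneg by (simp add: sum_ennreal)
  also have "\<dots> = (\<Sum>j. ennreal (rooted_tau j r k))"
    by (rule suminf_finite[symmetric]) (auto simp: rooted_tau_eq_0)
  finally show ?thesis .
qed

lemma tendsto_sum_mset:
  fixes f :: "nat \<Rightarrow> 'b \<Rightarrow> real"
  assumes "\<And>x. (\<lambda>m. f m x) \<longlonglongrightarrow> g x"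
  shows "(\<lambda>m. \<Sum>x\<in>#k. f m x) \<longlonglongrightarrow> (\<Sum>x\<in>#k. g x)"
  by (induction k) (auto intro!: tendsto_add assms)

lemma measurable_pair_link:
  "(\<lambda>p. \<Sum>r\<in>#fst p. \<Sum>s\<in>#snd p. \<kappa> r s) \<in> borel_measurable (config_space \<Otimes>\<^sub>M config_space)"
proof (rule borel_measurable_LIMSEQ_real)
  let ?q = "\<lambda>m x. dense_seq (nearby m x)"
  let ?L = "\<lambda>p :: 'a multiset \<times> 'a multiset. \<Sum>r\<in>#fst p. \<Sum>s\<in>#snd p. \<kappa> r s"
  fix p :: "'a multiset \<times> 'a multiset"
  show "(\<lambda>m. \<Sum>r\<in>#fst p. \<Sum>s\<in>#snd p. \<kappa> (?q m r) (?q m s)) \<longlonglongrightarrow> ?L p"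
    by (intro tendsto_sum_mset kappa_tendsto nearby_tendsto)
next
  fix m
  let ?h = "\<lambda>p. (image_mset (nearby m) (fst p), image_mset (nearby m) (snd p))"
  let ?F = "\<lambda>p :: nat multiset \<times> nat multiset. \<Sum>r\<in>#fst p. \<Sum>s\<in>#snd p. \<kappa> (dense_seq r) (dense_seq s)"
  have "?h \<in> config_space \<Otimes>\<^sub>M config_space \<rightarrow>\<^sub>M (count_space UNIV \<Otimes>\<^sub>M count_space UNIV)"
    by measurable
  then have "?h \<in> config_space \<Otimes>\<^sub>M config_space \<rightarrow>\<^sub>M count_space UNIV"
    by (simp add: pair_measure_countable countable_nat_mset)
  then have "(\<lambda>p. ?F (?h p)) \<in> borel_measurable (config_space \<Otimes>\<^sub>M config_space)"
    by (rule measurable_compose) simp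
  then show "(\<lambda>p. \<Sum>r\<in>#fst p. \<Sum>s\<in>#snd p. \<kappa> (dense_seq (nearby m r)) (dense_seq (nearby m s)))
      \<in> borel_measurable (config_space \<Otimes>\<^sub>M config_space)"
    by (simp add: image_mset.compositionality comp_def)
qed

text \<open>
  Bounding the size of the trees allows estimating their weight by induction on the bound, starting from zero; the
  total weight might a priori be infinite.
\<close>

definition small :: "nat \<Rightarrow> 'a multiset \<Rightarrow> ennreal" where
  "small N k = (if size k \<le> N then 1 else 0)"

lemma measurable_small [measurable]: "small N \<in> borel_measurable config_space"
proof -
  have [measurable]: "size \<in> config_space \<rightarrow>\<^sub>M count_space UNIV"
    using measurable_pts[of UNIV] by (simp add: pts_UNIV[abs_def])
  show ?thesis unfolding small_def[abs_def] by measurable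
qed

lemma small_splits: "p \<in># splits k \<Longrightarrow> small N k \<le> small N (fst p) * small N (snd p)"
  using splits_sum[of p k] by (auto simp: small_def)

end

lemma power_fact_Suc:
  assumes "0 \<le> t"
  shows "of_nat (Suc j) * ennreal (t ^ Suc j / fact (Suc j)) = ennreal (t ^ j / fact j) * ennreal t"
proof -
  have "real (Suc j) * (t ^ Suc j / fact (Suc j)) = t ^ j / fact j * t"
    by (simp add: field_simps del: of_nat_Suc)
  then show ?thesis using assms
    by (simp add: ennreal_mult[symmetric] ennreal_of_nat_eq_real_of_nat del: of_nat_Suc power_Suc fact_Suc)
qed

lemma suminf_power_fact:
  assumes "0 \<le> t"
  shows "(\<Sum>j. ennreal (t ^ j / fact j)) = ennreal (exp t)"
  using exp_converges[of t] assms by (intro suminf_ennreal_eq) (simp_all add: divide_inverse_commute)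

text \<open>
  The sum over all trees rooted at \<open>r\<close>, resolved by the degree of the root: attaching the subtrees one
  by one gives the terms \<open>T\<^sup>j / j!\<close> of the exponential of the sum over a single subtree.
\<close>

locale tree_function = kernel \<kappa> K + finite_borel \<theta>
  for \<kappa> :: "'a::polish_space \<Rightarrow> 'a \<Rightarrow> real" and K :: real and \<theta> :: "'a measure"
begin

abbreviation W where "W \<equiv> poisson_weight \<theta>"

definition branch :: "'a \<Rightarrow> ennreal" where
  "branch r = (\<integral>\<^sup>+k. ennreal (tau \<kappa> k) * link r k \<partial>W)"

definition branch_upto :: "nat \<Rightarrow> 'a \<Rightarrow> ennreal" where
  "branch_upto N r = (\<integral>\<^sup>+k. small N k * (ennreal (tau \<kappa> k) * link r k) \<partial>W)"

lemma nn_integral_splits_product: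
  assumes [measurable]: "f \<in> borel_measurable config_space" "g \<in> borel_measurable config_space"
  shows "(\<integral>\<^sup>+k. (\<Sum>p\<in>#splits k. f (fst p) * g (snd p)) \<partial>W) = (\<integral>\<^sup>+k. f k \<partial>W) * (\<integral>\<^sup>+k. g k \<partial>W)"
proof -
  have "(\<integral>\<^sup>+k. (\<Sum>p\<in>#splits k. f (fst p) * g (snd p)) \<partial>W) = (\<integral>\<^sup>+A. \<integral>\<^sup>+B. f A * g B \<partial>W \<partial>W)"
    by (subst nn_integral_splits) simp_all
  also have "\<dots> = (\<integral>\<^sup>+k. f k \<partial>W) * (\<integral>\<^sup>+k. g k \<partial>W)"
    by (simp add: nn_integral_cmult nn_integral_multc)
  finally show ?thesis .
qed

lemma emeasure_W_empty: "(\<integral>\<^sup>+k. ennreal (rooted_tau 0 r k) \<partial>W) = 1"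
proof -
  have "(\<integral>\<^sup>+k. ennreal (rooted_tau 0 r k) \<partial>W) = (\<integral>\<^sup>+k. indicator {k. size k = 0} k \<partial>W)"
    by (intro nn_integral_cong) (simp add: rooted_tau_0 indicator_def)
  also have "\<dots> = emeasure W {k. size k = 0}"
  proof (rule nn_integral_indicator)
    show "{k. size k = 0} \<in> sets W"
      using measurable_counts[of "{()}" "\<lambda>_. UNIV" "\<lambda>_. 0"] by simp
  qed
  finally show ?thesis by (simp only: emeasure_poisson_weight_size) simp
qed

lemma root_degree_eq:
  assumes "branch r = ennreal t" "0 \<le> t"
  shows "(\<integral>\<^sup>+k. ennreal (rooted_tau j r k) \<partial>W) = ennreal (t ^ j / fact j)"
proof (induction j)
  case (Suc j)
  have "of_nat (Suc j) * (\<integral>\<^sup>+k. ennreal (rooted_tau (Suc j) r k) \<partial>W) =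
    (\<integral>\<^sup>+k. of_nat (Suc j) * ennreal (rooted_tau (Suc j) r k) \<partial>W)"
    by (rule nn_integral_cmult[symmetric]) measurable
  also have "\<dots> = (\<integral>\<^sup>+k. ennreal (rooted_tau j r k) \<partial>W) * branch r"
    unfolding ennreal_rooted_tau_Suc branch_def by (rule nn_integral_splits_product) measurable
  also have "\<dots> = of_nat (Suc j) * ennreal (t ^ Suc j / fact (Suc j))"
    using Suc assms by (simp only: power_fact_Suc)
  finally show ?case by (rule ennreal_Suc_cancel)
qed (simp add: emeasure_W_empty)

lemma root_degree_upto_le:
  assumes "branch_upto N r \<le> ennreal t" "0 \<le> t"
  shows "(\<integral>\<^sup>+k. small N k * ennreal (rooted_tau j r k) \<partial>W) \<le> ennreal (t ^ j / fact j)"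
proof (induction j)
  case 0
  have "(\<integral>\<^sup>+k. small N k * ennreal (rooted_tau 0 r k) \<partial>W) \<le> (\<integral>\<^sup>+k. ennreal (rooted_tau 0 r k) \<partial>W)"
    by (intro nn_integral_mono) (simp add: small_def)
  then show ?case by (simp add: emeasure_W_empty)
next
  case (Suc j)
  have "of_nat (Suc j) * (\<integral>\<^sup>+k. small N k * ennreal (rooted_tau (Suc j) r k) \<partial>W) =
    (\<integral>\<^sup>+k. small N k * (of_nat (Suc j) * ennreal (rooted_tau (Suc j) r k)) \<partial>W)"
    by (subst nn_integral_cmult[symmetric]) (auto simp: mult_ac simp del: of_nat_Suc)
  also have "\<dots> \<le> (\<integral>\<^sup>+k. (\<Sum>p\<in>#splits k. (small N (fst p) * ennreal (rooted_tau j r (fst p))) *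
      (small N (snd p) * (ennreal (tau \<kappa> (snd p)) * link r (snd p)))) \<partial>W)"
  proof (rule nn_integral_mono)
    fix k
    have "small N k * (ennreal (rooted_tau j r (fst p)) * (ennreal (tau \<kappa> (snd p)) * link r (snd p))) \<le>
      (small N (fst p) * ennreal (rooted_tau j r (fst p))) * (small N (snd p) * (ennreal (tau \<kappa> (snd p)) * link r (snd p)))"
      if "p \<in># splits k" for p
      using mult_right_mono[OF small_splits[OF that, of N],
          of "ennreal (rooted_tau j r (fst p)) * (ennreal (tau \<kappa> (snd p)) * link r (snd p))"]
      by (simp add: mult_ac)
    then show "small N k * (of_nat (Suc j) * ennreal (rooted_tau (Suc j) r k)) \<le>
      (\<Sum>p\<in>#splits k. (small N (fst p) * ennreal (rooted_tau j r (fst p))) *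
      (small N (snd p) * (ennreal (tau \<kappa> (snd p)) * link r (snd p))))"
      unfolding ennreal_rooted_tau_Suc sum_mset_distrib_left by (intro sum_mset_mono) auto
  qed
  also have "\<dots> = (\<integral>\<^sup>+k. small N k * ennreal (rooted_tau j r k) \<partial>W) * branch_upto N r"
    unfolding branch_upto_def
    by (rule nn_integral_splits_product[of "\<lambda>k. small N k * ennreal (rooted_tau j r k)"
          "\<lambda>k. small N k * (ennreal (tau \<kappa> k) * link r k)"]) measurable
  also have "\<dots> \<le> ennreal (t ^ j / fact j) * ennreal t"
    by (intro mult_mono Suc assms(1)) simp_all
  also have "\<dots> = of_nat (Suc j) * ennreal (t ^ Suc j / fact (Suc j))"
    using assms(2) by (rule power_fact_Suc[symmetric])
  finally show ?case
    by (subst (asm) ennreal_mult_le_mult_iff) (auto simp del: of_nat_Suc power_Suc fact_Suc)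
qed

lemma rooted_trees_eq:
  assumes "branch r = ennreal t" "0 \<le> t"
  shows "(\<integral>\<^sup>+k. ennreal (tau \<kappa> (add_mset r k)) \<partial>W) = ennreal (exp t)"
  unfolding ennreal_tau_eq_suminf
  by (subst nn_integral_suminf) (simp_all add: root_degree_eq[OF assms] suminf_power_fact[OF assms(2)])

lemma rooted_trees_upto_le:
  assumes "branch_upto N r \<le> ennreal t" "0 \<le> t"
  shows "(\<integral>\<^sup>+k. small N k * ennreal (tau \<kappa> (add_mset r k)) \<partial>W) \<le> ennreal (exp t)"
proof -
  have "(\<integral>\<^sup>+k. small N k * ennreal (tau \<kappa> (add_mset r k)) \<partial>W) =
      (\<Sum>j. \<integral>\<^sup>+k. small N k * ennreal (rooted_tau j r k) \<partial>W)"
    unfolding ennreal_tau_eq_suminf by (subst nn_integral_suminf[symmetric]) simp_all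
  also have "\<dots> \<le> (\<Sum>j. ennreal (t ^ j / fact j))"
    by (intro suminf_le summableI root_degree_upto_le[OF assms])
  finally show ?thesis by (simp add: suminf_power_fact[OF assms(2)])
qed

lemma branch_upto_Suc:
  "branch_upto (Suc N) r = (\<integral>\<^sup>+s. ennreal (\<kappa> r s) * (\<integral>\<^sup>+k. small N k * ennreal (tau \<kappa> (add_mset s k)) \<partial>W) \<partial>\<theta>)"
proof -
  have "branch_upto (Suc N) r = (\<integral>\<^sup>+k. (\<Sum>s\<in>#k. ennreal (\<kappa> r s)) * (small (Suc N) k * ennreal (tau \<kappa> k)) \<partial>W)"
    unfolding branch_upto_def link_def by (simp add: mult_ac)
  also have "\<dots> = (\<integral>\<^sup>+s. ennreal (\<kappa> r s) * (\<integral>\<^sup>+k. small (Suc N) (add_mset s k) * ennreal (tau \<kappa> (add_mset s k)) \<partial>W) \<partial>\<theta>)"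
    by (rule mecke) measurable
  finally show ?thesis by (simp add: small_def)
qed

lemma branch_eq: "branch r = (\<integral>\<^sup>+s. ennreal (\<kappa> r s) * (\<integral>\<^sup>+k. ennreal (tau \<kappa> (add_mset s k)) \<partial>W) \<partial>\<theta>)"
proof -
  have "branch r = (\<integral>\<^sup>+k. (\<Sum>s\<in>#k. ennreal (\<kappa> r s)) * ennreal (tau \<kappa> k) \<partial>W)"
    unfolding branch_def link_def by (simp add: mult_ac)
  also have "\<dots> = (\<integral>\<^sup>+s. ennreal (\<kappa> r s) * (\<integral>\<^sup>+k. ennreal (tau \<kappa> (add_mset s k)) \<partial>W) \<partial>\<theta>)"
    by (rule mecke) measurable
  finally show ?thesis .
qed

lemma branch_upto_0: "branch_upto 0 r = 0"
proof -
  have "branch_upto 0 r = (\<integral>\<^sup>+k. 0 \<partial>W)"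
    unfolding branch_upto_def by (intro nn_integral_cong) (simp add: small_def)
  then show ?thesis by simp
qed

lemma branch_eq_SUP: "branch r = (SUP N. branch_upto N r)"
proof -
  have "branch r = (\<integral>\<^sup>+k. (SUP N. small N k * (ennreal (tau \<kappa> k) * link r k)) \<partial>W)"
    unfolding branch_def
  proof (intro nn_integral_cong antisym)
    fix k
    show "ennreal (tau \<kappa> k) * link r k \<le> (SUP N. small N k * (ennreal (tau \<kappa> k) * link r k))"
      by (rule SUP_upper2[of "size k"]) (auto simp: small_def)
    show "(SUP N. small N k * (ennreal (tau \<kappa> k) * link r k)) \<le> ennreal (tau \<kappa> k) * link r k"
      by (rule SUP_least) (auto simp: small_def)
  qed
  also have "\<dots> = (SUP N. branch_upto N r)"
    unfolding branch_upto_def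
  proof (rule nn_integral_monotone_convergence_SUP)
    show "incseq (\<lambda>N k. small N k * (ennreal (tau \<kappa> k) * link r k))"
      by (auto simp: incseq_def le_fun_def small_def)
  qed measurable
  finally show ?thesis .
qed

lemma measurable_link_sum [measurable]: "(\<lambda>k. \<Sum>r\<in>#A. link r k) \<in> borel_measurable config_space"
  by (induction A) simp_all

text \<open>
  Cutting an edge in all possible ways counts every tree on \<open>n\<close> points \<open>2 (n - 1)\<close> times, once for
  each orientation of each edge.
\<close>

lemma nn_integral_edges:
  "2 * (\<integral>\<^sup>+k. of_nat (size k) * ennreal (tau \<kappa> k) \<partial>W) = 2 * (\<integral>\<^sup>+k. ennreal (tau \<kappa> k) \<partial>W) +
    (\<integral>\<^sup>+k. (\<Sum>r\<in>#k. branch r) * ennreal (tau \<kappa> k) \<partial>W)"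
proof -
  have [measurable]: "size \<in> config_space \<rightarrow>\<^sub>M count_space UNIV"
    using measurable_pts[of UNIV] by (simp add: pts_UNIV[abs_def])
  define L :: "'a multiset \<times> 'a multiset \<Rightarrow> real" where "L p = (\<Sum>r\<in>#fst p. \<Sum>s\<in>#snd p. \<kappa> r s)" for p
  have [measurable]: "L \<in> borel_measurable (config_space \<Otimes>\<^sub>M config_space)"
    unfolding L_def[abs_def] by (rule measurable_pair_link)
  have L0: "0 \<le> L p" for p
    unfolding L_def by (intro sum_mset_nonneg_real kappa_nonneg)
  have L: "ennreal (L p) = (\<Sum>r\<in>#fst p. link r (snd p))" for p
    unfolding L_def link_eq by (rule sum_mset_ennreal[symmetric]) (rule sum_kappa_nonneg)
  have rec: "2 * (of_nat (size k) * ennreal (tau \<kappa> k)) = 2 * ennreal (tau \<kappa> k) +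
      (\<Sum>p\<in>#splits k. ennreal (tau \<kappa> (fst p)) * (ennreal (tau \<kappa> (snd p)) * ennreal (L p)))" for k
  proof -
    have pos: "0 \<le> tau \<kappa> (fst p) * tau \<kappa> (snd p) * L p" for p
      by (intro mult_nonneg_nonneg tau_nonneg L0)
    have eq: "2 * (real (size k) * tau \<kappa> k) = 2 * tau \<kappa> k + (\<Sum>p\<in>#splits k. tau \<kappa> (fst p) * tau \<kappa> (snd p) * L p)"
      using tau_edge_recursion[of k] unfolding L_def by (simp add: algebra_simps)
    have "2 * (of_nat (size k) * ennreal (tau \<kappa> k)) = ennreal (2 * (real (size k) * tau \<kappa> k))"
      using tau_nonneg[of k] by (simp add: ennreal_mult ennreal_of_nat_eq_real_of_nat)
    also have "\<dots> = ennreal (2 * tau \<kappa> k) + ennreal (\<Sum>p\<in>#splits k. tau \<kappa> (fst p) * tau \<kappa> (snd p) * L p)"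
      unfolding eq by (rule ennreal_plus) (use tau_nonneg[of k] sum_mset_nonneg_real[OF pos] in auto)
    also have "ennreal (2 * tau \<kappa> k) = 2 * ennreal (tau \<kappa> k)"
      using tau_nonneg[of k] by (simp add: ennreal_mult)
    also have "ennreal (\<Sum>p\<in>#splits k. tau \<kappa> (fst p) * tau \<kappa> (snd p) * L p) =
      (\<Sum>p\<in>#splits k. ennreal (tau \<kappa> (fst p)) * (ennreal (tau \<kappa> (snd p)) * ennreal (L p)))"
      unfolding sum_mset_ennreal[OF pos, symmetric]
      using tau_nonneg L0 by (simp add: ennreal_mult mult.assoc)
    finally show ?thesis .
  qed
  have inner: "(\<integral>\<^sup>+k. ennreal (tau \<kappa> k) * (\<Sum>r\<in>#A. link r k) \<partial>W) = (\<Sum>r\<in>#A. branch r)" for A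
    by (induction A) (simp_all add: distrib_left nn_integral_add branch_def)
  have "2 * (\<integral>\<^sup>+k. of_nat (size k) * ennreal (tau \<kappa> k) \<partial>W) = (\<integral>\<^sup>+k. 2 * (of_nat (size k) * ennreal (tau \<kappa> k)) \<partial>W)"
    by (rule nn_integral_cmult[symmetric]) measurable
  also have "\<dots> = (\<integral>\<^sup>+k. 2 * ennreal (tau \<kappa> k) \<partial>W) +
      (\<integral>\<^sup>+k. (\<Sum>p\<in>#splits k. ennreal (tau \<kappa> (fst p)) * (ennreal (tau \<kappa> (snd p)) * ennreal (L p))) \<partial>W)"
    unfolding rec by (rule nn_integral_add) measurable
  also have "(\<integral>\<^sup>+k. 2 * ennreal (tau \<kappa> k) \<partial>W) = 2 * (\<integral>\<^sup>+k. ennreal (tau \<kappa> k) \<partial>W)"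
    by (rule nn_integral_cmult) measurable
  also have "(\<integral>\<^sup>+k. (\<Sum>p\<in>#splits k. ennreal (tau \<kappa> (fst p)) * (ennreal (tau \<kappa> (snd p)) * ennreal (L p))) \<partial>W) =
    (\<integral>\<^sup>+A. \<integral>\<^sup>+B. ennreal (tau \<kappa> A) * (ennreal (tau \<kappa> B) * ennreal (L (A, B))) \<partial>W \<partial>W)"
    by (subst nn_integral_splits) simp_all
  also have "\<dots> = (\<integral>\<^sup>+A. (\<Sum>r\<in>#A. branch r) * ennreal (tau \<kappa> A) \<partial>W)"
    by (intro nn_integral_cong) (simp add: L nn_integral_cmult inner mult.commute)
  finally show ?thesis .
qed

end

section \<open>The subcritical minimizer\<close>

text \<open>
  A quantitative form of \<open>1 - e\<^bsup>-u\<^esup> \<le> u\<close>, from \<open>- ln (1 - x) \<ge> x + x\<^sup>2 / 2\<close>. The cubic term is what forces a solution of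
  \<open>\<eta> = 1 - e\<^bsup>-T\<eta>\<^esup>\<close> to vanish if the norm of \<open>T\<close> is at most one.
\<close>

lemma one_minus_exp_strict:
  assumes "0 \<le> (u :: real)"
  shows "(1 - exp (- u))\<^sup>2 + (1 - exp (- u)) ^ 3 \<le> u\<^sup>2"
proof -
  define x where "x = 1 - exp (- u)"
  have x: "0 \<le> x" "x < 1" using assms by (auto simp: x_def)
  define f where "f = (\<lambda>t :: real. - ln (1 - t) - t - t\<^sup>2 / 2)"
  have "f 0 \<le> f x"
  proof (rule DERIV_nonneg_imp_nondecreasing[OF x(1)])
    fix t assume t: "0 \<le> t" "t \<le> x"
    have "(f has_real_derivative (1 / (1 - t) - 1 - t)) (at t)"
      unfolding f_def using t x by (auto intro!: derivative_eq_intros simp: divide_simps algebra_simps)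
    moreover have "0 \<le> 1 / (1 - t) - 1 - t"
    proof -
      have "1 / (1 - t) - 1 - t = t\<^sup>2 / (1 - t)" using t x by (simp add: field_simps power2_eq_square)
      then show ?thesis using t x by simp
    qed
    ultimately show "\<exists>y. (f has_real_derivative y) (at t) \<and> 0 \<le> y" by blast
  qed
  then have "x + x\<^sup>2 / 2 \<le> u" by (simp add: f_def x_def)
  then have "(x + x\<^sup>2 / 2)\<^sup>2 \<le> u\<^sup>2" using x by (intro power_mono) auto
  moreover have "(x + x\<^sup>2 / 2)\<^sup>2 = x\<^sup>2 + x ^ 3 + x ^ 4 / 4"
    by (simp add: power2_eq_square power3_eq_cube power4_eq_xxxx algebra_simps)
  moreover have "0 \<le> x ^ 4 / 4" by simp
  ultimately show ?thesis unfolding x_def[symmetric] by linarith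
qed

context kernel_measure
begin

lemma finite_borel_theta: "finite_borel (theta \<kappa> \<nu>)"
  unfolding theta_def by (rule finite_borel_density[where C = 1]) (use kap_nonneg in auto)

sublocale tree: tree_function \<kappa> K "theta \<kappa> \<nu>"
  by (intro tree_function.intro finite_borel_theta kernel_axioms)

lemma nn_integral_theta:
  assumes [measurable]: "f \<in> borel_measurable borel" "g \<in> borel_measurable borel"
  shows "(\<integral>\<^sup>+s. f s * ennreal (exp (g s)) \<partial>theta \<kappa> \<nu>) = (\<integral>\<^sup>+s. f s * ennreal (exp (g s - kap \<kappa> \<nu> s)) \<partial>\<nu>)"
proof -
  have "(\<integral>\<^sup>+s. f s * ennreal (exp (g s)) \<partial>theta \<kappa> \<nu>) =
      (\<integral>\<^sup>+s. ennreal (exp (- kap \<kappa> \<nu> s)) * (f s * ennreal (exp (g s))) \<partial>\<nu>)"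
    unfolding theta_def by (rule nn_integral_density) (auto intro!: measurable_nu)
  also have "\<dots> = (\<integral>\<^sup>+s. f s * ennreal (exp (g s - kap \<kappa> \<nu> s)) \<partial>\<nu>)"
    by (intro nn_integral_cong) (simp add: exp_diff exp_minus ennreal_mult[symmetric] mult_ac divide_inverse)
  finally show ?thesis .
qed

text \<open>
  The total weight of the branches at \<open>r\<close> never exceeds \<open>\<kappa>\<nu>(r)\<close>, by induction on the size of the trees:
  the factor \<open>e\<^bsup>-\<kappa>\<nu>\<^esup>\<close> in \<open>theta \<kappa> \<nu>\<close> is just what compensates the exponential of the branches.
\<close>

lemma branch_upto_le: "tree.branch_upto N r \<le> ennreal (kap \<kappa> \<nu> r)"
proof (induction N arbitrary: r)
  case (Suc N)
  have "tree.branch_upto (Suc N) r \<le> (\<integral>\<^sup>+s. ennreal (\<kappa> r s) * ennreal (exp (kap \<kappa> \<nu> s)) \<partial>theta \<kappa> \<nu>)"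
    unfolding tree.branch_upto_Suc
    by (intro nn_integral_mono mult_left_mono tree.rooted_trees_upto_le Suc kap_nonneg) simp
  also have "\<dots> = (\<integral>\<^sup>+s. ennreal (\<kappa> r s) \<partial>\<nu>)"
    by (subst nn_integral_theta) simp_all
  also have "\<dots> = ennreal (kap \<kappa> \<nu> r)"
    unfolding kap_def using kappa_nonneg by (intro nn_integral_eq_integral integrable_kappa) auto
  finally show ?case .
qed (simp add: tree.branch_upto_0)

definition branch_real :: "'a \<Rightarrow> real" where
  "branch_real r = enn2real (tree.branch r)"

lemma branch_eq_real: "tree.branch r = ennreal (branch_real r)"
  and branch_real_nonneg: "0 \<le> branch_real r"
  and branch_real_le: "branch_real r \<le> kap \<kappa> \<nu> r"
proof -
  have le: "tree.branch r \<le> ennreal (kap \<kappa> \<nu> r)"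
    unfolding tree.branch_eq_SUP by (rule SUP_least) (rule branch_upto_le)
  then have "tree.branch r < top" using le_less_trans by fastforce
  then show eq: "tree.branch r = ennreal (branch_real r)" by (simp add: branch_real_def)
  show "0 \<le> branch_real r" by (simp add: branch_real_def)
  show "branch_real r \<le> kap \<kappa> \<nu> r" using le unfolding eq using kap_nonneg by (simp add: ennreal_le_iff)
qed

lemma measurable_branch_real [measurable]: "branch_real \<in> borel_measurable borel"
proof -
  have "(\<lambda>s. \<integral>\<^sup>+k. ennreal (tau \<kappa> (add_mset s k)) \<partial>tree.W) \<in> borel_measurable borel"
    by (rule tree.measurable_poisson_weight_integral) measurable
  note [measurable] = this
  have [measurable]: "tree.branch \<in> borel_measurable borel"
    unfolding tree.branch_eq by (rule tree.borel_measurable_nn_integral) measurable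
  show ?thesis unfolding branch_real_def[abs_def] by measurable
qed

lemma lambda_c_eq: "lambda_c \<kappa> \<nu> = density tree.W (\<lambda>k. ennreal (tau \<kappa> k))"
proof (rule measure_eqI)
  let ?m = "measure (theta \<kappa> \<nu>) UNIV"
  show "sets (lambda_c \<kappa> \<nu>) = sets (density tree.W (\<lambda>k. ennreal (tau \<kappa> k)))"
    by (simp add: lambda_c_def tree.poisson_law_eq)
  fix A assume "A \<in> sets (lambda_c \<kappa> \<nu>)"
  then have [measurable]: "A \<in> sets config_space" by (simp add: lambda_c_def tree.poisson_law_eq)
  have s: "sets (scale_measure (ennreal (exp (- ?m))) tree.W) = sets config_space" by simp
  have "emeasure (lambda_c \<kappa> \<nu>) A =
      (\<integral>\<^sup>+k. ennreal (exp ?m * tau \<kappa> k) * indicator A k \<partial>scale_measure (ennreal (exp (- ?m))) tree.W)"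
    unfolding lambda_c_def tree.poisson_law_eq
    by (rule emeasure_density) (auto simp: measurable_cong_sets[OF s refl])
  also have "\<dots> = ennreal (exp (- ?m)) * (\<integral>\<^sup>+k. ennreal (exp ?m * tau \<kappa> k) * indicator A k \<partial>tree.W)"
    by (rule nn_integral_scale_measure) measurable
  also have "\<dots> = (\<integral>\<^sup>+k. ennreal (exp (- ?m)) * (ennreal (exp ?m * tau \<kappa> k) * indicator A k) \<partial>tree.W)"
    by (rule nn_integral_cmult[symmetric]) measurable
  also have "\<dots> = (\<integral>\<^sup>+k. ennreal (tau \<kappa> k) * indicator A k \<partial>tree.W)"
  proof (rule nn_integral_cong)
    fix k
    have "exp (- ?m) * (exp ?m * tau \<kappa> k) = tau \<kappa> k" by (simp add: exp_minus)
    then have "ennreal (exp (- ?m)) * ennreal (exp ?m * tau \<kappa> k) = ennreal (tau \<kappa> k)"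
      by (subst ennreal_mult[symmetric]) (auto simp: tau_nonneg)
    then show "ennreal (exp (- ?m)) * (ennreal (exp ?m * tau \<kappa> k) * indicator A k) = ennreal (tau \<kappa> k) * indicator A k"
      by (simp add: mult.assoc[symmetric])
  qed
  also have "\<dots> = emeasure (density tree.W (\<lambda>k. ennreal (tau \<kappa> k))) A"
    by (rule emeasure_density[symmetric]) measurable
  finally show "emeasure (lambda_c \<kappa> \<nu>) A = emeasure (density tree.W (\<lambda>k. ennreal (tau \<kappa> k))) A" .
qed

lemma sets_lambda_c [simp]: "sets (lambda_c \<kappa> \<nu>) = sets config_space"
  by (simp add: lambda_c_eq)

lemma nn_integral_lambda_c:
  assumes [measurable]: "F \<in> borel_measurable config_space"
  shows "(\<integral>\<^sup>+k. F k \<partial>lambda_c \<kappa> \<nu>) = (\<integral>\<^sup>+k. F k * ennreal (tau \<kappa> k) \<partial>tree.W)"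
  unfolding lambda_c_eq by (subst nn_integral_density) (simp_all add: mult.commute)

lemma nn_integral_c_micro_lambda_c:
  assumes [measurable]: "\<phi> \<in> borel_measurable borel"
  shows "(\<integral>\<^sup>+s. \<phi> s \<partial>c_micro (lambda_c \<kappa> \<nu>)) =
    (\<integral>\<^sup>+s. \<phi> s * ennreal (exp (branch_real s - kap \<kappa> \<nu> s)) \<partial>\<nu>)"
proof -
  have "(\<integral>\<^sup>+s. \<phi> s \<partial>c_micro (lambda_c \<kappa> \<nu>)) = (\<integral>\<^sup>+k. (\<Sum>s\<in>#k. \<phi> s) * ennreal (tau \<kappa> k) \<partial>tree.W)"
    by (simp add: nn_integral_c_micro nn_integral_lambda_c)
  also have "\<dots> = (\<integral>\<^sup>+s. \<phi> s * (\<integral>\<^sup>+k. ennreal (tau \<kappa> (add_mset s k)) \<partial>tree.W) \<partial>theta \<kappa> \<nu>)"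
    by (rule tree.mecke) measurable
  also have "\<dots> = (\<integral>\<^sup>+s. \<phi> s * ennreal (exp (branch_real s)) \<partial>theta \<kappa> \<nu>)"
    by (simp add: tree.rooted_trees_eq[OF branch_eq_real branch_real_nonneg])
  also have "\<dots> = (\<integral>\<^sup>+s. \<phi> s * ennreal (exp (branch_real s - kap \<kappa> \<nu> s)) \<partial>\<nu>)"
    by (rule nn_integral_theta) measurable
  finally show ?thesis .
qed

text \<open>
  The defect \<open>\<eta>\<close> of the branches satisfies \<open>\<eta> = 1 - e\<^bsup>-T\<eta>\<^esup>\<close>, the survival equation of a branching process.
  If the norm is at most one there is no survival, since \<open>T \<eta>\<close> would be strictly larger than \<open>\<eta>\<close>.
\<close>

proposition c_micro_lambda_c:
  assumes op: "op_norm_L2 \<kappa> \<nu> \<le> 1"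
  shows "c_micro (lambda_c \<kappa> \<nu>) = \<nu>"
proof -
  define \<gamma> where "\<gamma> s = exp (branch_real s - kap \<kappa> \<nu> s)" for s
  define \<eta> where "\<eta> s = 1 - \<gamma> s" for s
  have [measurable]: "\<gamma> \<in> borel_measurable borel" "\<eta> \<in> borel_measurable borel"
    unfolding \<eta>_def[abs_def] \<gamma>_def[abs_def] by measurable
  have \<gamma>: "0 < \<gamma> s" "\<gamma> s \<le> 1" for s using branch_real_le by (auto simp: \<gamma>_def)
  have \<eta>: "0 \<le> \<eta> s" "\<bar>\<eta> s\<bar> \<le> 1" for s using \<gamma>[of s] by (auto simp: \<eta>_def)
  let ?G = "c_micro (lambda_c \<kappa> \<nu>)"
  have G: "?G = density \<nu> (\<lambda>s. ennreal (\<gamma> s))"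
  proof (rule measure_eqI)
    fix A assume "A \<in> sets ?G"
    then have [measurable]: "A \<in> sets borel" by simp
    have "emeasure ?G A = (\<integral>\<^sup>+s. indicator A s \<partial>?G)" by simp
    also have "\<dots> = (\<integral>\<^sup>+s. ennreal (\<gamma> s) * indicator A s \<partial>\<nu>)"
      by (subst nn_integral_c_micro_lambda_c) (simp_all add: \<gamma>_def mult.commute)
    also have "\<dots> = emeasure (density \<nu> (\<lambda>s. ennreal (\<gamma> s))) A"
      by (rule emeasure_density[symmetric]) (auto intro!: measurable_nu)
    finally show "emeasure ?G A = emeasure (density \<nu> (\<lambda>s. ennreal (\<gamma> s))) A" .
  qed simp
  have br: "branch_real r = T_op \<kappa> \<nu> \<gamma> r" for r
  proof -
    have "ennreal (branch_real r) = (\<integral>\<^sup>+k. link r k * ennreal (tau \<kappa> k) \<partial>tree.W)"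
      unfolding branch_eq_real[symmetric] tree.branch_def by (simp add: mult.commute)
    also have "\<dots> = (\<integral>\<^sup>+s. ennreal (\<kappa> r s) \<partial>?G)"
      unfolding link_def by (simp add: nn_integral_c_micro nn_integral_lambda_c)
    also have "\<dots> = (\<integral>\<^sup>+s. ennreal (\<kappa> r s * \<gamma> s) \<partial>\<nu>)"
      by (subst nn_integral_c_micro_lambda_c)
        (use kappa_nonneg in \<open>auto simp: \<gamma>_def ennreal_mult intro!: nn_integral_cong\<close>)
    also have "\<dots> = ennreal (T_op \<kappa> \<nu> \<gamma> r)"
      unfolding T_op_def using \<gamma> kappa_nonneg
      by (intro nn_integral_eq_integral integrable_kappa_times[where C = 1]) (auto simp: less_imp_le)
    finally show ?thesis
      using branch_real_nonneg T_op_nonneg[of \<gamma> r] \<gamma> by (simp add: less_imp_le)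
  qed
  have diff: "T_op \<kappa> \<nu> \<eta> r = kap \<kappa> \<nu> r - branch_real r" for r
  proof -
    have "integrable \<nu> (\<lambda>s. \<kappa> r s * \<gamma> s)"
      by (rule integrable_kappa_times[where C = 1]) (use \<gamma> in \<open>auto simp: less_imp_le abs_le_iff\<close>)
    then show ?thesis
      unfolding br kap_def T_op_def \<eta>_def using integrable_kappa by (simp add: right_diff_distrib)
  qed
  have T0: "0 \<le> T_op \<kappa> \<nu> \<eta> r" for r by (rule T_op_nonneg) (rule \<eta>)
  have \<eta>_eq: "\<eta> r = 1 - exp (- T_op \<kappa> \<nu> \<eta> r)" for r unfolding diff by (simp add: \<eta>_def \<gamma>_def)
  have i2: "integrable \<nu> (\<lambda>r. (\<eta> r)\<^sup>2)" and i3: "integrable \<nu> (\<lambda>r. \<eta> r ^ 3)"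
    using \<eta> by (auto intro!: integrable_bounded[where C = 1] simp: power_abs power_le_one)
  have iT: "integrable \<nu> (\<lambda>r. (T_op \<kappa> \<nu> \<eta> r)\<^sup>2)"
  proof (rule integrable_bounded)
    show "\<bar>(T_op \<kappa> \<nu> \<eta> r)\<^sup>2\<bar> \<le> (K * (1 * measure \<nu> UNIV))\<^sup>2" for r
      using T_op_bounded[of \<eta> 1 r] \<eta> T0[of r] by (auto intro!: power_mono)
  qed measurable
  have "(\<integral>r. (\<eta> r)\<^sup>2 \<partial>\<nu>) + (\<integral>r. \<eta> r ^ 3 \<partial>\<nu>) = (\<integral>r. (\<eta> r)\<^sup>2 + \<eta> r ^ 3 \<partial>\<nu>)"
    using i2 i3 by simp
  also have "\<dots> \<le> (\<integral>r. (T_op \<kappa> \<nu> \<eta> r)\<^sup>2 \<partial>\<nu>)"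
  proof (rule integral_mono)
    show "(\<eta> r)\<^sup>2 + \<eta> r ^ 3 \<le> (T_op \<kappa> \<nu> \<eta> r)\<^sup>2" for r
      using one_minus_exp_strict[OF T0[of r]] \<eta>_eq[of r] by simp
  qed (use i2 i3 iT in auto)
  also have "\<dots> \<le> (op_norm_L2 \<kappa> \<nu>)\<^sup>2 * (\<integral>r. (\<eta> r)\<^sup>2 \<partial>\<nu>)"
    by (rule op_norm_bound[OF _ \<eta>(2)]) measurable
  also have "\<dots> \<le> 1 * (\<integral>r. (\<eta> r)\<^sup>2 \<partial>\<nu>)"
    using op op_norm_nonneg by (intro mult_right_mono) (auto simp: power_le_one)
  finally have "(\<integral>r. \<eta> r ^ 3 \<partial>\<nu>) \<le> 0" by simp
  moreover have "0 \<le> (\<integral>r. \<eta> r ^ 3 \<partial>\<nu>)" using \<eta> by (intro Bochner_Integration.integral_nonneg) simp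
  ultimately have "(\<integral>r. \<eta> r ^ 3 \<partial>\<nu>) = 0" by simp
  then have "AE r in \<nu>. \<eta> r ^ 3 = 0"
    using i3 \<eta>(1) by (subst (asm) integral_nonneg_eq_0_iff_AE) auto
  then have "density \<nu> (\<lambda>s. ennreal (\<gamma> s)) = density \<nu> (\<lambda>_. 1)"
    by (intro density_cong) (auto intro!: measurable_nu elim!: eventually_mono simp: \<eta>_def)
  then show ?thesis using G by (simp add: density_1)
qed

text \<open>
  Weighted by the tree sum, the number of points minus the number of trees is the number of edges, and by
  \<open>nn_integral_edges\<close> the latter is half of \<open>\<langle>\<nu>, \<kappa>\<nu>\<rangle>\<close>.
\<close>

proposition measure_lambda_c:
  assumes op: "op_norm_L2 \<kappa> \<nu> \<le> 1"
  shows "finite_measure (lambda_c \<kappa> \<nu>)"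
    and "measure (lambda_c \<kappa> \<nu>) UNIV = measure \<nu> UNIV - 1/2 * (\<integral>r. kap \<kappa> \<nu> r \<partial>\<nu>)"
proof -
  have [measurable]: "size \<in> config_space \<rightarrow>\<^sub>M count_space UNIV"
    using measurable_pts[of UNIV] by (simp add: pts_UNIV[abs_def])
  note cm = c_micro_lambda_c[OF op]
  have sp: "space (lambda_c \<kappa> \<nu>) = UNIV" using sets_eq_imp_space_eq[OF sets_lambda_c] by simp
  have tot: "emeasure (lambda_c \<kappa> \<nu>) UNIV = (\<integral>\<^sup>+k. ennreal (tau \<kappa> k) \<partial>tree.W)"
    using nn_integral_lambda_c[of "\<lambda>_. 1"] sp by simp
  have size: "(\<integral>\<^sup>+k. of_nat (size k) * ennreal (tau \<kappa> k) \<partial>tree.W) = emeasure \<nu> UNIV"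
  proof -
    have "emeasure \<nu> UNIV = emeasure (c_micro (lambda_c \<kappa> \<nu>)) UNIV" by (simp add: cm)
    also have "\<dots> = (\<integral>\<^sup>+k. of_nat (size k) \<partial>lambda_c \<kappa> \<nu>)" by (subst emeasure_c_micro) simp_all
    also have "\<dots> = (\<integral>\<^sup>+k. of_nat (size k) * ennreal (tau \<kappa> k) \<partial>tree.W)" by (rule nn_integral_lambda_c) measurable
    finally show ?thesis by simp
  qed
  have "(\<integral>\<^sup>+k. ennreal (tau \<kappa> k) \<partial>tree.W) \<le> (\<integral>\<^sup>+k. of_nat (size k) * ennreal (tau \<kappa> k) \<partial>tree.W)"
  proof (rule nn_integral_mono)
    fix k
    show "ennreal (tau \<kappa> k) \<le> of_nat (size k) * ennreal (tau \<kappa> k)"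
    proof (cases "k = {#}")
      case False
      then have "(1 :: ennreal) \<le> of_nat (size k)"
        by (metis One_nat_def Suc_leI nonempty_has_size of_nat_1 of_nat_mono)
      from mult_right_mono[OF this] show ?thesis by simp
    qed simp
  qed
  then have lt: "emeasure (lambda_c \<kappa> \<nu>) UNIV < \<infinity>"
    unfolding tot size using emeasure_finite[of UNIV] by (metis infinity_ennreal_def less_top le_less_trans)
  then show fin: "finite_measure (lambda_c \<kappa> \<nu>)" by (intro finite_measureI) (simp add: sp)
  interpret l: finite_measure "lambda_c \<kappa> \<nu>" by (rule fin)
  have "branch_real = kap \<kappa> \<nu>"
  proof
    fix r
    have "ennreal (branch_real r) = (\<integral>\<^sup>+k. link r k * ennreal (tau \<kappa> k) \<partial>tree.W)"
      unfolding branch_eq_real[symmetric] tree.branch_def by (simp add: mult.commute)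
    also have "\<dots> = (\<integral>\<^sup>+s. ennreal (\<kappa> r s) \<partial>c_micro (lambda_c \<kappa> \<nu>))"
      unfolding link_def by (simp add: nn_integral_c_micro nn_integral_lambda_c)
    also have "\<dots> = ennreal (kap \<kappa> \<nu> r)"
      unfolding cm kap_def using kappa_nonneg by (intro nn_integral_eq_integral integrable_kappa) auto
    finally show "branch_real r = kap \<kappa> \<nu> r" using branch_real_nonneg kap_nonneg by simp
  qed
  then have br: "tree.branch r = ennreal (kap \<kappa> \<nu> r)" for r by (simp add: branch_eq_real)
  have "(\<integral>\<^sup>+k. (\<Sum>r\<in>#k. tree.branch r) * ennreal (tau \<kappa> k) \<partial>tree.W) = (\<integral>\<^sup>+r. ennreal (kap \<kappa> \<nu> r) \<partial>\<nu>)"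
    unfolding br using nn_integral_c_micro[OF sets_lambda_c, of "\<lambda>r. ennreal (kap \<kappa> \<nu> r)"]
    by (simp add: nn_integral_lambda_c cm)
  also have "\<dots> = ennreal (\<integral>r. kap \<kappa> \<nu> r \<partial>\<nu>)"
    using kap_nonneg kap_le by (intro nn_integral_eq_integral integrable_bounded[where C = "K * measure \<nu> UNIV"]) auto
  finally have e: "2 * emeasure \<nu> UNIV = 2 * emeasure (lambda_c \<kappa> \<nu>) UNIV + ennreal (\<integral>r. kap \<kappa> \<nu> r \<partial>\<nu>)"
    using tree.nn_integral_edges unfolding size tot by simp
  have "0 \<le> (\<integral>r. kap \<kappa> \<nu> r \<partial>\<nu>)" using kap_nonneg by (intro Bochner_Integration.integral_nonneg) simp
  then have "ennreal (2 * measure \<nu> UNIV) = ennreal (2 * measure (lambda_c \<kappa> \<nu>) UNIV + (\<integral>r. kap \<kappa> \<nu> r \<partial>\<nu>))"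
    using e by (simp add: emeasure_eq_measure l.emeasure_eq_measure ennreal_mult)
  then have "2 * measure \<nu> UNIV = 2 * measure (lambda_c \<kappa> \<nu>) UNIV + (\<integral>r. kap \<kappa> \<nu> r \<partial>\<nu>)"
    using \<open>0 \<le> (\<integral>r. kap \<kappa> \<nu> r \<partial>\<nu>)\<close> by (subst (asm) ennreal_inj) auto
  then show "measure (lambda_c \<kappa> \<nu>) UNIV = measure \<nu> UNIV - 1/2 * (\<integral>r. kap \<kappa> \<nu> r \<partial>\<nu>)" by simp
qed

end

section \<open>Minimizing over the microscopic states\<close>

subsection \<open>Measures below a given one\<close>

context finite_borel
begin

lemma submeasure_density:
  assumes "sets a = sets borel" "a \<le> \<nu>"
  obtains \<alpha> where "\<alpha> \<in> borel_measurable borel" "\<And>x. 0 \<le> \<alpha> x" "\<And>x. \<alpha> x \<le> (1::real)"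
    "a = density \<nu> (\<lambda>x. ennreal (\<alpha> x))" "diff_measure \<nu> a = density \<nu> (\<lambda>x. ennreal (1 - \<alpha> x))"
proof -
  obtain \<alpha> where \<alpha>: "\<alpha> \<in> borel_measurable \<nu>" "\<And>x. 0 \<le> \<alpha> x" "\<And>x. \<alpha> x \<le> (1::real)"
    "a = density \<nu> (\<lambda>x. ennreal (\<alpha> x))"
    by (rule dominated_density[OF finite_nu _ assms(2)]) (use assms(1) in auto)
  moreover have "\<alpha> \<in> borel_measurable borel" using \<alpha>(1) by (simp add: measurable_cong_sets[OF sets_nu refl])
  moreover have "diff_measure \<nu> a = density \<nu> (\<lambda>x. ennreal (1 - \<alpha> x))"
    unfolding \<alpha>(4) by (rule diff_measure_density[OF finite_nu \<alpha>(1-3)])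
  ultimately show ?thesis using that by blast
qed

lemma submeasure_emeasure_le: "sets a = sets borel \<Longrightarrow> a \<le> \<nu> \<Longrightarrow> emeasure a A \<le> emeasure \<nu> A"
  by (cases "A \<in> sets borel") (auto simp: le_measure emeasure_notin_sets)

lemma
  assumes a: "sets a = sets borel" "a \<le> \<nu>"
  shows finite_borel_submeasure: "finite_borel a"
    and finite_borel_diff: "finite_borel (diff_measure \<nu> a)"
    and diff_measure_le: "diff_measure \<nu> a \<le> \<nu>"
    and emeasure_submeasure_add: "A \<in> sets borel \<Longrightarrow> emeasure a A + emeasure (diff_measure \<nu> a) A = emeasure \<nu> A"
proof -
  obtain \<alpha> where \<alpha>: "\<alpha> \<in> borel_measurable borel" "\<And>x. 0 \<le> \<alpha> x" "\<And>x. \<alpha> x \<le> (1::real)"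
    "a = density \<nu> (\<lambda>x. ennreal (\<alpha> x))" "diff_measure \<nu> a = density \<nu> (\<lambda>x. ennreal (1 - \<alpha> x))"
    using submeasure_density[OF a] by blast
  note [measurable] = \<alpha>(1)
  show "finite_borel a" unfolding \<alpha>(4) by (rule finite_borel_density[OF \<alpha>(1,3)])
  show f: "finite_borel (diff_measure \<nu> a)"
    unfolding \<alpha>(5) by (rule finite_borel_density[where C = 1]) (use \<alpha> in auto)
  show add: "emeasure a A + emeasure (diff_measure \<nu> a) A = emeasure \<nu> A" if "A \<in> sets borel" for A
  proof -
    have "emeasure (diff_measure \<nu> a) A = emeasure \<nu> A - emeasure a A"
      by (rule emeasure_diff_measure)
        (use a that finite_nu \<open>finite_borel a\<close> submeasure_emeasure_le in \<open>auto simp: finite_borel_def\<close>)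
    then show ?thesis using submeasure_emeasure_le[OF a, of A] by (simp add: add_diff_inverse_ennreal)
  qed
  show "diff_measure \<nu> a \<le> \<nu>"
    using add by (subst le_measure) (auto, metis le_iff_add add.commute)
qed

lemma submeasure_split:
  fixes g :: "'a \<Rightarrow> real"
  assumes a: "sets a = sets borel" "a \<le> \<nu>" and g: "g \<in> borel_measurable borel" and i: "integrable \<nu> g"
  shows "integrable a g" "integrable (diff_measure \<nu> a) g"
    and "(\<integral>x. g x \<partial>a) + (\<integral>x. g x \<partial>diff_measure \<nu> a) = (\<integral>x. g x \<partial>\<nu>)"
proof -
  obtain \<alpha> where \<alpha>: "\<alpha> \<in> borel_measurable borel" "\<And>x. 0 \<le> \<alpha> x" "\<And>x. \<alpha> x \<le> (1::real)"
    "a = density \<nu> (\<lambda>x. ennreal (\<alpha> x))" "diff_measure \<nu> a = density \<nu> (\<lambda>x. ennreal (1 - \<alpha> x))"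
    using submeasure_density[OF a] by blast
  note [measurable] = \<alpha>(1) g
  have gm: "g \<in> borel_measurable \<nu>" by (rule measurable_nu[OF g])
  have am: "\<alpha> \<in> borel_measurable \<nu>" "(\<lambda>x. 1 - \<alpha> x) \<in> borel_measurable \<nu>" by (auto intro!: measurable_nu)
  have 1: "integrable \<nu> (\<lambda>x. \<alpha> x * g x)"
    by (rule Bochner_Integration.integrable_bound[OF i])
      (use \<alpha>(2,3) in \<open>auto simp: abs_mult measurable_nu intro!: mult_left_le_one_le\<close>)
  have 2: "integrable \<nu> (\<lambda>x. (1 - \<alpha> x) * g x)"
    by (rule Bochner_Integration.integrable_bound[OF i])
      (use \<alpha>(2,3) in \<open>auto simp: abs_mult measurable_nu intro!: mult_left_le_one_le\<close>)
  show "integrable a g" unfolding \<alpha>(4)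
    using integrable_density[OF gm am(1)] \<alpha>(2) 1 by simp
  show "integrable (diff_measure \<nu> a) g" unfolding \<alpha>(5)
    using integrable_density[OF gm am(2)] \<alpha>(3) 2 by simp
  have "(\<integral>x. g x \<partial>a) = (\<integral>x. \<alpha> x * g x \<partial>\<nu>)" unfolding \<alpha>(4)
    using integral_density[OF gm am(1)] \<alpha>(2) by simp
  moreover have "(\<integral>x. g x \<partial>diff_measure \<nu> a) = (\<integral>x. (1 - \<alpha> x) * g x \<partial>\<nu>)" unfolding \<alpha>(5)
    using integral_density[OF gm am(2)] \<alpha>(3) by simp
  moreover have "(\<integral>x. \<alpha> x * g x \<partial>\<nu>) + (\<integral>x. (1 - \<alpha> x) * g x \<partial>\<nu>) = (\<integral>x. \<alpha> x * g x + (1 - \<alpha> x) * g x \<partial>\<nu>)"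
    by (rule Bochner_Integration.integral_add[OF 1 2, symmetric])
  ultimately show "(\<integral>x. g x \<partial>a) + (\<integral>x. g x \<partial>diff_measure \<nu> a) = (\<integral>x. g x \<partial>\<nu>)"
    by (simp add: algebra_simps)
qed

lemma submeasure_AE:
  assumes a: "sets a = sets borel" "a \<le> \<nu>" and "AE x in \<nu>. P x"
  shows "AE x in a. P x"
proof -
  obtain \<alpha> where \<alpha>: "\<alpha> \<in> borel_measurable borel" "a = density \<nu> (\<lambda>x. ennreal (\<alpha> x))"
    using submeasure_density[OF a] by metis
  then show ?thesis using assms(3) by (subst \<alpha>(2), subst AE_density) (auto simp: measurable_nu)
qed

end

context kernel
begin

lemma kap_symmetric:
  assumes "finite_borel \<nu>" "finite_borel \<nu>'"
  shows "(\<integral>r. kap \<kappa> \<nu> r \<partial>\<nu>') = (\<integral>r. kap \<kappa> \<nu>' r \<partial>\<nu>)"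
proof -
  interpret n: kernel_measure \<kappa> K \<nu> using assms by (intro kernel_measure.intro kernel_axioms)
  interpret n': kernel_measure \<kappa> K \<nu>' using assms by (intro kernel_measure.intro kernel_axioms)
  interpret pair_sigma_finite \<nu> \<nu>' ..
  have k: "(\<integral>\<^sup>+s. ennreal (\<kappa> r s) \<partial>\<nu>) = ennreal (kap \<kappa> \<nu> r)" for r
    unfolding kap_def using kappa_nonneg by (intro nn_integral_eq_integral n.integrable_kappa) auto
  have k': "(\<integral>\<^sup>+s. ennreal (\<kappa> r s) \<partial>\<nu>') = ennreal (kap \<kappa> \<nu>' r)" for r
    unfolding kap_def using kappa_nonneg by (intro nn_integral_eq_integral n'.integrable_kappa) auto
  have "ennreal (\<integral>r. kap \<kappa> \<nu> r \<partial>\<nu>') = (\<integral>\<^sup>+r. ennreal (kap \<kappa> \<nu> r) \<partial>\<nu>')"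
    using n.kap_nonneg n.kap_le
    by (intro nn_integral_eq_integral[symmetric] n'.integrable_bounded[where C = "K * measure \<nu> UNIV"]) auto
  also have "\<dots> = (\<integral>\<^sup>+r. \<integral>\<^sup>+s. ennreal (\<kappa> r s) \<partial>\<nu> \<partial>\<nu>')" by (simp only: k)
  also have "\<dots> = (\<integral>\<^sup>+s. \<integral>\<^sup>+r. ennreal (\<kappa> r s) \<partial>\<nu>' \<partial>\<nu>)"
    by (rule Fubini') measurable
  also have "\<dots> = (\<integral>\<^sup>+s. ennreal (kap \<kappa> \<nu>' s) \<partial>\<nu>)"
    by (simp only: k'[symmetric] kappa_sym)
  also have "\<dots> = ennreal (\<integral>s. kap \<kappa> \<nu>' s \<partial>\<nu>)"
    using n'.kap_nonneg n'.kap_le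
    by (intro nn_integral_eq_integral n.integrable_bounded[where C = "K * measure \<nu>' UNIV"]) auto
  finally show ?thesis
    using n.kap_nonneg n'.kap_nonneg
    by (subst (asm) ennreal_inj) (auto intro!: Bochner_Integration.integral_nonneg)
qed

end

context kernel_measure
begin

lemma integrable_kap: "finite_borel \<nu>' \<Longrightarrow> integrable \<nu>' (kap \<kappa> \<nu>)"
proof -
  assume "finite_borel \<nu>'"
  then interpret n': kernel_measure \<kappa> K \<nu>' by (intro kernel_measure.intro kernel_axioms)
  show ?thesis
    by (rule n'.integrable_bounded[where C = "K * measure \<nu> UNIV"]) (use kap_nonneg kap_le in auto)
qed

lemma kap_submeasure_add:
  assumes "sets a = sets borel" "a \<le> \<nu>"
  shows "kap \<kappa> a r + kap \<kappa> (diff_measure \<nu> a) r = kap \<kappa> \<nu> r"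
  unfolding kap_def by (rule submeasure_split(3)[OF assms _ integrable_kappa]) measurable

end

text \<open>Campbell's formula for integrable functions.\<close>

lemma integral_sum_points:
  fixes g :: "'a::topological_space \<Rightarrow> real"
  assumes l: "sets l = sets config_space" and g[measurable]: "g \<in> borel_measurable borel"
    and i: "integrable (c_micro l) g"
  shows "integrable l (\<lambda>k. \<Sum>x\<in>#k. g x)" and "(\<integral>k. (\<Sum>x\<in>#k. g x) \<partial>l) = (\<integral>x. g x \<partial>c_micro l)"
proof -
  let ?p = "\<lambda>x. max 0 (g x)" and ?n = "\<lambda>x. max 0 (- g x)"
  have ml: "f \<in> borel_measurable config_space \<Longrightarrow> f \<in> borel_measurable l" for f :: "'a multiset \<Rightarrow> real"
    by (simp add: measurable_cong_sets[OF l refl])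
  have *: "integrable l (\<lambda>k. \<Sum>x\<in>#k. f x) \<and> (\<integral>k. (\<Sum>x\<in>#k. f x) \<partial>l) = (\<integral>x. f x \<partial>c_micro l)"
    if [measurable]: "f \<in> borel_measurable borel" and f0: "\<And>x. 0 \<le> f x" and fi: "integrable (c_micro l) f" for f :: "'a \<Rightarrow> real"
  proof -
    have s0: "0 \<le> (\<Sum>x\<in>#k. f x)" for k by (intro sum_mset_nonneg_real f0)
    have e: "(\<integral>\<^sup>+k. ennreal (\<Sum>x\<in>#k. f x) \<partial>l) = ennreal (\<integral>x. f x \<partial>c_micro l)"
    proof -
      have "(\<integral>\<^sup>+k. ennreal (\<Sum>x\<in>#k. f x) \<partial>l) = (\<integral>\<^sup>+x. ennreal (f x) \<partial>c_micro l)"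
        by (subst nn_integral_c_micro[OF l]) (simp_all add: sum_mset_ennreal f0)
      then show ?thesis using fi f0 by (simp add: nn_integral_eq_integral)
    qed
    have il: "integrable l (\<lambda>k. \<Sum>x\<in>#k. f x)"
      by (rule integrableI_nonneg) (use s0 e in \<open>auto intro!: ml\<close>)
    have "ennreal (\<integral>k. (\<Sum>x\<in>#k. f x) \<partial>l) = ennreal (\<integral>x. f x \<partial>c_micro l)"
      using e il s0 by (simp add: nn_integral_eq_integral)
    then show ?thesis
      using il s0 f0 by (subst (asm) ennreal_inj) (auto intro!: Bochner_Integration.integral_nonneg)
  qed
  have ip: "integrable (c_micro l) ?p" and "in": "integrable (c_micro l) ?n" using i by auto
  note P = *[of ?p, OF _ _ ip] and N = *[of ?n, OF _ _ "in"]
  have s: "(\<Sum>x\<in>#k. g x) = (\<Sum>x\<in>#k. ?p x) - (\<Sum>x\<in>#k. ?n x)" for k by (induction k) auto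
  show "integrable l (\<lambda>k. \<Sum>x\<in>#k. g x)" unfolding s using P N by simp
  have "g x = ?p x - ?n x" for x by simp
  then have "(\<integral>x. g x \<partial>c_micro l) = (\<integral>x. ?p x \<partial>c_micro l) - (\<integral>x. ?n x \<partial>c_micro l)"
    using Bochner_Integration.integral_diff[OF ip "in"] by simp
  then show "(\<integral>k. (\<Sum>x\<in>#k. g x) \<partial>l) = (\<integral>x. g x \<partial>c_micro l)"
    unfolding s using P N by simp
qed

subsection \<open>The rate of a microscopic state\<close>

locale rate = kernel_measure \<kappa> K \<mu> for \<kappa> :: "'a::polish_space \<Rightarrow> 'a \<Rightarrow> real" and K :: real and \<mu> :: "'a measure" +
  assumes total_mass: "measure \<mu> UNIV = 1"
begin

lemma kernel_measureI: "finite_borel \<nu> \<Longrightarrow> kernel_measure \<kappa> K \<nu>"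
  by (intro kernel_measure.intro kernel_axioms)

abbreviation tree_ref :: "'a multiset measure" where
  "tree_ref \<equiv> density (poisson_law \<mu>) (\<lambda>k. ennreal (tau \<kappa> k))"

lemma sets_tree_ref: "sets tree_ref = sets config_space"
  by (simp add: poisson_law_eq)

lemma sigma_finite_tree_ref: "sigma_finite_measure tree_ref"
proof -
  interpret W: finite_measure "poisson_weight \<mu>" by (rule finite_poisson_weight)
  have "finite_measure (poisson_law \<mu>)"
    unfolding poisson_law_eq
    by (rule finite_measureI) (simp add: space_scale_measure ennreal_mult_eq_top_iff)
  then interpret Q: finite_measure "poisson_law \<mu>" .
  have "(\<lambda>k. ennreal (tau \<kappa> k)) \<in> borel_measurable (poisson_law \<mu>)"
    unfolding poisson_law_eq by measurable
  then show ?thesis by (subst Q.sigma_finite_iff_density_finite) auto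
qed

lemma nn_integral_tree_ref:
  assumes [measurable]: "F \<in> borel_measurable config_space"
  shows "(\<integral>\<^sup>+k. F k \<partial>tree_ref) = (\<integral>\<^sup>+k. ennreal (exp (- 1)) * (F k * ennreal (tau \<kappa> k)) \<partial>poisson_weight \<mu>)"
proof -
  have "(\<integral>\<^sup>+k. F k \<partial>tree_ref) = (\<integral>\<^sup>+k. ennreal (tau \<kappa> k) * F k \<partial>poisson_law \<mu>)"
    by (rule nn_integral_density) (auto simp: poisson_law_eq measurable_cong_sets[OF sets_scale_measure refl]
        measurable_cong_sets[OF sets_poisson_weight refl])
  also have "\<dots> = ennreal (exp (- 1)) * (\<integral>\<^sup>+k. ennreal (tau \<kappa> k) * F k \<partial>poisson_weight \<mu>)"
    unfolding poisson_law_eq total_mass by (rule nn_integral_scale_measure) measurable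
  also have "\<dots> = (\<integral>\<^sup>+k. ennreal (exp (- 1)) * (F k * ennreal (tau \<kappa> k)) \<partial>poisson_weight \<mu>)"
    by (subst nn_integral_cmult[symmetric]) (simp_all add: mult_ac)
  finally show ?thesis .
qed

lemma I_Mi_eq:
  assumes "log_int l tree_ref = ereal v"
  shows "I_Mi \<kappa> \<mu> l = ereal (v - 2 * measure l UNIV + measure (c_micro l) UNIV + 1/2 * (\<integral>r. kap \<kappa> \<mu> r \<partial>c_micro l))"
  unfolding I_Mi_def assms by (simp add: one_ereal_def)

lemma I_Mi_ge:
  assumes "ereal v \<le> log_int l tree_ref"
  shows "ereal (v - 2 * measure l UNIV + measure (c_micro l) UNIV + 1/2 * (\<integral>r. kap \<kappa> \<mu> r \<partial>c_micro l)) \<le> I_Mi \<kappa> \<mu> l"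
  using assms unfolding I_Mi_def
  by (cases "log_int l tree_ref") (auto simp: one_ereal_def)

end

text \<open>
  A measure \<open>c \<le> \<mu>\<close> with density \<open>f\<close>, and a solution \<open>b\<close> of its balance equation with norm at most one. This
  covers both regimes: \<open>b = c\<close> if \<open>c\<close> has norm at most one itself, and the minimal solution otherwise.
\<close>

locale balanced = rate \<kappa> K \<mu> for \<kappa> :: "'a::polish_space \<Rightarrow> 'a \<Rightarrow> real" and K :: real and \<mu> :: "'a measure" +
  fixes c b :: "'a measure" and f :: "'a \<Rightarrow> real"
  assumes f_measurable [measurable]: "f \<in> borel_measurable borel" and f_nonneg: "0 \<le> f x" and f_le_1: "f x \<le> 1"
    and c_eq: "c = density \<mu> (\<lambda>x. ennreal (f x))"
    and balance: "balance_solution \<kappa> c b"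
    and subcritical: "op_norm_L2 \<kappa> b \<le> 1"
begin

abbreviation d where "d \<equiv> diff_measure c b"

lemma finite_borel_c: "finite_borel c"
  unfolding c_eq by (rule finite_borel_density[OF f_measurable f_le_1])

sublocale c: kernel_measure \<kappa> K c
  by (intro kernel_measureI finite_borel_c)

lemma b_sub: "sets b = sets borel" "b \<le> c"
  using balance by (auto simp: balance_solution_def fin_borel_def)

sublocale b: kernel_measure \<kappa> K b
  by (intro kernel_measureI c.finite_borel_submeasure b_sub)

sublocale d: kernel_measure \<kappa> K d
  by (intro kernel_measureI c.finite_borel_diff b_sub)

text \<open>
  \<open>\<phi>\<close> is the density of \<open>b\<close> with respect to \<open>\<mu>\<close>, and \<open>h\<close> that of \<open>theta \<kappa> b\<close>.
\<close>

definition \<phi> :: "'a \<Rightarrow> real" where "\<phi> x = f x / (1 + kap \<kappa> d x)"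
definition h :: "'a \<Rightarrow> real" where "h x = \<phi> x * exp (- kap \<kappa> b x)"

lemma measurable_phi [measurable]: "\<phi> \<in> borel_measurable borel"
  unfolding \<phi>_def[abs_def] by measurable

lemma measurable_h [measurable]: "h \<in> borel_measurable borel"
  unfolding h_def[abs_def] by measurable

lemma phi_nonneg: "0 \<le> \<phi> x"
  using f_nonneg[of x] d.kap_nonneg[of x] by (simp add: \<phi>_def)

lemma phi_le_f: "\<phi> x \<le> f x"
  unfolding \<phi>_def using f_nonneg[of x] d.kap_nonneg[of x] using mult_nonneg_nonneg[of "f x" "kap \<kappa> d x"]
  by (simp add: divide_le_eq algebra_simps)

lemma phi_le_1: "\<phi> x \<le> 1"
  using phi_le_f f_le_1 order_trans by blast

lemma phi_pos_iff: "0 < \<phi> x \<longleftrightarrow> 0 < f x"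
  using f_nonneg[of x] d.kap_nonneg[of x] by (simp add: \<phi>_def zero_less_divide_iff)

lemma h_nonneg: "0 \<le> h x"
  using phi_nonneg[of x] by (simp add: h_def)

lemma h_le_1: "h x \<le> 1"
proof -
  have "\<phi> x * exp (- kap \<kappa> b x) \<le> 1 * 1"
    by (rule mult_mono) (use phi_le_1 phi_nonneg b.kap_nonneg in auto)
  then show ?thesis by (simp add: h_def)
qed

lemma d_eq: "d = density b (\<lambda>r. ennreal (kap \<kappa> d r))"
  using balance by (simp add: balance_solution_def)

lemma b_eq: "b = density \<mu> (\<lambda>x. ennreal (\<phi> x))"
proof -
  let ?k = "\<lambda>x. ennreal (1 + kap \<kappa> d x)" and ?i = "\<lambda>x. ennreal (1 / (1 + kap \<kappa> d x))"
  have "c = density b ?k"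
  proof (rule measure_eqI)
    fix A assume "A \<in> sets c"
    then have A[measurable]: "A \<in> sets borel" by simp
    have "emeasure c A = emeasure b A + emeasure d A" using c.emeasure_submeasure_add[OF b_sub A] by simp
    also have "emeasure d A = (\<integral>\<^sup>+x. ennreal (kap \<kappa> d x) * indicator A x \<partial>b)"
      by (subst d_eq, rule emeasure_density) (auto intro!: b.measurable_nu)
    also have "emeasure b A + \<dots> = (\<integral>\<^sup>+x. indicator A x + ennreal (kap \<kappa> d x) * indicator A x \<partial>b)"
      by (subst nn_integral_add) (auto intro!: b.measurable_nu)
    also have "\<dots> = (\<integral>\<^sup>+x. ?k x * indicator A x \<partial>b)"
      using d.kap_nonneg by (intro nn_integral_cong) (simp add: distrib_right)
    also have "\<dots> = emeasure (density b ?k) A"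
      by (rule emeasure_density[symmetric]) (auto intro!: b.measurable_nu)
    finally show "emeasure c A = emeasure (density b ?k) A" .
  qed simp
  then have "density c ?i = density (density b ?k) ?i" by simp
  also have "\<dots> = density b (\<lambda>x. ?k x * ?i x)"
    by (rule density_density_eq) (auto intro!: b.measurable_nu)
  also have "(\<lambda>x. ?k x * ?i x) = (\<lambda>_. 1)"
  proof
    fix x
    have "1 + kap \<kappa> d x \<noteq> 0" using d.kap_nonneg[of x] by linarith
    then show "?k x * ?i x = 1" using d.kap_nonneg[of x] by (subst ennreal_mult[symmetric]) auto
  qed
  finally have "b = density c ?i" by (simp add: density_1)
  also have "\<dots> = density \<mu> (\<lambda>x. ennreal (f x) * ?i x)"
    unfolding c_eq by (rule density_density_eq) (auto intro!: measurable_nu simp: c_eq[symmetric])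
  also have "(\<lambda>x. ennreal (f x) * ?i x) = (\<lambda>x. ennreal (\<phi> x))"
    using f_nonneg d.kap_nonneg by (auto simp: fun_eq_iff ennreal_mult[symmetric] \<phi>_def)
  finally show ?thesis .
qed

lemma theta_eq: "theta \<kappa> b = density \<mu> (\<lambda>x. ennreal (h x))"
proof -
  have "theta \<kappa> b = density \<mu> (\<lambda>x. ennreal (\<phi> x) * ennreal (exp (- kap \<kappa> b x)))"
    unfolding theta_def by (subst (1) b_eq, rule density_density_eq) (auto intro!: measurable_nu)
  then show ?thesis using phi_nonneg by (simp add: ennreal_mult[symmetric] h_def)
qed

lemma AE_f_pos: "AE x in c. 0 < f x"
  unfolding c_eq by (subst AE_density) (auto simp: measurable_nu)

text \<open>
  The function \<open>f ln f\<close> is bounded on the unit interval, and \<open>kap \<kappa> d\<close> is bounded.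
\<close>

lemma integrable_ln_phi: "integrable c (\<lambda>x. ln (\<phi> x))"
proof -
  let ?C = "K * measure d UNIV"
  have C: "0 \<le> ?C" using d.kap_nonneg d.kap_le order_trans by blast
  have "\<bar>f x * ln (\<phi> x)\<bar> \<le> 1 + ln (1 + ?C)" for x
  proof (cases "f x = 0")
    case False
    then have fp: "0 < f x" using f_nonneg[of x] by simp
    have l: "ln (\<phi> x) = ln (f x) - ln (1 + kap \<kappa> d x)"
      unfolding \<phi>_def using fp d.kap_nonneg[of x] by (simp add: ln_div)
    have "ln (1 / f x) \<le> 1 / f x - 1" by (rule ln_le_minus_one) (use fp in simp)
    then have "f x * ln (1 / f x) \<le> f x * (1 / f x - 1)" using fp by (intro mult_left_mono) auto
    then have 1: "f x * (- ln (f x)) \<le> 1" using fp by (simp add: ln_div algebra_simps)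
    have 2: "ln (f x) \<le> 0" using fp f_le_1[of x] by simp
    have 3: "0 \<le> ln (1 + kap \<kappa> d x)" "ln (1 + kap \<kappa> d x) \<le> ln (1 + ?C)"
      using d.kap_nonneg[of x] d.kap_le[of x] by auto
    have 4: "f x * ln (1 + kap \<kappa> d x) \<le> ln (1 + ?C)"
      using mult_mono[of "f x" 1 "ln (1 + kap \<kappa> d x)" "ln (1 + ?C)"] fp f_le_1[of x] 3 by simp
    have "f x * ln (\<phi> x) \<le> 0" unfolding l by (rule mult_nonneg_nonpos) (use fp 2 3 in linarith)+
    moreover have "- (f x * ln (\<phi> x)) \<le> 1 + ln (1 + ?C)"
      unfolding l using 1 4 by (simp add: algebra_simps)
    ultimately show ?thesis by linarith
  qed (use C in simp)
  then have "integrable \<mu> (\<lambda>x. f x * ln (\<phi> x))"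
    by (intro integrable_bounded[where C = "1 + ln (1 + ?C)"]) auto
  then show ?thesis
    unfolding arg_cong[OF c_eq, of "\<lambda>M. integrable M (\<lambda>x. ln (\<phi> x))"]
    using f_nonneg by (subst integrable_density) (auto intro!: measurable_nu)
qed

lemma integrable_ln_h: "integrable c (\<lambda>x. ln (h x))"
  and integral_ln_h: "sets a = sets borel \<Longrightarrow> a \<le> c \<Longrightarrow> (\<integral>x. ln (h x) \<partial>a) = (\<integral>x. ln (\<phi> x) \<partial>a) - (\<integral>x. kap \<kappa> b x \<partial>a)"
proof -
  have ae: "AE x in c. ln (h x) = ln (\<phi> x) - kap \<kappa> b x"
    using AE_f_pos
  proof eventually_elim
    case (elim x)
    then have "0 < \<phi> x" by (simp add: phi_pos_iff)
    then show ?case by (simp add: h_def ln_mult)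
  qed
  have i: "integrable c (\<lambda>x. ln (\<phi> x) - kap \<kappa> b x)"
    using integrable_ln_phi b.integrable_kap[OF finite_borel_c] by simp
  show "integrable c (\<lambda>x. ln (h x))"
    by (subst integrable_cong_AE[OF _ _ ae]) (use i in \<open>auto intro!: c.measurable_nu\<close>)
  assume a: "sets a = sets borel" "a \<le> c"
  interpret a: finite_borel a by (rule c.finite_borel_submeasure[OF a])
  have "(\<integral>x. ln (h x) \<partial>a) = (\<integral>x. ln (\<phi> x) - kap \<kappa> b x \<partial>a)"
    by (rule integral_cong_AE) (auto intro!: a.measurable_nu c.submeasure_AE[OF a ae])
  also have "\<dots> = (\<integral>x. ln (\<phi> x) \<partial>a) - (\<integral>x. kap \<kappa> b x \<partial>a)"
    by (rule Bochner_Integration.integral_diff)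
      (use c.submeasure_split(1)[OF a _ integrable_ln_phi] b.integrable_kap[OF a.finite_borel_axioms] in auto)
  finally show "(\<integral>x. ln (h x) \<partial>a) = (\<integral>x. ln (\<phi> x) \<partial>a) - (\<integral>x. kap \<kappa> b x \<partial>a)" .
qed

text \<open>
  The density of \<open>lambda_c \<kappa> b\<close> with respect to the reference measure, which is also the comparison
  density for all other microscopic states.
\<close>

definition tilt :: "'a multiset \<Rightarrow> real" where
  "tilt k = exp 1 * (\<Prod>x\<in>#k. h x)"

lemma measurable_tilt [measurable]: "tilt \<in> borel_measurable config_space"
  unfolding tilt_def[abs_def] using measurable_prod_points[OF measurable_h h_nonneg] by measurable

lemma prod_h_nonneg: "0 \<le> (\<Prod>x\<in>#k. h x)"
  by (induction k) (auto simp: h_nonneg)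

lemma tilt_nonneg: "0 \<le> tilt k"
  unfolding tilt_def using prod_h_nonneg by simp

lemma ln_tilt:
  assumes "0 < tilt k"
  shows "ln (tilt k) = 1 + (\<Sum>x\<in>#k. ln (h x))"
proof -
  have "0 < (\<Prod>x\<in>#k. h x)" using assms by (simp add: tilt_def zero_less_mult_iff)
  then have "(\<Prod>x\<in>#k. h x) = exp (\<Sum>x\<in>#k. ln (h x))"
    unfolding prod_points_eq_exp[of h, OF h_nonneg] by (simp split: if_splits)
  then show ?thesis by (simp add: tilt_def ln_mult)
qed

lemma lambda_b_eq: "lambda_c \<kappa> b = density tree_ref (\<lambda>k. ennreal (tilt k))"
proof (rule measure_eqI)
  show "sets (lambda_c \<kappa> b) = sets (density tree_ref (\<lambda>k. ennreal (tilt k)))"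
    by (simp add: poisson_law_eq)
  fix A assume "A \<in> sets (lambda_c \<kappa> b)"
  then have [measurable]: "A \<in> sets config_space" by simp
  have "emeasure (lambda_c \<kappa> b) A = (\<integral>\<^sup>+k. indicator A k \<partial>lambda_c \<kappa> b)" by simp
  also have "\<dots> = (\<integral>\<^sup>+k. indicator A k * ennreal (tau \<kappa> k) \<partial>poisson_weight (theta \<kappa> b))"
    by (rule b.nn_integral_lambda_c) measurable
  also have "\<dots> = (\<integral>\<^sup>+k. indicator A k * ennreal (tau \<kappa> k) * ennreal (\<Prod>x\<in>#k. h x) \<partial>poisson_weight \<mu>)"
    unfolding theta_eq by (rule nn_integral_poisson_weight_density[OF _ measurable_h h_nonneg h_le_1]) measurable
  also have "\<dots> = (\<integral>\<^sup>+k. ennreal (exp (- 1)) * ((ennreal (tilt k) * indicator A k) * ennreal (tau \<kappa> k)) \<partial>poisson_weight \<mu>)"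
  proof (rule nn_integral_cong)
    fix k
    have "ennreal (exp (- 1)) * ennreal (tilt k) = ennreal (\<Prod>x\<in>#k. h x)"
      using prod_h_nonneg[of k] tilt_nonneg[of k]
      by (simp add: ennreal_mult[symmetric] tilt_def exp_minus)
    then show "indicator A k * ennreal (tau \<kappa> k) * ennreal (\<Prod>x\<in>#k. h x) =
      ennreal (exp (- 1)) * ((ennreal (tilt k) * indicator A k) * ennreal (tau \<kappa> k))"
      by (metis (no_types, lifting) mult.assoc mult.commute)
  qed
  also have "\<dots> = (\<integral>\<^sup>+k. ennreal (tilt k) * indicator A k \<partial>tree_ref)"
    by (rule nn_integral_tree_ref[symmetric]) measurable
  also have "\<dots> = emeasure (density tree_ref (\<lambda>k. ennreal (tilt k))) A"
    by (rule emeasure_density[symmetric])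
      (auto simp: measurable_cong_sets[OF sets_tree_ref refl] sets_tree_ref poisson_law_eq)
  finally show "emeasure (lambda_c \<kappa> b) A = emeasure (density tree_ref (\<lambda>k. ennreal (tilt k))) A" .
qed

lemma measurable_tilt_ref: "tilt \<in> borel_measurable tree_ref"
  using measurable_tilt by (simp add: measurable_cong_sets[OF sets_tree_ref refl])

lemma finite_lambda_b: "finite_measure (lambda_c \<kappa> b)"
  and mass_lambda_b: "measure (lambda_c \<kappa> b) UNIV = measure b UNIV - 1/2 * (\<integral>r. kap \<kappa> b r \<partial>b)"
  using b.measure_lambda_c[OF subcritical] by auto

lemma c_micro_lambda_b: "c_micro (lambda_c \<kappa> b) = b"
  by (rule b.c_micro_lambda_c[OF subcritical])

lemma integrable_tilt: "integrable tree_ref tilt"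
  and integral_tilt: "(\<integral>k. tilt k \<partial>tree_ref) = measure (lambda_c \<kappa> b) UNIV"
proof -
  interpret l: finite_measure "lambda_c \<kappa> b" by (rule finite_lambda_b)
  have sp: "space tree_ref = UNIV" using sets_eq_imp_space_eq[OF sets_tree_ref] by simp
  have "emeasure (lambda_c \<kappa> b) UNIV = (\<integral>\<^sup>+k. ennreal (tilt k) * indicator UNIV k \<partial>tree_ref)"
    unfolding lambda_b_eq by (rule emeasure_density)
      (use measurable_tilt_ref sp sets.top[of tree_ref] in auto)
  then have e: "(\<integral>\<^sup>+k. ennreal (tilt k) \<partial>tree_ref) = ennreal (measure (lambda_c \<kappa> b) UNIV)"
    by (simp add: l.emeasure_eq_measure)
  show i: "integrable tree_ref tilt"
    by (rule integrableI_nonneg) (use measurable_tilt_ref tilt_nonneg e in auto)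
  have "ennreal (\<integral>k. tilt k \<partial>tree_ref) = ennreal (measure (lambda_c \<kappa> b) UNIV)"
    using e i tilt_nonneg by (simp add: nn_integral_eq_integral)
  then show "(\<integral>k. tilt k \<partial>tree_ref) = measure (lambda_c \<kappa> b) UNIV"
    using tilt_nonneg by (subst (asm) ennreal_inj) (auto intro!: Bochner_Integration.integral_nonneg)
qed

lemma integrable_ln_tilt:
  assumes l: "sets l = sets config_space" "finite_measure l" and le: "c_micro l \<le> c"
  shows "AE k in l. 0 < tilt k" and "integrable l (\<lambda>k. ln (tilt k))"
    and "(\<integral>k. ln (tilt k) \<partial>l) = measure l UNIV + (\<integral>x. ln (h x) \<partial>c_micro l)"
proof -
  interpret l: finite_measure l by (rule l(2))
  have sp: "space l = UNIV" using sets_eq_imp_space_eq[OF l(1)] by simp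
  have ml: "f \<in> borel_measurable config_space \<Longrightarrow> f \<in> borel_measurable l" for f :: "'a multiset \<Rightarrow> real"
    by (simp add: measurable_cong_sets[OF l(1) refl])
  have sa: "sets (c_micro l) = sets borel" using l(1) by simp
  let ?Z = "{x. h x = 0}"
  have Z[measurable]: "?Z \<in> sets borel"
  proof -
    have "{x \<in> space borel. h x = 0} \<in> sets borel" by measurable
    then show ?thesis by simp
  qed
  have "AE x in c. x \<notin> ?Z"
    using AE_f_pos by eventually_elim (use phi_pos_iff in \<open>force simp: h_def\<close>)
  then have "AE x in c_micro l. x \<notin> ?Z" by (rule c.submeasure_AE[OF sa le])
  then have "emeasure (c_micro l) ?Z = 0"
    using Z sa by (subst (asm) AE_iff_measurable[of ?Z]) (auto simp: sets_eq_imp_space_eq[OF sa])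
  moreover have mZ: "(\<lambda>k. of_nat (pts ?Z k) :: ennreal) \<in> borel_measurable l"
  proof -
    have "(\<lambda>k. of_nat (pts ?Z k) :: ennreal) \<in> borel_measurable config_space" by measurable
    then show ?thesis by (simp add: measurable_cong_sets[OF l(1) refl])
  qed
  ultimately have "(\<integral>\<^sup>+k. of_nat (pts ?Z k) \<partial>l) = 0" using emeasure_c_micro[OF l(1) Z] by simp
  then have "AE k in l. (of_nat (pts ?Z k) :: ennreal) = 0"
    by (subst (asm) nn_integral_0_iff_AE[OF mZ]) simp
  then show pos: "AE k in l. 0 < tilt k"
  proof eventually_elim
    case (elim k)
    then show ?case using prod_points_eq_exp[of h k, OF h_nonneg] by (simp add: tilt_def)
  qed
  have ih: "integrable (c_micro l) (\<lambda>x. ln (h x))"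
    by (rule c.submeasure_split(1)[OF sa le _ integrable_ln_h]) measurable
  note S = integral_sum_points[OF l(1) _ ih]
  have ae: "AE k in l. ln (tilt k) = 1 + (\<Sum>x\<in>#k. ln (h x))"
    using pos by eventually_elim (rule ln_tilt)
  have mt: "(\<lambda>k. ln (tilt k)) \<in> borel_measurable l" "(\<lambda>k. 1 + (\<Sum>x\<in>#k. ln (h x))) \<in> borel_measurable l"
    by (rule ml; measurable)+
  show "integrable l (\<lambda>k. ln (tilt k))"
    by (subst integrable_cong_AE[OF mt ae]) (use S(1) in simp)
  have "(\<integral>k. ln (tilt k) \<partial>l) = (\<integral>k. 1 + (\<Sum>x\<in>#k. ln (h x)) \<partial>l)"
    by (rule integral_cong_AE[OF mt ae])
  then show "(\<integral>k. ln (tilt k) \<partial>l) = measure l UNIV + (\<integral>x. ln (h x) \<partial>c_micro l)"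
    using S by (simp add: sp)
qed

lemma I_Mi_lambda_b:
  "I_Mi \<kappa> \<mu> (lambda_c \<kappa> b) =
    ereal ((\<integral>x. ln (\<phi> x) \<partial>b) + 1/2 * (\<integral>r. kap \<kappa> \<mu> r \<partial>b) - 1/2 * (\<integral>r. kap \<kappa> b r \<partial>b))"
proof -
  have le: "c_micro (lambda_c \<kappa> b) \<le> c" unfolding c_micro_lambda_b by (rule b_sub)
  note L = integrable_ln_tilt[OF b.sets_lambda_c finite_lambda_b le]
  have "log_int (lambda_c \<kappa> b) tree_ref = ereal (\<integral>k. ln (tilt k) \<partial>lambda_c \<kappa> b)"
    by (rule log_int_density_integrable[OF sigma_finite_tree_ref measurable_tilt_ref tilt_nonneg lambda_b_eq L(2)])
  from I_Mi_eq[OF this] show ?thesis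
    unfolding L(3) c_micro_lambda_b integral_ln_h[OF b_sub] mass_lambda_b by simp
qed

lemma AE_phi_pos: "AE x in c. 0 < \<phi> x"
  using AE_f_pos by (simp add: phi_pos_iff)

lemma sigma_finite_mesoscopic_ref:
  assumes "finite_borel m"
  shows "sigma_finite_measure (density \<mu> (\<lambda>r. ennreal (kap \<kappa> m r)))"
    and "sets (density \<mu> (\<lambda>r. ennreal (kap \<kappa> m r))) = sets borel"
proof -
  interpret m: kernel_measure \<kappa> K m by (rule kernel_measureI[OF assms])
  interpret r: finite_borel "density \<mu> (\<lambda>r. ennreal (kap \<kappa> m r))"
    by (rule finite_borel_density[OF m.measurable_kap m.kap_le])
  show "sigma_finite_measure (density \<mu> (\<lambda>r. ennreal (kap \<kappa> m r)))" ..
  show "sets (density \<mu> (\<lambda>r. ennreal (kap \<kappa> m r))) = sets borel" by simp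
qed

lemma I_Me_d: "I_Me \<kappa> \<mu> d = ereal ((\<integral>x. ln (\<phi> x) \<partial>d) + 1/2 * (\<integral>r. kap \<kappa> \<mu> r \<partial>d))"
proof -
  let ?R = "density \<mu> (\<lambda>r. ennreal (kap \<kappa> d r))"
  have "d = density \<mu> (\<lambda>x. ennreal (\<phi> x) * ennreal (kap \<kappa> d x))"
    by (subst (1) d_eq, subst (1) b_eq, rule density_density_eq) (auto intro!: measurable_nu)
  also have "\<dots> = density ?R (\<lambda>x. ennreal (\<phi> x))"
    by (subst density_density_eq) (auto intro!: measurable_nu simp: mult.commute)
  finally have de: "d = density ?R (\<lambda>x. ennreal (\<phi> x))" .
  have "log_int d ?R = ereal (\<integral>x. ln (\<phi> x) \<partial>d)"
    by (rule log_int_density_integrable[OF sigma_finite_mesoscopic_ref(1)[OF d.finite_borel_axioms] _ phi_nonneg de])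
      (auto intro!: measurable_nu c.submeasure_split(2)[OF b_sub _ integrable_ln_phi])
  then show ?thesis unfolding I_Me_def by simp
qed

text \<open>
  The lower bound: Gibbs' inequality with the comparison densities \<open>tilt\<close> for the microscopic and \<open>\<phi>\<close> for
  the mesoscopic part. Everything that depends on the state cancels, since \<open>\<langle>b, \<kappa>m\<rangle> = \<langle>m, \<kappa>b\<rangle>\<close>, and the
  balance equation identifies the remaining constant.
\<close>

proposition I_Mi_plus_I_Me_ge:
  assumes l: "sets l = sets config_space" "finite_measure l" and le: "c_micro l \<le> c"
  shows "I_Mi \<kappa> \<mu> (lambda_c \<kappa> b) + I_Me \<kappa> \<mu> d \<le> I_Mi \<kappa> \<mu> l + I_Me \<kappa> \<mu> (diff_measure c (c_micro l))"
proof -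
  define a where "a = c_micro l"
  define m where "m = diff_measure c a"
  have a: "sets a = sets borel" "a \<le> c" using l le by (auto simp: a_def)
  interpret l: finite_measure l by (rule l(2))
  interpret a: kernel_measure \<kappa> K a by (intro kernel_measureI c.finite_borel_submeasure a)
  interpret m: kernel_measure \<kappa> K m unfolding m_def by (intro kernel_measureI c.finite_borel_diff a)
  have m: "m \<le> c" unfolding m_def by (rule c.diff_measure_le[OF a])
  have sp: "space l = UNIV" using sets_eq_imp_space_eq[OF l(1)] by simp
  note L = integrable_ln_tilt[OF l le]
  have "sets l = sets tree_ref" using l(1) sets_tree_ref by simp
  from gibbs[OF sigma_finite_tree_ref l(2) this tilt_nonneg L(1) integrable_tilt L(2)]
  have "ereal (measure l UNIV - measure (lambda_c \<kappa> b) UNIV + (measure l UNIV + (\<integral>x. ln (h x) \<partial>a))) \<le> log_int l tree_ref"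
    unfolding L(3) integral_tilt sp a_def .
  from I_Mi_ge[OF this] have mi: "ereal (measure a UNIV - measure (lambda_c \<kappa> b) UNIV + (\<integral>x. ln (\<phi> x) \<partial>a) - (\<integral>x. kap \<kappa> b x \<partial>a)
      + 1/2 * (\<integral>r. kap \<kappa> \<mu> r \<partial>a)) \<le> I_Mi \<kappa> \<mu> l"
    unfolding integral_ln_h[OF a] a_def[symmetric] by (simp add: algebra_simps)
  let ?R = "density \<mu> (\<lambda>r. ennreal (kap \<kappa> m r))"
  note R = sigma_finite_mesoscopic_ref[OF m.finite_borel_axioms]
  have "\<bar>kap \<kappa> m x * \<phi> x\<bar> \<le> K * measure m UNIV * 1" for x
    unfolding abs_mult
    by (rule mult_mono) (use m.kap_nonneg[of x] m.kap_le[of x] phi_nonneg[of x] phi_le_1[of x] in auto)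
  then have "integrable \<mu> (\<lambda>x. kap \<kappa> m x * \<phi> x)"
    by (intro integrable_bounded) auto
  then have iR: "integrable ?R \<phi>"
    by (subst integrable_density) (use m.kap_nonneg in \<open>auto intro!: measurable_nu\<close>)
  have "(\<integral>x. \<phi> x \<partial>?R) = (\<integral>x. kap \<kappa> m x * \<phi> x \<partial>\<mu>)"
    by (subst integral_density) (use m.kap_nonneg in \<open>auto intro!: measurable_nu\<close>)
  also have "\<dots> = (\<integral>x. kap \<kappa> m x \<partial>density \<mu> (\<lambda>x. ennreal (\<phi> x)))"
    by (subst integral_density) (use phi_nonneg in \<open>auto intro!: measurable_nu simp: mult.commute\<close>)
  also have "\<dots> = (\<integral>x. kap \<kappa> m x \<partial>b)"
    by (rule arg_cong[OF b_eq[symmetric]])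
  also have "\<dots> = (\<integral>x. kap \<kappa> b x \<partial>m)"
    by (rule kap_symmetric[OF m.finite_borel_axioms b.finite_borel_axioms])
  finally have int_phi: "(\<integral>x. \<phi> x \<partial>?R) = (\<integral>x. kap \<kappa> b x \<partial>m)" .
  have lm: "integrable m (\<lambda>x. ln (\<phi> x))"
    unfolding m_def by (rule c.submeasure_split(2)[OF a _ integrable_ln_phi]) measurable
  have "sets m = sets ?R" using R(2) by simp
  from gibbs[OF R(1) m.finite_nu this phi_nonneg _ iR lm] c.submeasure_AE[OF m.sets_nu m AE_phi_pos]
  have "ereal (measure m UNIV - (\<integral>x. kap \<kappa> b x \<partial>m) + (\<integral>x. ln (\<phi> x) \<partial>m)) \<le> log_int m ?R"
    unfolding int_phi by simp
  then have me: "ereal (measure m UNIV - (\<integral>x. kap \<kappa> b x \<partial>m) + (\<integral>x. ln (\<phi> x) \<partial>m) + 1/2 * (\<integral>r. kap \<kappa> \<mu> r \<partial>m)) \<le> I_Me \<kappa> \<mu> m"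
    unfolding I_Me_def by (cases "log_int m ?R") auto
  have split: "(\<integral>x. g x \<partial>a) + (\<integral>x. g x \<partial>m) = (\<integral>x. g x \<partial>b) + (\<integral>x. g x \<partial>d)"
    if "integrable c g" "g \<in> borel_measurable borel" for g :: "'a \<Rightarrow> real"
    using c.submeasure_split(3)[OF a that(2,1)] c.submeasure_split(3)[OF b_sub that(2,1)] by (simp add: m_def)
  have s1: "measure a UNIV + measure m UNIV = measure b UNIV + measure d UNIV"
    using split[of "\<lambda>_. 1"] by simp
  have s2: "(\<integral>x. ln (\<phi> x) \<partial>a) + (\<integral>x. ln (\<phi> x) \<partial>m) = (\<integral>x. ln (\<phi> x) \<partial>b) + (\<integral>x. ln (\<phi> x) \<partial>d)"
    by (rule split[OF integrable_ln_phi]) measurable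
  have s3: "(\<integral>x. kap \<kappa> b x \<partial>a) + (\<integral>x. kap \<kappa> b x \<partial>m) = (\<integral>x. kap \<kappa> b x \<partial>b) + (\<integral>x. kap \<kappa> b x \<partial>d)"
    by (rule split[OF b.integrable_kap[OF finite_borel_c]]) measurable
  have s4: "(\<integral>x. kap \<kappa> \<mu> x \<partial>a) + (\<integral>x. kap \<kappa> \<mu> x \<partial>m) = (\<integral>x. kap \<kappa> \<mu> x \<partial>b) + (\<integral>x. kap \<kappa> \<mu> x \<partial>d)"
    by (rule split[OF integrable_kap[OF finite_borel_c]]) measurable
  have "measure d UNIV = (\<integral>x. 1 \<partial>d)" by simp
  also have "\<dots> = (\<integral>x. kap \<kappa> d x * 1 \<partial>b)"
    by (subst (1) d_eq, subst integral_density) (use d.kap_nonneg in \<open>auto intro!: b.measurable_nu\<close>)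
  also have "\<dots> = (\<integral>x. kap \<kappa> b x \<partial>d)"
    using kap_symmetric[OF d.finite_borel_axioms b.finite_borel_axioms] by simp
  finally have s5: "measure d UNIV = (\<integral>x. kap \<kappa> b x \<partial>d)" .
  let ?x = "measure a UNIV - measure (lambda_c \<kappa> b) UNIV + (\<integral>x. ln (\<phi> x) \<partial>a) - (\<integral>x. kap \<kappa> b x \<partial>a)
      + 1/2 * (\<integral>r. kap \<kappa> \<mu> r \<partial>a)"
  let ?y = "measure m UNIV - (\<integral>x. kap \<kappa> b x \<partial>m) + (\<integral>x. ln (\<phi> x) \<partial>m) + 1/2 * (\<integral>r. kap \<kappa> \<mu> r \<partial>m)"
  have "I_Mi \<kappa> \<mu> (lambda_c \<kappa> b) + I_Me \<kappa> \<mu> d = ereal (?x + ?y)"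
    unfolding I_Mi_lambda_b I_Me_d plus_ereal.simps using s1 s2 s3 s4 s5 mass_lambda_b by simp
  also have "\<dots> = ereal ?x + ereal ?y" by simp
  also have "\<dots> \<le> I_Mi \<kappa> \<mu> l + I_Me \<kappa> \<mu> m" by (rule add_mono[OF mi me])
  finally show ?thesis unfolding m_def a_def .
qed

lemma lambda_b_micro_state: "lambda_c \<kappa> b \<in> micro_states \<mu> x"
proof -
  have E: "{{#}} \<in> sets config_space"
  proof -
    have "{k. size k = 0} \<in> sets config_space"
      using measurable_counts[of "{()}" "\<lambda>_. UNIV" "\<lambda>_. 0"] by simp
    moreover have "{k. size k = 0} = {{#}}" by auto
    ultimately show ?thesis by simp
  qed
  have "emeasure (lambda_c \<kappa> b) {{#}} = (\<integral>\<^sup>+k. indicator {{#}} k \<partial>lambda_c \<kappa> b)"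
    by (rule nn_integral_indicator[symmetric]) (simp add: E)
  also have "\<dots> = (\<integral>\<^sup>+k. indicator {{#}} k * ennreal (tau \<kappa> k) \<partial>poisson_weight (theta \<kappa> b))"
    by (rule b.nn_integral_lambda_c) (rule borel_measurable_indicator[OF E])
  also have "\<dots> = (\<integral>\<^sup>+k. 0 \<partial>poisson_weight (theta \<kappa> b))"
    by (rule nn_integral_cong) (auto simp: indicator_def)
  finally have "emeasure (lambda_c \<kappa> b) {{#}} = 0" by simp
  moreover have "b \<le> \<mu>"
  proof (rule order_trans[OF b_sub(2)])
    have "density \<mu> (\<lambda>x. ennreal (f x)) \<le> density \<mu> (\<lambda>x. ennreal 1)"
      by (rule density_le) (use f_le_1 in auto)
    then show "c \<le> \<mu>" unfolding c_eq by (simp add: density_1)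
  qed
  ultimately show ?thesis using finite_lambda_b by (simp add: micro_states_def c_micro_lambda_b)
qed

end

section \<open>Macroscopic states and the remaining mass\<close>

lemma
  assumes "sets a = sets borel" "sets b = sets borel"
  shows sets_add_measure: "sets (add_measure a b) = sets borel"
    and emeasure_add_measure: "A \<in> sets borel \<Longrightarrow> emeasure (add_measure a b) A = emeasure a A + emeasure b A"
proof -
  have "sets (add_measure a b) = sets a"
    unfolding add_measure_def by (simp add: sets.space_closed sets.sigma_sets_eq)
  with assms show "sets (add_measure a b) = sets borel" by simp
  show "emeasure (add_measure a b) A = emeasure a A + emeasure b A" if A: "A \<in> sets borel"
    unfolding add_measure_def
  proof (rule emeasure_measure_of_sigma)
    show "sigma_algebra (space a) (sets a)" by (rule sets.sigma_algebra_axioms)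
    show "positive (sets a) (\<lambda>A. emeasure a A + emeasure b A)" by (simp add: positive_def)
    show "countably_additive (sets a) (\<lambda>A. emeasure a A + emeasure b A)"
    proof (rule countably_additiveI)
      fix A :: "nat \<Rightarrow> _" assume A: "range A \<subseteq> sets a" "disjoint_family A"
      have "(\<Sum>i. emeasure a (A i) + emeasure b (A i)) = (\<Sum>i. emeasure a (A i)) + (\<Sum>i. emeasure b (A i))"
        by (rule suminf_add[symmetric]) auto
      also have "\<dots> = emeasure a (\<Union>i. A i) + emeasure b (\<Union>i. A i)"
        using A assms by (simp add: suminf_emeasure)
      finally show "(\<Sum>i. emeasure a (A i) + emeasure b (A i)) = emeasure a (\<Union>i. A i) + emeasure b (\<Union>i. A i)" .
    qed
  qed (use A assms in simp)
qed

lemma point_measures_sets: "\<alpha> \<in> point_measures \<Longrightarrow> sets \<alpha> = sets (count_space nonzero_measures)"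
  by (auto simp: point_measures_def)

lemma point_measures_space: "\<alpha> \<in> point_measures \<Longrightarrow> space \<alpha> = nonzero_measures"
  by (auto simp: point_measures_def)

lemma measurable_point_measure: "\<alpha> \<in> point_measures \<Longrightarrow> (F :: _ \<Rightarrow> 'b::topological_space) \<in> borel_measurable \<alpha>"
  by (simp add: measurable_cong_sets[OF point_measures_sets refl])

lemma
  fixes \<alpha> :: "'a::topological_space measure measure"
  assumes \<alpha>: "\<alpha> \<in> point_measures"
  shows sets_c_macro: "sets (c_macro \<alpha>) = sets borel"
    and nn_integral_c_macro: "f \<in> borel_measurable borel \<Longrightarrow> (\<integral>\<^sup>+x. f x \<partial>c_macro \<alpha>) = (\<integral>\<^sup>+y. \<integral>\<^sup>+x. f x \<partial>y \<partial>\<alpha>)"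
proof -
  define y' where "y' y = (if y \<in> nonzero_measures then y else null_measure borel)" for y :: "'a measure"
  have s: "sets (y' y) = sets borel" for y
    by (auto simp: y'_def nonzero_measures_def fin_borel_def)
  have c: "(\<integral>\<^sup>+y. F (y' y) \<partial>\<alpha>) = (\<integral>\<^sup>+y. F y \<partial>\<alpha>)" for F :: "'a measure \<Rightarrow> ennreal"
    by (rule nn_integral_cong) (simp add: y'_def point_measures_space[OF \<alpha>])
  have m: "(\<lambda>y. emeasure (y' y) R) \<in> borel_measurable \<alpha>" for R
    by (rule measurable_point_measure[OF \<alpha>])
  have eq: "c_macro \<alpha> = measure_of (space borel) (sets borel) (\<lambda>R. \<integral>\<^sup>+y. emeasure (y' y) R \<partial>\<alpha>)"
    unfolding c_macro_def space_borel by (simp only: c[of "\<lambda>y. emeasure y _"])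
  show "sets (c_macro \<alpha>) = sets borel" unfolding eq by (rule sets_mixture[of y' borel \<alpha>]) (simp_all add: s m)
  assume f: "f \<in> borel_measurable borel"
  show "(\<integral>\<^sup>+x. f x \<partial>c_macro \<alpha>) = (\<integral>\<^sup>+y. \<integral>\<^sup>+x. f x \<partial>y \<partial>\<alpha>)"
    unfolding eq using nn_integral_mixture[of y' borel \<alpha> f, OF s m f] c[of "\<lambda>y. \<integral>\<^sup>+x. f x \<partial>y"] by simp
qed

lemma emeasure_c_macro:
  assumes "\<alpha> \<in> point_measures" and R: "R \<in> sets borel"
  shows "emeasure (c_macro \<alpha>) R = (\<integral>\<^sup>+y. emeasure y R \<partial>\<alpha>)"
proof -
  have "emeasure (c_macro \<alpha>) R = (\<integral>\<^sup>+x. indicator R x \<partial>c_macro \<alpha>)"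
    by (rule nn_integral_indicator[symmetric]) (simp add: sets_c_macro[OF assms(1)] R)
  also have "\<dots> = (\<integral>\<^sup>+y. \<integral>\<^sup>+x. indicator R x \<partial>y \<partial>\<alpha>)"
    by (rule nn_integral_c_macro[OF assms(1) borel_measurable_indicator[OF R]])
  also have "\<dots> = (\<integral>\<^sup>+y. emeasure y R \<partial>\<alpha>)"
    by (intro nn_integral_cong nn_integral_indicator)
      (auto simp: point_measures_space[OF assms(1)] nonzero_measures_def fin_borel_def R)
  finally show ?thesis .
qed

lemma
  assumes y: "(y :: 'a::topological_space measure) \<in> fin_borel"
  shows macro_delta_point_measure: "macro_delta y \<in> point_measures"
    and c_macro_macro_delta: "c_macro (macro_delta y) = y"
    and nn_integral_macro_delta: "y \<noteq> null_measure borel \<Longrightarrow> (\<integral>\<^sup>+z. F z \<partial>macro_delta y) = F y"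
    and AE_macro_delta: "y \<noteq> null_measure borel \<Longrightarrow> (AE z in macro_delta y. P z) \<longleftrightarrow> P y"
proof -
  have N: "y \<noteq> null_measure borel \<Longrightarrow> y \<in> nonzero_measures" using y by (simp add: nonzero_measures_def)
  have sy: "sets y = sets borel" using y by (simp add: fin_borel_def)
  show int: "(\<integral>\<^sup>+z. F z \<partial>macro_delta y) = F y" if "y \<noteq> null_measure borel" for F
    using that N by (simp add: macro_delta_def nn_integral_return)
  show "(AE z in macro_delta y. P z) \<longleftrightarrow> P y" if "y \<noteq> null_measure borel"
  proof -
    have "(AE z in return (count_space nonzero_measures) y. P z) \<longleftrightarrow> P y"
      by (rule AE_return) (use N that in simp_all)
    then show ?thesis unfolding macro_delta_def if_not_P[OF that] .
  qed
  show pm: "macro_delta y \<in> point_measures"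
  proof (cases "y = null_measure borel")
    case True
    have "distr (count_space ({} :: nat set)) (count_space nonzero_measures) (\<lambda>_. y) = macro_delta y"
      unfolding macro_delta_def using True
      by (intro measure_eqI) (auto simp: emeasure_distr)
    then show ?thesis unfolding point_measures_def mem_Collect_eq
      by (intro exI[of _ "{}"] exI[of _ "\<lambda>_. y"] conjI Pi_I) (rule sym, auto)
  next
    case False
    have "distr (count_space ({0} :: nat set)) (count_space nonzero_measures) (\<lambda>_. y) = macro_delta y"
      unfolding macro_delta_def using False N[OF False]
      by (intro measure_eqI) (auto simp: emeasure_distr emeasure_return indicator_def)
    then show ?thesis unfolding point_measures_def mem_Collect_eq
      by (intro exI[of _ "{0}"] exI[of _ "\<lambda>_. y"] conjI Pi_I) (rule sym, auto simp: N[OF False])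
  qed
  show "c_macro (macro_delta y) = y"
  proof (rule measure_eqI)
    show "sets (c_macro (macro_delta y)) = sets y" using sets_c_macro[OF pm] sy by simp
    fix A assume "A \<in> sets (c_macro (macro_delta y))"
    then have A: "A \<in> sets borel" using sets_c_macro[OF pm] by simp
    show "emeasure (c_macro (macro_delta y)) A = emeasure y A"
    proof (cases "y = null_measure borel")
      case True
      then show ?thesis unfolding emeasure_c_macro[OF pm A] by (simp add: macro_delta_def)
    next
      case False
      then show ?thesis unfolding emeasure_c_macro[OF pm A] by (rule int)
    qed
  qed
qed

context finite_borel
begin

lemma fin_borel_iff_finite_borel: "m \<in> fin_borel \<longleftrightarrow> finite_borel m"
  by (auto simp: fin_borel_def finite_borel_def)

lemma emeasure_diff:
  assumes a: "sets a = sets borel" "a \<le> \<nu>" and A: "A \<in> sets borel"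
  shows "emeasure (diff_measure \<nu> a) A = emeasure \<nu> A - emeasure a A"
  by (rule emeasure_diff_measure)
    (use a A finite_nu finite_borel_submeasure[OF a] submeasure_emeasure_le[OF a] in \<open>auto simp: finite_borel_def\<close>)

lemma le_measureI:
  assumes "sets a = sets borel" "sets b = sets borel" "\<And>A. A \<in> sets borel \<Longrightarrow> emeasure a A \<le> emeasure b A"
  shows "a \<le> b"
  using assms by (subst le_measure) auto

lemma add_measure_le_left:
  assumes ab: "sets a = sets borel" "sets b = sets borel" and le: "add_measure a b \<le> \<nu>"
  shows "a \<le> \<nu>"
proof (rule le_measureI[OF ab(1) sets_nu])
  fix A :: "'a set" assume A: "A \<in> sets borel"
  have "emeasure (add_measure a b) A \<le> emeasure \<nu> A"
    using le sets_add_measure[OF ab] A by (subst (asm) le_measure) auto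
  then show "emeasure a A \<le> emeasure \<nu> A"
    unfolding emeasure_add_measure[OF ab A] by (rule order_trans[rotated]) (metis le_iff_add)
qed

lemma add_measure_commute:
  assumes "sets a = sets borel" "sets b = sets borel"
  shows "add_measure a b = add_measure b a"
  by (rule measure_eqI) (auto simp: sets_add_measure emeasure_add_measure assms add.commute)

lemma add_measure_le_iff:
  assumes ab: "sets a = sets borel" "sets b = sets borel" and le: "a \<le> \<nu>"
  shows "add_measure a b \<le> \<nu> \<longleftrightarrow> b \<le> diff_measure \<nu> a"
proof -
  have s: "emeasure a A + emeasure b A \<le> emeasure \<nu> A \<longleftrightarrow> emeasure b A \<le> emeasure (diff_measure \<nu> a) A"
    if A: "A \<in> sets borel" for A
  proof -
    interpret a: finite_borel a by (rule finite_borel_submeasure[OF ab(1) le])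
    have "emeasure \<nu> A = emeasure a A + emeasure (diff_measure \<nu> a) A"
      by (rule emeasure_submeasure_add[OF ab(1) le A, symmetric])
    then show ?thesis using a.emeasure_finite[of A] by (simp add: ennreal_add_left_cancel_le)
  qed
  show ?thesis
    using s by (subst (1 2) le_measure) (auto simp: sets_add_measure emeasure_add_measure ab)
qed

text \<open>
  The rate function subtracts the microscopic mass first; when the macroscopic state is given, the other order is
  needed.
\<close>

lemma diff_diff_measure:
  assumes ab: "sets a = sets borel" "sets b = sets borel" and le: "add_measure a b \<le> \<nu>"
  shows "diff_measure (diff_measure \<nu> a) b = diff_measure (diff_measure \<nu> b) a"
proof -
  have le': "add_measure b a \<le> \<nu>" using le add_measure_commute[OF ab] by simp
  have a: "a \<le> \<nu>" by (rule add_measure_le_left[OF ab le])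
  have b: "b \<le> \<nu>" by (rule add_measure_le_left[OF ab(2,1) le'])
  interpret da: finite_borel "diff_measure \<nu> a" by (rule finite_borel_diff[OF ab(1) a])
  interpret db: finite_borel "diff_measure \<nu> b" by (rule finite_borel_diff[OF ab(2) b])
  have ba: "b \<le> diff_measure \<nu> a" using le add_measure_le_iff[OF ab a] by simp
  have ab': "a \<le> diff_measure \<nu> b" using le' add_measure_le_iff[OF ab(2,1) b] by simp
  show ?thesis
  proof (rule measure_eqI)
    fix A assume "A \<in> sets (diff_measure (diff_measure \<nu> a) b)"
    then have A: "A \<in> sets borel" by simp
    show "emeasure (diff_measure (diff_measure \<nu> a) b) A = emeasure (diff_measure (diff_measure \<nu> b) a) A"
      unfolding da.emeasure_diff[OF ab(2) ba A] db.emeasure_diff[OF ab(1) ab' A]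
        emeasure_diff[OF ab(1) a A] emeasure_diff[OF ab(2) b A]
      by (rule diff_diff_commute_ennreal)
  qed simp
qed

lemma diff_measure_self: "diff_measure \<nu> \<nu> = null_measure borel"
proof (rule measure_eqI)
  fix A assume "A \<in> sets (diff_measure \<nu> \<nu>)"
  then show "emeasure (diff_measure \<nu> \<nu>) A = emeasure (null_measure borel) A"
    using emeasure_diff[OF sets_nu order_refl, of A] emeasure_finite[of A] by simp
qed simp

end

section \<open>Optimizing over the microscopic states\<close>

context rate
begin

lemma I_Me_null: "I_Me \<kappa> \<mu> (null_measure borel) = 0"
  by (simp add: I_Me_def log_int_def eintegral_def absolutely_continuous_def null_sets_def)

lemma balanced_self:
  assumes f: "f \<in> borel_measurable borel" "\<And>x. 0 \<le> f x" "\<And>x. f x \<le> 1" and c: "c = density \<mu> (\<lambda>x. ennreal (f x))"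
    and sub: "op_norm_L2 \<kappa> c \<le> 1"
  shows "balanced \<kappa> K \<mu> c c f"
proof -
  interpret c: kernel_measure \<kappa> K c
    unfolding c by (intro kernel_measureI finite_borel_density[OF f(1,3)])
  have "density c (\<lambda>r. ennreal (kap \<kappa> (diff_measure c c) r)) = diff_measure c c"
    unfolding c.diff_measure_self
    by (rule measure_eqI) (auto simp: kap_def emeasure_density)
  then have "balance_solution \<kappa> c c"
    unfolding balance_solution_def c.fin_borel_iff_finite_borel using c.finite_borel_axioms by simp
  then show ?thesis
    by (intro balanced.intro balanced_axioms.intro rate_axioms f c sub)
qed

lemma balanced_minimal:
  assumes f: "f \<in> borel_measurable borel" "\<And>x. 0 \<le> f x" "\<And>x. f x \<le> 1" and c: "c = density \<mu> (\<lambda>x. ennreal (f x))"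
    and sup: "1 < op_norm_L2 \<kappa> c"
  shows "balanced \<kappa> K \<mu> c (b_star \<kappa> c) f"
proof -
  interpret c: kernel_measure \<kappa> K c
    unfolding c by (intro kernel_measureI finite_borel_density[OF f(1,3)])
  show ?thesis
    unfolding c.minimal_solution_b_star(3)[OF sup]
    by (intro balanced.intro balanced_axioms.intro rate_axioms f c c.balance_solution_minimal_b c.op_norm_minimal_b_le_1)
qed

text \<open>
  Both cases of \<open>J\<close> are of the form treated above, as the mesoscopic part is empty in the first one.
\<close>

lemma J_attained:
  assumes f: "f \<in> borel_measurable borel" "\<And>x. 0 \<le> f x" "\<And>x. f x \<le> 1" and c: "c = density \<mu> (\<lambda>x. ennreal (f x))"
  obtains b where "balanced \<kappa> K \<mu> c b f"
    "J_fun \<kappa> \<mu> c = I_Mi \<kappa> \<mu> (lambda_c \<kappa> b) + I_Me \<kappa> \<mu> (diff_measure c b)"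
proof (cases "op_norm_L2 \<kappa> c \<le> 1")
  case True
  interpret c: finite_borel c unfolding c by (rule finite_borel_density[OF f(1,3)])
  show ?thesis
    by (rule that[OF balanced_self[OF f c True]])
      (simp add: J_fun_def True c.diff_measure_self I_Me_null)
next
  case False
  show ?thesis
    by (rule that[OF balanced_minimal[OF f c]]) (use False in \<open>simp_all add: J_fun_def\<close>)
qed

proposition I_Mi_lambda_c:
  assumes c: "c \<in> fin_borel" "c \<le> \<mu>" and sub: "op_norm_L2 \<kappa> c \<le> 1"
  shows "I_Mi \<kappa> \<mu> (lambda_c \<kappa> c) = log_int c \<mu> + ereal (1/2 * (\<integral>r. kap \<kappa> (diff_measure \<mu> c) r \<partial>c))"
proof -
  have sc: "sets c = sets borel" using c by (simp add: fin_borel_def)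
  obtain f where f: "f \<in> borel_measurable borel" "\<And>x. 0 \<le> f x" "\<And>x. f x \<le> (1::real)"
    and ce: "c = density \<mu> (\<lambda>x. ennreal (f x))"
    using submeasure_density[OF sc c(2)] by blast
  interpret balanced \<kappa> K \<mu> c c f by (rule balanced_self[OF f ce sub])
  have "\<phi> = f" unfolding \<phi>_def[abs_def] c.diff_measure_self by (simp add: kap_def)
  then have phi: "\<phi> x = f x" for x by simp
  have "log_int c \<mu> = ereal (\<integral>x. ln (f x) \<partial>c)"
    by (rule log_int_density_integrable[OF _ measurable_nu[OF f(1)] f(2) ce])
      (use integrable_ln_phi in \<open>simp_all add: phi, unfold_locales\<close>)
  moreover have "(\<integral>r. kap \<kappa> c r \<partial>c) + (\<integral>r. kap \<kappa> (diff_measure \<mu> c) r \<partial>c) = (\<integral>r. kap \<kappa> \<mu> r \<partial>c)"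
  proof -
    interpret r: kernel_measure \<kappa> K "diff_measure \<mu> c" by (intro kernel_measureI finite_borel_diff sc c)
    have "(\<integral>r. kap \<kappa> c r \<partial>c) + (\<integral>r. kap \<kappa> (diff_measure \<mu> c) r \<partial>c) =
      (\<integral>r. kap \<kappa> c r + kap \<kappa> (diff_measure \<mu> c) r \<partial>c)"
      by (rule Bochner_Integration.integral_add[symmetric]) (intro c.integrable_kap r.integrable_kap finite_borel_c)+
    then show ?thesis by (simp add: kap_submeasure_add[OF sc c(2)])
  qed
  ultimately show ?thesis unfolding I_Mi_lambda_b by (simp add: phi algebra_simps)
qed

proposition INF_microscopic:
  assumes \<alpha>: "\<alpha> \<in> macro_states \<mu> x"
  shows "(INF l'\<in>micro_states \<mu> x. rate_I \<kappa> \<mu> l' \<alpha>) =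
    (if c_macro \<alpha> \<le> \<mu> then I_Ma \<kappa> \<mu> \<alpha> + J_fun \<kappa> \<mu> (diff_measure \<mu> (c_macro \<alpha>)) else \<infinity>)"
proof -
  have sa: "sets (c_macro \<alpha>) = sets borel" using \<alpha> by (intro sets_c_macro) (simp add: macro_states_def)
  have sl: "sets (c_micro l) = sets borel" if "l \<in> micro_states \<mu> x" for l
    using that by (auto simp: micro_states_def)
  show ?thesis
  proof (cases "c_macro \<alpha> \<le> \<mu>")
    case False
    have "rate_I \<kappa> \<mu> l \<alpha> = \<infinity>" if "l \<in> micro_states \<mu> x" for l
      using add_measure_le_left[OF sa sl[OF that]] add_measure_commute[OF sa sl[OF that]] False
      by (auto simp: rate_I_def)
    then have "\<infinity> \<le> (INF l'\<in>micro_states \<mu> x. rate_I \<kappa> \<mu> l' \<alpha>)" by (intro INF_greatest) simp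
    with False show ?thesis by simp
  next
    case True
    define c where "c = diff_measure \<mu> (c_macro \<alpha>)"
    obtain g where g: "g \<in> borel_measurable borel" "\<And>x. 0 \<le> g x" "\<And>x. g x \<le> (1::real)"
      and g': "c_macro \<alpha> = density \<mu> (\<lambda>x. ennreal (g x))"
        "diff_measure \<mu> (c_macro \<alpha>) = density \<mu> (\<lambda>x. ennreal (1 - g x))"
      using submeasure_density[OF sa True] by blast
    from g'(2) have ce: "c = density \<mu> (\<lambda>x. ennreal (1 - g x))" by (simp only: c_def)
    obtain b where b: "balanced \<kappa> K \<mu> c b (\<lambda>x. 1 - g x)"
      and J: "J_fun \<kappa> \<mu> c = I_Mi \<kappa> \<mu> (lambda_c \<kappa> b) + I_Me \<kappa> \<mu> (diff_measure c b)"
      by (rule J_attained[OF _ _ _ ce]) (use g in auto)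
    interpret balanced \<kappa> K \<mu> c b "\<lambda>x. 1 - g x" by (rule b)
    have rate: "rate_I \<kappa> \<mu> l \<alpha> = I_Ma \<kappa> \<mu> \<alpha> + (I_Mi \<kappa> \<mu> l + I_Me \<kappa> \<mu> (diff_measure c (c_micro l)))"
      if "sets (c_micro l) = sets borel" "c_micro l \<le> c" for l
    proof -
      have le: "add_measure (c_macro \<alpha>) (c_micro l) \<le> \<mu>"
        using that add_measure_le_iff[OF sa that(1) True] by (simp add: c_def)
      then show ?thesis
        using diff_diff_measure[OF sa that(1) le] add_measure_commute[OF sa that(1)]
        by (simp add: rate_I_def c_def add_ac)
    qed
    have "(INF l'\<in>micro_states \<mu> x. rate_I \<kappa> \<mu> l' \<alpha>) = I_Ma \<kappa> \<mu> \<alpha> + J_fun \<kappa> \<mu> c"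
    proof (rule antisym)
      have "rate_I \<kappa> \<mu> (lambda_c \<kappa> b) \<alpha> = I_Ma \<kappa> \<mu> \<alpha> + J_fun \<kappa> \<mu> c"
        using rate[of "lambda_c \<kappa> b"] b_sub by (simp add: c_micro_lambda_b J)
      then show "(INF l'\<in>micro_states \<mu> x. rate_I \<kappa> \<mu> l' \<alpha>) \<le> I_Ma \<kappa> \<mu> \<alpha> + J_fun \<kappa> \<mu> c"
        using INF_lower[OF lambda_b_micro_state, of "\<lambda>l. rate_I \<kappa> \<mu> l \<alpha>"] by simp
      show "I_Ma \<kappa> \<mu> \<alpha> + J_fun \<kappa> \<mu> c \<le> (INF l'\<in>micro_states \<mu> x. rate_I \<kappa> \<mu> l' \<alpha>)"
      proof (rule INF_greatest)
        fix l assume l: "l \<in> micro_states \<mu> x"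
        then have l': "sets l = sets config_space" "finite_measure l" by (auto simp: micro_states_def)
        show "I_Ma \<kappa> \<mu> \<alpha> + J_fun \<kappa> \<mu> c \<le> rate_I \<kappa> \<mu> l \<alpha>"
        proof (cases "c_micro l \<le> c")
          case le: True
          show ?thesis
            unfolding rate[OF sl[OF l] le] J by (rule add_left_mono[OF I_Mi_plus_I_Me_ge[OF l' le]])
        next
          case False
          then show ?thesis
            using add_measure_le_iff[OF sa sl[OF l] True] add_measure_commute[OF sa sl[OF l]]
            by (simp add: rate_I_def c_def)
        qed
      qed
    qed
    then show ?thesis using True by (simp add: c_def)
  qed
qed

end

section \<open>Optimizing over the macroscopic states\<close>

subsection \<open>Integrals over point measures\<close>

text \<open>
  Each summand of the point measure occurs in the sum that defines \<open>c_macro\<close>.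
\<close>

lemma point_measure_atom_le:
  fixes \<alpha> :: "'a::topological_space measure measure"
  assumes \<alpha>: "\<alpha> \<in> point_measures"
  shows "AE y in \<alpha>. sets y = sets borel \<and> y \<le> c_macro \<alpha>"
proof -
  obtain ind :: "nat set" and Y where
    \<alpha>_eq: "\<alpha> = distr (count_space ind) (count_space nonzero_measures) Y" and Y: "Y \<in> ind \<rightarrow> nonzero_measures"
    using \<alpha> unfolding point_measures_def by auto
  have mY: "Y \<in> count_space ind \<rightarrow>\<^sub>M count_space nonzero_measures" using Y by simp
  have sY: "sets (Y n) = sets borel" if "n \<in> ind" for n
    using Y that by (auto simp: nonzero_measures_def fin_borel_def Pi_iff)
  have "Y n \<le> c_macro \<alpha>" if n: "n \<in> ind" for n
  proof -
    have "emeasure (Y n) A \<le> emeasure (c_macro \<alpha>) A" if A: "A \<in> sets borel" for A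
    proof -
      have "emeasure (Y n) A = (\<integral>\<^sup>+j. emeasure (Y n) A * indicator {n} j \<partial>count_space ind)"
        using n by (subst nn_integral_cmult_indicator) auto
      also have "\<dots> \<le> (\<integral>\<^sup>+j. emeasure (Y j) A \<partial>count_space ind)"
        by (rule nn_integral_mono) (auto simp: indicator_def)
      also have "\<dots> = (\<integral>\<^sup>+y. emeasure y A \<partial>\<alpha>)"
        unfolding \<alpha>_eq by (rule nn_integral_distr[OF mY, symmetric]) simp
      also have "\<dots> = emeasure (c_macro \<alpha>) A" by (rule emeasure_c_macro[OF \<alpha> A, symmetric])
      finally show ?thesis .
    qed
    then show ?thesis using sets_c_macro[OF \<alpha>] sY[OF n] by (subst le_measure) auto
  qed
  with sY show ?thesis
    unfolding \<alpha>_eq by (subst AE_distr_iff[OF mY]) (auto simp: AE_count_space)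
qed

lemma
  fixes G :: "'a::topological_space \<Rightarrow> real"
  assumes \<alpha>: "\<alpha> \<in> point_measures" and G: "G \<in> borel_measurable borel"
    and i: "integrable (c_macro \<alpha>) G" and iy: "AE y in \<alpha>. integrable y G"
  shows integrable_over_points: "integrable \<alpha> (\<lambda>y. \<integral>x. G x \<partial>y)"
    and integral_over_points: "(\<integral>y. (\<integral>x. G x \<partial>y) \<partial>\<alpha>) = (\<integral>x. G x \<partial>c_macro \<alpha>)"
proof -
  note m = measurable_point_measure[OF \<alpha>]
  let ?p = "\<lambda>x. max 0 (G x)" and ?n = "\<lambda>x. max 0 (- G x)"
  have *: "integrable \<alpha> (\<lambda>y. \<integral>x. f x \<partial>y) \<and> (\<integral>y. (\<integral>x. f x \<partial>y) \<partial>\<alpha>) = (\<integral>x. f x \<partial>c_macro \<alpha>)"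
    if f[measurable]: "f \<in> borel_measurable borel" and f0: "\<And>x. 0 \<le> f x"
      and fi: "integrable (c_macro \<alpha>) f" and fy: "AE y in \<alpha>. integrable y f" for f :: "'a \<Rightarrow> real"
  proof -
    have s0: "0 \<le> (\<integral>x. f x \<partial>y)" for y by (rule Bochner_Integration.integral_nonneg) (rule f0)
    have "(\<integral>\<^sup>+y. ennreal (\<integral>x. f x \<partial>y) \<partial>\<alpha>) = (\<integral>\<^sup>+y. \<integral>\<^sup>+x. ennreal (f x) \<partial>y \<partial>\<alpha>)"
      using fy by (intro nn_integral_cong_AE) (auto simp: nn_integral_eq_integral f0)
    also have "\<dots> = (\<integral>\<^sup>+x. ennreal (f x) \<partial>c_macro \<alpha>)"
      by (rule nn_integral_c_macro[OF \<alpha>, symmetric]) measurable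
    also have "\<dots> = ennreal (\<integral>x. f x \<partial>c_macro \<alpha>)"
      using fi f0 by (simp add: nn_integral_eq_integral)
    finally have e: "(\<integral>\<^sup>+y. ennreal (\<integral>x. f x \<partial>y) \<partial>\<alpha>) = ennreal (\<integral>x. f x \<partial>c_macro \<alpha>)" .
    have il: "integrable \<alpha> (\<lambda>y. \<integral>x. f x \<partial>y)"
      by (rule integrableI_nonneg) (use s0 e m in auto)
    have "ennreal (\<integral>y. (\<integral>x. f x \<partial>y) \<partial>\<alpha>) = ennreal (\<integral>x. f x \<partial>c_macro \<alpha>)"
      using e il s0 by (simp add: nn_integral_eq_integral)
    then show ?thesis
      using il s0 f0 by (subst (asm) ennreal_inj) (auto intro!: Bochner_Integration.integral_nonneg)
  qed
  have P: "integrable \<alpha> (\<lambda>y. \<integral>x. ?p x \<partial>y) \<and> (\<integral>y. (\<integral>x. ?p x \<partial>y) \<partial>\<alpha>) = (\<integral>x. ?p x \<partial>c_macro \<alpha>)"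
    by (rule *) (use G i iy in \<open>auto elim: eventually_mono\<close>)
  have N: "integrable \<alpha> (\<lambda>y. \<integral>x. ?n x \<partial>y) \<and> (\<integral>y. (\<integral>x. ?n x \<partial>y) \<partial>\<alpha>) = (\<integral>x. ?n x \<partial>c_macro \<alpha>)"
    by (rule *) (use G i iy in \<open>auto elim: eventually_mono\<close>)
  have d: "(\<integral>x. G x \<partial>y) = (\<integral>x. ?p x \<partial>y) - (\<integral>x. ?n x \<partial>y)" if "integrable y G" for y
  proof -
    have "(\<integral>x. G x \<partial>y) = (\<integral>x. ?p x - ?n x \<partial>y)" by (rule Bochner_Integration.integral_cong) auto
    also have "\<dots> = (\<integral>x. ?p x \<partial>y) - (\<integral>x. ?n x \<partial>y)"
      by (rule Bochner_Integration.integral_diff) (use that in auto)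
    finally show ?thesis .
  qed
  have ae: "AE y in \<alpha>. (\<integral>x. G x \<partial>y) = (\<integral>x. ?p x \<partial>y) - (\<integral>x. ?n x \<partial>y)"
    using iy by eventually_elim (rule d)
  have "integrable \<alpha> (\<lambda>y. (\<integral>x. ?p x \<partial>y) - (\<integral>x. ?n x \<partial>y))" using P N by simp
  then show "integrable \<alpha> (\<lambda>y. \<integral>x. G x \<partial>y)"
    by (subst integrable_cong_AE[OF m m ae])
  have "(\<integral>y. (\<integral>x. G x \<partial>y) \<partial>\<alpha>) = (\<integral>y. (\<integral>x. ?p x \<partial>y) - (\<integral>x. ?n x \<partial>y) \<partial>\<alpha>)"
    by (rule integral_cong_AE[OF m m ae])
  also have "\<dots> = (\<integral>x. ?p x \<partial>c_macro \<alpha>) - (\<integral>x. ?n x \<partial>c_macro \<alpha>)" using P N by simp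
  finally show "(\<integral>y. (\<integral>x. G x \<partial>y) \<partial>\<alpha>) = (\<integral>x. G x \<partial>c_macro \<alpha>)" using d[OF i] by simp
qed

lemma enn2ereal_pos_minus_neg: "enn2ereal (e2ennreal z) - enn2ereal (e2ennreal (- z)) = z"
proof (cases "0 \<le> z")
  case True
  then have "e2ennreal (- z) = 0" by (intro e2ennreal_neg) simp
  with True show ?thesis by (simp add: enn2ereal_e2ennreal zero_ennreal.rep_eq)
next
  case False
  then have "e2ennreal z = 0" "0 \<le> - z" by (auto intro!: e2ennreal_neg)
  then show ?thesis by (simp add: enn2ereal_e2ennreal zero_ennreal.rep_eq)
qed

subsection \<open>Two inequalities for the hyperbolic sine\<close>

lemma exp_half_le_one_minus_exp:
  fixes v :: real
  assumes "0 \<le> v"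
  shows "v * exp (- (v / 2)) \<le> 1 - exp (- v)"
proof -
  let ?g = "\<lambda>v :: real. exp (v / 2) - exp (- (v / 2)) - v"
  have "?g 0 \<le> ?g v"
  proof (rule DERIV_nonneg_imp_nondecreasing[OF assms])
    fix x :: real
    have "(?g has_real_derivative exp (x / 2) / 2 + exp (- (x / 2)) / 2 - 1) (at x)"
      by (auto intro!: derivative_eq_intros)
    moreover have "0 \<le> exp (x / 2) / 2 + exp (- (x / 2)) / 2 - 1"
      using exp_ge_add_one_self[of "x / 2"] exp_ge_add_one_self[of "- (x / 2)"] by linarith
    ultimately show "\<exists>y. (?g has_real_derivative y) (at x) \<and> 0 \<le> y" by blast
  qed
  then have "v \<le> exp (v / 2) - exp (- (v / 2))" by simp
  then have "v * exp (- (v / 2)) \<le> (exp (v / 2) - exp (- (v / 2))) * exp (- (v / 2))"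
    by (rule mult_right_mono) simp
  also have "\<dots> = 1 - exp (- v)" by (simp add: left_diff_distrib exp_add[symmetric] flip: exp_minus)
  finally show ?thesis .
qed

text \<open>
  Divided by \<open>exp (- (v / 2))\<close> this reads \<open>v sinh (u / 2) \<le> u sinh (v / 2)\<close>, which is convexity.
\<close>

lemma one_minus_exp_le_chord:
  fixes u v :: real
  assumes "0 \<le> u" "u \<le> v" "0 < v"
  shows "(1 - exp (- u)) * exp (- ((v - u) / 2)) \<le> u * ((1 - exp (- v)) / v)"
proof -
  let ?g = "\<lambda>x :: real. exp (x / 2) - exp (- (x / 2))"
  have "convex_on {0..} ?g"
  proof (rule f''_ge0_imp_convex[where f' = "\<lambda>x. exp (x / 2) / 2 + exp (- (x / 2)) / 2"
        and f'' = "\<lambda>x. exp (x / 2) / 4 - exp (- (x / 2)) / 4"])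
    show "convex {0::real..}" by simp
    fix x :: real assume "x \<in> {0..}"
    then show "0 \<le> exp (x / 2) / 4 - exp (- (x / 2)) / 4" by simp
  qed (auto intro!: derivative_eq_intros)
  from convex_onD[OF this, of "u / v" 0 v] have "?g u \<le> u / v * ?g v" using assms by simp
  then have "?g u * exp (- (v / 2)) \<le> u / v * ?g v * exp (- (v / 2))" by (rule mult_right_mono) simp
  moreover have "?g u * exp (- (v / 2)) = (1 - exp (- u)) * exp (- ((v - u) / 2))"
    by (simp add: left_diff_distrib exp_add[symmetric] field_simps)
  moreover have "?g v * exp (- (v / 2)) = 1 - exp (- v)"
    by (simp add: left_diff_distrib exp_add[symmetric] flip: exp_minus)
  ultimately show ?thesis by (simp add: mult.assoc)
qed

subsection \<open>The lower bound for the giant component\<close>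

text \<open>
  The mass \<open>\<nu> = \<mu> - c_micro l\<close> that the macroscopic and mesoscopic particles have to share, with density \<open>f\<close>.
  The level \<open>k\<close> truncates the factor \<open>1 - exp (- kap \<kappa> \<nu>)\<close> from below, as it may vanish.
\<close>

locale remaining_mass = rate \<kappa> K \<mu> for \<kappa> :: "'a::polish_space \<Rightarrow> 'a \<Rightarrow> real" and K :: real and \<mu> :: "'a measure" +
  fixes \<nu> :: "'a measure" and f :: "'a \<Rightarrow> real" and k :: nat
  assumes f_measurable [measurable]: "f \<in> borel_measurable borel" and f_nonneg: "0 \<le> f x" and f_le_1: "f x \<le> 1"
    and nu_eq: "\<nu> = density \<mu> (\<lambda>x. ennreal (f x))"
begin

lemma finite_borel_nu: "finite_borel \<nu>"
  unfolding nu_eq by (rule finite_borel_density[OF f_measurable f_le_1])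

sublocale n: kernel_measure \<kappa> K \<nu>
  by (intro kernel_measureI finite_borel_nu)

text \<open>
  \<open>s\<close> is the truncated factor. The measure \<open>share\<close> is chosen such that \<open>kap \<kappa> share\<close> integrates against \<open>y\<close> to the bound
  for the nonlinear term of the component \<open>y\<close>.
\<close>

definition s :: "'a \<Rightarrow> real" where "s x = max (1 - exp (- kap \<kappa> \<nu> x)) (exp (- real k))"
definition \<rho> :: "'a \<Rightarrow> real" where "\<rho> x = (1 - exp (- kap \<kappa> \<nu> x)) / kap \<kappa> \<nu> x / s x"
definition share :: "'a measure" where "share = density \<nu> (\<lambda>x. ennreal (\<rho> x))"

text \<open>
  Every macroscopic or mesoscopic component \<open>y\<close> costs at least \<open>\<integral> G dy\<close>. As this is linear in \<open>y\<close>, the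
  bounds add up to \<open>\<integral> G d\<nu>\<close>, whatever the partition of \<open>\<nu>\<close>.
\<close>

definition G :: "'a \<Rightarrow> real" where
  "G x = 1 + ln (f x) - ln (s x) + (kap \<kappa> \<mu> x - kap \<kappa> \<nu> x) / 2 - kap \<kappa> share x"

lemma measurable_s [measurable]: "s \<in> borel_measurable borel"
  unfolding s_def[abs_def] by measurable

lemma measurable_rho [measurable]: "\<rho> \<in> borel_measurable borel"
  unfolding \<rho>_def[abs_def] by measurable

lemma s_pos: "0 < s x" and s_ge: "exp (- real k) \<le> s x" "1 - exp (- kap \<kappa> \<nu> x) \<le> s x" and s_le_1: "s x \<le> 1"
proof -
  show "exp (- real k) \<le> s x" "1 - exp (- kap \<kappa> \<nu> x) \<le> s x" "s x \<le> 1" by (simp_all add: s_def)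
  then show "0 < s x" using exp_gt_zero[of "- real k"] by linarith
qed

lemma ln_s_bounds: "- real k \<le> ln (s x)" "ln (s x) \<le> 0"
proof -
  have "ln (exp (- real k)) \<le> ln (s x)" by (subst ln_le_cancel_iff) (use s_pos s_ge in auto)
  then show "- real k \<le> ln (s x)" by simp
  show "ln (s x) \<le> 0" using s_pos s_le_1 by simp
qed

lemma rho_nonneg: "0 \<le> \<rho> x"
  using n.kap_nonneg[of x] s_pos[of x] by (simp add: \<rho>_def)

lemma rho_le: "\<rho> x \<le> exp (real k)"
proof -
  let ?a = "(1 - exp (- kap \<kappa> \<nu> x)) / kap \<kappa> \<nu> x"
  have "1 - exp (- kap \<kappa> \<nu> x) \<le> kap \<kappa> \<nu> x"
    using exp_ge_add_one_self[of "- kap \<kappa> \<nu> x"] by linarith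
  then have "?a \<le> 1" "0 \<le> ?a" using n.kap_nonneg[of x] by (auto simp: divide_le_eq)
  then have "?a / s x \<le> 1 / exp (- real k)"
    by (intro frac_le) (use s_ge in auto)
  then show ?thesis by (simp add: \<rho>_def exp_minus inverse_eq_divide)
qed

lemma finite_borel_share: "finite_borel share"
  unfolding share_def by (rule n.finite_borel_density[OF measurable_rho rho_le])

sublocale sh: kernel_measure \<kappa> K share
  by (intro kernel_measureI finite_borel_share)

lemma measurable_G [measurable]: "G \<in> borel_measurable borel"
  unfolding G_def[abs_def] by measurable

lemma AE_f_pos: "AE x in \<nu>. 0 < f x"
  unfolding nu_eq by (subst AE_density) (auto simp: measurable_nu)

lemma integrable_ln_f: "integrable \<nu> (\<lambda>x. ln (f x))"
proof -
  have "\<bar>f x * ln (f x)\<bar> \<le> 1" for x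
  proof (cases "f x = 0")
    case False
    then have fp: "0 < f x" using f_nonneg[of x] by simp
    have "ln (1 / f x) \<le> 1 / f x - 1" by (rule ln_le_minus_one) (use fp in simp)
    then have "f x * ln (1 / f x) \<le> f x * (1 / f x - 1)" using fp by (intro mult_left_mono) auto
    then have "- (f x * ln (f x)) \<le> 1" using fp by (simp add: ln_div algebra_simps)
    moreover have "f x * ln (f x) \<le> 0" by (rule mult_nonneg_nonpos) (use fp f_le_1[of x] in auto)
    ultimately show ?thesis by linarith
  qed simp
  then have "integrable \<mu> (\<lambda>x. f x * ln (f x))"
    by (intro integrable_bounded[where C = 1]) auto
  then show ?thesis
    unfolding nu_eq using f_nonneg by (subst integrable_density) (auto intro!: measurable_nu)
qed

lemma integrable_ln_s: "finite_borel y \<Longrightarrow> integrable y (\<lambda>x. ln (s x))"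
proof -
  assume "finite_borel y"
  then interpret y: kernel_measure \<kappa> K y by (rule kernel_measureI)
  have "\<bar>ln (s x)\<bar> \<le> real k" for x using ln_s_bounds[of x] by simp
  then show ?thesis by (intro y.integrable_bounded) auto
qed

lemma integrable_G: "integrable \<nu> G"
  unfolding G_def[abs_def]
  using integrable_ln_f integrable_ln_s[OF finite_borel_nu] integrable_kap[OF finite_borel_nu]
    n.integrable_kap[OF finite_borel_nu] sh.integrable_kap[OF finite_borel_nu] by simp

text \<open>
  Gibbs' inequality with the comparison density \<open>f exp (- (kap \<kappa> \<nu> - t) / 2) / s\<close>. The choice is such that the
  linear terms agree with \<open>G\<close>, and that the remaining one is dominated by a linear functional of \<open>y\<close>.
\<close>

lemma component_cost_ge:
  assumes y: "sets y = sets borel" "y \<le> \<nu>"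
    and [measurable]: "r \<in> borel_measurable borel" "t \<in> borel_measurable borel"
    and r: "\<And>x. 0 \<le> r x" "\<And>x. r x \<le> C" and t: "\<And>x. 0 \<le> t x" "\<And>x. t x \<le> C"
    and key: "\<And>x. r x * exp (- ((kap \<kappa> \<nu> x - t x) / 2)) \<le> kap \<kappa> y x * ((1 - exp (- kap \<kappa> \<nu> x)) / kap \<kappa> \<nu> x)"
  shows "ereal (\<integral>x. G x \<partial>y) \<le> log_int y (density \<mu> (\<lambda>x. ennreal (r x))) + ereal (1/2 * (\<integral>x. kap \<kappa> \<mu> x - t x \<partial>y))"
proof -
  interpret y: kernel_measure \<kappa> K y by (intro kernel_measureI n.finite_borel_submeasure y)
  let ?R = "density \<mu> (\<lambda>x. ennreal (r x))"
  interpret R: finite_borel ?R by (rule finite_borel_density[OF _ r(2)]) measurable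
  have sR: "sigma_finite_measure ?R" ..
  define e where "e x = exp (- ((kap \<kappa> \<nu> x - t x) / 2)) / s x" for x
  define w where "w x = f x * e x" for x
  have [measurable]: "e \<in> borel_measurable borel" "w \<in> borel_measurable borel"
    unfolding e_def[abs_def] w_def[abs_def] by measurable
  have e0: "0 < e x" for x using s_pos[of x] by (simp add: e_def)
  have w0: "0 \<le> w x" for x using f_nonneg[of x] e0[of x] by (simp add: w_def)
  have eC: "e x \<le> exp (C / 2) * exp (real k)" for x
  proof -
    have "exp (- ((kap \<kappa> \<nu> x - t x) / 2)) \<le> exp (C / 2)"
      unfolding exp_le_cancel_iff using n.kap_nonneg[of x] t(2)[of x] by (simp add: field_simps)
    then have "e x \<le> exp (C / 2) / exp (- real k)"
      unfolding e_def by (intro frac_le) (use s_ge in auto)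
    then show ?thesis by (simp add: exp_minus inverse_eq_divide)
  qed
  have wC: "w x \<le> 1 * (exp (C / 2) * exp (real k))" for x
    unfolding w_def by (rule mult_mono) (use f_le_1 eC e0[of x] in auto)
  have iw: "integrable ?R w"
    by (rule R.integrable_const_bound[where B = "1 * (exp (C / 2) * exp (real k))"])
      (use w0 wC in \<open>auto intro!: R.measurable_nu\<close>)
  have ae: "AE x in y. 0 < f x" by (rule n.submeasure_AE[OF y AE_f_pos])
  then have wpos: "AE x in y. 0 < w x" by eventually_elim (use e0 in \<open>simp add: w_def\<close>)
  let ?L = "\<lambda>x. ln (f x) - (kap \<kappa> \<nu> x - t x) / 2 - ln (s x)"
  have it: "integrable y t" by (rule y.integrable_bounded[where C = C]) (use t in auto)
  have ilf: "integrable y (\<lambda>x. ln (f x))"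
    by (rule n.submeasure_split(1)[OF y _ integrable_ln_f]) measurable
  note I = ilf it n.integrable_kap[OF y.finite_borel_axioms] integrable_ln_s[OF y.finite_borel_axioms]
    integrable_kap[OF y.finite_borel_axioms] sh.integrable_kap[OF y.finite_borel_axioms]
  have iL: "integrable y ?L" using I by simp
  have lw: "AE x in y. ln (w x) = ?L x"
    using ae
  proof eventually_elim
    case (elim x)
    then show ?case using s_pos[of x] by (simp add: w_def e_def ln_mult ln_div)
  qed
  have m: "(\<lambda>x. ln (w x)) \<in> borel_measurable y" "?L \<in> borel_measurable y"
    by (auto intro!: y.measurable_nu)
  have ilw: "integrable y (\<lambda>x. ln (w x))" using integrable_cong_AE[OF m lw] iL by simp
  have "(\<integral>x. w x \<partial>?R) = (\<integral>x. r x * w x \<partial>\<mu>)"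
    by (subst integral_density) (use r in \<open>auto intro!: measurable_nu\<close>)
  also have "\<dots> = (\<integral>x. f x * (r x * e x) \<partial>\<mu>)" by (simp add: w_def mult_ac)
  also have "\<dots> = (\<integral>x. r x * e x \<partial>\<nu>)"
    unfolding nu_eq by (subst integral_density) (use f_nonneg in \<open>auto intro!: measurable_nu\<close>)
  also have "\<dots> \<le> (\<integral>x. \<rho> x * kap \<kappa> y x \<partial>\<nu>)"
  proof (rule integral_mono)
    have "\<bar>r x * e x\<bar> \<le> C * (exp (C / 2) * exp (real k))" for x
      unfolding abs_mult by (rule mult_mono) (use r[of x] e0[of x] eC[of x] in auto)
    then show "integrable \<nu> (\<lambda>x. r x * e x)" by (intro n.integrable_bounded) auto
    have "\<bar>\<rho> x * kap \<kappa> y x\<bar> \<le> exp (real k) * (K * measure y UNIV)" for x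
      unfolding abs_mult
      by (rule mult_mono) (use rho_nonneg[of x] rho_le[of x] y.kap_nonneg[of x] y.kap_le[of x] in auto)
    then show "integrable \<nu> (\<lambda>x. \<rho> x * kap \<kappa> y x)" by (intro n.integrable_bounded) auto
    fix x
    have "r x * exp (- ((kap \<kappa> \<nu> x - t x) / 2)) / s x \<le> kap \<kappa> y x * ((1 - exp (- kap \<kappa> \<nu> x)) / kap \<kappa> \<nu> x) / s x"
      by (rule divide_right_mono[OF key]) (use s_pos[of x] in simp)
    then show "r x * e x \<le> \<rho> x * kap \<kappa> y x" by (simp add: e_def \<rho>_def mult.commute)
  qed
  also have "\<dots> = (\<integral>x. kap \<kappa> y x \<partial>share)"
    unfolding share_def by (subst integral_density) (use rho_nonneg in \<open>auto intro!: n.measurable_nu\<close>)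
  also have "\<dots> = (\<integral>x. kap \<kappa> share x \<partial>y)"
    by (rule kap_symmetric[OF y.finite_borel_axioms finite_borel_share])
  finally have le: "(\<integral>x. w x \<partial>?R) \<le> (\<integral>x. kap \<kappa> share x \<partial>y)" .
  have "sets y = sets ?R" by simp
  from gibbs[OF sR y.finite_nu this w0 wpos iw ilw]
  have "ereal (measure y UNIV - (\<integral>x. w x \<partial>?R) + (\<integral>x. ?L x \<partial>y)) \<le> log_int y ?R"
    using integral_cong_AE[OF m lw] by simp
  then have g: "ereal (measure y UNIV - (\<integral>x. kap \<kappa> share x \<partial>y) + (\<integral>x. ?L x \<partial>y)) \<le> log_int y ?R"
    by (rule order_trans[rotated]) (use le in simp)
  have "(\<integral>x. G x \<partial>y) = measure y UNIV - (\<integral>x. kap \<kappa> share x \<partial>y) + (\<integral>x. ?L x \<partial>y) + 1/2 * (\<integral>x. kap \<kappa> \<mu> x - t x \<partial>y)"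
    unfolding G_def[abs_def] using I by (simp add: field_simps)
  then have "ereal (\<integral>x. G x \<partial>y) = ereal (measure y UNIV - (\<integral>x. kap \<kappa> share x \<partial>y) + (\<integral>x. ?L x \<partial>y))
      + ereal (1/2 * (\<integral>x. kap \<kappa> \<mu> x - t x \<partial>y))" by simp
  also have "\<dots> \<le> log_int y ?R + ereal (1/2 * (\<integral>x. kap \<kappa> \<mu> x - t x \<partial>y))"
    by (rule add_right_mono[OF g])
  finally show ?thesis .
qed

lemma kap_le_kap_nu:
  assumes "sets y = sets borel" "y \<le> \<nu>"
  shows "0 \<le> kap \<kappa> y x" "kap \<kappa> y x \<le> kap \<kappa> \<nu> x"
proof -
  interpret y: kernel_measure \<kappa> K y by (intro kernel_measureI n.finite_borel_submeasure assms)
  interpret z: kernel_measure \<kappa> K "diff_measure \<nu> y" by (intro kernel_measureI n.finite_borel_diff assms)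
  show "0 \<le> kap \<kappa> y x" by (rule y.kap_nonneg)
  show "kap \<kappa> y x \<le> kap \<kappa> \<nu> x" using n.kap_submeasure_add[OF assms, of x] z.kap_nonneg[of x] by simp
qed

lemma macroscopic_cost_ge:
  assumes y: "sets y = sets borel" "y \<le> \<nu>"
  shows "ereal (\<integral>x. G x \<partial>y) \<le> log_int y (density \<mu> (\<lambda>x. ennreal (1 - exp (- kap \<kappa> y x))))
    + ereal (1/2 * (\<integral>x. kap \<kappa> \<mu> x - kap \<kappa> y x \<partial>y))"
proof -
  interpret y: kernel_measure \<kappa> K y by (intro kernel_measureI n.finite_borel_submeasure y)
  have C: "kap \<kappa> y x \<le> 1 + K * measure y UNIV" "1 - exp (- kap \<kappa> y x) \<le> 1 + K * measure y UNIV" for x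
    using y.kap_le[of x] y.kap_nonneg[of x] exp_gt_zero[of "- kap \<kappa> y x"] by linarith+
  show ?thesis
  proof (rule component_cost_ge[OF y, where C = "1 + K * measure y UNIV"])
    fix x
    show "(1 - exp (- kap \<kappa> y x)) * exp (- ((kap \<kappa> \<nu> x - kap \<kappa> y x) / 2))
        \<le> kap \<kappa> y x * ((1 - exp (- kap \<kappa> \<nu> x)) / kap \<kappa> \<nu> x)"
    proof (cases "kap \<kappa> \<nu> x = 0")
      case True
      then have "kap \<kappa> y x = 0" using kap_le_kap_nu[OF y, of x] by simp
      then show ?thesis by simp
    next
      case False
      then show ?thesis
        using kap_le_kap_nu[OF y, of x] by (intro one_minus_exp_le_chord) auto
    qed
  qed (use C y.kap_nonneg in auto)
qed

lemma mesoscopic_cost_ge: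
  assumes y: "sets y = sets borel" "y \<le> \<nu>"
  shows "ereal (\<integral>x. G x \<partial>y) \<le> I_Me \<kappa> \<mu> y"
proof -
  interpret y: kernel_measure \<kappa> K y by (intro kernel_measureI n.finite_borel_submeasure y)
  have C: "0 \<le> K * measure y UNIV" using y.kap_nonneg y.kap_le order_trans by blast
  have "ereal (\<integral>x. G x \<partial>y) \<le> log_int y (density \<mu> (\<lambda>x. ennreal (kap \<kappa> y x)))
    + ereal (1/2 * (\<integral>x. kap \<kappa> \<mu> x - 0 \<partial>y))"
  proof (rule component_cost_ge[OF y, where C = "K * measure y UNIV"])
    fix x
    show "kap \<kappa> y x * exp (- ((kap \<kappa> \<nu> x - 0) / 2)) \<le> kap \<kappa> y x * ((1 - exp (- kap \<kappa> \<nu> x)) / kap \<kappa> \<nu> x)"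
    proof (cases "kap \<kappa> \<nu> x = 0")
      case True
      then have "kap \<kappa> y x = 0" using kap_le_kap_nu[OF y, of x] by simp
      then show ?thesis by simp
    next
      case False
      then have "0 < kap \<kappa> \<nu> x" using n.kap_nonneg[of x] by simp
      then show ?thesis
        using exp_half_le_one_minus_exp[of "kap \<kappa> \<nu> x"] y.kap_nonneg[of x]
        by (intro mult_left_mono) (simp_all add: le_divide_eq mult.commute)
    qed
  qed (use C y.kap_nonneg y.kap_le in auto)
  then show ?thesis by (simp add: I_Me_def)
qed

lemma rate_ge_integral_G:
  assumes \<alpha>: "\<alpha> \<in> point_measures" and le: "c_macro \<alpha> \<le> \<nu>"
  shows "ereal (\<integral>x. G x \<partial>\<nu>) \<le> I_Ma \<kappa> \<mu> \<alpha> + I_Me \<kappa> \<mu> (diff_measure \<nu> (c_macro \<alpha>))"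
proof -
  have sa: "sets (c_macro \<alpha>) = sets borel" by (rule sets_c_macro[OF \<alpha>])
  have sub: "AE y in \<alpha>. sets y = sets borel \<and> y \<le> \<nu>"
    using point_measure_atom_le[OF \<alpha>] by eventually_elim (use le order_trans in blast)
  have iy: "AE y in \<alpha>. integrable y G"
    using sub by eventually_elim (blast intro: n.submeasure_split(1)[OF _ _ measurable_G integrable_G])
  note S = n.submeasure_split[OF sa le measurable_G integrable_G]
  have "ereal (\<integral>y. (\<integral>x. G x \<partial>y) \<partial>\<alpha>) \<le> I_Ma \<kappa> \<mu> \<alpha>"
    unfolding I_Ma_def Let_def
  proof (cases "AE y in \<alpha>. absolutely_continuous (density \<mu> (\<lambda>r. ennreal (1 - exp (- kap \<kappa> y r)))) y")
    case True
    have "AE y in \<alpha>. ereal (\<integral>x. G x \<partial>y) \<le> log_int y (density \<mu> (\<lambda>r. ennreal (1 - exp (- kap \<kappa> y r))))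
         + ereal (1/2 * (\<integral>r. kap \<kappa> \<mu> r - kap \<kappa> y r \<partial>y))"
      using sub by eventually_elim (blast intro: macroscopic_cost_ge)
    then show "ereal (\<integral>y. (\<integral>x. G x \<partial>y) \<partial>\<alpha>) \<le>
      (if AE y in \<alpha>. absolutely_continuous (density \<mu> (\<lambda>r. ennreal (1 - exp (- kap \<kappa> y r)))) y
       then eintegral \<alpha> (\<lambda>y. log_int y (density \<mu> (\<lambda>r. ennreal (1 - exp (- kap \<kappa> y r))))
         + ereal (1/2 * (\<integral>r. kap \<kappa> \<mu> r - kap \<kappa> y r \<partial>y))) else \<infinity>)"
      unfolding if_P[OF True]
      by (rule eintegral_ge_integral[OF integrable_over_points[OF \<alpha> measurable_G S(1) iy]])
  qed simp
  moreover have "ereal (\<integral>x. G x \<partial>diff_measure \<nu> (c_macro \<alpha>)) \<le> I_Me \<kappa> \<mu> (diff_measure \<nu> (c_macro \<alpha>))"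
    by (rule mesoscopic_cost_ge) (use n.diff_measure_le[OF sa le] in auto)
  moreover have "ereal (\<integral>x. G x \<partial>\<nu>) = ereal (\<integral>y. (\<integral>x. G x \<partial>y) \<partial>\<alpha>) + ereal (\<integral>x. G x \<partial>diff_measure \<nu> (c_macro \<alpha>))"
    using S(3) by (simp add: integral_over_points[OF \<alpha> measurable_G S(1) iy])
  ultimately show ?thesis by (simp only: add_mono)
qed

text \<open>The correction \<open>1 - kap \<kappa> share\<close> in \<open>G\<close> has a nonnegative integral, because \<open>\<rho> (kap \<kappa> \<nu>) \<le> 1\<close>.\<close>

lemma integral_G_ge:
  "(\<integral>x. ln (f x) - ln (s x) \<partial>\<nu>) + 1/2 * (\<integral>x. kap \<kappa> \<mu> x - kap \<kappa> \<nu> x \<partial>\<nu>) \<le> (\<integral>x. G x \<partial>\<nu>)"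
proof -
  note I = integrable_ln_f n.integrable_kap[OF finite_borel_nu] integrable_ln_s[OF finite_borel_nu]
    integrable_kap[OF finite_borel_nu] sh.integrable_kap[OF finite_borel_nu]
  have r1: "\<rho> x * kap \<kappa> \<nu> x \<le> 1" for x
    using s_ge(2)[of x] s_pos[of x] by (cases "kap \<kappa> \<nu> x = 0") (auto simp: \<rho>_def divide_le_eq)
  have "(\<integral>x. kap \<kappa> share x \<partial>\<nu>) = (\<integral>x. kap \<kappa> \<nu> x \<partial>share)"
    by (rule kap_symmetric[OF finite_borel_share finite_borel_nu])
  also have "\<dots> = (\<integral>x. \<rho> x * kap \<kappa> \<nu> x \<partial>\<nu>)"
    unfolding share_def by (subst integral_density) (use rho_nonneg in \<open>auto intro!: n.measurable_nu\<close>)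
  also have "\<dots> \<le> (\<integral>x. 1 \<partial>\<nu>)"
  proof (rule integral_mono)
    have "\<bar>\<rho> x * kap \<kappa> \<nu> x\<bar> \<le> 1" for x using r1[of x] rho_nonneg[of x] n.kap_nonneg[of x] by simp
    then show "integrable \<nu> (\<lambda>x. \<rho> x * kap \<kappa> \<nu> x)" by (intro n.integrable_bounded) auto
  qed (use r1 in simp_all)
  finally have "(\<integral>x. kap \<kappa> share x \<partial>\<nu>) \<le> measure \<nu> UNIV" by simp
  moreover have "(\<integral>x. G x \<partial>\<nu>) = measure \<nu> UNIV + (\<integral>x. ln (f x) - ln (s x) \<partial>\<nu>)
      + 1/2 * (\<integral>x. kap \<kappa> \<mu> x - kap \<kappa> \<nu> x \<partial>\<nu>) - (\<integral>x. kap \<kappa> share x \<partial>\<nu>)"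
    unfolding G_def[abs_def] using I by (simp add: field_simps)
  ultimately show ?thesis by linarith
qed

end

subsection \<open>The giant component is optimal\<close>

context rate
begin

lemma I_Ma_macro_delta:
  assumes \<nu>: "\<nu> \<in> fin_borel" and ne: "\<nu> \<noteq> null_measure borel"
  shows "I_Ma \<kappa> \<mu> (macro_delta \<nu>) = log_int \<nu> (density \<mu> (\<lambda>x. ennreal (1 - exp (- kap \<kappa> \<nu> x))))
    + ereal (1/2 * (\<integral>x. kap \<kappa> \<mu> x - kap \<kappa> \<nu> x \<partial>\<nu>))"
proof -
  have "eintegral (macro_delta \<nu>) F = F \<nu>" for F
    unfolding eintegral_def nn_integral_macro_delta[OF \<nu> ne] by (rule enn2ereal_pos_minus_neg)
  then show ?thesis
    unfolding I_Ma_def Let_def AE_macro_delta[OF \<nu> ne] by (simp add: log_int_def)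
qed

lemma I_Ma_macro_delta_null: "I_Ma \<kappa> \<mu> (macro_delta (null_measure borel)) = 0"
proof -
  have "AE y in macro_delta (null_measure borel). P y" for P :: "'a measure \<Rightarrow> bool"
    by (rule AE_I'[of nonzero_measures]) (auto simp: macro_delta_def null_sets_def)
  then show ?thesis unfolding I_Ma_def Let_def by (simp add: macro_delta_def eintegral_def)
qed

text \<open>
  Letting the truncation level tend to infinity. If \<open>kap \<kappa> \<nu>\<close> vanishes on a set that \<open>\<nu>\<close> charges, both
  sides are infinite: the particles in this set cannot be connected to anything.
\<close>

proposition I_Ma_macro_delta_le:
  assumes f: "f \<in> borel_measurable borel" "\<And>x. 0 \<le> f x" "\<And>x. f x \<le> 1" and \<nu>: "\<nu> = density \<mu> (\<lambda>x. ennreal (f x))"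
    and \<alpha>: "\<alpha> \<in> point_measures" and le: "c_macro \<alpha> \<le> \<nu>"
  shows "I_Ma \<kappa> \<mu> (macro_delta \<nu>) \<le> I_Ma \<kappa> \<mu> \<alpha> + I_Me \<kappa> \<mu> (diff_measure \<nu> (c_macro \<alpha>))"
proof -
  define X where "X = I_Ma \<kappa> \<mu> \<alpha> + I_Me \<kappa> \<mu> (diff_measure \<nu> (c_macro \<alpha>))"
  have rm: "remaining_mass \<kappa> K \<mu> \<nu> f"
    by (intro remaining_mass.intro remaining_mass_axioms.intro rate_axioms f \<nu>)
  interpret n: kernel_measure \<kappa> K \<nu> by (intro kernel_measureI remaining_mass.finite_borel_nu[OF rm])
  have sa: "sets (c_macro \<alpha>) = sets borel" by (rule sets_c_macro[OF \<alpha>])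
  let ?s = "\<lambda>k x. remaining_mass.s \<kappa> \<nu> k x"
  let ?c = "1/2 * (\<integral>x. kap \<kappa> \<mu> x - kap \<kappa> \<nu> x \<partial>\<nu>)"
  have bound: "ereal ((\<integral>x. ln (f x) - ln (?s k x) \<partial>\<nu>) + ?c) \<le> X" for k :: nat
    using remaining_mass.integral_G_ge[OF rm, of k] remaining_mass.rate_ge_integral_G[OF rm \<alpha> le, of k]
    unfolding X_def[symmetric] by (meson ereal_less_eq(3) order_trans)
  show "I_Ma \<kappa> \<mu> (macro_delta \<nu>) \<le> X"
  proof (cases "\<nu> = null_measure borel")
    case True
    have "remaining_mass.s \<kappa> \<nu> 0 x = 1" for x
      using n.kap_nonneg[of x] unfolding remaining_mass.s_def[OF rm] by simp
    with bound[of 0] True show ?thesis by (simp add: I_Ma_macro_delta_null zero_ereal_def)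
  next
    case False
    have nu: "\<nu> \<in> fin_borel" using n.finite_borel_axioms by (simp add: fin_borel_iff_finite_borel)
    let ?R = "density \<mu> (\<lambda>x. ennreal (1 - exp (- kap \<kappa> \<nu> x)))"
    let ?Z = "{x. kap \<kappa> \<nu> x = 0}"
    have Z[measurable]: "?Z \<in> sets borel"
    proof -
      have "{x \<in> space borel. kap \<kappa> \<nu> x = 0} \<in> sets borel" by measurable
      then show ?thesis by simp
    qed
    have ilf: "integrable \<nu> (\<lambda>x. ln (f x))" by (rule remaining_mass.integrable_ln_f[OF rm])
    have "log_int \<nu> ?R + ereal ?c \<le> X"
    proof (cases "emeasure \<nu> ?Z = 0")
      case True
      have U: "AE x in \<nu>. 0 < kap \<kappa> \<nu> x"
      proof -
        have "AE x in \<nu>. x \<notin> ?Z" by (rule AE_not_in) (use True Z in \<open>auto simp: null_sets_def\<close>)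
        then show ?thesis by eventually_elim (use n.kap_nonneg in \<open>auto simp: less_le\<close>)
      qed
      define g where "g x = f x / (1 - exp (- kap \<kappa> \<nu> x))" for x
      define p where "p x = - ln (1 - exp (- kap \<kappa> \<nu> x))" for x
      have [measurable]: "f \<in> borel_measurable borel" "g \<in> borel_measurable borel" "p \<in> borel_measurable borel"
        using f(1) unfolding g_def[abs_def] p_def[abs_def] by measurable
      have pos: "0 < 1 - exp (- kap \<kappa> \<nu> x)" if "0 < kap \<kappa> \<nu> x" for x using that by simp
      have p0: "0 \<le> p x" for x
        using n.kap_nonneg[of x] by (cases "kap \<kappa> \<nu> x = 0") (auto simp: p_def)
      have R_finite: "finite_borel ?R"
        by (rule finite_borel_density[where C = 1]) auto
      have sR: "sigma_finite_measure ?R"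
        by (rule finite_measure.axioms(1)) (use R_finite in \<open>simp add: finite_borel_def\<close>)
      have "\<nu> = density ?R (\<lambda>x. ennreal (g x))"
      proof -
        have U': "AE x in \<mu>. 0 < f x \<longrightarrow> 0 < kap \<kappa> \<nu> x"
        proof -
          have "AE x in density \<mu> (\<lambda>x. ennreal (f x)). 0 < kap \<kappa> \<nu> x" using U by (simp only: \<nu>[symmetric])
          then show ?thesis by (subst (asm) AE_density) (auto simp: measurable_nu)
        qed
        have "density ?R (\<lambda>x. ennreal (g x)) = density \<mu> (\<lambda>x. ennreal (1 - exp (- kap \<kappa> \<nu> x)) * ennreal (g x))"
          by (rule density_density_eq) auto
        also have "\<dots> = density \<mu> (\<lambda>x. ennreal (f x))"
        proof (rule density_cong)
          show "AE x in \<mu>. ennreal (1 - exp (- kap \<kappa> \<nu> x)) * ennreal (g x) = ennreal (f x)"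
            using U'
          proof eventually_elim
            case (elim x)
            show ?case
            proof (cases "f x = 0")
              case False
              then have "0 < kap \<kappa> \<nu> x" using elim f(2)[of x] by simp
              from pos[OF this] show ?thesis using f(2)[of x] by (subst ennreal_mult[symmetric]) (auto simp: g_def)
            qed (simp add: g_def)
          qed
        qed auto
        finally show ?thesis using \<nu> by simp
      qed
      moreover have "0 \<le> g x" for x using f(2)[of x] n.kap_nonneg[of x] by (simp add: g_def)
      moreover have "g \<in> borel_measurable ?R" by simp
      ultimately have L: "log_int \<nu> ?R = eintegral \<nu> (\<lambda>x. ereal (ln (g x)))"
        by (intro log_int_density(1)[OF sR])
      have "eintegral \<nu> (\<lambda>x. ereal (ln (g x))) \<le> X - ereal ?c"
      proof (rule eintegral_le_truncations[OF ilf _ p0])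
        show "AE x in \<nu>. ereal (ln (g x)) = ereal (ln (f x) + p x)"
          using U remaining_mass.AE_f_pos[OF rm]
        proof eventually_elim
          case (elim x)
          then show ?case using pos[OF elim(1)] by (simp add: g_def p_def ln_div)
        qed
        fix k :: nat
        have "\<bar>min (p x) (real k)\<bar> \<le> real k" for x using p0[of x] by simp
        then show ip: "integrable \<nu> (\<lambda>x. min (p x) (real k))" by (intro n.integrable_bounded) auto
        have "AE x in \<nu>. ln (f x) + min (p x) (real k) = ln (f x) - ln (?s k x)"
          using U
        proof eventually_elim
          case (elim x)
          have "ln (?s k x) = max (ln (1 - exp (- kap \<kappa> \<nu> x))) (- real k)"
          proof (cases "1 - exp (- kap \<kappa> \<nu> x) \<le> exp (- real k)")
            case True
            then have "ln (1 - exp (- kap \<kappa> \<nu> x)) \<le> ln (exp (- real k))"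
              by (subst ln_le_cancel_iff) (use pos[OF elim] in auto)
            with True show ?thesis unfolding remaining_mass.s_def[OF rm] by (simp add: max_def)
          next
            case False
            then have "ln (exp (- real k)) \<le> ln (1 - exp (- kap \<kappa> \<nu> x))"
              by (subst ln_le_cancel_iff) (use pos[OF elim] in auto)
            with False show ?thesis unfolding remaining_mass.s_def[OF rm] by (auto simp: max_def)
          qed
          then show ?case by (simp add: p_def min_def max_def)
        qed
        then have "(\<integral>x. ln (f x) + min (p x) (real k) \<partial>\<nu>) = (\<integral>x. ln (f x) - ln (?s k x) \<partial>\<nu>)"
          by (intro integral_cong_AE)
            (use remaining_mass.measurable_s[OF rm, of k] in \<open>auto intro!: n.measurable_nu\<close>)
        with bound[of k] have "ereal ((\<integral>x. ln (f x) + min (p x) (real k) \<partial>\<nu>) + ?c) \<le> X" by simp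
        then show "ereal (\<integral>x. ln (f x) + min (p x) (real k) \<partial>\<nu>) \<le> X - ereal ?c"
          by (cases X) auto
      qed simp
      then show ?thesis unfolding L
        by (cases X; cases "eintegral \<nu> (\<lambda>x. ereal (ln (g x)))") auto
    next
      case False
      have Zp: "0 < measure \<nu> ?Z" using False by (simp add: n.emeasure_eq_measure zero_less_measure_iff)
      have "X = \<infinity>"
      proof (rule ccontr)
        assume "X \<noteq> \<infinity>"
        moreover have "X \<noteq> -\<infinity>" using bound[of 0] by auto
        ultimately obtain z where z: "X = ereal z" by (cases X) auto
        define C where "C = (\<integral>x. ln (f x) \<partial>\<nu>) + ?c"
        have ge: "C + real k * measure \<nu> ?Z \<le> z" for k :: nat
        proof -
          have i: "integrable \<nu> (\<lambda>x. ln (?s k x))"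
            by (rule remaining_mass.integrable_ln_s[OF rm n.finite_borel_axioms])
          have "real k * measure \<nu> ?Z = (\<integral>x. real k * indicator ?Z x \<partial>\<nu>)" by simp
          also have "\<dots> \<le> (\<integral>x. - ln (?s k x) \<partial>\<nu>)"
          proof (rule integral_mono)
            show "integrable \<nu> (\<lambda>x. real k * indicator ?Z x :: real)"
              by (intro integrable_mult_right n.integrable_bounded[where C = 1]) (auto simp: indicator_def)
            fix x
            show "real k * indicator ?Z x \<le> - ln (?s k x)"
              using remaining_mass.ln_s_bounds(2)[OF rm, of k x]
              by (cases "x \<in> ?Z") (auto simp: remaining_mass.s_def[OF rm] max_def)
          qed (use i in simp)
          finally have "real k * measure \<nu> ?Z \<le> - (\<integral>x. ln (?s k x) \<partial>\<nu>)" by simp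
          moreover have "(\<integral>x. ln (f x) - ln (?s k x) \<partial>\<nu>) = (\<integral>x. ln (f x) \<partial>\<nu>) - (\<integral>x. ln (?s k x) \<partial>\<nu>)"
            using ilf i by simp
          ultimately show ?thesis using bound[of k] z by (simp add: C_def)
        qed
        obtain k :: nat where "z - C < real k * measure \<nu> ?Z" using reals_Archimedean3[OF Zp] by blast
        with ge[of k] show False by linarith
      qed
      then show ?thesis by simp
    qed
    then show ?thesis by (simp add: I_Ma_macro_delta[OF nu False])
  qed
qed

proposition INF_macroscopic:
  assumes l: "l \<in> micro_states \<mu> x"
  shows "(INF \<alpha>'\<in>macro_states \<mu> x. rate_I \<kappa> \<mu> l \<alpha>') =
    (if c_micro l \<le> \<mu> then I_Mi \<kappa> \<mu> l + I_Ma \<kappa> \<mu> (macro_delta (diff_measure \<mu> (c_micro l))) else \<infinity>)"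
proof -
  have sl: "sets (c_micro l) = sets borel" using l by (auto simp: micro_states_def)
  have sa: "sets (c_macro \<alpha>) = sets borel" if "\<alpha> \<in> macro_states \<mu> x" for \<alpha>
    using that by (intro sets_c_macro) (simp add: macro_states_def)
  show ?thesis
  proof (cases "c_micro l \<le> \<mu>")
    case False
    have "rate_I \<kappa> \<mu> l \<alpha> = \<infinity>" if "\<alpha> \<in> macro_states \<mu> x" for \<alpha>
      using add_measure_le_left[OF sl sa[OF that]] False by (auto simp: rate_I_def)
    then have "\<infinity> \<le> (INF \<alpha>'\<in>macro_states \<mu> x. rate_I \<kappa> \<mu> l \<alpha>')" by (intro INF_greatest) simp
    with False show ?thesis by simp
  next
    case True
    define \<nu> where "\<nu> = diff_measure \<mu> (c_micro l)"
    obtain g where g: "g \<in> borel_measurable borel" "\<And>x. 0 \<le> g x" "\<And>x. g x \<le> (1::real)"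
      and g': "c_micro l = density \<mu> (\<lambda>x. ennreal (g x))"
        "diff_measure \<mu> (c_micro l) = density \<mu> (\<lambda>x. ennreal (1 - g x))"
      using submeasure_density[OF sl True] by blast
    have ne: "\<nu> = density \<mu> (\<lambda>x. ennreal (1 - g x))" using g'(2) by (simp only: \<nu>_def)
    interpret n: finite_borel \<nu> unfolding \<nu>_def by (rule finite_borel_diff[OF sl True])
    have nf: "\<nu> \<in> fin_borel" using n.finite_borel_axioms by (simp add: fin_borel_iff_finite_borel)
    have rate: "rate_I \<kappa> \<mu> l \<alpha> = I_Mi \<kappa> \<mu> l + (I_Ma \<kappa> \<mu> \<alpha> + I_Me \<kappa> \<mu> (diff_measure \<nu> (c_macro \<alpha>)))"
      if "sets (c_macro \<alpha>) = sets borel" "c_macro \<alpha> \<le> \<nu>" for \<alpha>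
      using that add_measure_le_iff[OF sl that(1) True] by (simp add: rate_I_def \<nu>_def add.assoc)
    have "(INF \<alpha>'\<in>macro_states \<mu> x. rate_I \<kappa> \<mu> l \<alpha>') = I_Mi \<kappa> \<mu> l + I_Ma \<kappa> \<mu> (macro_delta \<nu>)"
    proof (rule antisym)
      have ms: "macro_delta \<nu> \<in> macro_states \<mu> x"
        using macro_delta_point_measure[OF nf] diff_measure_le[OF sl True, folded \<nu>_def]
        by (simp add: macro_states_def c_macro_macro_delta[OF nf])
      have "rate_I \<kappa> \<mu> l (macro_delta \<nu>) = I_Mi \<kappa> \<mu> l + I_Ma \<kappa> \<mu> (macro_delta \<nu>)"
        using rate[of "macro_delta \<nu>"] by (simp add: c_macro_macro_delta[OF nf] n.diff_measure_self I_Me_null)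
      then show "(INF \<alpha>'\<in>macro_states \<mu> x. rate_I \<kappa> \<mu> l \<alpha>') \<le> I_Mi \<kappa> \<mu> l + I_Ma \<kappa> \<mu> (macro_delta \<nu>)"
        using INF_lower[OF ms, of "\<lambda>\<alpha>. rate_I \<kappa> \<mu> l \<alpha>"] by simp
      show "I_Mi \<kappa> \<mu> l + I_Ma \<kappa> \<mu> (macro_delta \<nu>) \<le> (INF \<alpha>'\<in>macro_states \<mu> x. rate_I \<kappa> \<mu> l \<alpha>')"
      proof (rule INF_greatest)
        fix \<alpha> assume \<alpha>: "\<alpha> \<in> macro_states \<mu> x"
        then have pm: "\<alpha> \<in> point_measures" by (simp add: macro_states_def)
        show "I_Mi \<kappa> \<mu> l + I_Ma \<kappa> \<mu> (macro_delta \<nu>) \<le> rate_I \<kappa> \<mu> l \<alpha>"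
        proof (cases "c_macro \<alpha> \<le> \<nu>")
          case le: True
          have "I_Ma \<kappa> \<mu> (macro_delta \<nu>) \<le> I_Ma \<kappa> \<mu> \<alpha> + I_Me \<kappa> \<mu> (diff_measure \<nu> (c_macro \<alpha>))"
            by (rule I_Ma_macro_delta_le[OF _ _ _ ne pm le]) (use g in auto)
          then show ?thesis unfolding rate[OF sa[OF \<alpha>] le] by (rule add_left_mono)
        next
          case False
          then show ?thesis
            using add_measure_le_iff[OF sl sa[OF \<alpha>] True] by (simp add: rate_I_def \<nu>_def)
        qed
      qed
    qed
    then show ?thesis using True by (simp add: \<nu>_def)
  qed
qed

end

lemma bounded_kernel:
  fixes \<kappa> :: "'a::polish_space \<Rightarrow> 'a \<Rightarrow> real"
  assumes "compact (UNIV :: 'a set)" "continuous_on UNIV (\<lambda>z. \<kappa> (fst z) (snd z))"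
  obtains K where "\<And>r s. \<kappa> r s \<le> K"
proof -
  have "compact ((\<lambda>z. \<kappa> (fst z) (snd z)) ` (UNIV \<times> UNIV))"
    by (rule compact_continuous_image) (use assms(2) compact_Times[OF assms(1,1)] in simp_all)
  then have "bdd_above (range (\<lambda>z. \<kappa> (fst z) (snd z)))"
    by (intro bounded_imp_bdd_above compact_imp_bounded) simp
  then obtain K where K: "\<And>z. \<kappa> (fst z) (snd z) \<le> K" unfolding bdd_above_def by auto
  show ?thesis by (rule that[of K]) (use K[of "(_, _)"] in simp)
qed

theorem theorem2p3:
  fixes \<mu> :: "'a::polish_space measure"
    and \<kappa> :: "'a \<Rightarrow> 'a \<Rightarrow> real"
    and x :: "nat \<Rightarrow> nat \<Rightarrow> 'a"
  assumes "compact (UNIV :: 'a set)"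
    and "prob_space \<mu>" and "sets \<mu> = sets borel"
    and "\<And>r s. 0 \<le> \<kappa> r s" and "\<And>r s. \<kappa> r s = \<kappa> s r"
    and "continuous_on UNIV (\<lambda>z. \<kappa> (fst z) (snd z))"
    and "irreducible_kernel \<mu> \<kappa>"
    and "weakly_converges (empirical x) \<mu>"
  shows "(\<forall>l\<in>micro_states \<mu> x.
            (INF \<alpha>'\<in>macro_states \<mu> x. rate_I \<kappa> \<mu> l \<alpha>') =
              (if c_micro l \<le> \<mu>
               then I_Mi \<kappa> \<mu> l + I_Ma \<kappa> \<mu> (macro_delta (diff_measure \<mu> (c_micro l)))
               else \<infinity>)) \<and>
         (\<forall>\<alpha>\<in>macro_states \<mu> x.
            (INF l'\<in>micro_states \<mu> x. rate_I \<kappa> \<mu> l' \<alpha>) =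
              (if c_macro \<alpha> \<le> \<mu>
               then I_Ma \<kappa> \<mu> \<alpha> + J_fun \<kappa> \<mu> (diff_measure \<mu> (c_macro \<alpha>))
               else \<infinity>)) \<and>
         (\<forall>c\<in>fin_borel. c \<le> \<mu> \<longrightarrow> op_norm_L2 \<kappa> c \<le> 1 \<longrightarrow>
            I_Mi \<kappa> \<mu> (lambda_c \<kappa> c) =
              log_int c \<mu> + ereal (1/2 * (\<integral>r. kap \<kappa> (diff_measure \<mu> c) r \<partial>c))) \<and>
         (\<forall>c\<in>fin_borel. c \<le> \<mu> \<longrightarrow> op_norm_L2 \<kappa> c > 1 \<longrightarrow>
            (\<exists>!b. minimal_solution \<kappa> c b) \<and> op_norm_L2 \<kappa> (b_star \<kappa> c) = 1)"
proof -
  obtain K where K: "\<And>r s. \<kappa> r s \<le> K" using bounded_kernel[OF assms(1,6)] by blast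
  interpret p: prob_space \<mu> by fact
  have "space \<mu> = UNIV" using sets_eq_imp_space_eq[OF assms(3)] by simp
  then have mass: "measure \<mu> UNIV = 1" using p.prob_space by simp
  have "finite_borel \<mu>" by (rule finite_borel.intro) (use assms p.finite_measure_axioms in simp_all)
  moreover have "kernel \<kappa> K" by (rule kernel.intro) (use assms K in auto)
  ultimately interpret rate \<kappa> K \<mu>
    by (intro rate.intro rate_axioms.intro kernel_measure.intro mass)
  have "(\<exists>!b. minimal_solution \<kappa> c b) \<and> op_norm_L2 \<kappa> (b_star \<kappa> c) = 1"
    if "c \<in> fin_borel" "1 < op_norm_L2 \<kappa> c" for c
  proof -
    interpret c: kernel_measure \<kappa> K c
      using that by (intro kernel_measureI) (simp add: fin_borel_iff_finite_borel)
    show ?thesis using c.minimal_solution_b_star[OF that(2)] by simp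
  qed
  then show ?thesis using INF_macroscopic INF_microscopic I_Mi_lambda_c by simp
qed

end
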